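(* Let $\Omega\subset\mathbb{R}^n$ be a bounded Lipschitz domain and let $\mathcal{O}\subset\Omega$ be a non-empty open Lipschitz domain compactly contained in $\Omega$. Let $0<a<1$, $f\in H^{-a}(\mathcal{O})$ and $G\in H^a(\Omega)$ with $G=g$ in $\Omega\setminus\overline{\mathcal{O}}$. Then there exists a unique weak solution $v\in H^a(\Omega)$ of the Dirichlet problem $$(-\Delta)^a_\Omega v=f\ \text{ in }\mathcal{O},\qquad v=g\ \text{ on }\Omega\setminus\overline{\mathcal{O}}.$$ Moreover, it satisfies the stability estimate $$\|v\|_{H^a(\Omega)}\le C\left(\|f\|_{H^{-a}(\mathcal{O})}+\|G\|_{H^a(\Omega)}\right)$$ with a constant $C$ independent of $f$ and $G$.
   Context: All functions are real valued. $H^r(\mathbb{R}^n)$ is the $L^2$-based Sobolev space with norm $\|\langle\xi\rangle^r\widehat u\|_{L^2}$. For an open set $U$ with Lipschitz boundary, $H^r(U)$ is the space of restrictions to $U$ of elements of $H^r(\mathbb{R}^n)$ with the quotient norm, $\widetilde H^r(U)$ is the closure of $C_c^\infty(U)$ in $H^r(\mathbb{R}^n)$, and $H^{-r}(U)$ is identified with the dual of $\widetilde H^r(U)$. $(-\Delta)^a_\Omega$ is the regional fractional Laplacian, $(-\Delta)^a_\Omega u(x)=C_{n,a}\,\mathrm{p.v.}\int_\Omega\frac{u(x)-u(y)}{|x-y|^{n+2a}}dy$ with a constant $C_{n,a}>0$. The associated bilinear form is $$\mathcal{B}_\Omega(\varphi,\psi)=\int_\Omega\int_\Omega\frac{(\varphi(x)-\varphi(y))(\psi(x)-\psi(y))}{|x-y|^{n+2a}}\,dy\,dx,\qquad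 \varphi,\psi\in H^a(\Omega).$$ By definition, $v\in H^a(\Omega)$ is a weak solution of the Dirichlet problem if $\mathcal{B}_\Omega(v,\psi)=\langle f,\psi\rangle$ for all $\psi\in\widetilde H^a(\mathcal{O})$ and $v=g$ on $\Omega\setminus\overline{\mathcal{O}}$ (the positive normalization constant is absorbed in this definition). *)

theory Defs
  imports "HOL-Analysis.Analysis"
begin

text \<open>
  Functions on an open set \<open>U\<close> are represented by total functions on \<open>real ^ 'n\<close> whose values
  outside \<open>U\<close> are irrelevant; elements of the function spaces are functions, and equality in
  the spaces is equality almost everywhere with respect to Lebesgue measure.
\<close>

section \<open>Square integrable functions and their Fourier transform\<close>

definition L2_fun :: "(real ^ 'n \<Rightarrow> 'b::{banach, second_countable_topology}) \<Rightarrow> bool" where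
  "L2_fun u \<longleftrightarrow> u \<in> borel_measurable lebesgue \<and> integrable lebesgue (\<lambda>x. (norm (u x))\<^sup>2)"

definition L2_norm :: "(real ^ 'n \<Rightarrow> 'b::{banach, second_countable_topology}) \<Rightarrow> real" where
  "L2_norm u = sqrt (\<integral>x. (norm (u x))\<^sup>2 \<partial>lebesgue)"

text \<open>Unitary normalization, so that the Sobolev norm of order 0 is the \<open>L\<^sup>2\<close> norm.\<close>

definition fourier_integral :: "(real ^ 'n \<Rightarrow> real) \<Rightarrow> real ^ 'n \<Rightarrow> complex" where
  "fourier_integral u \<xi> =
     (2 * pi) powr (- real CARD('n) / 2) *\<^sub>R (\<integral>x. cis (- (x \<bullet> \<xi>)) * complex_of_real (u x) \<partial>lebesgue)"

text \<open>
  For \<open>u\<close> in \<open>L\<^sup>2\<close>, the Fourier transform is the \<open>L\<^sup>2\<close> limit of the Fourier integrals of the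
  truncations of \<open>u\<close> to balls.  By Plancherel's theorem it exists, and it is unique up to null sets.
\<close>

definition is_fourier_transform :: "(real ^ 'n \<Rightarrow> real) \<Rightarrow> (real ^ 'n \<Rightarrow> complex) \<Rightarrow> bool" where
  "is_fourier_transform u w \<longleftrightarrow> L2_fun w \<and>
     ((\<lambda>R. \<integral>\<^sup>+\<xi>. ennreal ((norm (fourier_integral (\<lambda>x. indicator (ball 0 R) x * u x) \<xi> - w \<xi>))\<^sup>2) \<partial>lebesgue)
        \<longlongrightarrow> 0) at_top"

definition fourier_L2 :: "(real ^ 'n \<Rightarrow> real) \<Rightarrow> real ^ 'n \<Rightarrow> complex" where
  "fourier_L2 u = (SOME w. is_fourier_transform u w)"

section \<open>Sobolev spaces of nonnegative order and duals\<close>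

definition japanese_bracket :: "real ^ 'n \<Rightarrow> real" where
  "japanese_bracket \<xi> = sqrt (1 + (norm \<xi>)\<^sup>2)"

text \<open>
  \<open>H\<^sup>r\<close> of the whole space.  The requirement that \<open>u\<close> itself is in \<open>L\<^sup>2\<close> is the right
  one only for \<open>r \<ge> 0\<close>; negative orders are treated as dual spaces below.
\<close>

definition sobolev :: "real \<Rightarrow> (real ^ 'n \<Rightarrow> real) set" where
  "sobolev r = {u. L2_fun u \<and> is_fourier_transform u (fourier_L2 u) \<and>
                   L2_fun (\<lambda>\<xi>. (japanese_bracket \<xi> powr r) *\<^sub>R fourier_L2 u \<xi>)}"

definition sobolev_norm :: "real \<Rightarrow> (real ^ 'n \<Rightarrow> real) \<Rightarrow> real" where
  "sobolev_norm r u = L2_norm (\<lambda>\<xi>. (japanese_bracket \<xi> powr r) *\<^sub>R fourier_L2 u \<xi>)"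

definition sobolev_extensions ::
    "real \<Rightarrow> (real ^ 'n) set \<Rightarrow> (real ^ 'n \<Rightarrow> real) \<Rightarrow> (real ^ 'n \<Rightarrow> real) set" where
  "sobolev_extensions r U u = {w \<in> sobolev r. AE x in lebesgue_on U. w x = u x}"

definition sobolev_on :: "real \<Rightarrow> (real ^ 'n) set \<Rightarrow> (real ^ 'n \<Rightarrow> real) set" where
  "sobolev_on r U = {u. sobolev_extensions r U u \<noteq> {}}"

definition sobolev_on_norm :: "real \<Rightarrow> (real ^ 'n) set \<Rightarrow> (real ^ 'n \<Rightarrow> real) \<Rightarrow> real" where
  "sobolev_on_norm r U u = (INF w\<in>sobolev_extensions r U u. sobolev_norm r w)"

primrec Ck_fun :: "nat \<Rightarrow> (real ^ 'n \<Rightarrow> real) \<Rightarrow> bool" where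
  "Ck_fun 0 f \<longleftrightarrow> continuous_on UNIV f"
| "Ck_fun (Suc k) f \<longleftrightarrow> (\<forall>x. f differentiable at x) \<and>
     (\<forall>b\<in>Basis. Ck_fun k (\<lambda>x. frechet_derivative f (at x) b))"

definition test_functions :: "(real ^ 'n) set \<Rightarrow> (real ^ 'n \<Rightarrow> real) set" where
  "test_functions U = {\<phi>. (\<forall>k. Ck_fun k \<phi>) \<and>
     compact (closure {x. \<phi> x \<noteq> 0}) \<and> closure {x. \<phi> x \<noteq> 0} \<subseteq> U}"

text \<open>The closure of the test functions on \<open>U\<close> in \<open>H\<^sup>r\<close> of the whole space.\<close>

definition sobolev_tilde :: "real \<Rightarrow> (real ^ 'n) set \<Rightarrow> (real ^ 'n \<Rightarrow> real) set" where
  "sobolev_tilde r U = {u \<in> sobolev r.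
     \<forall>\<epsilon>>0. \<exists>\<phi>\<in>test_functions U. sobolev_norm r (\<lambda>x. u x - \<phi> x) < \<epsilon>}"

text \<open>
  \<open>H\<^sup>-\<^sup>r(U)\<close> as the space of bounded linear functionals on \<open>sobolev_tilde r U\<close>, with the operator
  norm.  The bound forces a functional to respect almost everywhere equality; its values outside
  \<open>sobolev_tilde r U\<close> are irrelevant.
\<close>

definition sobolev_dual :: "real \<Rightarrow> (real ^ 'n) set \<Rightarrow> ((real ^ 'n \<Rightarrow> real) \<Rightarrow> real) set" where
  "sobolev_dual r U = {f.
     (\<forall>\<phi>\<in>sobolev_tilde r U. \<forall>\<psi>\<in>sobolev_tilde r U. f (\<lambda>x. \<phi> x + \<psi> x) = f \<phi> + f \<psi>) \<and>
     (\<forall>c. \<forall>\<psi>\<in>sobolev_tilde r U. f (\<lambda>x. c * \<psi> x) = c * f \<psi>) \<and>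
     (\<exists>K. \<forall>\<psi>\<in>sobolev_tilde r U. \<bar>f \<psi>\<bar> \<le> K * sobolev_norm r \<psi>)}"

definition sobolev_dual_norm :: "real \<Rightarrow> (real ^ 'n) set \<Rightarrow> ((real ^ 'n \<Rightarrow> real) \<Rightarrow> real) \<Rightarrow> real" where
  "sobolev_dual_norm r U f = (SUP \<psi>\<in>{\<psi> \<in> sobolev_tilde r U. sobolev_norm r \<psi> \<le> 1}. \<bar>f \<psi>\<bar>)"

section \<open>Lipschitz domains\<close>

text \<open>
  Near each boundary point, \<open>U\<close> is the strict epigraph of a Lipschitz function over the
  hyperplane orthogonal to a unit vector \<open>e\<close>; the hyperplane plays the role of
  \<open>\<real>\<^sup>n\<^sup>-\<^sup>1\<close> in rotated coordinates.
\<close>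

definition lipschitz_boundary :: "(real ^ 'n) set \<Rightarrow> bool" where
  "lipschitz_boundary U \<longleftrightarrow> (\<forall>p\<in>frontier U. \<exists>e r L \<gamma>. norm e = 1 \<and> r > 0 \<and>
     L-lipschitz_on {y. y \<bullet> e = 0} \<gamma> \<and>
     U \<inter> ball p r = {x \<in> ball p r. \<gamma> (x - (x \<bullet> e) *\<^sub>R e) < x \<bullet> e})"

definition lipschitz_domain :: "(real ^ 'n) set \<Rightarrow> bool" where
  "lipschitz_domain U \<longleftrightarrow> open U \<and> connected U \<and> U \<noteq> {} \<and> lipschitz_boundary U"

definition compactly_contained :: "(real ^ 'n) set \<Rightarrow> (real ^ 'n) set \<Rightarrow> bool" where
  "compactly_contained V U \<longleftrightarrow> compact (closure V) \<and> closure V \<subseteq> U"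

section \<open>The Dirichlet problem for the regional fractional Laplacian\<close>

definition regional_form ::
    "real \<Rightarrow> (real ^ 'n) set \<Rightarrow> (real ^ 'n \<Rightarrow> real) \<Rightarrow> (real ^ 'n \<Rightarrow> real) \<Rightarrow> real" where
  "regional_form a \<Omega> \<phi> \<psi> =
     (\<integral>x. (\<integral>y. (\<phi> x - \<phi> y) * (\<psi> x - \<psi> y) / norm (x - y) powr (real CARD('n) + 2 * a)
        \<partial>lebesgue_on \<Omega>) \<partial>lebesgue_on \<Omega>)"

text \<open>
  Weak solutions of \<open>(-\<Delta>)\<^sup>a v = f\<close> in \<open>\<O>\<close> (regional fractional Laplacian of \<open>\<Omega>\<close>),
  \<open>v = g\<close> on \<open>\<Omega> - closure \<O>\<close>; the positive normalization constant of the operator is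
  absorbed in the right-hand side.
\<close>

definition weak_solution ::
    "real \<Rightarrow> (real ^ 'n) set \<Rightarrow> (real ^ 'n) set \<Rightarrow> ((real ^ 'n \<Rightarrow> real) \<Rightarrow> real) \<Rightarrow>
     (real ^ 'n \<Rightarrow> real) \<Rightarrow> (real ^ 'n \<Rightarrow> real) \<Rightarrow> bool" where
  "weak_solution a \<Omega> \<O> f g v \<longleftrightarrow> v \<in> sobolev_on a \<Omega> \<and>
     (\<forall>\<psi>\<in>sobolev_tilde a \<O>. regional_form a \<Omega> v \<psi> = f \<psi>) \<and>
     (AE x in lebesgue_on (\<Omega> - closure \<O>). v x = g x)"

end

theory Submission
  imports Defs "HOL-Probability.Probability"
begin

text \<open>
  The problem is solved by the Hilbert space method. Write \<open>v = W + z\<close>, where \<open>W\<close> extends \<open>G\<close>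
  to the whole space and \<open>z\<close> lies in the closure \<open>sobolev_tilde a \<O>\<close> of the test functions.
  Then \<open>z\<close> has to represent the functional \<open>\<psi> \<mapsto> f \<psi> - B(W, \<psi>)\<close> by the regional form \<open>B\<close>, so
  that existence and the stability estimate follow from the Riesz representation theorem
  (\<open>riesz_representation_form\<close>) once \<open>B\<close> is bounded and coercive on \<open>sobolev_tilde a \<O>\<close>
  (\<open>regional_coercive\<close>).

  Coercivity has two reasons. A function that vanishes off \<open>\<O>\<close> is compared by \<open>B\<close> with its
  zero values on the nonempty open set \<open>\<Omega> - closure \<O>\<close>, at bounded distance, and this controls
  its \<open>L\<^sup>2\<close> norm (\<open>Poincare_regional\<close>). The part of the energy over the whole space that \<open>B\<close>
  does not see comes from pairs of points, one in \<open>\<O>\<close> and one off \<open>\<Omega>\<close>, whose distance is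
  bounded below; there the kernel is integrable (\<open>exterior_energy\<close>).

  The Sobolev norm is defined by the Fourier transform and the form by a double integral. They
  are linked by Plancherel's theorem applied to the increments of a function: the squared norm
  of \<open>u(\<cdot> + s) - u\<close> is the integral of \<open>\<bar>e\<^sup>i\<^sup>s\<^sup>\<xi> - 1\<bar>\<^sup>2\<close> against the squared modulus of the
  transform of \<open>u\<close>, and integration in \<open>s\<close> against the kernel \<open>\<bar>s\<bar>\<^sup>-\<^sup>n\<^sup>-\<^sup>2\<^sup>a\<close> produces a multiplier
  comparable to \<open>\<bar>\<xi>\<bar>\<^sup>2\<^sup>a\<close>. Hence \<open>H\<^sup>a\<close> consists of the \<open>L\<^sup>2\<close> functions of finite Gagliardo energy,
  with equivalent norms (\<open>sobolev_energy\<close>), and all later arguments are carried out with the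
  energy. Plancherel's theorem itself is proved by a Gaussian regularization
  (\<open>plancherel_raw_fourier\<close>) and transferred to \<open>L\<^sup>2\<close> by completeness.

  Uniqueness is where the Lipschitz boundary enters. The difference of two solutions vanishes
  almost everywhere on \<open>\<Omega> - closure \<O>\<close>. To be tested against itself it must be a limit of test
  functions on \<open>\<O>\<close>, and that is the density theorem \<open>sobolev_tilde_lipschitz\<close>: near a boundary
  point the function is pushed into \<open>\<O>\<close> along the axis of the local graph, which costs little
  energy because translations are continuous, and is then mollified.
\<close>

section \<open>Square integrable functions\<close>

text \<open>
  The squared norm is an extended nonnegative number, so that it can be transformed by
  Tonelli's theorem before it is known to be finite.
\<close>

definition L2sq :: "'a measure \<Rightarrow> ('a \<Rightarrow> 'b::real_normed_vector) \<Rightarrow> ennreal" where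
  "L2sq M f = (\<integral>\<^sup>+x. ennreal ((norm (f x))\<^sup>2) \<partial>M)"

text \<open>
  The norm as a real number; it is \<open>0\<close> when the squared norm is infinite.
\<close>

definition L2n :: "'a measure \<Rightarrow> ('a \<Rightarrow> 'b::real_normed_vector) \<Rightarrow> real" where
  "L2n M f = sqrt (enn2real (L2sq M f))"

lemma L2n_nonneg [simp]: "L2n M f \<ge> 0"
  by (simp add: L2n_def)

lemma L2sq_eq_L2n: "L2sq M f < top \<Longrightarrow> L2sq M f = ennreal ((L2n M f)\<^sup>2)"
  by (simp add: L2n_def)

lemma L2sq_uminus: "L2sq M (\<lambda>x. - f x) = L2sq M f"
  by (simp add: L2sq_def)

lemma L2sq_minus_commute: "L2sq M (\<lambda>x. f x - g x) = L2sq M (\<lambda>x. g x - f x)"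
  by (simp add: L2sq_def norm_minus_commute)

lemma L2sq_scale:
  fixes f :: "'a \<Rightarrow> 'b::{real_normed_vector, second_countable_topology}"
  assumes [measurable]: "f \<in> borel_measurable M"
  shows "L2sq M (\<lambda>x. c *\<^sub>R f x) = ennreal (c\<^sup>2) * L2sq M f"
  unfolding L2sq_def by (subst nn_integral_cmult[symmetric]) (auto simp: power_mult_distrib ennreal_mult')

lemma L2sq_cong_AE: "AE x in M. f x = g x \<Longrightarrow> L2sq M f = L2sq M g"
  unfolding L2sq_def by (rule nn_integral_cong_AE) auto

lemma L2sq_mono_AE: "AE x in M. norm (f x) \<le> norm (g x) \<Longrightarrow> L2sq M f \<le> L2sq M g"
  unfolding L2sq_def by (rule nn_integral_mono_AE) (auto elim!: eventually_mono simp: power_mono)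

lemma L2sq_add_le:
  fixes f g :: "'a \<Rightarrow> 'b::{real_normed_vector, second_countable_topology}"
  assumes [measurable]: "f \<in> borel_measurable M" "g \<in> borel_measurable M"
  shows "L2sq M (\<lambda>x. f x + g x) \<le> 2 * L2sq M f + 2 * L2sq M g"
proof -
  have *: "(norm (f x + g x))\<^sup>2 \<le> 2 * (norm (f x))\<^sup>2 + 2 * (norm (g x))\<^sup>2" for x
  proof -
    have "(norm (f x + g x))\<^sup>2 \<le> (norm (f x) + norm (g x))\<^sup>2"
      by (simp add: norm_triangle_ineq power_mono)
    also have "\<dots> \<le> 2 * (norm (f x))\<^sup>2 + 2 * (norm (g x))\<^sup>2"
      using sum_squares_bound[of "norm (f x)" "norm (g x)"] by (simp add: power2_sum)
    finally show ?thesis .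
  qed
  have "L2sq M (\<lambda>x. f x + g x) \<le> (\<integral>\<^sup>+x. 2 * ennreal ((norm (f x))\<^sup>2) + 2 * ennreal ((norm (g x))\<^sup>2) \<partial>M)"
    unfolding L2sq_def
  proof (rule nn_integral_mono)
    fix x
    have "ennreal ((norm (f x + g x))\<^sup>2) \<le> ennreal (2 * (norm (f x))\<^sup>2 + 2 * (norm (g x))\<^sup>2)"
      using * by (rule ennreal_leI)
    also have "\<dots> = 2 * ennreal ((norm (f x))\<^sup>2) + 2 * ennreal ((norm (g x))\<^sup>2)"
      by (simp add: ennreal_plus ennreal_mult')
    finally show "ennreal ((norm (f x + g x))\<^sup>2) \<le> 2 * ennreal ((norm (f x))\<^sup>2) + 2 * ennreal ((norm (g x))\<^sup>2)" .
  qed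
  also have "\<dots> = 2 * L2sq M f + 2 * L2sq M g"
    unfolding L2sq_def by (simp add: nn_integral_add nn_integral_cmult)
  finally show ?thesis .
qed

lemma L2sq_diff_le:
  fixes f g :: "'a \<Rightarrow> 'b::{real_normed_vector, second_countable_topology}"
  assumes [measurable]: "f \<in> borel_measurable M" "g \<in> borel_measurable M"
  shows "L2sq M (\<lambda>x. f x - g x) \<le> 2 * L2sq M f + 2 * L2sq M g"
  using L2sq_add_le[of f M "\<lambda>x. - g x"] by (simp add: L2sq_uminus)

lemma L2sq_add_finite:
  fixes f g :: "'a \<Rightarrow> 'b::{real_normed_vector, second_countable_topology}"
  assumes "f \<in> borel_measurable M" "g \<in> borel_measurable M" "L2sq M f < top" "L2sq M g < top"
  shows "L2sq M (\<lambda>x. f x + g x) < top"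
  by (rule order_le_less_trans[OF L2sq_add_le[OF assms(1,2)]])
    (use assms(3,4) in \<open>simp add: ennreal_mult_less_top\<close>)

lemma L2sq_diff_finite:
  fixes f g :: "'a \<Rightarrow> 'b::{real_normed_vector, second_countable_topology}"
  assumes "f \<in> borel_measurable M" "g \<in> borel_measurable M" "L2sq M f < top" "L2sq M g < top"
  shows "L2sq M (\<lambda>x. f x - g x) < top"
  using L2sq_add_finite[of f M "\<lambda>x. - g x"] assms by (simp add: L2sq_uminus)

lemma power_strict_mono_ennreal:
  fixes x y :: ennreal
  assumes "x < y" shows "x\<^sup>2 < y\<^sup>2"
proof (cases y)
  case (real r)
  with assms obtain s where "x = ennreal s" "0 \<le> s" "s < r"
    by (cases x) (auto simp: ennreal_less_iff)
  with real show ?thesis by (simp add: ennreal_power ennreal_less_iff power_strict_mono)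
next
  case top
  with assms show ?thesis by (cases x) (auto simp: ennreal_power power2_eq_square ennreal_mult_less_top)
qed

text \<open>
  Expand the square and estimate the mixed term by the Cauchy--Schwarz inequality.
\<close>

lemma L2n_triangle:
  fixes f g :: "'a \<Rightarrow> 'b::{real_normed_vector, second_countable_topology}"
  assumes [measurable]: "f \<in> borel_measurable M" "g \<in> borel_measurable M"
    and fin: "L2sq M f < top" "L2sq M g < top"
  shows "L2n M (\<lambda>x. f x + g x) \<le> L2n M f + L2n M g"
proof -
  define p q where "p = L2n M f" and "q = L2n M g"
  define P where "P = (\<integral>\<^sup>+x. ennreal (norm (f x)) * ennreal (norm (g x)) \<partial>M)"
  have pq: "p \<ge> 0" "q \<ge> 0" "L2sq M f = ennreal (p\<^sup>2)" "L2sq M g = ennreal (q\<^sup>2)"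
    using fin by (auto simp: p_def q_def L2sq_eq_L2n)
  have "P\<^sup>2 \<le> L2sq M f * L2sq M g"
    unfolding P_def L2sq_def
    using Cauchy_Schwarz_nn_integral[of "\<lambda>x. ennreal (norm (f x))" M "\<lambda>x. ennreal (norm (g x))"]
    by (simp add: ennreal_power)
  then have P2: "P\<^sup>2 \<le> (ennreal (p*q))\<^sup>2"
    using pq by (simp add: ennreal_mult' ennreal_power power_mult_distrib)
  have P: "P \<le> ennreal (p*q)"
  proof (rule ccontr)
    assume "\<not> P \<le> ennreal (p*q)"
    then have "ennreal (p*q) < P" by simp
    then have "(ennreal (p*q))\<^sup>2 < P\<^sup>2"
      by (rule power_strict_mono_ennreal)
    with P2 show False by simp
  qed
  have "L2sq M (\<lambda>x. f x + g x) \<le> (\<integral>\<^sup>+x. ennreal ((norm (f x))\<^sup>2) +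
           2 * (ennreal (norm (f x)) * ennreal (norm (g x))) + ennreal ((norm (g x))\<^sup>2) \<partial>M)"
    unfolding L2sq_def
  proof (rule nn_integral_mono)
    fix x
    have "(norm (f x + g x))\<^sup>2 \<le> (norm (f x) + norm (g x))\<^sup>2"
      by (simp add: norm_triangle_ineq power_mono)
    also have "\<dots> = (norm (f x))\<^sup>2 + 2 * (norm (f x) * norm (g x)) + (norm (g x))\<^sup>2"
      by (simp add: power2_sum)
    finally have "ennreal ((norm (f x + g x))\<^sup>2) \<le> ennreal ((norm (f x))\<^sup>2 + 2 * (norm (f x) * norm (g x)) + (norm (g x))\<^sup>2)"
      by (rule ennreal_leI)
    also have "\<dots> = ennreal ((norm (f x))\<^sup>2) + 2 * (ennreal (norm (f x)) * ennreal (norm (g x))) + ennreal ((norm (g x))\<^sup>2)"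
      by (simp add: ennreal_plus ennreal_mult')
    finally show "ennreal ((norm (f x + g x))\<^sup>2) \<le> \<dots>" .
  qed
  also have "\<dots> = L2sq M f + 2 * P + L2sq M g"
    unfolding L2sq_def P_def by (simp add: nn_integral_add nn_integral_cmult)
  also have "\<dots> \<le> L2sq M f + 2 * ennreal (p*q) + L2sq M g"
    using P by (intro add_mono mult_left_mono order_refl) auto
  also have "\<dots> = ennreal (p\<^sup>2 + 2*(p*q) + q\<^sup>2)"
    using pq by (simp add: ennreal_plus ennreal_mult')
  also have "\<dots> = ennreal ((p+q)\<^sup>2)"
    by (simp add: power2_sum algebra_simps)
  finally have "enn2real (L2sq M (\<lambda>x. f x + g x)) \<le> (p+q)\<^sup>2"
    by (simp add: enn2real_leI)
  then show ?thesis
    unfolding L2n_def[of M "\<lambda>x. f x + g x"] p_def[symmetric] q_def[symmetric]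
    using pq by (intro real_le_lsqrt) auto
qed

lemma L2n_diff_commute: "L2n M (\<lambda>x. f x - g x) = L2n M (\<lambda>x. g x - f x)"
  unfolding L2n_def by (subst L2sq_minus_commute) (rule refl)

lemma L2n_reverse_triangle:
  fixes f g :: "'a \<Rightarrow> 'b::{real_normed_vector, second_countable_topology}"
  assumes [measurable]: "f \<in> borel_measurable M" "g \<in> borel_measurable M"
    and fin: "L2sq M f < top" "L2sq M g < top"
  shows "\<bar>L2n M f - L2n M g\<bar> \<le> L2n M (\<lambda>x. f x - g x)"
proof -
  have d: "L2sq M (\<lambda>x. f x - g x) < top" "L2sq M (\<lambda>x. g x - f x) < top"
    using fin by (simp_all add: L2sq_diff_finite)
  have "L2n M (\<lambda>x. (f x - g x) + g x) \<le> L2n M (\<lambda>x. f x - g x) + L2n M g"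
    using fin d by (intro L2n_triangle) auto
  moreover have "L2n M (\<lambda>x. (g x - f x) + f x) \<le> L2n M (\<lambda>x. g x - f x) + L2n M f"
    using fin d by (intro L2n_triangle) auto
  ultimately show ?thesis by (simp add: L2n_diff_commute[of M g f] abs_le_iff)
qed

lemma L2sq_tendsto:
  fixes f :: "'i \<Rightarrow> 'a \<Rightarrow> 'b::{real_normed_vector, second_countable_topology}"
  assumes meas: "\<And>j. f j \<in> borel_measurable M" "g \<in> borel_measurable M"
    and fin: "L2sq M g < top"
    and lim: "((\<lambda>j. L2sq M (\<lambda>x. f j x - g x)) \<longlongrightarrow> 0) F"
  shows "((\<lambda>j. L2sq M (f j)) \<longlongrightarrow> L2sq M g) F"
proof -
  note [measurable] = meas
  have ev1: "\<forall>\<^sub>F j in F. L2sq M (\<lambda>x. f j x - g x) < top"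
    using order_tendstoD(2)[OF lim, of top] by simp
  have *: "L2sq M (f j) < top" if "L2sq M (\<lambda>x. f j x - g x) < top" for j
    using L2sq_add_finite[of "\<lambda>x. f j x - g x" M g] that fin meas by simp
  have n0: "((\<lambda>j. L2n M (\<lambda>x. f j x - g x)) \<longlongrightarrow> 0) F"
    unfolding L2n_def using tendsto_real_sqrt[OF tendsto_enn2real[of _ 0, unfolded ennreal_0, OF lim]]
    by simp
  have "((\<lambda>j. L2n M (f j) - L2n M g) \<longlongrightarrow> 0) F"
  proof (rule tendsto_rabs_zero_cancel, rule tendsto_sandwich[OF _ _ tendsto_const n0])
    show "\<forall>\<^sub>F j in F. \<bar>L2n M (f j) - L2n M g\<bar> \<le> L2n M (\<lambda>x. f j x - g x)"
      using ev1 by eventually_elim (auto intro!: L2n_reverse_triangle * fin)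
  qed auto
  then have "((\<lambda>j. L2n M (f j)) \<longlongrightarrow> L2n M g) F" by (simp add: LIM_zero_iff)
  then have "((\<lambda>j. ennreal ((L2n M (f j))\<^sup>2)) \<longlongrightarrow> ennreal ((L2n M g)\<^sup>2)) F"
    by (intro tendsto_ennrealI tendsto_power)
  then have "((\<lambda>j. L2sq M (f j)) \<longlongrightarrow> ennreal ((L2n M g)\<^sup>2)) F"
  proof (rule Lim_transform_eventually)
    show "\<forall>\<^sub>F j in F. ennreal ((L2n M (f j))\<^sup>2) = L2sq M (f j)"
      using ev1 by eventually_elim (simp add: * L2sq_eq_L2n[symmetric])
  qed
  then show ?thesis by (simp add: L2sq_eq_L2n[OF fin])
qed

lemma ennreal_approx_below:
  assumes "0 < (c::ennreal)" obtains e where "0 < e" "ennreal e < c"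
proof (cases c)
  case (real r)
  with assms have "0 < r/2" "ennreal (r/2) < c" by (auto simp: ennreal_less_iff)
  then show ?thesis by (rule that)
next
  case top then show ?thesis by (intro that[of 1]) auto
qed

text \<open>
  Fatou's lemma.
\<close>

lemma L2sq_le_of_AE_limit:
  fixes f :: "nat \<Rightarrow> 'a \<Rightarrow> 'b::{banach, second_countable_topology}"
  assumes [measurable]: "\<And>k. f k \<in> borel_measurable M"
    and lim: "AE x in M. (\<lambda>k. f k x) \<longlonglongrightarrow> g x"
  shows "L2sq M g \<le> liminf (\<lambda>k. L2sq M (f k))"
proof -
  have "L2sq M g = (\<integral>\<^sup>+x. liminf (\<lambda>k. ennreal ((norm (f k x))\<^sup>2)) \<partial>M)"
    unfolding L2sq_def
  proof (rule nn_integral_cong_AE)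
    show "AE x in M. ennreal ((norm (g x))\<^sup>2) = liminf (\<lambda>k. ennreal ((norm (f k x))\<^sup>2))"
      using lim
    proof eventually_elim
      case (elim x)
      then have "(\<lambda>k. ennreal ((norm (f k x))\<^sup>2)) \<longlonglongrightarrow> ennreal ((norm (g x))\<^sup>2)" by (intro tendsto_intros)
      then show ?case by (rule lim_imp_Liminf[symmetric, rotated]) simp
    qed
  qed
  also have "\<dots> \<le> liminf (\<lambda>k. L2sq M (f k))" unfolding L2sq_def by (rule nn_integral_liminf) measurable
  finally show ?thesis .
qed

text \<open>
  Along a rapidly Cauchy subsequence the increments have summable weighted squares, hence it
  converges almost everywhere, and Fatou's lemma turns the pointwise limit into a limit in the
  mean. The subsequence is part of the conclusion because the Gagliardo energy of the limit is
  estimated through pointwise convergence as well.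
\<close>

lemma L2_complete:
  fixes f :: "nat \<Rightarrow> 'a \<Rightarrow> 'b::{banach, second_countable_topology}"
  assumes meas [measurable]: "\<And>n. f n \<in> borel_measurable M"
    and cauchy: "\<And>e. e > 0 \<Longrightarrow> \<exists>K. \<forall>m\<ge>K. \<forall>n\<ge>K. L2sq M (\<lambda>x. f m x - f n x) \<le> ennreal e"
  obtains g r where "g \<in> borel_measurable M" "strict_mono r"
    "AE x in M. (\<lambda>k. f (r k) x) \<longlonglongrightarrow> g x" "(\<lambda>n. L2sq M (\<lambda>x. f n x - g x)) \<longlonglongrightarrow> 0"
proof -
  have "\<forall>k. \<exists>K. \<forall>m\<ge>K. \<forall>n\<ge>K. L2sq M (\<lambda>x. f m x - f n x) \<le> ennreal ((1/4)^k)"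
    using cauchy by simp
  then obtain K where K: "\<And>k m n. m \<ge> K k \<Longrightarrow> n \<ge> K k \<Longrightarrow> L2sq M (\<lambda>x. f m x - f n x) \<le> ennreal ((1/4)^k)"
    by metis
  \<comment> \<open>Partial sums are strictly increasing and dominate every summand.\<close>
  define r where "r k = (\<Sum>i\<le>k. Suc (K i))" for k
  have r_mono: "strict_mono r" unfolding strict_mono_Suc_iff r_def by simp
  have rK: "r k \<ge> K k" for k
    unfolding r_def by (rule order_trans[OF _ member_le_sum[of k]]) auto
  define d where "d k x = f (r (Suc k)) x - f (r k) x" for k x
  have [measurable]: "d k \<in> borel_measurable M" for k unfolding d_def by measurable
  have d_le: "L2sq M (d k) \<le> ennreal ((1/4)^k)" for k
    unfolding d_def using K[of k "r (Suc k)" "r k"] rK[of k] r_mono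
    by (meson lessI order_less_imp_le order_trans strict_mono_less_eq)
  have "(\<integral>\<^sup>+x. (\<Sum>k. ennreal (2^k * (norm (d k x))\<^sup>2)) \<partial>M) = (\<Sum>k. \<integral>\<^sup>+x. ennreal (2^k * (norm (d k x))\<^sup>2) \<partial>M)"
    by (rule nn_integral_suminf) measurable
  also have "\<dots> = (\<Sum>k. ennreal (2^k) * L2sq M (d k))"
    unfolding L2sq_def by (simp add: ennreal_mult' nn_integral_cmult)
  also have "\<dots> \<le> (\<Sum>k. ennreal ((1/2)^k))"
  proof (intro suminf_le)
    fix k
    have "ennreal (2^k) * L2sq M (d k) \<le> ennreal (2^k) * ennreal ((1/4)^k)"
      using d_le by (intro mult_left_mono) auto
    also have "\<dots> = ennreal ((1/2)^k)"
      by (simp add: ennreal_mult'[symmetric] power_mult_distrib[symmetric])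
    finally show "ennreal (2^k) * L2sq M (d k) \<le> ennreal ((1/2)^k)" .
  qed auto
  also have "\<dots> = ennreal (\<Sum>k. (1/2)^k)"
    by (intro suminf_ennreal2) (auto intro: summable_geometric)
  also have "\<dots> < top" by simp
  finally have "AE x in M. (\<Sum>k. ennreal (2^k * (norm (d k x))\<^sup>2)) \<noteq> top"
    by (intro nn_integral_PInf_AE[unfolded infinity_ennreal_def]) auto
  then have conv: "AE x in M. convergent (\<lambda>k. f (r k) x)"
  proof eventually_elim
    case (elim x)
    then have s: "summable (\<lambda>k. 2^k * (norm (d k x))\<^sup>2)"
      by (intro summable_suminf_not_top) auto
    have "summable (\<lambda>k. (1/2)^k + 2^k * (norm (d k x))\<^sup>2)"
      using s by (intro summable_add) (auto intro: summable_geometric)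
    then have "summable (\<lambda>k. d k x)"
    proof (rule summable_comparison_test')
      fix k :: nat
      \<comment> \<open>The arithmetic-geometric mean inequality bounds the increments by a summable sequence.\<close>
      have "2 * (1 * (2^k * norm (d k x))) \<le> 1\<^sup>2 + (2^k * norm (d k x))\<^sup>2"
        using sum_squares_bound[of 1 "2^k * norm (d k x)"] by simp
      then have "(2 * (2^k * norm (d k x))) / 2^k \<le> (1 + (2^k * norm (d k x))\<^sup>2) / 2^k"
        by (intro divide_right_mono) auto
      then have "2 * norm (d k x) \<le> (1/2)^k + 2^k * (norm (d k x))\<^sup>2"
        by (simp add: field_simps power2_eq_square)
      then show "norm (d k x) \<le> (1/2)^k + 2^k * (norm (d k x))\<^sup>2"
        using norm_ge_zero[of "d k x"] by linarith
    qed
    then have "convergent (\<lambda>n. (\<Sum>k<n. d k x))"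
      by (simp add: summable_iff_convergent)
    moreover have "(\<Sum>k<n. d k x) = f (r n) x - f (r 0) x" for n
      unfolding d_def by (rule sum_lessThan_telescope)
    ultimately have "convergent (\<lambda>n. f (r n) x - f (r 0) x)" by simp
    then show "convergent (\<lambda>n. f (r n) x)"
      using convergent_diff_const_right_iff by blast
  qed
  define g where "g x = lim (\<lambda>k. f (r k) x)" for x
  have g_meas[measurable]: "g \<in> borel_measurable M" unfolding g_def by measurable
  have g_lim: "AE x in M. (\<lambda>k. f (r k) x) \<longlonglongrightarrow> g x"
    using conv by eventually_elim (simp add: g_def convergent_LIMSEQ_iff)
  have "(\<lambda>n. L2sq M (\<lambda>x. f n x - g x)) \<longlonglongrightarrow> 0"
  proof (rule order_tendstoI)
    fix c :: ennreal assume "0 < c"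
    then obtain e where e: "0 < e" "ennreal e < c" by (rule ennreal_approx_below)
    obtain L where L: "\<And>m n. m \<ge> L \<Longrightarrow> n \<ge> L \<Longrightarrow> L2sq M (\<lambda>x. f m x - f n x) \<le> ennreal e"
      using cauchy[OF e(1)] by metis
    have "L2sq M (\<lambda>x. f n x - g x) \<le> ennreal e" if n: "n \<ge> L" for n
    proof -
      have "L2sq M (\<lambda>x. f n x - g x) \<le> liminf (\<lambda>k. L2sq M (\<lambda>x. f n x - f (r k) x))"
      proof (rule L2sq_le_of_AE_limit)
        show "AE x in M. (\<lambda>k. f n x - f (r k) x) \<longlonglongrightarrow> f n x - g x"
          using g_lim by eventually_elim (intro tendsto_diff tendsto_const)
      qed measurable
      also have "\<dots> \<le> ennreal e"
      proof (rule Liminf_le)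
        show "\<forall>\<^sub>F k in sequentially. L2sq M (\<lambda>x. f n x - f (r k) x) \<le> ennreal e"
          using eventually_ge_at_top[of L]
        proof eventually_elim
          case (elim k)
          then have "r k \<ge> L" using seq_suble[OF r_mono, of k] by simp
          then show ?case using L n by blast
        qed
      qed simp
      finally show ?thesis .
    qed
    then show "\<forall>\<^sub>F n in sequentially. L2sq M (\<lambda>x. f n x - g x) < c"
      by (auto intro!: eventually_sequentiallyI[of L] intro: order_le_less_trans[OF _ e(2)])
  qed auto
  with g_meas r_mono g_lim show ?thesis by (rule that)
qed

section \<open>Approximation and translation in the mean\<close>

lemma pred_ball_borel [measurable]:
  "Measurable.pred borel (\<lambda>x. x \<in> cball (a::'a::euclidean_space) r)"
  "Measurable.pred borel (\<lambda>x. x \<in> ball (a::'a::euclidean_space) r)"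
  by (simp_all add: pred_def)

lemma L2sq_dominated_tendsto:
  fixes f :: "nat \<Rightarrow> 'a \<Rightarrow> 'b::{real_normed_vector, second_countable_topology}"
  assumes meas [measurable]: "\<And>j. f j \<in> borel_measurable M" "g \<in> borel_measurable M" "w \<in> borel_measurable M"
    and lim: "AE x in M. (\<lambda>j. f j x) \<longlonglongrightarrow> g x"
    and bd: "\<And>j. AE x in M. norm (f j x - g x) \<le> w x"
    and fin: "L2sq M w < top"
  shows "(\<lambda>j. L2sq M (\<lambda>x. f j x - g x)) \<longlonglongrightarrow> 0"
proof -
  have "(\<lambda>j. \<integral>\<^sup>+x. ennreal ((norm (f j x - g x))\<^sup>2) \<partial>M) \<longlonglongrightarrow> (\<integral>\<^sup>+x. 0 \<partial>M)"
  proof (rule nn_integral_dominated_convergence[where w="\<lambda>x. ennreal ((w x)\<^sup>2)"])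
    show "(\<integral>\<^sup>+x. ennreal ((w x)\<^sup>2) \<partial>M) < \<infinity>" using fin by (simp add: L2sq_def)
    show "AE x in M. ennreal ((norm (f j x - g x))\<^sup>2) \<le> ennreal ((w x)\<^sup>2)" for j
      using bd[of j] by eventually_elim (auto intro!: ennreal_leI power_mono)
    show "AE x in M. (\<lambda>j. ennreal ((norm (f j x - g x))\<^sup>2)) \<longlonglongrightarrow> 0"
      using lim
    proof eventually_elim
      case (elim x)
      then have "(\<lambda>j. ennreal ((norm (f j x - g x))\<^sup>2)) \<longlonglongrightarrow> ennreal ((norm (g x - g x))\<^sup>2)"
        by (intro tendsto_intros)
      then show ?case by simp
    qed
  qed auto
  then show ?thesis by (simp add: L2sq_def)
qed

lemma nn_integral_lborel_translate:
  fixes f :: "'a::euclidean_space \<Rightarrow> ennreal"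
  assumes [measurable]: "f \<in> borel_measurable borel"
  shows "(\<integral>\<^sup>+x. f (x + h) \<partial>lborel) = (\<integral>\<^sup>+x. f x \<partial>lborel)"
  by (subst (2) lborel_distr_plus[symmetric, of h]) (simp add: nn_integral_distr add.commute)

lemma L2sq_translate:
  fixes f :: "'a::euclidean_space \<Rightarrow> 'b::{real_normed_vector, second_countable_topology}"
  assumes [measurable]: "f \<in> borel_measurable borel"
  shows "L2sq lborel (\<lambda>x. f (x + h)) = L2sq lborel f"
  unfolding L2sq_def by (rule nn_integral_lborel_translate[of "\<lambda>x. ennreal ((norm (f x))\<^sup>2)"]) measurable

lemma L2sq_bounded_support:
  fixes f :: "'a::euclidean_space \<Rightarrow> real"
  assumes "\<And>x. \<bar>f x\<bar> \<le> B" "\<And>x. x \<notin> cball 0 r \<Longrightarrow> f x = 0"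
  shows "L2sq lborel f < top"
proof -
  have "L2sq lborel f \<le> (\<integral>\<^sup>+x. ennreal (B\<^sup>2) * indicator (cball 0 r) (x::'a) \<partial>lborel)"
    unfolding L2sq_def
  proof (rule nn_integral_mono)
    fix x
    have "(norm (f x))\<^sup>2 \<le> B\<^sup>2" using assms(1)[of x] by (intro power_mono) auto
    then show "ennreal ((norm (f x))\<^sup>2) \<le> ennreal (B\<^sup>2) * indicator (cball 0 r) x"
      using assms(2)[of x] by (auto simp: indicator_def intro: ennreal_leI)
  qed
  also have "\<dots> < top"
    using emeasure_bounded_finite[of "cball 0 r::'a set"]
    by (simp add: nn_integral_cmult_indicator ennreal_mult_less_top)
  finally show ?thesis .
qed

lemma L2_approx_bounded_support:
  fixes f :: "'a::euclidean_space \<Rightarrow> real"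
  assumes [measurable]: "f \<in> borel_measurable borel" and fin: "L2sq lborel f < top"
  defines "F \<equiv> \<lambda>k x. max (- real k) (min (real k) (f x)) * indicator (cball 0 (real k)) x"
  shows "(\<lambda>k. L2sq lborel (\<lambda>x. F k x - f x)) \<longlonglongrightarrow> 0"
proof (rule L2sq_dominated_tendsto)
  show "AE x in lborel. (\<lambda>k. F k x) \<longlonglongrightarrow> f x"
  proof (rule AE_I2)
    fix x
    have "\<forall>\<^sub>F k in sequentially. F k x = f x"
      using eventually_ge_at_top[of "nat \<lceil>max \<bar>f x\<bar> (norm x)\<rceil>"]
    proof eventually_elim
      case (elim k)
      then have "max \<bar>f x\<bar> (norm x) \<le> real k" by linarith
      then show ?case by (auto simp: F_def indicator_def)
    qed
    then show "(\<lambda>k. F k x) \<longlonglongrightarrow> f x" by (rule tendsto_eventually)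
  qed
  show "AE x in lborel. norm (F j x - f x) \<le> \<bar>f x\<bar>" for j
    by (rule AE_I2) (auto simp: F_def indicator_def max_def min_def)
  show "L2sq lborel (\<lambda>x. \<bar>f x\<bar>) < top" using fin by (simp add: L2sq_def)
qed (use assms(1) in \<open>simp_all add: F_def\<close>)

text \<open>
  Measurable functions are almost everywhere limits of continuous ones. Cutting these off in
  height and in support makes dominated convergence applicable.
\<close>

lemma L2_approx_continuous:
  fixes f :: "'a::euclidean_space \<Rightarrow> real"
  assumes [measurable]: "f \<in> borel_measurable borel"
    and bd: "\<And>x. \<bar>f x\<bar> \<le> B" and supp: "\<And>x. x \<notin> cball 0 r \<Longrightarrow> f x = 0"
  shows "\<exists>g. (\<forall>j. continuous_on UNIV (g j) \<and> (\<forall>x. \<bar>g j x\<bar> \<le> B) \<and> (\<forall>x. x \<notin> cball 0 (r+1) \<longrightarrow> g j x = 0)) \<and>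
     (\<lambda>j::nat. L2sq lborel (\<lambda>x. g j x - f x)) \<longlonglongrightarrow> 0"
proof -
  have B: "B \<ge> 0" using bd[of 0] by linarith
  have "f measurable_on UNIV"
    by (rule lebesgue_measurable_imp_measurable_on) (auto simp: measurable_completion)
  then obtain N g where N: "negligible N" and g: "\<And>n::nat. continuous_on UNIV (g n)"
    "\<And>x. x \<notin> N \<Longrightarrow> (\<lambda>n. g n x) \<longlonglongrightarrow> f x"
    unfolding measurable_on_def by auto
  define G where "G j x = max (-B) (min B (g j x)) * max 0 (min 1 (r + 1 - norm x))" for j x
  have G1: "continuous_on UNIV (G j)" for j
    unfolding G_def by (intro continuous_intros g)
  have [measurable]: "G j \<in> borel_measurable borel" for j
    using G1 by (rule borel_measurable_continuous_onI)
  have G2: "\<bar>G j x\<bar> \<le> B" for j x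
  proof -
    have "\<bar>G j x\<bar> \<le> B * 1" unfolding G_def abs_mult using B by (intro mult_mono) auto
    then show ?thesis by simp
  qed
  have G3: "G j x = 0" if "x \<notin> cball 0 (r+1)" for j x
    using that by (auto simp: G_def)
  have "(\<lambda>j. L2sq lborel (\<lambda>x. G j x - f x)) \<longlonglongrightarrow> 0"
  proof (rule L2sq_dominated_tendsto)
    have "AE x in lebesgue. x \<notin> N" using N by (simp add: AE_not_in negligible_iff_null_sets)
    then have "AE x in lborel. x \<notin> N" by (simp add: AE_completion_iff)
    then show "AE x in lborel. (\<lambda>j. G j x) \<longlonglongrightarrow> f x"
    proof eventually_elim
      case (elim x)
      have "(\<lambda>j. G j x) \<longlonglongrightarrow> max (-B) (min B (f x)) * max 0 (min 1 (r + 1 - norm x))"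
        unfolding G_def by (intro tendsto_intros g elim)
      also have "max (-B) (min B (f x)) = f x" using bd[of x] by (auto simp: max_def min_def)
      also have "f x * max 0 (min 1 (r + 1 - norm x)) = f x"
        using supp[of x] by (cases "x \<in> cball 0 r") auto
      finally show ?case .
    qed
    show "AE x in lborel. norm (G j x - f x) \<le> 2 * B * indicator (cball 0 (r+1)) x" for j
    proof (rule AE_I2)
      fix x
      have "norm (G j x - f x) \<le> 2 * B" using G2[of j x] bd[of x] by auto
      then show "norm (G j x - f x) \<le> 2 * B * indicator (cball 0 (r+1)) x"
        using G3[of x j] supp[of x] by (cases "x \<in> cball 0 (r+1)") auto
    qed
    show "L2sq lborel (\<lambda>x. 2 * B * indicator (cball 0 (r+1)) x :: real) < top"
      by (rule L2sq_bounded_support[of _ "2*B" "r+1"]) (use B in \<open>auto simp: indicator_def\<close>)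
  qed measurable
  with G1 G2 G3 show ?thesis by blast
qed

text \<open>
  For continuous functions of compact support this is dominated convergence. The property
  passes to limits in the mean because translations are isometries, and such functions are
  dense.
\<close>

lemma L2_translation_seq:
  fixes f :: "'a::euclidean_space \<Rightarrow> real"
  assumes fm [measurable]: "f \<in> borel_measurable borel" and fin: "L2sq lborel f < top"
    and h: "h \<longlonglongrightarrow> 0"
  shows "(\<lambda>j. L2sq lborel (\<lambda>x. f (x + h j) - f x)) \<longlonglongrightarrow> 0"
proof -
  define P :: "('a \<Rightarrow> real) \<Rightarrow> bool" where
    "P f \<longleftrightarrow> (\<lambda>j. L2sq lborel (\<lambda>x. f (x + h j) - f x)) \<longlonglongrightarrow> 0" for f
  \<comment> \<open>The class of functions with the property is closed under limits in \<open>L\<^sup>2\<close>.\<close>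
  have closed: "P f" if g: "\<And>k. g k \<in> borel_measurable borel" "\<And>k::nat. P (g k)"
    and f [measurable]: "f \<in> borel_measurable borel" and lim: "(\<lambda>k. L2sq lborel (\<lambda>x. g k x - f x)) \<longlonglongrightarrow> 0" for g f
    unfolding P_def
  proof (rule order_tendstoI)
    note [measurable] = g(1)
    fix c :: ennreal assume c: "0 < c"
    obtain e where e: "0 < e" "ennreal e < c" using ennreal_approx_below[OF c] by blast
    have c6: "0 < ennreal (e/12)" using e by simp
    obtain k where k: "L2sq lborel (\<lambda>x. g k x - f x) < ennreal (e/12)"
      using order_tendstoD(2)[OF lim c6] by (auto simp: eventually_sequentially)
    have "\<forall>\<^sub>F j in sequentially. L2sq lborel (\<lambda>x. g k (x + h j) - g k x) < ennreal (e/12)"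
      using order_tendstoD(2)[OF g(2)[unfolded P_def] c6] .
    then show "\<forall>\<^sub>F j in sequentially. L2sq lborel (\<lambda>x. f (x + h j) - f x) < c"
    proof eventually_elim
      case (elim j)
      have "L2sq lborel (\<lambda>x. f (x + h j) - f x) =
         L2sq lborel (\<lambda>x. (f (x + h j) - g k (x + h j)) + ((g k (x + h j) - g k x) + (g k x - f x)))"
        by simp
      also have "\<dots> \<le> 2 * L2sq lborel (\<lambda>x. f (x + h j) - g k (x + h j)) + 2 *
           L2sq lborel (\<lambda>x. (g k (x + h j) - g k x) + (g k x - f x))"
        by (rule L2sq_add_le) measurable
      also have "L2sq lborel (\<lambda>x. f (x + h j) - g k (x + h j)) = L2sq lborel (\<lambda>x. g k x - f x)"
        by (subst L2sq_minus_commute, rule L2sq_translate) measurable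
      also have "L2sq lborel (\<lambda>x. (g k (x + h j) - g k x) + (g k x - f x)) \<le>
         2 * L2sq lborel (\<lambda>x. g k (x + h j) - g k x) + 2 * L2sq lborel (\<lambda>x. g k x - f x)"
        by (rule L2sq_add_le) measurable
      also have "2 * L2sq lborel (\<lambda>x. g k x - f x) +
        2 * (2 * L2sq lborel (\<lambda>x. g k (x + h j) - g k x) + 2 * L2sq lborel (\<lambda>x. g k x - f x)) \<le>
        2 * ennreal (e/12) + 2 * (2 * ennreal (e/12) + 2 * ennreal (e/12))"
        using k elim by (intro add_mono mult_left_mono) auto
      also have "\<dots> = ennreal (10 * e / 12)"
        using e(1) by (simp add: ennreal_plus[symmetric] ennreal_numeral[symmetric] ennreal_mult'[symmetric] del: ennreal_plus ennreal_numeral)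
      also have "\<dots> \<le> ennreal e" using e(1) by (intro ennreal_leI) simp
      finally show ?case using e(2) by (simp add: mult_left_mono order_le_less_trans)
    qed
  qed auto
  have cont: "P g" if g: "continuous_on UNIV g" "\<And>x. \<bar>g x\<bar> \<le> B" "\<And>x. x \<notin> cball 0 r \<Longrightarrow> g x = 0" for g B r
    unfolding P_def
  proof -
    have [measurable]: "g \<in> borel_measurable borel"
      using g(1) by (rule borel_measurable_continuous_onI)
    obtain H where H: "\<And>j. norm (h j) \<le> H"
      using convergent_imp_Bseq[OF convergentI[OF h]] by (auto simp: Bseq_def)
    have B: "B \<ge> 0" using g(2)[of 0] by linarith
    show "(\<lambda>j. L2sq lborel (\<lambda>x. g (x + h j) - g x)) \<longlonglongrightarrow> 0"
    proof (rule L2sq_dominated_tendsto)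
      show "AE x in lborel. (\<lambda>j. g (x + h j)) \<longlonglongrightarrow> g x"
      proof (rule AE_I2)
        fix x
        have "(\<lambda>j. x + h j) \<longlonglongrightarrow> x + 0" by (intro tendsto_intros h)
        moreover have "isCont g x" using g(1) by (simp add: continuous_on_eq_continuous_at)
        ultimately show "(\<lambda>j. g (x + h j)) \<longlonglongrightarrow> g x"
          using isCont_tendsto_compose[of x g "\<lambda>j. x + h j"] by simp
      qed
      show "AE x in lborel. norm (g (x + h j) - g x) \<le> 2 * B * indicator (cball 0 (r+H)) x" for j
      proof (rule AE_I2)
        fix x
        have H0: "0 \<le> H" using H[of 0] norm_ge_zero order_trans by blast
        have "norm (g (x + h j) - g x) \<le> 2 * B" using g(2)[of "x + h j"] g(2)[of x] by auto
        moreover have "g (x + h j) = 0 \<and> g x = 0" if "x \<notin> cball 0 (r+H)"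
          using that H[of j] H0 norm_triangle_ineq2[of x "- h j"] by (intro conjI g(3)) auto
        ultimately show "norm (g (x + h j) - g x) \<le> 2 * B * indicator (cball 0 (r+H)) x"
          by (cases "x \<in> cball 0 (r+H)") auto
      qed
      show "L2sq lborel (\<lambda>x. 2 * B * indicator (cball 0 (r+H)) x :: real) < top"
        by (rule L2sq_bounded_support[of _ "2*B" "r+H"]) (use B in \<open>auto simp: indicator_def\<close>)
    qed measurable
  qed
  have bounded: "P g" if gm [measurable]: "g \<in> borel_measurable borel"
    and g: "\<And>x. \<bar>g x\<bar> \<le> B" "\<And>x. x \<notin> cball 0 r \<Longrightarrow> g x = 0" for g B r
  proof -
    obtain w where w: "\<And>j. continuous_on UNIV (w j)" "\<And>j x. \<bar>w j x\<bar> \<le> B" "\<And>j x. x \<notin> cball 0 (r+1) \<Longrightarrow> w j x = 0"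
      "(\<lambda>j::nat. L2sq lborel (\<lambda>x. w j x - g x)) \<longlonglongrightarrow> 0"
      using L2_approx_continuous[of g B r, OF gm] g by blast
    show ?thesis
    proof (rule closed[of w])
      show "P (w k)" for k by (rule cont[OF w(1-3)])
    qed (use w gm in \<open>auto intro: borel_measurable_continuous_onI\<close>)
  qed
  have "P f"
  proof (rule closed[OF _ _ fm L2_approx_bounded_support[OF fm fin]])
    fix k :: nat
    show "P (\<lambda>x. max (- real k) (min (real k) (f x)) * indicator (cball 0 (real k)) x)"
      by (rule bounded[of _ "real k" "real k"]) (auto simp: indicator_def)
  qed measurable
  then show ?thesis by (simp add: P_def)
qed

lemma L2_translation_continuous:
  fixes f :: "'a::euclidean_space \<Rightarrow> real"
  assumes "f \<in> borel_measurable borel" and "L2sq lborel f < top"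
  shows "((\<lambda>h. L2sq lborel (\<lambda>x. f (x + h) - f x)) \<longlongrightarrow> 0) (nhds 0)"
proof -
  have "continuous (at 0) (\<lambda>h. L2sq lborel (\<lambda>x. f (x + h) - f x))"
    unfolding continuous_at_sequentially comp_def
    using L2_translation_seq[OF assms] by (simp add: L2sq_def)
  then have "((\<lambda>h. L2sq lborel (\<lambda>x. f (x + h) - f x)) \<longlongrightarrow> L2sq lborel (\<lambda>x. f (x + 0) - f x)) (nhds 0)"
    unfolding continuous_within
    by (rule tendsto_at_iff_tendsto_nhds[of "\<lambda>h. L2sq lborel (\<lambda>x. f (x + h) - f x)" 0, THEN iffD1])
  then show ?thesis by (simp add: L2sq_def)
qed

section \<open>Plancherel's theorem for integrable functions\<close>

definition gauss :: "'a::euclidean_space \<Rightarrow> real" where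
  "gauss x = exp (- (norm x)\<^sup>2 / 2)"

lemma gauss_measurable [measurable]: "gauss \<in> borel_measurable borel"
  unfolding gauss_def by measurable

lemma cis_measurable [measurable]: "cis \<in> borel_measurable borel"
  by (intro borel_measurable_continuous_onI continuous_intros)

text \<open>
  The characteristic function of the standard normal distribution, without its normalization.
\<close>

lemma gaussian_1d:
  fixes c :: real
  shows "integrable lborel (\<lambda>t. exp (- (\<i> * c * complex_of_real t) - t\<^sup>2 / 2))"
    and "(\<integral>t. exp (- (\<i> * c * complex_of_real t) - t\<^sup>2 / 2) \<partial>lborel) = sqrt (2 * pi) * exp (- c\<^sup>2 / 2)"
proof -
  have eq: "exp (- (\<i> * c * complex_of_real t) - t\<^sup>2 / 2) =
      sqrt (2 * pi) *\<^sub>R (std_normal_density t *\<^sub>R iexp ((-c) * t))" for t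
  proof -
    have "- (\<i> * c * complex_of_real t) - t\<^sup>2 / 2 = complex_of_real (- t\<^sup>2 / 2) + \<i> * complex_of_real ((-c) * t)"
      by simp
    then have "exp (- (\<i> * c * complex_of_real t) - t\<^sup>2 / 2) = complex_of_real (exp (- t\<^sup>2 / 2)) * iexp ((-c) * t)"
      by (simp only: exp_add exp_of_real)
    then show ?thesis by (simp add: std_normal_density_def scaleR_conv_of_real)
  qed
  have ch: "(CLINT t|std_normal_distribution. iexp ((-c) * t)) = complex_of_real (exp (- (c\<^sup>2) / 2))"
    using fun_cong[OF char_std_normal_distribution, of "-c"] unfolding char_def by simp
  interpret N: prob_space std_normal_distribution by (rule prob_space_normal_density) simp
  have "integrable std_normal_distribution (\<lambda>t. iexp ((-c) * t))"
    by (rule N.integrable_const_bound[of _ 1]) auto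
  then have i: "integrable lborel (\<lambda>t. std_normal_density t *\<^sub>R iexp ((-c) * t))"
    by (subst (asm) integrable_density) (auto simp: normal_density_nonneg)
  show "integrable lborel (\<lambda>t. exp (- (\<i> * c * complex_of_real t) - t\<^sup>2 / 2))"
    unfolding eq by (intro integrable_scaleR_right i)
  have "(\<integral>t. exp (- (\<i> * c * complex_of_real t) - t\<^sup>2 / 2) \<partial>lborel) =
      sqrt (2 * pi) *\<^sub>R (\<integral>t. std_normal_density t *\<^sub>R iexp ((-c) * t) \<partial>lborel)"
    unfolding eq by (simp only: integral_scaleR_right)
  also have "(\<integral>t. std_normal_density t *\<^sub>R iexp ((-c) * t) \<partial>lborel) = (CLINT t|std_normal_distribution. iexp ((-c) * t))"
    by (subst integral_density) (auto simp: normal_density_nonneg)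
  also note ch
  finally show "(\<integral>t. exp (- (\<i> * c * complex_of_real t) - t\<^sup>2 / 2) \<partial>lborel) = sqrt (2 * pi) * exp (- c\<^sup>2 / 2)"
    by (simp add: scaleR_conv_of_real flip: exp_of_real)
qed

text \<open>
  Lebesgue measure is the image of a product of one-dimensional measures, and the Gaussian and
  the character are products of functions of the coordinates.
\<close>

lemma gaussian_fourier:
  fixes x :: "'a::euclidean_space"
  shows "integrable lborel (\<lambda>\<xi>. cis (- (x \<bullet> \<xi>)) * complex_of_real (gauss \<xi>))"
    and "(\<integral>\<xi>. cis (- (x \<bullet> \<xi>)) * complex_of_real (gauss \<xi>) \<partial>lborel) =
           complex_of_real (sqrt (2 * pi) ^ DIM('a) * gauss x)"
proof -
  interpret product_sigma_finite "\<lambda>_::'a. lborel :: real measure" ..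
  define S where "S f = (\<Sum>b\<in>Basis. f b *\<^sub>R b)" for f :: "'a \<Rightarrow> real"
  have S_inner: "S f \<bullet> b = f b" if "b \<in> Basis" for f b
    unfolding S_def using that by (simp add: inner_sum_left inner_Basis if_distrib cong: if_cong)
  have [measurable]: "S \<in> (\<Pi>\<^sub>M b\<in>Basis. lborel) \<rightarrow>\<^sub>M borel"
    unfolding S_def by measurable
  let ?g = "\<lambda>b t. exp (- (\<i> * complex_of_real (x \<bullet> b) * complex_of_real t) - complex_of_real (t\<^sup>2 / 2))"
  let ?F = "\<lambda>\<xi>. cis (- (x \<bullet> \<xi>)) * complex_of_real (gauss \<xi>)"
  have eq: "?F (S f) = (\<Prod>b\<in>Basis. ?g b (f b))" for f
  proof -
    have 1: "x \<bullet> S f = (\<Sum>b\<in>Basis. (x \<bullet> b) * f b)"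
      by (subst euclidean_inner) (simp add: S_inner)
    have 2: "(norm (S f))\<^sup>2 = (\<Sum>b\<in>Basis. (f b)\<^sup>2)"
      unfolding power2_norm_eq_inner by (subst euclidean_inner) (simp add: S_inner power2_eq_square)
    have "(\<Prod>b\<in>Basis. ?g b (f b)) = exp (\<Sum>b\<in>Basis. - (\<i> * complex_of_real (x \<bullet> b) * complex_of_real (f b)) - complex_of_real ((f b)\<^sup>2 / 2))"
      by (simp add: exp_sum)
    also have "(\<Sum>b\<in>Basis. - (\<i> * complex_of_real (x \<bullet> b) * complex_of_real (f b)) - complex_of_real ((f b)\<^sup>2 / 2))
       = - (\<i> * complex_of_real (x \<bullet> S f)) - complex_of_real ((norm (S f))\<^sup>2 / 2)"
      unfolding 1 2 by (simp add: sum_subtractf sum_negf sum_distrib_left sum_divide_distrib mult.assoc)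
    also have "exp \<dots> = ?F (S f)"
    proof -
      have "- (\<i> * complex_of_real (x \<bullet> S f)) - complex_of_real ((norm (S f))\<^sup>2 / 2) =
          \<i> * complex_of_real (- (x \<bullet> S f)) + complex_of_real (- (norm (S f))\<^sup>2 / 2)" by simp
      then show ?thesis unfolding gauss_def cis_conv_exp by (simp only: exp_add exp_of_real)
    qed
    finally show ?thesis ..
  qed
  have int: "integrable (\<Pi>\<^sub>M b\<in>Basis. lborel) (\<lambda>f. \<Prod>b\<in>Basis. ?g b (f b))"
    by (rule product_integrable_prod) (use gaussian_1d(1) in auto)
  have m: "?F \<in> borel_measurable borel" by measurable
  have lb: "lborel = distr (\<Pi>\<^sub>M b\<in>Basis. lborel) borel S"
    unfolding S_def[abs_def] by (rule lborel_eq)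
  show "integrable lborel ?F"
    by (subst lb, subst integrable_distr_eq) (use int m in \<open>simp_all only: eq, measurable\<close>)
  have "(\<integral>\<xi>. ?F \<xi> \<partial>lborel) = (\<integral>f. ?F (S f) \<partial>(\<Pi>\<^sub>M b\<in>Basis. lborel))"
    by (subst lb, subst integral_distr) (use m in measurable)
  also have "\<dots> = (\<Prod>b\<in>Basis. (\<integral>t. ?g b t \<partial>lborel))"
    unfolding eq by (rule product_integral_prod) (use gaussian_1d(1) in auto)
  also have "\<dots> = (\<Prod>b\<in>Basis. complex_of_real (sqrt (2 * pi) * exp (- (x \<bullet> b)\<^sup>2 / 2)))"
    by (intro prod.cong refl) (use gaussian_1d(2) in simp)
  also have "\<dots> = complex_of_real (sqrt (2 * pi) ^ DIM('a) * (\<Prod>b\<in>Basis. exp (- (x \<bullet> b)\<^sup>2 / 2)))"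
    by (simp add: prod.distrib)
  also have "(\<Prod>b\<in>Basis. exp (- (x \<bullet> b)\<^sup>2 / 2)) = gauss x"
    unfolding gauss_def power2_norm_eq_inner
    by (subst euclidean_inner) (simp add: exp_sum[symmetric] sum_negf sum_divide_distrib power2_eq_square)
  finally show "(\<integral>\<xi>. ?F \<xi> \<partial>lborel) = complex_of_real (sqrt (2 * pi) ^ DIM('a) * gauss x)" .
qed

lemma gauss_integral:
  shows "integrable lborel (gauss :: 'a::euclidean_space \<Rightarrow> real)"
    and "(\<integral>x. gauss (x::'a) \<partial>lborel) = sqrt (2 * pi) ^ DIM('a)"
proof -
  have i: "integrable lborel (\<lambda>x::'a. complex_of_real (gauss x))"
    using gaussian_fourier(1)[of "0::'a"] by simp
  then show "integrable lborel (gauss :: 'a \<Rightarrow> real)" by (simp only: complex_of_real_integrable_eq)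
  have "complex_of_real (\<integral>x. gauss (x::'a) \<partial>lborel) = complex_of_real (sqrt (2 * pi) ^ DIM('a))"
    using gaussian_fourier(2)[of "0::'a"] by (simp add: gauss_def[of 0])
  then show "(\<integral>x. gauss (x::'a) \<partial>lborel) = sqrt (2 * pi) ^ DIM('a)" by (simp only: of_real_eq_iff)
qed

lemma lborel_integral_scale:
  fixes f :: "'a::euclidean_space \<Rightarrow> 'b::{banach, second_countable_topology}"
  assumes f [measurable]: "f \<in> borel_measurable borel" and c: "c > 0"
  shows "(\<integral>x. f x \<partial>lborel) = c ^ DIM('a) *\<^sub>R (\<integral>x. f (c *\<^sub>R x) \<partial>lborel)"
proof -
  have "(\<integral>x. f x \<partial>lborel) = (\<integral>x. f x \<partial>density (distr lborel borel (\<lambda>x. 0 + c *\<^sub>R x)) (\<lambda>_. \<bar>c\<bar>^DIM('a)))"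
    using lborel_affine[of c "0::'a"] c by simp
  also have "\<dots> = (\<integral>x. (\<bar>c\<bar>^DIM('a)) *\<^sub>R f (c *\<^sub>R x) \<partial>lborel)"
    by (subst integral_density) (auto simp: integral_distr)
  finally show ?thesis using c by simp
qed

lemma lborel_integrable_scale:
  fixes f :: "'a::euclidean_space \<Rightarrow> 'b::{banach, second_countable_topology}"
  assumes f: "integrable lborel f" and c: "c > 0"
  shows "integrable lborel (\<lambda>x. f (c *\<^sub>R x))"
proof -
  have [measurable]: "f \<in> borel_measurable borel" using f by simp
  have "integrable (density (distr lborel borel (\<lambda>x. 0 + c *\<^sub>R x)) (\<lambda>_. \<bar>c\<bar>^DIM('a))) f"
    using lborel_affine[of c "0::'a"] c f by simp
  then have "integrable lborel (\<lambda>x. \<bar>c\<bar>^DIM('a) *\<^sub>R f (c *\<^sub>R x))"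
    by (subst (asm) integrable_density) (auto simp: integrable_distr_eq)
  then have "integrable lborel (\<lambda>x. inverse (\<bar>c\<bar>^DIM('a)) *\<^sub>R (\<bar>c\<bar>^DIM('a) *\<^sub>R f (c *\<^sub>R x)))"
    by (rule integrable_scaleR_right)
  then show ?thesis using c by simp
qed

lemma lborel_integral_translate:
  fixes f :: "'a::euclidean_space \<Rightarrow> 'b::{banach, second_countable_topology}"
  assumes f [measurable]: "f \<in> borel_measurable borel"
  shows "(\<integral>x. f (x + h) \<partial>lborel) = (\<integral>x. f x \<partial>lborel)"
  by (subst (2) lborel_distr_plus[symmetric, of h]) (simp add: integral_distr add.commute)

lemma lborel_integrable_translate:
  fixes f :: "'a::euclidean_space \<Rightarrow> 'b::{banach, second_countable_topology}"
  assumes f: "integrable lborel f"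
  shows "integrable lborel (\<lambda>x. f (x + h))"
proof -
  have [measurable]: "f \<in> borel_measurable borel" using f by simp
  have "integrable (distr lborel borel ((+) h)) f" by (simp only: lborel_distr_plus f)
  then show ?thesis by (simp add: integrable_distr_eq add.commute)
qed

lemma gaussian_fourier_scaled:
  fixes z :: "'a::euclidean_space"
  assumes d: "d > 0"
  shows "d ^ DIM('a) *\<^sub>R (\<integral>\<xi>. cis (- (z \<bullet> \<xi>)) * complex_of_real (gauss (d *\<^sub>R \<xi>)) \<partial>lborel) =
     complex_of_real (sqrt (2 * pi) ^ DIM('a) * gauss (z /\<^sub>R d))"
proof -
  have "complex_of_real (sqrt (2 * pi) ^ DIM('a) * gauss (z /\<^sub>R d)) =
      (\<integral>\<xi>. cis (- ((z /\<^sub>R d) \<bullet> \<xi>)) * complex_of_real (gauss \<xi>) \<partial>lborel)"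
    by (simp only: gaussian_fourier(2))
  also have "\<dots> = d ^ DIM('a) *\<^sub>R (\<integral>\<xi>. cis (- ((z /\<^sub>R d) \<bullet> (d *\<^sub>R \<xi>))) * complex_of_real (gauss (d *\<^sub>R \<xi>)) \<partial>lborel)"
    by (rule lborel_integral_scale) (use d in simp_all)
  also have "(\<lambda>\<xi>. (z /\<^sub>R d) \<bullet> (d *\<^sub>R \<xi>)) = (\<lambda>\<xi>. z \<bullet> \<xi>)"
    using d by auto
  finally show ?thesis using d by (simp add: field_simps)
qed


text \<open>
  The Fourier integral without the normalizing constant.
\<close>

definition raw_fourier :: "('a::euclidean_space \<Rightarrow> real) \<Rightarrow> 'a \<Rightarrow> complex" where
  "raw_fourier u \<xi> = (\<integral>x. cis (- (x \<bullet> \<xi>)) * complex_of_real (u x) \<partial>lborel)"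

definition autocorr :: "('a::euclidean_space \<Rightarrow> real) \<Rightarrow> 'a \<Rightarrow> real" where
  "autocorr u z = (\<integral>y. u y * u (y + z) \<partial>lborel)"

lemma raw_fourier_measurable [measurable]:
  fixes u :: "'a::euclidean_space \<Rightarrow> real"
  assumes [measurable]: "u \<in> borel_measurable borel"
  shows "raw_fourier u \<in> borel_measurable borel"
proof -
  have "raw_fourier u \<in> borel_measurable (lborel :: 'a measure)"
    unfolding raw_fourier_def[abs_def] by measurable
  then show ?thesis by simp
qed

lemma autocorr_measurable [measurable]:
  fixes u :: "'a::euclidean_space \<Rightarrow> real"
  assumes [measurable]: "u \<in> borel_measurable borel"
  shows "autocorr u \<in> borel_measurable borel"
proof -
  have "autocorr u \<in> borel_measurable (lborel :: 'a measure)"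
    unfolding autocorr_def[abs_def] by measurable
  then show ?thesis by simp
qed

lemma integrable_mult_cis:
  assumes "integrable M u" and [measurable]: "g \<in> borel_measurable M"
  shows "integrable M (\<lambda>x. cis (g x) * complex_of_real (u x))"
proof (rule Bochner_Integration.integrable_bound[OF assms(1)])
  show "AE x in M. norm (cis (g x) * complex_of_real (u x)) \<le> norm (u x)"
    by (simp add: norm_mult)
qed (use assms in measurable)

lemma integrable_shear:
  fixes u :: "'a::euclidean_space \<Rightarrow> real"
  assumes u: "integrable lborel u"
  shows "integrable (lborel \<Otimes>\<^sub>M lborel) (\<lambda>(y, z). u y * u (y + z))"
proof -
  have [measurable]: "u \<in> borel_measurable borel" using u by simp
  have fin: "(\<integral>\<^sup>+x. ennreal \<bar>u x\<bar> \<partial>lborel) < top"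
    using u by (simp add: integrable_iff_bounded)
  have "(\<integral>\<^sup>+p. ennreal (norm (case p of (y, z) \<Rightarrow> u y * u (y + z))) \<partial>(lborel \<Otimes>\<^sub>M lborel)) =
      (\<integral>\<^sup>+y. \<integral>\<^sup>+z. ennreal \<bar>u y\<bar> * ennreal \<bar>u (y + z)\<bar> \<partial>lborel \<partial>lborel)"
    by (subst lborel.nn_integral_fst[symmetric]) (auto simp: abs_mult ennreal_mult')
  also have "\<dots> = (\<integral>\<^sup>+y. ennreal \<bar>u y\<bar> * (\<integral>\<^sup>+z. ennreal \<bar>u (z + y)\<bar> \<partial>lborel) \<partial>lborel)"
    by (subst nn_integral_cmult) (auto simp: add.commute)
  also have "\<dots> = (\<integral>\<^sup>+y. ennreal \<bar>u y\<bar> * (\<integral>\<^sup>+z. ennreal \<bar>u z\<bar> \<partial>lborel) \<partial>lborel)"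
    by (subst nn_integral_lborel_translate[of "\<lambda>z. ennreal \<bar>u z\<bar>"]) auto
  also have "\<dots> = (\<integral>\<^sup>+y. ennreal \<bar>u y\<bar> \<partial>lborel) * (\<integral>\<^sup>+z. ennreal \<bar>u z\<bar> \<partial>lborel)"
    by (subst nn_integral_multc) auto
  also have "\<dots> < top" using fin by (simp add: ennreal_mult_less_top)
  finally show ?thesis by (intro integrableI_bounded) auto
qed

lemma autocorr_integrable:
  fixes u :: "'a::euclidean_space \<Rightarrow> real"
  assumes u: "integrable lborel u"
  shows "integrable lborel (autocorr u)"
proof -
  have "integrable (lborel \<Otimes>\<^sub>M lborel) (\<lambda>(z, y). u y * u (y + z))"
    using lborel_pair.integrable_product_swap[OF integrable_shear[OF u]] by (simp add: case_prod_unfold)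
  from lborel_pair.integrable_fst'[OF this] show ?thesis
    unfolding autocorr_def[abs_def] by simp
qed

text \<open>
  The Wiener--Khinchin identity: substitute \<open>x = y + z\<close> in the double integral for the squared
  modulus and integrate over \<open>y\<close> first.
\<close>

lemma norm_raw_fourier_sq:
  fixes u :: "'a::euclidean_space \<Rightarrow> real"
  assumes u: "integrable lborel u"
  shows "complex_of_real ((norm (raw_fourier u \<xi>))\<^sup>2) = raw_fourier (autocorr u) \<xi>"
proof -
  have [measurable]: "u \<in> borel_measurable borel" using u by simp
  let ?G = "\<lambda>(y, z). cis (- (z \<bullet> \<xi>)) * complex_of_real (u y * u (y + z))"
  have int: "integrable (lborel \<Otimes>\<^sub>M lborel) ?G"
    using integrable_mult_cis[OF integrable_shear[OF u], of "\<lambda>p. - (snd p \<bullet> \<xi>)"]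
    by (simp add: case_prod_unfold)
  have cnj: "cnj (raw_fourier u \<xi>) = (\<integral>y. cis (y \<bullet> \<xi>) * complex_of_real (u y) \<partial>lborel)"
  proof -
    have "cnj (raw_fourier u \<xi>) = (\<integral>y. cnj (cis (- (y \<bullet> \<xi>)) * complex_of_real (u y)) \<partial>lborel)"
      unfolding raw_fourier_def by (rule Bochner_Integration.integral_cnj[symmetric])
    then show ?thesis by (simp only: complex_cnj_mult complex_cnj_complex_of_real cis_cnj minus_minus)
  qed
  have "complex_of_real ((norm (raw_fourier u \<xi>))\<^sup>2) = cnj (raw_fourier u \<xi>) * raw_fourier u \<xi>"
    by (subst complex_norm_square) (simp add: mult.commute)
  also have "\<dots> = (\<integral>y. cis (y \<bullet> \<xi>) * complex_of_real (u y) * raw_fourier u \<xi> \<partial>lborel)"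
    unfolding cnj by simp
  also have "\<dots> = (\<integral>y. (\<integral>z. ?G (y, z) \<partial>lborel) \<partial>lborel)"
  proof (rule Bochner_Integration.integral_cong[OF refl])
    fix y
    have "raw_fourier u \<xi> = (\<integral>z. cis (- ((z + y) \<bullet> \<xi>)) * complex_of_real (u (z + y)) \<partial>lborel)"
      unfolding raw_fourier_def by (rule lborel_integral_translate[symmetric]) measurable
    also have "cis (y \<bullet> \<xi>) * complex_of_real (u y) * \<dots> =
      (\<integral>z. cis (y \<bullet> \<xi>) * complex_of_real (u y) * (cis (- ((z + y) \<bullet> \<xi>)) * complex_of_real (u (z + y))) \<partial>lborel)"
      by simp
    also have "\<dots> = (\<integral>z. ?G (y, z) \<partial>lborel)"
    proof (rule Bochner_Integration.integral_cong[OF refl])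
      fix z
      have "cis (y \<bullet> \<xi>) * cis (- ((z + y) \<bullet> \<xi>)) = cis (- (z \<bullet> \<xi>))"
        by (simp add: cis_mult inner_add_left)
      then show "cis (y \<bullet> \<xi>) * complex_of_real (u y) * (cis (- ((z + y) \<bullet> \<xi>)) * complex_of_real (u (z + y)))
          = ?G (y, z)"
        by (simp add: add.commute)
    qed
    finally show "cis (y \<bullet> \<xi>) * complex_of_real (u y) * raw_fourier u \<xi> = (\<integral>z. ?G (y, z) \<partial>lborel)" .
  qed
  also have "\<dots> = (\<integral>z. (\<integral>y. ?G (y, z) \<partial>lborel) \<partial>lborel)"
    using lborel_pair.Fubini_integral[of "\<lambda>y z. ?G (y, z)"] int by simp
  also have "\<dots> = raw_fourier (autocorr u) \<xi>"
    unfolding raw_fourier_def autocorr_def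
    by (simp only: prod.case integral_mult_right_zero integral_complex_of_real)
  finally show ?thesis .
qed

lemma integrable_mult_L2:
  fixes f g :: "'a \<Rightarrow> real"
  assumes [measurable]: "f \<in> borel_measurable M" "g \<in> borel_measurable M"
    and fin: "L2sq M f < top" "L2sq M g < top"
  shows "integrable M (\<lambda>x. f x * g x)" "\<bar>\<integral>x. f x * g x \<partial>M\<bar> \<le> L2n M f * L2n M g"
proof -
  define P where "P = (\<integral>\<^sup>+x. ennreal \<bar>f x\<bar> * ennreal \<bar>g x\<bar> \<partial>M)"
  have "P\<^sup>2 \<le> L2sq M f * L2sq M g"
    unfolding P_def L2sq_def
    using Cauchy_Schwarz_nn_integral[of "\<lambda>x. ennreal \<bar>f x\<bar>" M "\<lambda>x. ennreal \<bar>g x\<bar>"]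
    by (simp add: ennreal_power)
  also have "\<dots> = (ennreal (L2n M f * L2n M g))\<^sup>2"
    using fin by (simp add: L2sq_eq_L2n ennreal_mult' ennreal_power power_mult_distrib)
  finally have "P\<^sup>2 \<le> (ennreal (L2n M f * L2n M g))\<^sup>2" .
  then have P: "P \<le> ennreal (L2n M f * L2n M g)"
    using power_strict_mono_ennreal[of "ennreal (L2n M f * L2n M g)" P] by (meson linorder_not_less)
  have Pe: "(\<integral>\<^sup>+x. ennreal (norm (f x * g x)) \<partial>M) = P"
    unfolding P_def by (simp add: abs_mult ennreal_mult')
  show i: "integrable M (\<lambda>x. f x * g x)"
    by (rule integrableI_bounded) (use Pe P in \<open>auto intro: order_le_less_trans\<close>)
  have "\<bar>\<integral>x. f x * g x \<partial>M\<bar> \<le> (\<integral>x. norm (f x * g x) \<partial>M)"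
    using integral_norm_bound[of M "\<lambda>x. f x * g x"] by simp
  also have "\<dots> = enn2real P"
    by (subst Pe[symmetric]) (rule integral_eq_nn_integral; use i in auto)
  also have "\<dots> \<le> L2n M f * L2n M g"
    using P by (intro enn2real_leI) auto
  finally show "\<bar>\<integral>x. f x * g x \<partial>M\<bar> \<le> L2n M f * L2n M g" .
qed

lemma autocorr_bound:
  fixes u :: "'a::euclidean_space \<Rightarrow> real"
  assumes [measurable]: "u \<in> borel_measurable borel" and fin: "L2sq lborel u < top"
  shows "\<bar>autocorr u z\<bar> \<le> (L2n lborel u)\<^sup>2"
proof -
  have t: "L2sq lborel (\<lambda>y. u (y + z)) = L2sq lborel u" by (rule L2sq_translate) measurable
  have "\<bar>autocorr u z\<bar> \<le> L2n lborel u * L2n lborel (\<lambda>y. u (y + z))"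
    unfolding autocorr_def by (rule integrable_mult_L2) (use fin t in auto)
  also have "\<dots> = (L2n lborel u)\<^sup>2" by (simp add: L2n_def t)
  finally show ?thesis .
qed

text \<open>
  By the Cauchy--Schwarz inequality this follows from the continuity of translations in the
  mean.
\<close>

lemma autocorr_tendsto:
  fixes u :: "'a::euclidean_space \<Rightarrow> real"
  assumes [measurable]: "u \<in> borel_measurable borel" and fin: "L2sq lborel u < top"
  shows "(autocorr u \<longlongrightarrow> autocorr u 0) (nhds 0)"
proof -
  have "((\<lambda>z. L2sq lborel (\<lambda>y. u (y + z) - u y)) \<longlongrightarrow> ennreal 0) (nhds 0)"
    using L2_translation_continuous[OF assms] by simp
  then have "((\<lambda>z. enn2real (L2sq lborel (\<lambda>y. u (y + z) - u y))) \<longlongrightarrow> 0) (nhds 0)"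
    by (rule tendsto_enn2real) simp
  then have "((\<lambda>z. L2n lborel u * L2n lborel (\<lambda>y. u (y + z) - u y)) \<longlongrightarrow> L2n lborel u * sqrt 0) (nhds 0)"
    unfolding L2n_def by (intro tendsto_mult tendsto_const tendsto_real_sqrt)
  then have l: "((\<lambda>z. L2n lborel u * L2n lborel (\<lambda>y. u (y + z) - u y)) \<longlongrightarrow> 0) (nhds 0)" by simp
  have "((\<lambda>z. autocorr u z - autocorr u 0) \<longlongrightarrow> 0) (nhds 0)"
  proof (rule tendsto_rabs_zero_cancel, rule tendsto_sandwich[OF _ _ tendsto_const l])
    have "\<bar>autocorr u z - autocorr u 0\<bar> \<le> L2n lborel u * L2n lborel (\<lambda>y. u (y + z) - u y)" for z
    proof -
      have f: "L2sq lborel (\<lambda>y. u (y + z)) < top"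
        using fin by (subst L2sq_translate) auto
      have "autocorr u z - autocorr u 0 = (\<integral>y. u y * u (y + z) - u y * u (y + 0) \<partial>lborel)"
        unfolding autocorr_def
        by (subst Bochner_Integration.integral_diff) (use fin f in \<open>auto intro!: integrable_mult_L2\<close>)
      also have "\<dots> = (\<integral>y. u y * (u (y + z) - u y) \<partial>lborel)" by (simp add: algebra_simps)
      also have "\<bar>\<dots>\<bar> \<le> L2n lborel u * L2n lborel (\<lambda>y. u (y + z) - u y)"
        by (rule integrable_mult_L2) (use fin f in \<open>auto intro!: L2sq_diff_finite\<close>)
      finally show ?thesis .
    qed
    then show "\<forall>\<^sub>F z in nhds 0. \<bar>autocorr u z - autocorr u 0\<bar> \<le> L2n lborel u * L2n lborel (\<lambda>y. u (y + z) - u y)"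
      by simp
  qed auto
  then show ?thesis by (simp add: LIM_zero_iff)
qed

lemma autocorr_0:
  fixes u :: "'a::euclidean_space \<Rightarrow> real"
  assumes [measurable]: "u \<in> borel_measurable borel" and fin: "L2sq lborel u < top"
  shows "L2sq lborel u = ennreal (autocorr u 0)"
proof -
  have "L2sq lborel u = (\<integral>\<^sup>+x. ennreal (u x * u (x + 0)) \<partial>lborel)"
    unfolding L2sq_def by (simp add: power2_eq_square)
  also have "\<dots> = ennreal (autocorr u 0)"
    unfolding autocorr_def
    by (rule nn_integral_eq_integral) (use fin in \<open>auto intro!: integrable_mult_L2\<close>)
  finally show ?thesis .
qed

lemma integrable_tensor:
  fixes f g :: "'a::euclidean_space \<Rightarrow> real"
  assumes f: "integrable lborel f" and g: "integrable lborel g"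
  shows "integrable (lborel \<Otimes>\<^sub>M lborel) (\<lambda>(x, y). f x * g y)"
proof -
  have [measurable]: "f \<in> borel_measurable borel" "g \<in> borel_measurable borel" using f g by simp_all
  have fin: "(\<integral>\<^sup>+x. ennreal \<bar>f x\<bar> \<partial>lborel) < top" "(\<integral>\<^sup>+x. ennreal \<bar>g x\<bar> \<partial>lborel) < top"
    using f g by (simp_all add: integrable_iff_bounded)
  have "(\<integral>\<^sup>+p. ennreal (norm (case p of (x, y) \<Rightarrow> f x * g y)) \<partial>(lborel \<Otimes>\<^sub>M lborel)) =
      (\<integral>\<^sup>+x. \<integral>\<^sup>+y. ennreal \<bar>f x\<bar> * ennreal \<bar>g y\<bar> \<partial>lborel \<partial>lborel)"
    by (subst lborel.nn_integral_fst[symmetric]) (auto simp: abs_mult ennreal_mult')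
  also have "\<dots> = (\<integral>\<^sup>+x. ennreal \<bar>f x\<bar> \<partial>lborel) * (\<integral>\<^sup>+y. ennreal \<bar>g y\<bar> \<partial>lborel)"
    by (simp add: nn_integral_cmult nn_integral_multc)
  also have "\<dots> < top" using fin by (simp add: ennreal_mult_less_top)
  finally show ?thesis by (intro integrableI_bounded) auto
qed

lemma raw_fourier_bound:
  "norm (raw_fourier u \<xi>) \<le> (\<integral>x. \<bar>u x\<bar> \<partial>lborel)"
  unfolding raw_fourier_def
  using integral_norm_bound[of lborel "\<lambda>x. cis (- (x \<bullet> \<xi>)) * complex_of_real (u x)"]
  by (simp add: norm_mult)

text \<open>
  By Fubini's theorem the Gaussian weight can be moved from the transform to the
  autocorrelation, where it reappears as its own Fourier transform; after rescaling, letting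
  \<open>d\<close> tend to \<open>0\<close> evaluates the autocorrelation at the origin.
\<close>

lemma damped_energy:
  fixes u :: "'a::euclidean_space \<Rightarrow> real"
  assumes u: "integrable lborel u" and d: "d > 0"
  shows "integrable lborel (\<lambda>\<xi>. gauss (d *\<^sub>R \<xi>) * (norm (raw_fourier u \<xi>))\<^sup>2)"
    and "(\<integral>\<xi>. gauss (d *\<^sub>R \<xi>) * (norm (raw_fourier u \<xi>))\<^sup>2 \<partial>lborel) =
       sqrt (2 * pi) ^ DIM('a) * (\<integral>z. autocorr u (d *\<^sub>R z) * gauss z \<partial>lborel)"
proof -
  have [measurable]: "u \<in> borel_measurable borel" using u by simp
  define A where "A = autocorr u"
  have A: "integrable lborel A" unfolding A_def using u by (rule autocorr_integrable)
  have [measurable]: "A \<in> borel_measurable borel" using A by simp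
  have g: "integrable lborel (\<lambda>\<xi>::'a. gauss (d *\<^sub>R \<xi>))"
    by (rule lborel_integrable_scale[OF gauss_integral(1) d])
  show "integrable lborel (\<lambda>\<xi>. gauss (d *\<^sub>R \<xi>) * (norm (raw_fourier u \<xi>))\<^sup>2)"
  proof (rule Bochner_Integration.integrable_bound)
    show "integrable lborel (\<lambda>\<xi>::'a. gauss (d *\<^sub>R \<xi>) * (\<integral>x. \<bar>u x\<bar> \<partial>lborel)\<^sup>2)" using g by simp
    show "AE \<xi> in lborel. norm (gauss (d *\<^sub>R \<xi>) * (norm (raw_fourier u \<xi>))\<^sup>2) \<le> norm (gauss (d *\<^sub>R \<xi>) * (\<integral>x. \<bar>u x\<bar> \<partial>lborel)\<^sup>2)"
      using power_mono[OF raw_fourier_bound[of u] norm_ge_zero, where n=2] by (auto simp: abs_mult intro!: mult_left_mono)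
  qed measurable
  let ?G = "\<lambda>\<xi> z. cis (- (z \<bullet> \<xi>)) * complex_of_real (gauss (d *\<^sub>R \<xi>) * A z)"
  have int: "integrable (lborel \<Otimes>\<^sub>M lborel) (\<lambda>(\<xi>, z). ?G \<xi> z)"
    using integrable_mult_cis[OF integrable_tensor[OF g A], of "\<lambda>p. - (snd p \<bullet> fst p)"]
    by (simp add: case_prod_unfold)
  have d0: "d ^ DIM('a) \<noteq> 0" using d by simp
  have "complex_of_real (\<integral>\<xi>. gauss (d *\<^sub>R \<xi>) * (norm (raw_fourier u \<xi>))\<^sup>2 \<partial>lborel) =
     (\<integral>\<xi>. complex_of_real (gauss (d *\<^sub>R \<xi>)) * raw_fourier A \<xi> \<partial>lborel)"
    unfolding A_def norm_raw_fourier_sq[OF u, symmetric]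
    by (simp only: integral_complex_of_real[symmetric] of_real_mult)
  also have "\<dots> = (\<integral>\<xi>. (\<integral>z. ?G \<xi> z \<partial>lborel) \<partial>lborel)"
  proof (rule Bochner_Integration.integral_cong[OF refl])
    fix \<xi>
    have "complex_of_real (gauss (d *\<^sub>R \<xi>)) * raw_fourier A \<xi> =
        (\<integral>z. complex_of_real (gauss (d *\<^sub>R \<xi>)) * (cis (- (z \<bullet> \<xi>)) * complex_of_real (A z)) \<partial>lborel)"
      unfolding raw_fourier_def by (rule integral_mult_right_zero[symmetric])
    also have "\<dots> = (\<integral>z. ?G \<xi> z \<partial>lborel)"
      by (rule Bochner_Integration.integral_cong) (auto simp: mult.left_commute)
    finally show "complex_of_real (gauss (d *\<^sub>R \<xi>)) * raw_fourier A \<xi> = (\<integral>z. ?G \<xi> z \<partial>lborel)" .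
  qed
  also have "\<dots> = (\<integral>z. (\<integral>\<xi>. ?G \<xi> z \<partial>lborel) \<partial>lborel)"
    by (rule lborel_pair.Fubini_integral[OF int, symmetric])
  also have "\<dots> = (\<integral>z. complex_of_real (A z) * (\<integral>\<xi>. cis (- (z \<bullet> \<xi>)) * complex_of_real (gauss (d *\<^sub>R \<xi>)) \<partial>lborel) \<partial>lborel)"
  proof (rule Bochner_Integration.integral_cong[OF refl])
    fix z
    have "(\<integral>\<xi>. ?G \<xi> z \<partial>lborel) = (\<integral>\<xi>. complex_of_real (A z) * (cis (- (z \<bullet> \<xi>)) * complex_of_real (gauss (d *\<^sub>R \<xi>))) \<partial>lborel)"
      by (rule Bochner_Integration.integral_cong) (auto simp: mult_ac)
    also have "\<dots> = complex_of_real (A z) * (\<integral>\<xi>. cis (- (z \<bullet> \<xi>)) * complex_of_real (gauss (d *\<^sub>R \<xi>)) \<partial>lborel)"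
      by (rule integral_mult_right_zero)
    finally show "(\<integral>\<xi>. ?G \<xi> z \<partial>lborel) = complex_of_real (A z) * (\<integral>\<xi>. cis (- (z \<bullet> \<xi>)) * complex_of_real (gauss (d *\<^sub>R \<xi>)) \<partial>lborel)" .
  qed
  also have "d ^ DIM('a) *\<^sub>R \<dots> = (\<integral>z. complex_of_real (A z) * complex_of_real (sqrt (2 * pi) ^ DIM('a) * gauss (z /\<^sub>R d)) \<partial>lborel)"
    unfolding gaussian_fourier_scaled[OF d, symmetric]
    by (simp only: integral_scaleR_right mult_scaleR_right)
  also have "\<dots> = complex_of_real (\<integral>z. A z * (sqrt (2 * pi) ^ DIM('a) * gauss (z /\<^sub>R d)) \<partial>lborel)"
    by (simp only: integral_complex_of_real[symmetric] of_real_mult)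
  also have "(\<integral>z. A z * (sqrt (2 * pi) ^ DIM('a) * gauss (z /\<^sub>R d)) \<partial>lborel) =
      d ^ DIM('a) *\<^sub>R (\<integral>z. A (d *\<^sub>R z) * (sqrt (2 * pi) ^ DIM('a) * gauss ((d *\<^sub>R z) /\<^sub>R d)) \<partial>lborel)"
    by (rule lborel_integral_scale) (use d in simp_all)
  also have "(\<integral>z. A (d *\<^sub>R z) * (sqrt (2 * pi) ^ DIM('a) * gauss ((d *\<^sub>R z) /\<^sub>R d)) \<partial>lborel) =
      (\<integral>z. sqrt (2 * pi) ^ DIM('a) * (A (d *\<^sub>R z) * gauss z) \<partial>lborel)"
    using d by (intro Bochner_Integration.integral_cong refl) simp
  also have "\<dots> = sqrt (2 * pi) ^ DIM('a) * (\<integral>z. A (d *\<^sub>R z) * gauss z \<partial>lborel)" by simp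
  finally have "d ^ DIM('a) * (\<integral>\<xi>. gauss (d *\<^sub>R \<xi>) * (norm (raw_fourier u \<xi>))\<^sup>2 \<partial>lborel) =
     d ^ DIM('a) * (sqrt (2 * pi) ^ DIM('a) * (\<integral>z. A (d *\<^sub>R z) * gauss z \<partial>lborel))"
    by (simp only: real_scaleR_def scaleR_conv_of_real[where 'a=complex] of_real_mult[symmetric] of_real_eq_iff)
  then show "(\<integral>\<xi>. gauss (d *\<^sub>R \<xi>) * (norm (raw_fourier u \<xi>))\<^sup>2 \<partial>lborel) =
       sqrt (2 * pi) ^ DIM('a) * (\<integral>z. autocorr u (d *\<^sub>R z) * gauss z \<partial>lborel)"
    unfolding A_def by (rule mult_left_cancel[OF d0, THEN iffD1])
qed

text \<open>
  Remove the damping: as \<open>d\<close> decreases to \<open>0\<close>, the damped integrals increase to the full one,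
  while the averages of the autocorrelation tend to its value at \<open>0\<close>, the squared norm of \<open>u\<close>.
\<close>

theorem plancherel_raw_fourier:
  fixes u :: "'a::euclidean_space \<Rightarrow> real"
  assumes u: "integrable lborel u" and fin: "L2sq lborel u < top"
  shows "L2sq lborel (raw_fourier u) = ennreal ((2 * pi) ^ DIM('a)) * L2sq lborel u"
proof -
  have [measurable]: "u \<in> borel_measurable borel" using u by simp
  define d :: "nat \<Rightarrow> real" where "d j = 1 / real (Suc j)" for j
  have d: "d j > 0" for j by (simp add: d_def)
  have d0: "d \<longlonglongrightarrow> 0" unfolding d_def by (rule LIMSEQ_Suc[OF lim_1_over_n])
  let ?f = "\<lambda>j \<xi>. gauss (d j *\<^sub>R \<xi>) * (norm (raw_fourier u \<xi>))\<^sup>2"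
  have "(\<lambda>j. \<integral>z. autocorr u (d j *\<^sub>R z) * gauss z \<partial>lborel) \<longlonglongrightarrow> (\<integral>z. autocorr u 0 * gauss (z::'a) \<partial>lborel)"
  proof (rule integral_dominated_convergence[where w="\<lambda>z. (L2n lborel u)\<^sup>2 * gauss z"])
    show "integrable lborel (\<lambda>z::'a. (L2n lborel u)\<^sup>2 * gauss z)"
      using gauss_integral(1)[where 'a='a] by simp
    show "AE z in lborel. norm (autocorr u (d j *\<^sub>R z) * gauss z) \<le> (L2n lborel u)\<^sup>2 * gauss z" for j
      using autocorr_bound[OF _ fin] by (auto simp: abs_mult gauss_def)
    show "AE z in lborel. (\<lambda>j. autocorr u (d j *\<^sub>R z) * gauss z) \<longlonglongrightarrow> autocorr u 0 * gauss z"
    proof (rule AE_I2)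
      fix z :: 'a
      have "(\<lambda>j. d j *\<^sub>R z) \<longlonglongrightarrow> 0 *\<^sub>R z" by (intro tendsto_intros d0)
      then have "filterlim (\<lambda>j. d j *\<^sub>R z) (nhds 0) sequentially" by simp
      from filterlim_compose[OF autocorr_tendsto[OF _ fin] this]
      show "(\<lambda>j. autocorr u (d j *\<^sub>R z) * gauss z) \<longlonglongrightarrow> autocorr u 0 * gauss z"
        by (intro tendsto_mult tendsto_const) auto
    qed
  qed measurable
  then have "(\<lambda>j. sqrt (2 * pi) ^ DIM('a) * (\<integral>z. autocorr u (d j *\<^sub>R z) * gauss z \<partial>lborel))
      \<longlonglongrightarrow> sqrt (2 * pi) ^ DIM('a) * (autocorr u 0 * sqrt (2 * pi) ^ DIM('a))"
    by (intro tendsto_mult tendsto_const) (simp add: gauss_integral(2))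
  then have "(\<lambda>j. ennreal (\<integral>\<xi>. ?f j \<xi> \<partial>lborel)) \<longlonglongrightarrow> ennreal (sqrt (2 * pi) ^ DIM('a) * (autocorr u 0 * sqrt (2 * pi) ^ DIM('a)))"
    unfolding damped_energy(2)[OF u d] by (rule tendsto_ennrealI)
  also have "sqrt (2 * pi) ^ DIM('a) * (autocorr u 0 * sqrt (2 * pi) ^ DIM('a)) = (2 * pi) ^ DIM('a) * autocorr u 0"
  proof -
    have "sqrt (2 * pi) ^ DIM('a) * sqrt (2 * pi) ^ DIM('a) = (2 * pi) ^ DIM('a)"
      unfolding power_mult_distrib[symmetric] by simp
    then show ?thesis by (metis mult.assoc mult.commute)
  qed
  also have "ennreal \<dots> = ennreal ((2 * pi) ^ DIM('a)) * L2sq lborel u"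
    by (simp add: autocorr_0[OF _ fin] ennreal_mult')
  also have "(\<lambda>j. ennreal (\<integral>\<xi>. ?f j \<xi> \<partial>lborel)) = (\<lambda>j. \<integral>\<^sup>+\<xi>. ennreal (?f j \<xi>) \<partial>lborel)"
    by (intro ext nn_integral_eq_integral[symmetric] damped_energy(1)[OF u d]) (simp add: gauss_def)
  finally have L: "(\<lambda>j. \<integral>\<^sup>+\<xi>. ennreal (?f j \<xi>) \<partial>lborel) \<longlonglongrightarrow> ennreal ((2 * pi) ^ DIM('a)) * L2sq lborel u" .
  have "(\<lambda>j. \<integral>\<^sup>+\<xi>. ennreal (?f j \<xi>) \<partial>lborel) \<longlonglongrightarrow> (\<integral>\<^sup>+\<xi>. ennreal ((norm (raw_fourier u \<xi>))\<^sup>2) \<partial>lborel)"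
  proof (rule nn_integral_LIMSEQ)
    have "gauss (d j *\<^sub>R \<xi>) \<le> gauss (d (Suc j) *\<^sub>R \<xi>)" for j and \<xi> :: 'a
    proof -
      have "d (Suc j) * norm \<xi> \<le> d j * norm \<xi>"
        by (intro mult_right_mono) (auto simp: d_def field_simps)
      then have "(d (Suc j) * norm \<xi>)\<^sup>2 \<le> (d j * norm \<xi>)\<^sup>2" using d[of "Suc j"] by (intro power_mono) auto
      then show ?thesis using d[of j] d[of "Suc j"] by (simp add: gauss_def)
    qed
    then show "incseq (\<lambda>j \<xi>. ennreal (?f j \<xi>))"
      by (intro incseq_SucI le_funI ennreal_leI mult_right_mono) auto
    show "(\<lambda>j. ennreal (?f j \<xi>)) \<longlonglongrightarrow> ennreal ((norm (raw_fourier u \<xi>))\<^sup>2)" for \<xi>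
    proof -
      have "(\<lambda>j. ?f j \<xi>) \<longlonglongrightarrow> exp (- (norm (0 *\<^sub>R \<xi>))\<^sup>2 / 2) * (norm (raw_fourier u \<xi>))\<^sup>2"
        unfolding gauss_def by (intro tendsto_intros d0) auto
      then show ?thesis by (intro tendsto_ennrealI) simp
    qed
  qed measurable
  from LIMSEQ_unique[OF this L] show ?thesis by (simp add: L2sq_def)
qed

section \<open>The Fourier transform of square integrable functions\<close>

lemma L2sq_lebesgue: "L2sq lebesgue f = L2sq lborel f"
  unfolding L2sq_def by (rule nn_integral_completion)

lemma L2_fun_iff: "L2_fun u \<longleftrightarrow> u \<in> borel_measurable lebesgue \<and> L2sq lborel u < top"
proof -
  have "integrable lebesgue (\<lambda>x. (norm (u x))\<^sup>2) \<longleftrightarrow> L2sq lborel u < top"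
    if [measurable]: "u \<in> borel_measurable lebesgue"
  proof -
    have "integrable lebesgue (\<lambda>x. (norm (u x))\<^sup>2) \<longleftrightarrow> (\<integral>\<^sup>+x. ennreal (norm ((norm (u x))\<^sup>2)) \<partial>lebesgue) < \<infinity>"
      unfolding integrable_iff_bounded by simp
    also have "(\<integral>\<^sup>+x. ennreal (norm ((norm (u x))\<^sup>2)) \<partial>lebesgue) = L2sq lborel u"
      by (simp add: L2sq_def nn_integral_completion)
    finally show ?thesis by simp
  qed
  then show ?thesis unfolding L2_fun_def by auto
qed

lemma L2_norm_eq_L2n:
  assumes [measurable]: "u \<in> borel_measurable lebesgue"
  shows "L2_norm u = L2n lborel u"
proof -
  have "(\<integral>x. (norm (u x))\<^sup>2 \<partial>lebesgue) = enn2real (\<integral>\<^sup>+x. ennreal ((norm (u x))\<^sup>2) \<partial>lebesgue)"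
    by (rule integral_eq_nn_integral) auto
  then show ?thesis by (simp add: L2_norm_def L2n_def L2sq_def nn_integral_completion)
qed

lemma borel_representative:
  fixes u :: "real ^ 'n \<Rightarrow> real"
  assumes "u \<in> borel_measurable lebesgue"
  obtains v where "v \<in> borel_measurable borel" "AE x in lebesgue. u x = v x"
proof -
  obtain v where "v \<in> borel_measurable lborel" "AE x in lborel. u x = v x"
    using completion_ex_borel_measurable_real[OF assms] by auto
  then show ?thesis by (intro that[of v]) (auto simp: AE_completion)
qed

lemma borel_imp_lebesgue: "u \<in> borel_measurable borel \<Longrightarrow> u \<in> borel_measurable lebesgue"
  by (simp add: measurable_completion)

abbreviation trunc :: "real \<Rightarrow> (real ^ 'n \<Rightarrow> real) \<Rightarrow> real ^ 'n \<Rightarrow> real" where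
  "trunc R u \<equiv> (\<lambda>x. indicator (ball 0 R) x * u x)"

lemma is_fourier_transform_iff:
  "is_fourier_transform u w \<longleftrightarrow> w \<in> borel_measurable lebesgue \<and> L2sq lborel w < top \<and>
     ((\<lambda>R. L2sq lborel (\<lambda>\<xi>. fourier_integral (trunc R u) \<xi> - w \<xi>)) \<longlongrightarrow> 0) at_top"
  unfolding is_fourier_transform_def L2_fun_iff L2sq_def nn_integral_completion by simp

lemma fourier_integral_cong_AE:
  fixes u v :: "real ^ 'n \<Rightarrow> real"
  assumes "u \<in> borel_measurable lebesgue" "v \<in> borel_measurable lebesgue" "AE x in lebesgue. u x = v x"
  shows "fourier_integral u = fourier_integral v"
proof
  fix \<xi> :: "real ^ 'n"
  note [measurable] = assms(1,2)
  have c: "(\<lambda>x. cis (- (x \<bullet> \<xi>))) \<in> borel_measurable lebesgue"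
    by (rule borel_imp_lebesgue) measurable
  have "(\<integral>x. cis (- (x \<bullet> \<xi>)) * complex_of_real (u x) \<partial>lebesgue) = (\<integral>x. cis (- (x \<bullet> \<xi>)) * complex_of_real (v x) \<partial>lebesgue)"
    by (rule integral_cong_AE) (use c assms in auto)
  then show "fourier_integral u \<xi> = fourier_integral v \<xi>" by (simp add: fourier_integral_def)
qed

lemma trunc_lebesgue [measurable]:
  assumes "u \<in> borel_measurable lebesgue"
  shows "trunc R u \<in> borel_measurable lebesgue"
  by (intro borel_measurable_times assms borel_imp_lebesgue) measurable

text \<open>
  Fourier integrals do not change on null sets, so the predicate is literally the same for
  both functions, and so is the choice made in \<open>fourier_L2\<close>.
\<close>

lemma is_fourier_transform_cong_AE:
  assumes "u \<in> borel_measurable lebesgue" "v \<in> borel_measurable lebesgue" "AE x in lebesgue. u x = v x"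
  shows "is_fourier_transform u = is_fourier_transform v"
proof -
  have "fourier_integral (trunc R u) = fourier_integral (trunc R v)" for R
    by (rule fourier_integral_cong_AE) (use assms in auto)
  then show ?thesis unfolding is_fourier_transform_def[abs_def] by simp
qed

definition fourier_const :: "'n itself \<Rightarrow> real" where
  "fourier_const _ = (2 * pi) powr (- real CARD('n) / 2)"

lemma fourier_integral_raw_fourier:
  fixes u :: "real ^ 'n \<Rightarrow> real"
  assumes [measurable]: "u \<in> borel_measurable borel"
  shows "fourier_integral u \<xi> = fourier_const TYPE('n) *\<^sub>R raw_fourier u \<xi>"
  unfolding fourier_integral_def raw_fourier_def fourier_const_def by (subst integral_completion) auto

lemma fourier_integral_measurable [measurable]:
  fixes u :: "real ^ 'n \<Rightarrow> real"
  assumes [measurable]: "u \<in> borel_measurable borel"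
  shows "fourier_integral u \<in> borel_measurable borel"
  unfolding fourier_integral_raw_fourier[OF assms, abs_def] by measurable

lemma plancherel_L1:
  fixes u :: "real ^ 'n \<Rightarrow> real"
  assumes u: "integrable lborel u" and fin: "L2sq lborel u < top"
  shows "L2sq lborel (fourier_integral u) = L2sq lborel u"
proof -
  have [measurable]: "u \<in> borel_measurable borel" using u by simp
  have c: "(fourier_const TYPE('n))\<^sup>2 * (2 * pi) ^ CARD('n) = 1"
  proof -
    have "(2 * pi) ^ CARD('n) = (2 * pi) powr real CARD('n)"
      by (rule powr_realpow[symmetric]) simp
    then show ?thesis unfolding fourier_const_def power2_eq_square by (simp only: powr_add[symmetric]) simp
  qed
  have "L2sq lborel (fourier_integral u) = ennreal ((fourier_const TYPE('n))\<^sup>2) * L2sq lborel (raw_fourier u)"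
    unfolding fourier_integral_raw_fourier[OF \<open>u \<in> borel_measurable borel\<close>, abs_def]
    by (rule L2sq_scale) measurable
  also have "\<dots> = ennreal ((fourier_const TYPE('n))\<^sup>2 * (2 * pi) ^ CARD('n)) * L2sq lborel u"
    by (simp add: plancherel_raw_fourier[OF u fin] ennreal_mult' mult.assoc)
  finally show ?thesis unfolding c by simp
qed

lemma fourier_integral_diff:
  fixes u v :: "real ^ 'n \<Rightarrow> real"
  assumes "integrable lborel u" "integrable lborel v"
  shows "fourier_integral (\<lambda>x. u x - v x) \<xi> = fourier_integral u \<xi> - fourier_integral v \<xi>"
proof -
  have [measurable]: "u \<in> borel_measurable borel" "v \<in> borel_measurable borel" using assms by simp_all
  have "integrable lborel (\<lambda>x. cis (- (x \<bullet> \<xi>)) * complex_of_real (u x))"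
       "integrable lborel (\<lambda>x. cis (- (x \<bullet> \<xi>)) * complex_of_real (v x))"
    by (auto intro!: integrable_mult_cis assms)
  then show ?thesis
    by (simp add: fourier_integral_raw_fourier raw_fourier_def scaleR_diff_right[symmetric] right_diff_distrib)
qed

lemma fourier_integral_translate:
  fixes u :: "real ^ 'n \<Rightarrow> real"
  assumes [measurable]: "u \<in> borel_measurable borel"
  shows "fourier_integral (\<lambda>x. u (x + h)) \<xi> = cis (h \<bullet> \<xi>) * fourier_integral u \<xi>"
proof -
  have "raw_fourier (\<lambda>x. u (x + h)) \<xi> = (\<integral>x. cis (h \<bullet> \<xi>) * (cis (- ((x + h) \<bullet> \<xi>)) * complex_of_real (u (x + h))) \<partial>lborel)"
    unfolding raw_fourier_def by (simp add: mult.assoc[symmetric] cis_mult inner_add_left)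
  also have "\<dots> = cis (h \<bullet> \<xi>) * (\<integral>x. cis (- ((x + h) \<bullet> \<xi>)) * complex_of_real (u (x + h)) \<partial>lborel)"
    by (rule integral_mult_right_zero)
  also have "(\<integral>x. cis (- ((x + h) \<bullet> \<xi>)) * complex_of_real (u (x + h)) \<partial>lborel) = raw_fourier u \<xi>"
    unfolding raw_fourier_def by (rule lborel_integral_translate) measurable
  finally show ?thesis by (simp add: fourier_integral_raw_fourier)
qed

lemma trunc_props:
  fixes u :: "real ^ 'n \<Rightarrow> real"
  assumes [measurable]: "u \<in> borel_measurable borel" and fin: "L2sq lborel u < top"
  shows "integrable lborel (trunc R u)" and "L2sq lborel (trunc R u) < top"
    and "((\<lambda>R. L2sq lborel (\<lambda>x. trunc R u x - u x)) \<longlongrightarrow> 0) at_top"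
proof -
  have "L2sq lborel (indicator (ball 0 R) :: real ^ 'n \<Rightarrow> real) < top"
    by (rule L2sq_bounded_support[of _ 1 R]) (auto simp: indicator_def)
  then show "integrable lborel (trunc R u)"
    by (intro integrable_mult_L2 fin) auto
  have le: "L2sq lborel (trunc R u) \<le> L2sq lborel u" for R
    by (rule L2sq_mono_AE) (auto simp: indicator_def)
  then show "L2sq lborel (trunc R u) < top" using fin by (rule order_le_less_trans)
  show "((\<lambda>R. L2sq lborel (\<lambda>x. trunc R u x - u x)) \<longlongrightarrow> 0) at_top"
  proof (rule tendsto_at_topI_sequentially)
    fix X :: "nat \<Rightarrow> real" assume X: "filterlim X at_top sequentially"
    show "(\<lambda>n. L2sq lborel (\<lambda>x. trunc (X n) u x - u x)) \<longlonglongrightarrow> 0"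
    proof (rule L2sq_dominated_tendsto)
      show "AE x in lborel. (\<lambda>n. trunc (X n) u x) \<longlonglongrightarrow> u x"
      proof (rule AE_I2)
        fix x :: "real ^ 'n"
        have "\<forall>\<^sub>F n in sequentially. X n > norm x"
          using X by (simp add: filterlim_at_top_dense)
        then have "\<forall>\<^sub>F n in sequentially. trunc (X n) u x = u x"
          by eventually_elim simp
        then show "(\<lambda>n. trunc (X n) u x) \<longlonglongrightarrow> u x" by (rule tendsto_eventually)
      qed
      show "AE x in lborel. norm (trunc (X j) u x - u x) \<le> \<bar>u x\<bar>" for j
        by (rule AE_I2) (auto simp: indicator_def)
      show "L2sq lborel (\<lambda>x. \<bar>u x\<bar>) < top" using fin by (simp add: L2sq_def)
    qed auto
  qed
qed

lemma fourier_integral_trunc_diff: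
  fixes u :: "real ^ 'n \<Rightarrow> real"
  assumes um [measurable]: "u \<in> borel_measurable borel" and fin: "L2sq lborel u < top"
  shows "L2sq lborel (\<lambda>\<xi>. fourier_integral (trunc R u) \<xi> - fourier_integral (trunc S u) \<xi>)
     \<le> 2 * L2sq lborel (\<lambda>x. trunc R u x - u x) + 2 * L2sq lborel (\<lambda>x. trunc S u x - u x)"
proof -
  note t = trunc_props[OF um fin]
  have "L2sq lborel (\<lambda>\<xi>. fourier_integral (trunc R u) \<xi> - fourier_integral (trunc S u) \<xi>) =
        L2sq lborel (fourier_integral (\<lambda>x. trunc R u x - trunc S u x))"
    by (subst fourier_integral_diff[OF t(1) t(1), abs_def, symmetric]) simp
  also have "\<dots> = L2sq lborel (\<lambda>x. trunc R u x - trunc S u x)"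
    by (rule plancherel_L1) (intro Bochner_Integration.integrable_diff t L2sq_diff_finite; measurable)+
  also have "\<dots> = L2sq lborel (\<lambda>x. (trunc R u x - u x) - (trunc S u x - u x))" by simp
  also have "\<dots> \<le> 2 * L2sq lborel (\<lambda>x. trunc R u x - u x) + 2 * L2sq lborel (\<lambda>x. trunc S u x - u x)"
    by (rule L2sq_diff_le) measurable
  finally show ?thesis .
qed

lemma filterlim_nat_ceiling_at_top: "filterlim (\<lambda>R::real. nat \<lceil>R\<rceil>) at_top at_top"
  unfolding filterlim_at_top
proof
  fix Z :: nat
  show "\<forall>\<^sub>F R::real in at_top. Z \<le> nat \<lceil>R\<rceil>"
    using eventually_ge_at_top[of "real Z"] by eventually_elim linarith
qed

text \<open>
  By Plancherel's theorem the transforms of the truncations form a Cauchy sequence along the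
  integer radii. Convergence along all radii follows by comparing \<open>R\<close> with the next integer.
\<close>

lemma fourier_transform_exists:
  fixes u :: "real ^ 'n \<Rightarrow> real"
  assumes um [measurable]: "u \<in> borel_measurable borel" and fin: "L2sq lborel u < top"
  obtains w where "w \<in> borel_measurable borel" "is_fourier_transform u w"
proof -
  note t = trunc_props[OF um fin]
  let ?e = "\<lambda>R. L2sq lborel (\<lambda>x. trunc R u x - u x)"
  let ?F = "\<lambda>R. fourier_integral (trunc R u)"
  have en: "(\<lambda>n. ?e (real n)) \<longlonglongrightarrow> 0"
    by (rule filterlim_compose[OF t(3) filterlim_real_sequentially])
  have cauchy: "\<exists>K. \<forall>m\<ge>K. \<forall>n\<ge>K. L2sq lborel (\<lambda>\<xi>. ?F (real m) \<xi> - ?F (real n) \<xi>) \<le> ennreal e" if "e > 0" for e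
  proof -
    have "0 < ennreal (e/4)" using that by simp
    from order_tendstoD(2)[OF en this] obtain K where K: "\<And>n. n \<ge> K \<Longrightarrow> ?e (real n) < ennreal (e/4)"
      by (auto simp: eventually_sequentially)
    have "L2sq lborel (\<lambda>\<xi>. ?F (real m) \<xi> - ?F (real n) \<xi>) \<le> ennreal e" if "m \<ge> K" "n \<ge> K" for m n
    proof -
      have "L2sq lborel (\<lambda>\<xi>. ?F (real m) \<xi> - ?F (real n) \<xi>) \<le> 2 * ?e (real m) + 2 * ?e (real n)"
        by (rule fourier_integral_trunc_diff[OF um fin])
      also have "\<dots> \<le> 2 * ennreal (e/4) + 2 * ennreal (e/4)"
        using K[OF that(1)] K[OF that(2)] by (intro add_mono mult_left_mono) auto
      also have "\<dots> = ennreal e" using \<open>e > 0\<close>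
        by (simp add: ennreal_plus[symmetric] ennreal_numeral[symmetric] ennreal_mult'[symmetric] del: ennreal_plus ennreal_numeral)
      finally show ?thesis .
    qed
    then show ?thesis by blast
  qed
  have Fm: "\<And>n. ?F (real n) \<in> borel_measurable lborel" by simp
  obtain w r where w: "w \<in> borel_measurable lborel"
    and "strict_mono r" "AE x in lborel. (\<lambda>k. ?F (real (r k)) x) \<longlonglongrightarrow> w x"
    and wl: "(\<lambda>n. L2sq lborel (\<lambda>\<xi>. ?F (real n) \<xi> - w \<xi>)) \<longlonglongrightarrow> 0"
    by (rule L2_complete[OF Fm cauchy])
  have [measurable]: "w \<in> borel_measurable borel" using w by simp
  obtain n where "L2sq lborel (\<lambda>\<xi>. ?F (real n) \<xi> - w \<xi>) < 1"
    using order_tendstoD(2)[OF wl, of 1] by (auto simp: eventually_sequentially)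
  then have n: "L2sq lborel (\<lambda>\<xi>. ?F (real n) \<xi> - w \<xi>) < top" by (rule order_less_trans) simp
  have "L2sq lborel (\<lambda>\<xi>. ?F (real n) \<xi> - (?F (real n) \<xi> - w \<xi>)) < top"
    by (rule L2sq_diff_finite) (use n t in \<open>auto simp: plancherel_L1\<close>)
  then have wfin: "L2sq lborel w < top" by simp
  have lim: "((\<lambda>R. 2 * (2 * ?e R + 2 * ?e (real (nat \<lceil>R\<rceil>))) + 2 * L2sq lborel (\<lambda>\<xi>. ?F (real (nat \<lceil>R\<rceil>)) \<xi> - w \<xi>))
      \<longlongrightarrow> 2 * (2 * 0 + 2 * 0) + 2 * 0) at_top"
    by (intro tendsto_add ennreal_tendsto_cmult t(3) filterlim_compose[OF en filterlim_nat_ceiling_at_top]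
         filterlim_compose[OF wl filterlim_nat_ceiling_at_top]) auto
  have "((\<lambda>R. L2sq lborel (\<lambda>\<xi>. ?F R \<xi> - w \<xi>)) \<longlongrightarrow> 0) at_top"
  proof (rule tendsto_sandwich[OF _ _ tendsto_const lim[unfolded mult_zero_right add_0_right]])
    have "L2sq lborel (\<lambda>\<xi>. ?F R \<xi> - w \<xi>) \<le>
       2 * (2 * ?e R + 2 * ?e (real j)) + 2 * L2sq lborel (\<lambda>\<xi>. ?F (real j) \<xi> - w \<xi>)" for R j
    proof -
      have "L2sq lborel (\<lambda>\<xi>. ?F R \<xi> - w \<xi>) = L2sq lborel (\<lambda>\<xi>. (?F R \<xi> - ?F (real j) \<xi>) + (?F (real j) \<xi> - w \<xi>))" by simp
      also have "\<dots> \<le> 2 * L2sq lborel (\<lambda>\<xi>. ?F R \<xi> - ?F (real j) \<xi>) + 2 * L2sq lborel (\<lambda>\<xi>. ?F (real j) \<xi> - w \<xi>)"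
        by (rule L2sq_add_le) measurable
      also have "\<dots> \<le> 2 * (2 * ?e R + 2 * ?e (real j)) + 2 * L2sq lborel (\<lambda>\<xi>. ?F (real j) \<xi> - w \<xi>)"
        by (intro add_mono mult_left_mono fourier_integral_trunc_diff um fin) auto
      finally show ?thesis .
    qed
    then show "\<forall>\<^sub>F R in at_top. L2sq lborel (\<lambda>\<xi>. ?F R \<xi> - w \<xi>) \<le>
       2 * (2 * ?e R + 2 * ?e (real (nat \<lceil>R\<rceil>))) + 2 * L2sq lborel (\<lambda>\<xi>. ?F (real (nat \<lceil>R\<rceil>)) \<xi> - w \<xi>)" by simp
  qed auto
  then have "is_fourier_transform u w"
    unfolding is_fourier_transform_iff using wfin w by (simp add: borel_imp_lebesgue)
  then show ?thesis using w by (intro that[of w]) auto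
qed

lemma fourier_transform_unique:
  assumes um [measurable]: "u \<in> borel_measurable borel" and "is_fourier_transform u w" "is_fourier_transform u w'"
  shows "AE \<xi> in lebesgue. w \<xi> = w' \<xi>"
proof -
  let ?F = "\<lambda>R. fourier_integral (trunc R u)"
  have m [measurable]: "w \<in> borel_measurable lebesgue" "w' \<in> borel_measurable lebesgue"
    and Fm [measurable]: "\<And>R. ?F R \<in> borel_measurable lebesgue"
    using assms(2,3) by (auto simp: is_fourier_transform_iff intro!: borel_imp_lebesgue)
  have l: "((\<lambda>R. L2sq lebesgue (\<lambda>\<xi>. ?F R \<xi> - w \<xi>)) \<longlongrightarrow> 0) at_top" "((\<lambda>R. L2sq lebesgue (\<lambda>\<xi>. ?F R \<xi> - w' \<xi>)) \<longlongrightarrow> 0) at_top"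
    using assms(2,3) by (auto simp: is_fourier_transform_iff L2sq_lebesgue)
  have "((\<lambda>R. 2 * L2sq lebesgue (\<lambda>\<xi>. ?F R \<xi> - w \<xi>) + 2 * L2sq lebesgue (\<lambda>\<xi>. ?F R \<xi> - w' \<xi>)) \<longlongrightarrow> 2 * 0 + 2 * 0) at_top"
    by (intro tendsto_add ennreal_tendsto_cmult l) auto
  moreover have "L2sq lebesgue (\<lambda>\<xi>. w' \<xi> - w \<xi>) \<le> 2 * L2sq lebesgue (\<lambda>\<xi>. ?F R \<xi> - w \<xi>) + 2 * L2sq lebesgue (\<lambda>\<xi>. ?F R \<xi> - w' \<xi>)" for R
    using L2sq_diff_le[of "\<lambda>\<xi>. ?F R \<xi> - w \<xi>" lebesgue "\<lambda>\<xi>. ?F R \<xi> - w' \<xi>"] by simp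
  ultimately have "L2sq lebesgue (\<lambda>\<xi>. w' \<xi> - w \<xi>) \<le> 2 * 0 + 2 * 0"
    by (intro tendsto_le[OF trivial_limit_at_top_linorder _ tendsto_const]) auto
  then have "(\<integral>\<^sup>+\<xi>. ennreal ((norm (w' \<xi> - w \<xi>))\<^sup>2) \<partial>lebesgue) = 0" by (simp add: L2sq_def)
  then have "AE \<xi> in lebesgue. ennreal ((norm (w' \<xi> - w \<xi>))\<^sup>2) = 0"
    by (subst (asm) nn_integral_0_iff_AE) auto
  then show ?thesis by eventually_elim auto
qed


lemma fourier_transform_norm:
  fixes u :: "real ^ 'n \<Rightarrow> real"
  assumes um [measurable]: "u \<in> borel_measurable borel" and fin: "L2sq lborel u < top"
    and w: "is_fourier_transform u w"
  shows "L2sq lborel w = L2sq lborel u"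
proof -
  let ?F = "\<lambda>R. fourier_integral (trunc R u)"
  note t = trunc_props[OF um fin]
  have "((\<lambda>R. L2sq lebesgue (?F R)) \<longlongrightarrow> L2sq lebesgue w) at_top"
  proof (rule L2sq_tendsto)
    show "?F R \<in> borel_measurable lebesgue" for R by (rule borel_imp_lebesgue) measurable
  qed (use w in \<open>auto simp: is_fourier_transform_iff L2sq_lebesgue\<close>)
  moreover have "L2sq lebesgue (?F R) = L2sq lborel (trunc R u)" for R
    by (simp add: L2sq_lebesgue plancherel_L1 t)
  moreover have "((\<lambda>R. L2sq lborel (trunc R u)) \<longlongrightarrow> L2sq lborel u) at_top"
    by (rule L2sq_tendsto) (use t fin in auto)
  ultimately show ?thesis
    using tendsto_unique[OF trivial_limit_at_top_linorder] by (simp add: L2sq_lebesgue)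
qed

lemma norm_cis_diff_le: "norm (cis t - 1) \<le> 2"
  using norm_triangle_ineq4[of "cis t" 1] by simp

text \<open>
  For truncations this is Plancherel's theorem for the difference of two integrable functions,
  and both sides are continuous in the mean.
\<close>

lemma fourier_transform_translate_diff:
  fixes u :: "real ^ 'n \<Rightarrow> real"
  assumes um [measurable]: "u \<in> borel_measurable borel" and fin: "L2sq lborel u < top"
    and w: "is_fourier_transform u w"
  shows "L2sq lborel (\<lambda>x. u (x + h) - u x) = L2sq lborel (\<lambda>\<xi>. (cis (h \<bullet> \<xi>) - 1) * w \<xi>)"
proof -
  let ?F = "\<lambda>R. fourier_integral (trunc R u)"
  let ?v = "\<lambda>R x. trunc R u (x + h) - trunc R u x"
  note t = trunc_props[OF um fin]
  have wm [measurable]: "w \<in> borel_measurable lebesgue" and wfin: "L2sq lborel w < top"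
    and wl: "((\<lambda>R. L2sq lborel (\<lambda>\<xi>. ?F R \<xi> - w \<xi>)) \<longlongrightarrow> 0) at_top"
    using w by (auto simp: is_fourier_transform_iff)
  have Fm [measurable]: "?F R \<in> borel_measurable lebesgue" for R by (rule borel_imp_lebesgue) measurable
  have cm [measurable]: "(\<lambda>\<xi>. cis (h \<bullet> \<xi>) - 1) \<in> borel_measurable lebesgue" by (rule borel_imp_lebesgue) measurable
  have th: "integrable lborel (\<lambda>x. trunc R u (x + h))" "L2sq lborel (\<lambda>x. trunc R u (x + h)) < top" for R
    using lborel_integrable_translate[OF t(1)] L2sq_translate[of "trunc R u" h] t(2) by auto
  have "((\<lambda>R. L2sq lborel (?v R)) \<longlongrightarrow> L2sq lborel (\<lambda>x. u (x + h) - u x)) at_top"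
  proof (rule L2sq_tendsto)
    show "L2sq lborel (\<lambda>x. u (x + h) - u x) < top"
      by (rule L2sq_diff_finite) (auto simp: L2sq_translate fin)
    have lim: "((\<lambda>R. 2 * L2sq lborel (\<lambda>x. trunc R u x - u x) + 2 * L2sq lborel (\<lambda>x. trunc R u x - u x)) \<longlongrightarrow> 2 * 0 + 2 * 0) at_top"
      by (intro tendsto_add ennreal_tendsto_cmult t) auto
    show "((\<lambda>R. L2sq lborel (\<lambda>x. ?v R x - (u (x + h) - u x))) \<longlongrightarrow> 0) at_top"
    proof (rule tendsto_sandwich[OF _ _ tendsto_const lim[unfolded mult_zero_right add_0_right]])
      have "L2sq lborel (\<lambda>x. ?v R x - (u (x + h) - u x)) \<le> 2 * L2sq lborel (\<lambda>x. trunc R u x - u x) + 2 * L2sq lborel (\<lambda>x. trunc R u x - u x)" for R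
      proof -
        have "L2sq lborel (\<lambda>x. ?v R x - (u (x + h) - u x)) = L2sq lborel (\<lambda>x. (trunc R u (x + h) - u (x + h)) - (trunc R u x - u x))"
          by (simp add: algebra_simps)
        also have "\<dots> \<le> 2 * L2sq lborel (\<lambda>x. trunc R u (x + h) - u (x + h)) + 2 * L2sq lborel (\<lambda>x. trunc R u x - u x)"
          by (rule L2sq_diff_le) measurable
        also have "L2sq lborel (\<lambda>x. trunc R u (x + h) - u (x + h)) = L2sq lborel (\<lambda>x. trunc R u x - u x)"
          by (rule L2sq_translate[of "\<lambda>x. trunc R u x - u x"]) measurable
        finally show ?thesis .
      qed
      then show "\<forall>\<^sub>F R in at_top. L2sq lborel (\<lambda>x. ?v R x - (u (x + h) - u x)) \<le> 2 * L2sq lborel (\<lambda>x. trunc R u x - u x) + 2 * L2sq lborel (\<lambda>x. trunc R u x - u x)"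
        by simp
    qed auto
  qed auto
  moreover have "L2sq lborel (?v R) = L2sq lebesgue (\<lambda>\<xi>. (cis (h \<bullet> \<xi>) - 1) * ?F R \<xi>)" for R
  proof -
    have "L2sq lborel (?v R) = L2sq lborel (fourier_integral (?v R))"
      by (rule plancherel_L1[symmetric]) (use th t in \<open>auto intro!: L2sq_diff_finite\<close>)
    also have "fourier_integral (?v R) = (\<lambda>\<xi>. (cis (h \<bullet> \<xi>) - 1) * ?F R \<xi>)"
    proof
      fix \<xi>
      have "fourier_integral (?v R) \<xi> = fourier_integral (\<lambda>x. trunc R u (x + h)) \<xi> - ?F R \<xi>"
        by (rule fourier_integral_diff) (use th t in auto)
      also have "fourier_integral (\<lambda>x. trunc R u (x + h)) \<xi> = cis (h \<bullet> \<xi>) * ?F R \<xi>"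
        by (rule fourier_integral_translate) measurable
      finally show "fourier_integral (?v R) \<xi> = (cis (h \<bullet> \<xi>) - 1) * ?F R \<xi>" by (simp add: algebra_simps)
    qed
    finally show ?thesis by (simp add: L2sq_lebesgue)
  qed
  moreover have "((\<lambda>R. L2sq lebesgue (\<lambda>\<xi>. (cis (h \<bullet> \<xi>) - 1) * ?F R \<xi>)) \<longlongrightarrow> L2sq lebesgue (\<lambda>\<xi>. (cis (h \<bullet> \<xi>) - 1) * w \<xi>)) at_top"
  proof (rule L2sq_tendsto)
    have bd: "L2sq lebesgue (\<lambda>\<xi>. (cis (h \<bullet> \<xi>) - 1) * g \<xi>) \<le> 4 * L2sq lborel g" if "g \<in> borel_measurable lebesgue" for g :: "real ^ 'n \<Rightarrow> complex"
    proof -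
      have "L2sq lebesgue (\<lambda>\<xi>. (cis (h \<bullet> \<xi>) - 1) * g \<xi>) \<le> L2sq lebesgue (\<lambda>\<xi>. 2 *\<^sub>R g \<xi>)"
        by (rule L2sq_mono_AE) (auto simp: norm_mult norm_cis_diff_le intro!: mult_right_mono)
      also have "\<dots> = 4 * L2sq lborel g"
        using L2sq_scale[OF that, of 2] by (simp add: L2sq_lebesgue)
      finally show ?thesis .
    qed
    show "L2sq lebesgue (\<lambda>\<xi>. (cis (h \<bullet> \<xi>) - 1) * w \<xi>) < top"
      using bd[OF wm] wfin by (auto simp: ennreal_mult_less_top intro: order_le_less_trans)
    have lim: "((\<lambda>R. 4 * L2sq lborel (\<lambda>\<xi>. ?F R \<xi> - w \<xi>)) \<longlongrightarrow> 4 * 0) at_top"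
      by (intro ennreal_tendsto_cmult wl) auto
    show "((\<lambda>R. L2sq lebesgue (\<lambda>\<xi>. (cis (h \<bullet> \<xi>) - 1) * ?F R \<xi> - (cis (h \<bullet> \<xi>) - 1) * w \<xi>)) \<longlongrightarrow> 0) at_top"
    proof (rule tendsto_sandwich[OF _ _ tendsto_const lim[unfolded mult_zero_right add_0_right]])
      show "\<forall>\<^sub>F R in at_top. L2sq lebesgue (\<lambda>\<xi>. (cis (h \<bullet> \<xi>) - 1) * ?F R \<xi> - (cis (h \<bullet> \<xi>) - 1) * w \<xi>) \<le> 4 * L2sq lborel (\<lambda>\<xi>. ?F R \<xi> - w \<xi>)"
        unfolding right_diff_distrib[symmetric] by (intro always_eventually allI bd) measurable
    qed auto
  qed auto
  ultimately show ?thesis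
    using tendsto_unique[OF trivial_limit_at_top_linorder] by (simp add: L2sq_lebesgue)
qed

section \<open>The Gagliardo energy and the Sobolev norm\<close>

definition frac_kernel :: "real \<Rightarrow> real ^ 'n \<Rightarrow> real" where
  "frac_kernel a s = norm s powr (- (real CARD('n) + 2 * a))"

lemma frac_kernel_nonneg [simp]: "frac_kernel a s \<ge> 0" by (simp add: frac_kernel_def)

lemma frac_kernel_measurable [measurable]: "frac_kernel a \<in> borel_measurable borel"
  unfolding frac_kernel_def[abs_def] by measurable

lemma frac_kernel_minus [simp]: "frac_kernel a (- s) = frac_kernel a s" by (simp add: frac_kernel_def)

lemma frac_kernel_scale:
  assumes "r > 0"
  shows "frac_kernel a (r *\<^sub>R (s :: real ^ 'n)) = r powr (- (real CARD('n) + 2 * a)) * frac_kernel a s"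
  using assms by (simp add: frac_kernel_def powr_mult)

text \<open>
  The integrand is of order \<open>\<bar>s\<bar>\<^sup>2\<^sup>-\<^sup>n\<^sup>-\<^sup>2\<^sup>a\<close> near the origin and \<open>\<bar>s\<bar>\<^sup>-\<^sup>n\<^sup>-\<^sup>2\<^sup>a\<close> at infinity. On dyadic
  shells this gives two geometric series, convergent because of \<open>a < 1\<close> and \<open>0 < a\<close>,
  respectively.
\<close>

lemma frac_kernel_min_finite:
  assumes a: "0 < a" "a < 1"
  shows "(\<integral>\<^sup>+s. ennreal (frac_kernel a s * min 4 ((norm (s :: real ^ 'n))\<^sup>2)) \<partial>lborel) < top"
proof -
  define p where "p = real CARD('n) + 2 * a"
  define V where "V = unit_ball_vol (real CARD('n))"
  have V: "V \<ge> 0" unfolding V_def by simp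
  have p: "p > 0" using a by (simp add: p_def add_nonneg_pos)
  define A where "A j = 2 powr (real (Suc j) * p - 2 * real j)" for j :: nat
  define B where "B j = 4 * 2 powr (- real j * p)" for j :: nat
  let ?T = "\<lambda>j (s :: real ^ 'n). ennreal (A j) * indicator (ball 0 (2 powr (- real j))) s
      + ennreal (B j) * indicator (ball 0 (2 powr real (Suc j))) s"
  have pointwise: "ennreal (frac_kernel a s * min 4 ((norm s)\<^sup>2)) \<le> (\<Sum>j. ?T j s)" for s :: "real ^ 'n"
  proof (cases "s = 0")
    case False
    \<comment> \<open>The dyadic shell of \<open>s\<close>; negative \<open>m\<close> is the inside of the unit ball.\<close>
    define m where "m = \<lfloor>log 2 (norm s)\<rfloor>"
    have n0: "norm s > 0" using False by simp
    have "real_of_int m \<le> log 2 (norm s)" "log 2 (norm s) < real_of_int m + 1"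
      unfolding m_def by linarith+
    then have m: "2 powr real_of_int m \<le> norm s" "norm s < 2 powr (real_of_int m + 1)"
      using n0 by (simp_all add: le_log_iff log_less_iff)
    have kle: "frac_kernel a s \<le> 2 powr (- (real_of_int m * p))"
    proof -
      have "frac_kernel a s \<le> (2 powr real_of_int m) powr (- p)"
        unfolding frac_kernel_def p_def[symmetric] by (rule powr_mono2') (use p m in auto)
      then show ?thesis by (simp add: powr_powr)
    qed
    have "\<exists>j. ennreal (frac_kernel a s * min 4 ((norm s)\<^sup>2)) \<le> ?T j s"
    proof (cases "m < 0")
      case True
      define j where "j = nat (- m - 1)"
      have mj: "real_of_int m = - real (Suc j)" using True by (simp add: j_def)
      have "(norm s)\<^sup>2 \<le> (2 powr (- real j))\<^sup>2"
        using m(2) mj by (intro power_mono) auto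
      also have "\<dots> = 2 powr (- (2 * real j))" by (simp add: power2_eq_square flip: powr_add)
      finally have "frac_kernel a s * min 4 ((norm s)\<^sup>2) \<le> 2 powr (- (real_of_int m * p)) * 2 powr (- (2 * real j))"
        using kle by (intro mult_mono) auto
      also have "\<dots> = A j" by (simp add: A_def mj algebra_simps flip: powr_add)
      finally have "ennreal (frac_kernel a s * min 4 ((norm s)\<^sup>2)) \<le> ennreal (A j)" by (rule ennreal_leI)
      moreover have "s \<in> ball 0 (2 powr (- real j))" using m(2) mj by simp
      ultimately show ?thesis by (intro exI[of _ j]) (simp add: add_increasing2)
    next
      case False
      define j where "j = nat m"
      have mj: "real_of_int m = real j" using False by (simp add: j_def)
      have "frac_kernel a s * min 4 ((norm s)\<^sup>2) \<le> 2 powr (- (real_of_int m * p)) * 4"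
        using kle by (intro mult_mono) auto
      also have "\<dots> = B j" by (simp add: B_def mj)
      finally have "ennreal (frac_kernel a s * min 4 ((norm s)\<^sup>2)) \<le> ennreal (B j)" by (rule ennreal_leI)
      moreover have "s \<in> ball 0 (2 powr real (Suc j))" using m(2) mj by (simp add: add.commute)
      ultimately show ?thesis by (intro exI[of _ j]) (simp add: add_increasing)
    qed
    then obtain j where "ennreal (frac_kernel a s * min 4 ((norm s)\<^sup>2)) \<le> ?T j s" ..
    also have "?T j s \<le> (\<Sum>j. ?T j s)"
      using sum_le_suminf[of "\<lambda>j. ?T j s" "{j}"] by simp
    finally show ?thesis .
  qed simp
  define q1 q2 where "q1 = 2 powr (- (2 - 2 * a))" and "q2 = 2 powr (- (2 * a))"
  have q: "0 \<le> q1" "q1 < 1" "0 \<le> q2" "q2 < 1"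
    unfolding q1_def q2_def using a by (simp_all add: powr_less_one)
  have ball: "emeasure lborel (ball (0 :: real ^ 'n) r) = ennreal (V * r ^ CARD('n))" if "r \<ge> 0" for r
    using emeasure_ball[of r "0 :: real ^ 'n"] that by (simp add: V_def)
  have "(\<integral>\<^sup>+s. ennreal (frac_kernel a s * min 4 ((norm (s :: real ^ 'n))\<^sup>2)) \<partial>lborel) \<le> (\<integral>\<^sup>+s. (\<Sum>j. ?T j s) \<partial>lborel)"
    by (rule nn_integral_mono) (rule pointwise)
  also have "\<dots> = (\<Sum>j. \<integral>\<^sup>+s. ?T j s \<partial>lborel)"
    by (rule nn_integral_suminf) measurable
  also have "\<dots> = (\<Sum>j. ennreal (V * (2 powr p * q1 ^ j + 4 * 2 ^ CARD('n) * q2 ^ j)))"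
  proof (rule suminf_cong)
    fix j
    have "(\<integral>\<^sup>+s. ?T j s \<partial>lborel) = ennreal (A j) * emeasure lborel (ball (0 :: real ^ 'n) (2 powr (- real j)))
        + ennreal (B j) * emeasure lborel (ball (0 :: real ^ 'n) (2 powr real (Suc j)))"
      by (subst nn_integral_add) (auto simp: nn_integral_cmult_indicator)
    also have "\<dots> = ennreal (A j * (V * (2 powr (- real j)) ^ CARD('n)) + B j * (V * (2 powr real (Suc j)) ^ CARD('n)))"
      using V by (subst (1 2) ball) (auto simp: A_def B_def ennreal_mult' ennreal_plus)
    also have "A j * (V * (2 powr (- real j)) ^ CARD('n)) = V * (2 powr p * q1 ^ j)"
    proof -
      have "A j * (2 powr (- real j)) ^ CARD('n) = 2 powr (real (Suc j) * p - 2 * real j + real CARD('n) * (- real j))"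
        unfolding A_def by (simp add: powr_power powr_add powr_diff powr_minus field_simps)
      also have "real (Suc j) * p - 2 * real j + real CARD('n) * (- real j) = p + real j * (- (2 - 2 * a))"
        by (simp add: p_def algebra_simps)
      also have "2 powr \<dots> = 2 powr p * q1 ^ j"
        unfolding q1_def by (simp add: powr_add powr_power mult.commute)
      finally show ?thesis by (simp add: algebra_simps)
    qed
    also have "B j * (V * (2 powr real (Suc j)) ^ CARD('n)) = V * (4 * 2 ^ CARD('n) * q2 ^ j)"
    proof -
      have "2 powr (- real j * p) * (2 powr real (Suc j)) ^ CARD('n) = 2 powr (- real j * p + real CARD('n) * real (Suc j))"
        by (simp only: powr_add powr_power)
      also have "- real j * p + real CARD('n) * real (Suc j) = real CARD('n) + real j * (- (2 * a))"
        by (simp add: p_def algebra_simps)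
      also have "2 powr \<dots> = 2 ^ CARD('n) * q2 ^ j"
        unfolding q2_def by (simp only: powr_add powr_power) (simp add: mult.commute powr_realpow)
      finally have "2 powr (- real j * p) * (2 powr real (Suc j)) ^ CARD('n) = 2 ^ CARD('n) * q2 ^ j" .
      then show ?thesis unfolding B_def by (simp add: algebra_simps)
    qed
    finally show "(\<integral>\<^sup>+s. ?T j s \<partial>lborel) = ennreal (V * (2 powr p * q1 ^ j + 4 * 2 ^ CARD('n) * q2 ^ j))"
      by (simp add: algebra_simps)
  qed
  also have "\<dots> = ennreal (\<Sum>j. V * (2 powr p * q1 ^ j + 4 * 2 ^ CARD('n) * q2 ^ j))"
    by (rule suminf_ennreal2) (use q V in \<open>auto intro!: summable_mult summable_add summable_geometric\<close>)
  also have "\<dots> < top" by simp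
  finally show ?thesis .
qed

lemma nn_integral_lborel_scale:
  fixes f :: "'a::euclidean_space \<Rightarrow> ennreal"
  assumes f [measurable]: "f \<in> borel_measurable borel" and c: "c > 0"
  shows "(\<integral>\<^sup>+x. f x \<partial>lborel) = ennreal (c ^ DIM('a)) * (\<integral>\<^sup>+x. f (c *\<^sub>R x) \<partial>lborel)"
proof -
  have "(\<integral>\<^sup>+x. f x \<partial>lborel) = (\<integral>\<^sup>+x. f x \<partial>density (distr lborel borel (\<lambda>x. 0 + c *\<^sub>R x)) (\<lambda>_. \<bar>c\<bar>^DIM('a)))"
    using lborel_affine[of c "0::'a"] c by simp
  also have "\<dots> = (\<integral>\<^sup>+x. ennreal (\<bar>c\<bar>^DIM('a)) * f (c *\<^sub>R x) \<partial>lborel)"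
    by (subst nn_integral_density) (auto simp: nn_integral_distr)
  finally show ?thesis using c by (simp add: nn_integral_cmult)
qed

text \<open>
  The Fourier multiplier of the Gagliardo energy, see \<open>gagliardo_fourier\<close>; up to a constant it
  is \<open>\<bar>\<xi>\<bar>\<^sup>2\<^sup>a\<close>, but two-sided bounds are enough for the equivalence of norms.
\<close>

definition frac_symbol :: "real \<Rightarrow> real ^ 'n \<Rightarrow> ennreal" where
  "frac_symbol a \<xi> = (\<integral>\<^sup>+s. ennreal (frac_kernel a s * (norm (cis (s \<bullet> \<xi>) - 1))\<^sup>2) \<partial>lborel)"

lemma frac_symbol_0: "frac_symbol a 0 = 0"
  by (simp add: frac_symbol_def)

text \<open>
  Substitute \<open>s / \<bar>\<xi>\<bar>\<close> for \<open>s\<close>.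
\<close>

lemma frac_symbol_scale:
  fixes \<xi> :: "real ^ 'n"
  assumes "\<xi> \<noteq> 0"
  shows "frac_symbol a \<xi> = ennreal (norm \<xi> powr (2 * a)) * frac_symbol a (sgn \<xi>)"
proof -
  define r where "r = 1 / norm \<xi>"
  have r: "r > 0" using assms by (simp add: r_def)
  have e: "(r *\<^sub>R s) \<bullet> \<xi> = s \<bullet> sgn \<xi>" for s by (simp add: r_def sgn_div_norm inverse_eq_divide)
  have "frac_symbol a \<xi> = ennreal (r ^ CARD('n)) * (\<integral>\<^sup>+s. ennreal (frac_kernel a (r *\<^sub>R s) * (norm (cis ((r *\<^sub>R s) \<bullet> \<xi>) - 1))\<^sup>2) \<partial>lborel)"
    unfolding frac_symbol_def by (subst nn_integral_lborel_scale[OF _ r]) auto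
  also have "(\<integral>\<^sup>+s. ennreal (frac_kernel a (r *\<^sub>R s) * (norm (cis ((r *\<^sub>R s) \<bullet> \<xi>) - 1))\<^sup>2) \<partial>lborel)
     = ennreal (r powr (- (real CARD('n) + 2 * a))) * frac_symbol a (sgn \<xi>)"
    unfolding frac_symbol_def e frac_kernel_scale[OF r]
    by (subst nn_integral_cmult[symmetric]) (auto simp: ennreal_mult'[symmetric] mult.assoc)
  also have "ennreal (r ^ CARD('n)) * (ennreal (r powr (- (real CARD('n) + 2 * a))) * frac_symbol a (sgn \<xi>)) =
     ennreal (r ^ CARD('n) * r powr (- (real CARD('n) + 2 * a))) * frac_symbol a (sgn \<xi>)"
    using r by (simp add: ennreal_mult' mult.assoc)
  also have "r ^ CARD('n) * r powr (- (real CARD('n) + 2 * a)) = r powr (- 2 * a)"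
    using r by (simp flip: powr_realpow powr_add)
  also have "\<dots> = norm \<xi> powr (2 * a)" using assms by (simp add: r_def powr_divide powr_minus_divide)
  finally show ?thesis .
qed

lemma norm_cis_minus_1_sq: "(norm (cis t - 1))\<^sup>2 = 2 - 2 * cos t"
  by (simp add: cmod_power2 power2_diff)

lemma norm_cis_minus_1_le: "(norm (cis t - 1))\<^sup>2 \<le> t\<^sup>2"
proof -
  have "2 - 2 * cos t = (2 * sin (t/2))\<^sup>2"
    using cos_double_sin[of "t/2"] by (simp add: power_mult_distrib)
  also have "\<dots> \<le> t\<^sup>2"
    using abs_sin_x_le_abs_x[of "t/2"] by (intro abs_le_square_iff[THEN iffD1]) auto
  finally show ?thesis by (simp add: norm_cis_minus_1_sq)
qed

text \<open>
  By homogeneity it is enough to consider a unit vector \<open>e\<close>. The upper bound uses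
  \<open>\<bar>cis t - 1\<bar> \<le> min 2 \<bar>t\<bar>\<close>. For the lower bound it suffices to integrate over the ball of
  radius \<open>1/2\<close> about \<open>e\<close>, where the phase \<open>s \<bullet> e\<close> stays between \<open>1/2\<close> and \<open>3/2\<close>.
\<close>

lemma frac_symbol_bounds:
  assumes a: "0 < a" "a < 1"
  obtains c C where "0 < c" "0 < C"
    "\<And>\<xi> :: real ^ 'n. ennreal (c * norm \<xi> powr (2 * a)) \<le> frac_symbol a \<xi>"
    "\<And>\<xi> :: real ^ 'n. frac_symbol a \<xi> \<le> ennreal (C * norm \<xi> powr (2 * a))"
proof -
  define K where "K = enn2real (\<integral>\<^sup>+s. ennreal (frac_kernel a s * min 4 ((norm (s :: real ^ 'n))\<^sup>2)) \<partial>lborel)"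
  have K: "(\<integral>\<^sup>+s. ennreal (frac_kernel a s * min 4 ((norm (s :: real ^ 'n))\<^sup>2)) \<partial>lborel) = ennreal K"
    unfolding K_def using frac_kernel_min_finite[OF a, where 'n='n] by simp
  have K0: "K \<ge> 0" by (simp add: K_def)
  define p where "p = real CARD('n) + 2 * a"
  define V where "V = unit_ball_vol (real CARD('n)) * (1/2) ^ CARD('n)"
  \<comment> \<open>The smallest value of the kernel, the smallest value of the phase factor, and the volume of the ball.\<close>
  define c where "c = (3/2) powr (- p) * (2 - 2 * cos (1/2)) * V"
  have cos1: "cos (1/2 :: real) < 1"
    using cos_monotone_0_pi[of 0 "1/2"] pi_gt3 by simp
  have c: "c > 0" unfolding c_def V_def using cos1 by simp
  have up: "frac_symbol a e \<le> ennreal K" if "norm e = 1" for e :: "real ^ 'n"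
    unfolding frac_symbol_def K[symmetric]
  proof (intro nn_integral_mono ennreal_leI mult_left_mono)
    fix s :: "real ^ 'n"
    have "(norm (cis (s \<bullet> e) - 1))\<^sup>2 \<le> 2\<^sup>2" using norm_cis_diff_le by (intro power_mono) auto
    then have 1: "(norm (cis (s \<bullet> e) - 1))\<^sup>2 \<le> 4" by simp
    have 2: "(s \<bullet> e)\<^sup>2 \<le> (norm s)\<^sup>2"
      using Cauchy_Schwarz_ineq2[of s e] that by (intro abs_le_square_iff[THEN iffD1]) auto
    show "(norm (cis (s \<bullet> e) - 1))\<^sup>2 \<le> min 4 ((norm s)\<^sup>2)"
      by (rule min.boundedI[OF 1 order_trans[OF norm_cis_minus_1_le 2]])
  qed auto
  have low: "ennreal c \<le> frac_symbol a e" if e: "norm e = 1" for e :: "real ^ 'n"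
  proof -
    have "ennreal c = (\<integral>\<^sup>+s. ennreal ((3/2) powr (- p) * (2 - 2 * cos (1/2))) * indicator (ball e (1/2)) s \<partial>lborel)"
      using emeasure_ball[of "1/2" e] cos1
      by (simp add: nn_integral_cmult_indicator V_def c_def ennreal_mult'[symmetric])
    also have "\<dots> \<le> frac_symbol a e"
      unfolding frac_symbol_def
    proof (rule nn_integral_mono)
      fix s :: "real ^ 'n"
      show "ennreal ((3/2) powr (- p) * (2 - 2 * cos (1/2))) * indicator (ball e (1/2)) s \<le> ennreal (frac_kernel a s * (norm (cis (s \<bullet> e) - 1))\<^sup>2)"
      proof (cases "s \<in> ball e (1/2)")
        case True
        then have d: "norm (s - e) < 1/2" by (simp add: dist_norm norm_minus_commute)
        have "norm s \<le> 3/2" using norm_triangle_ineq2[of s e] d e by simp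
        moreover have "s \<noteq> 0" using d e by auto
        ultimately have k: "(3/2) powr (- p) \<le> frac_kernel a s"
          unfolding frac_kernel_def p_def[symmetric] using a by (intro powr_mono2') (auto simp: p_def)
        have ee: "e \<bullet> e = 1" using e by (simp add: dot_square_norm)
        have "\<bar>(s - e) \<bullet> e\<bar> < 1/2" using Cauchy_Schwarz_ineq2[of "s - e" e] d e by simp
        then have "1/2 \<le> s \<bullet> e" "s \<bullet> e \<le> 3/2" unfolding inner_diff_left ee by linarith+
        then have "cos (s \<bullet> e) \<le> cos (1/2)" using pi_gt3 by (intro cos_monotone_0_pi_le) auto
        then have "2 - 2 * cos (1/2) \<le> (norm (cis (s \<bullet> e) - 1))\<^sup>2" by (simp add: norm_cis_minus_1_sq)
        then show ?thesis using True k cos1 by (auto intro!: ennreal_leI mult_mono)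
      qed simp
    qed
    finally show ?thesis .
  qed
  have "ennreal (c * norm \<xi> powr (2 * a)) \<le> frac_symbol a \<xi> \<and> frac_symbol a \<xi> \<le> ennreal ((K + 1) * norm \<xi> powr (2 * a))" for \<xi> :: "real ^ 'n"
  proof (cases "\<xi> = 0")
    case False
    then have e: "norm (sgn \<xi>) = 1" by (simp add: norm_sgn)
    have "frac_symbol a (sgn \<xi>) \<le> ennreal (K + 1)" using up[OF e] by (rule order_trans) (simp add: ennreal_leI)
    then show ?thesis
      unfolding frac_symbol_scale[OF False] using low[OF e] K0 c
      by (auto simp: ennreal_mult' mult.commute intro!: mult_right_mono)
  qed (simp add: frac_symbol_0)
  then show ?thesis using c K0 by (intro that[of c "K + 1"]) auto
qed

lemma japanese_bracket_powr_bounds: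
  assumes a: "0 < a" "a < 1"
  shows "(japanese_bracket \<xi> powr a)\<^sup>2 \<le> 2 * (1 + norm \<xi> powr (2 * a))"
    and "1 + norm \<xi> powr (2 * a) \<le> 2 * (japanese_bracket \<xi> powr a)\<^sup>2"
proof -
  have eq: "(japanese_bracket \<xi> powr a)\<^sup>2 = (1 + (norm \<xi>)\<^sup>2) powr a"
  proof -
    have "japanese_bracket \<xi> powr a = ((1 + (norm \<xi>)\<^sup>2) powr (1/2)) powr a"
      by (simp add: japanese_bracket_def powr_half_sqrt)
    then show ?thesis by (simp add: powr_powr power2_eq_square flip: powr_add)
  qed
  have n2: "((norm \<xi>)\<^sup>2) powr a = norm \<xi> powr (2 * a)"
    by (simp add: powr_powr flip: powr_numeral)
  have "(1 + (norm \<xi>)\<^sup>2) powr a \<le> (2 * max 1 ((norm \<xi>)\<^sup>2)) powr a"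
    using a by (intro powr_mono2) auto
  also have "\<dots> = 2 powr a * max 1 ((norm \<xi>)\<^sup>2) powr a" by (rule powr_mult)
  also have "\<dots> \<le> 2 * (1 + norm \<xi> powr (2 * a))"
  proof (rule mult_mono)
    show "2 powr a \<le> (2::real)" using a powr_mono[of a 1 2] by simp
    show "max 1 ((norm \<xi>)\<^sup>2) powr a \<le> 1 + norm \<xi> powr (2 * a)"
      unfolding n2[symmetric] by (simp add: max_def)
  qed auto
  finally show "(japanese_bracket \<xi> powr a)\<^sup>2 \<le> 2 * (1 + norm \<xi> powr (2 * a))" by (simp add: eq)
  have "1 \<le> (1 + (norm \<xi>)\<^sup>2) powr a" using a by (intro ge_one_powr_ge_zero) auto
  moreover have "norm \<xi> powr (2 * a) \<le> (1 + (norm \<xi>)\<^sup>2) powr a"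
    unfolding n2[symmetric] using a by (intro powr_mono2) auto
  ultimately show "1 + norm \<xi> powr (2 * a) \<le> 2 * (japanese_bracket \<xi> powr a)\<^sup>2" by (simp add: eq)
qed

text \<open>
  The Gagliardo energy with the increment as the outer variable. In this form it interacts
  directly with translations, with operations commuting with them, and with Plancherel's
  theorem; \<open>double_integral_eq_gagliardo\<close> is the usual double integral.
\<close>

definition gagliardo :: "real \<Rightarrow> (real ^ 'n \<Rightarrow> real) \<Rightarrow> ennreal" where
  "gagliardo a u = (\<integral>\<^sup>+s. ennreal (frac_kernel a s) * L2sq lborel (\<lambda>x. u (x + s) - u x) \<partial>lborel)"

lemma AE_lborel_translate:
  assumes "AE x in lborel. P x"
  shows "AE x in lborel. P (x + (s :: 'a::euclidean_space))"
proof -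
  have "AE x in distr lborel borel ((+) s). P x" using assms by (simp only: lborel_distr_plus)
  from AE_distrD[OF _ this] show ?thesis by (simp add: add.commute)
qed

lemma gagliardo_cong_AE:
  assumes "AE x in lebesgue. u x = v x"
  shows "gagliardo a u = gagliardo a v"
proof -
  have 1: "AE x in lborel. u x = v x" using assms by (simp add: AE_completion_iff)
  have "L2sq lborel (\<lambda>x. u (x + s) - u x) = L2sq lborel (\<lambda>x. v (x + s) - v x)" for s
    by (rule L2sq_cong_AE) (use 1 AE_lborel_translate[OF 1, of s] in auto)
  then show ?thesis by (simp add: gagliardo_def)
qed

lemma gagliardo_fourier:
  fixes u :: "real ^ 'n \<Rightarrow> real"
  assumes um [measurable]: "u \<in> borel_measurable borel" and fin: "L2sq lborel u < top"
    and w [measurable]: "w \<in> borel_measurable borel" and ft: "is_fourier_transform u w"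
  shows "gagliardo a u = (\<integral>\<^sup>+\<xi>. ennreal ((norm (w \<xi>))\<^sup>2) * frac_symbol a \<xi> \<partial>lborel)"
proof -
  have "gagliardo a u = (\<integral>\<^sup>+s. \<integral>\<^sup>+\<xi>. ennreal ((norm (w \<xi>))\<^sup>2) * ennreal (frac_kernel a s * (norm (cis (s \<bullet> \<xi>) - 1))\<^sup>2) \<partial>lborel \<partial>lborel)"
    unfolding gagliardo_def
  proof (rule nn_integral_cong)
    fix s :: "real ^ 'n"
    have "ennreal (frac_kernel a s) * L2sq lborel (\<lambda>x. u (x + s) - u x) =
       ennreal (frac_kernel a s) * (\<integral>\<^sup>+\<xi>. ennreal ((norm ((cis (s \<bullet> \<xi>) - 1) * w \<xi>))\<^sup>2) \<partial>lborel)"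
      unfolding fourier_transform_translate_diff[OF um fin ft] by (simp only: L2sq_def)
    also have "\<dots> = (\<integral>\<^sup>+\<xi>. ennreal (frac_kernel a s) * ennreal ((norm ((cis (s \<bullet> \<xi>) - 1) * w \<xi>))\<^sup>2) \<partial>lborel)"
      by (rule nn_integral_cmult[symmetric]) measurable
    also have "\<dots> = (\<integral>\<^sup>+\<xi>. ennreal ((norm (w \<xi>))\<^sup>2) * ennreal (frac_kernel a s * (norm (cis (s \<bullet> \<xi>) - 1))\<^sup>2) \<partial>lborel)"
      by (intro nn_integral_cong) (simp add: norm_mult power_mult_distrib mult_ac flip: ennreal_mult')
    finally show "ennreal (frac_kernel a s) * L2sq lborel (\<lambda>x. u (x + s) - u x) = \<dots>" .
  qed
  also have "\<dots> = (\<integral>\<^sup>+\<xi>. \<integral>\<^sup>+s. ennreal ((norm (w \<xi>))\<^sup>2) * ennreal (frac_kernel a s * (norm (cis (s \<bullet> \<xi>) - 1))\<^sup>2) \<partial>lborel \<partial>lborel)"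
    by (rule lborel_pair.Fubini') measurable
  also have "\<dots> = (\<integral>\<^sup>+\<xi>. ennreal ((norm (w \<xi>))\<^sup>2) * frac_symbol a \<xi> \<partial>lborel)"
    unfolding frac_symbol_def by (subst nn_integral_cmult) auto
  finally show ?thesis .
qed


lemma nn_integral_mult_sandwich:
  fixes f g h :: "'a \<Rightarrow> ennreal"
  assumes [measurable]: "f \<in> borel_measurable M" "g \<in> borel_measurable M"
    and "\<And>x. h x \<le> c * g x"
  shows "(\<integral>\<^sup>+x. f x * h x \<partial>M) \<le> c * (\<integral>\<^sup>+x. f x * g x \<partial>M)"
proof -
  have "(\<integral>\<^sup>+x. f x * h x \<partial>M) \<le> (\<integral>\<^sup>+x. c * (f x * g x) \<partial>M)"
    by (rule nn_integral_mono) (metis assms(3) mult.left_commute mult_left_mono zero_le)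
  also have "\<dots> = c * (\<integral>\<^sup>+x. f x * g x \<partial>M)" by (rule nn_integral_cmult) measurable
  finally show ?thesis .
qed

lemma frac_symbol_measurable [measurable]: "frac_symbol a \<in> borel_measurable (borel :: (real ^ 'n) measure)"
proof -
  have "frac_symbol a \<in> borel_measurable (lborel :: (real ^ 'n) measure)"
    unfolding frac_symbol_def[abs_def] by measurable
  then show ?thesis by simp
qed

lemma japanese_bracket_measurable [measurable]: "japanese_bracket \<in> borel_measurable borel"
  unfolding japanese_bracket_def[abs_def] by measurable

text \<open>
  Both quantities are integrals of the squared modulus of the same Fourier transform, with
  comparable weights. This is the only link between the norm and the energy that the rest of
  the development uses.
\<close>

lemma sobolev_energy:
  assumes a: "0 < a" "a < 1"
  obtains C where "C > 0"
    "\<And>u :: real ^ 'n \<Rightarrow> real. u \<in> sobolev a \<longleftrightarrow> L2_fun u \<and> gagliardo a u < top"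
    "\<And>u :: real ^ 'n \<Rightarrow> real. u \<in> sobolev a \<Longrightarrow> L2sq lborel u + gagliardo a u \<le> ennreal (C * (sobolev_norm a u)\<^sup>2)"
    "\<And>u :: real ^ 'n \<Rightarrow> real. u \<in> sobolev a \<Longrightarrow> ennreal ((sobolev_norm a u)\<^sup>2) \<le> ennreal C * (L2sq lborel u + gagliardo a u)"
proof -
  obtain c C where cC: "0 < c" "0 < C"
    "\<And>\<xi> :: real ^ 'n. ennreal (c * norm \<xi> powr (2 * a)) \<le> frac_symbol a \<xi>"
    "\<And>\<xi> :: real ^ 'n. frac_symbol a \<xi> \<le> ennreal (C * norm \<xi> powr (2 * a))"
    using frac_symbol_bounds[OF a, where 'n='n] by metis
  \<comment> \<open>The two terms serve the two directions of the comparison of the weights.\<close>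
  define D where "D = max (2 * max 1 C) (2 * max 1 (1/c))"
  have D: "D > 0" unfolding D_def by simp
  have up: "1 + frac_symbol a \<xi> \<le> ennreal D * ennreal ((japanese_bracket \<xi> powr a)\<^sup>2)" for \<xi> :: "real ^ 'n"
  proof -
    have "1 + frac_symbol a \<xi> \<le> ennreal 1 + ennreal (C * norm \<xi> powr (2 * a))"
      using cC(4) by (intro add_mono) auto
    also have "\<dots> = ennreal (1 + C * norm \<xi> powr (2 * a))" using cC(2) by (simp add: ennreal_plus)
    also have "1 + C * norm \<xi> powr (2 * a) \<le> max 1 C * 1 + max 1 C * norm \<xi> powr (2 * a)"
      by (intro add_mono mult_right_mono) auto
    also have "\<dots> = max 1 C * (1 + norm \<xi> powr (2 * a))" by (simp add: distrib_left)
    also have "\<dots> \<le> max 1 C * (2 * (japanese_bracket \<xi> powr a)\<^sup>2)"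
      by (intro mult_left_mono japanese_bracket_powr_bounds(2) a) auto
    also have "\<dots> = (2 * max 1 C) * (japanese_bracket \<xi> powr a)\<^sup>2" by simp
    also have "\<dots> \<le> D * (japanese_bracket \<xi> powr a)\<^sup>2"
      by (intro mult_right_mono) (auto simp: D_def)
    finally show ?thesis using D by (simp add: ennreal_mult' ennreal_leI)
  qed
  have low: "ennreal ((japanese_bracket \<xi> powr a)\<^sup>2) \<le> ennreal D * (1 + frac_symbol a \<xi>)" for \<xi> :: "real ^ 'n"
  proof -
    have "norm \<xi> powr (2 * a) = (1/c) * (c * norm \<xi> powr (2 * a))" using cC(1) by simp
    also have "\<dots> \<le> max 1 (1/c) * (c * norm \<xi> powr (2 * a))"
      using cC(1) by (intro mult_right_mono) auto
    finally have "1 + norm \<xi> powr (2 * a) \<le> max 1 (1/c) * (1 + c * norm \<xi> powr (2 * a))"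
      by (simp add: distrib_left)
    then have "2 * (1 + norm \<xi> powr (2 * a)) \<le> 2 * (max 1 (1/c) * (1 + c * norm \<xi> powr (2 * a)))"
      by (rule mult_left_mono) simp
    with japanese_bracket_powr_bounds(1)[OF a, of \<xi>]
    have "(japanese_bracket \<xi> powr a)\<^sup>2 \<le> 2 * (max 1 (1/c) * (1 + c * norm \<xi> powr (2 * a)))"
      by (rule order_trans)
    also have "\<dots> \<le> D * (1 + c * norm \<xi> powr (2 * a))"
      unfolding mult.assoc[symmetric] using cC(1) by (intro mult_right_mono) (auto simp: D_def)
    finally have "ennreal ((japanese_bracket \<xi> powr a)\<^sup>2) \<le> ennreal (D * (1 + c * norm \<xi> powr (2 * a)))"
      by (rule ennreal_leI)
    also have "\<dots> = ennreal D * (1 + ennreal (c * norm \<xi> powr (2 * a)))"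
      using D cC(1) by (simp add: ennreal_mult' ennreal_plus del: ennreal_plus[symmetric])
    also have "\<dots> \<le> ennreal D * (1 + frac_symbol a \<xi>)"
      by (intro mult_left_mono add_left_mono cC(3)) auto
    finally show ?thesis .
  qed
  define Q where "Q u = L2sq lborel (\<lambda>\<xi>. (japanese_bracket \<xi> powr a) *\<^sub>R fourier_L2 u \<xi>)" for u :: "real ^ 'n \<Rightarrow> real"
  have main: "is_fourier_transform u (fourier_L2 u) \<and>
      (\<lambda>\<xi>. (japanese_bracket \<xi> powr a) *\<^sub>R fourier_L2 u \<xi>) \<in> borel_measurable lebesgue \<and>
      L2sq lborel u + gagliardo a u \<le> ennreal D * Q u \<and> Q u \<le> ennreal D * (L2sq lborel u + gagliardo a u)"
    if u: "L2_fun u" for u :: "real ^ 'n \<Rightarrow> real"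
  proof -
    have um: "u \<in> borel_measurable lebesgue" and ufin: "L2sq lborel u < top" using u by (auto simp: L2_fun_iff)
    obtain v where v [measurable]: "v \<in> borel_measurable borel" and uv: "AE x in lebesgue. u x = v x"
      using borel_representative[OF um] .
    have L2uv: "L2sq lborel u = L2sq lborel v"
      using L2sq_cong_AE[OF uv] by (simp add: L2sq_lebesgue)
    then have vfin: "L2sq lborel v < top" using ufin by simp
    obtain w where w [measurable]: "w \<in> borel_measurable borel" and ft: "is_fourier_transform v w"
      using fourier_transform_exists[OF v vfin] .
    have ft_uv: "is_fourier_transform u = is_fourier_transform v"
      by (rule is_fourier_transform_cong_AE[OF um borel_imp_lebesgue[OF v] uv])
    have F: "is_fourier_transform u (fourier_L2 u)"
      unfolding fourier_L2_def by (rule someI[of _ w]) (simp add: ft_uv ft)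
    then have Fm: "fourier_L2 u \<in> borel_measurable lebesgue" by (simp add: is_fourier_transform_iff)
    have Fw: "AE \<xi> in lebesgue. fourier_L2 u \<xi> = w \<xi>"
      by (rule fourier_transform_unique[OF v _ ft]) (use F ft_uv in simp)
    have Q: "Q u = (\<integral>\<^sup>+\<xi>. ennreal ((norm (w \<xi>))\<^sup>2) * ennreal ((japanese_bracket \<xi> powr a)\<^sup>2) \<partial>lborel)"
    proof -
      have "Q u = L2sq lebesgue (\<lambda>\<xi>. (japanese_bracket \<xi> powr a) *\<^sub>R w \<xi>)"
        unfolding Q_def L2sq_lebesgue[symmetric] by (rule L2sq_cong_AE) (use Fw in auto)
      then show ?thesis
        by (simp add: L2sq_def nn_integral_completion power_mult_distrib ennreal_mult' mult.commute)
    qed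
    have E: "L2sq lborel u + gagliardo a u = (\<integral>\<^sup>+\<xi>. ennreal ((norm (w \<xi>))\<^sup>2) * (1 + frac_symbol a \<xi>) \<partial>lborel)"
    proof -
      have "L2sq lborel u + gagliardo a u = L2sq lborel w + gagliardo a v"
        unfolding L2uv fourier_transform_norm[OF v vfin ft] gagliardo_cong_AE[OF uv] ..
      also have "\<dots> = (\<integral>\<^sup>+\<xi>. ennreal ((norm (w \<xi>))\<^sup>2) \<partial>lborel) + (\<integral>\<^sup>+\<xi>. ennreal ((norm (w \<xi>))\<^sup>2) * frac_symbol a \<xi> \<partial>lborel)"
        unfolding gagliardo_fourier[OF v vfin w ft] L2sq_def ..
      also have "\<dots> = (\<integral>\<^sup>+\<xi>. ennreal ((norm (w \<xi>))\<^sup>2) * (1 + frac_symbol a \<xi>) \<partial>lborel)"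
        by (subst nn_integral_add[symmetric]) (auto simp: distrib_left)
      finally show ?thesis .
    qed
    have "(\<lambda>\<xi>. (japanese_bracket \<xi> powr a) *\<^sub>R fourier_L2 u \<xi>) \<in> borel_measurable lebesgue"
      by (rule borel_measurable_scaleR[OF borel_imp_lebesgue Fm]) measurable
    moreover have "L2sq lborel u + gagliardo a u \<le> ennreal D * Q u"
      unfolding Q E by (rule nn_integral_mult_sandwich[OF _ _ up]) measurable
    moreover have "Q u \<le> ennreal D * (L2sq lborel u + gagliardo a u)"
      unfolding Q E by (rule nn_integral_mult_sandwich[OF _ _ low]) measurable
    ultimately show ?thesis using F by simp
  qed
  have iff: "u \<in> sobolev a \<longleftrightarrow> L2_fun u \<and> gagliardo a u < top" for u :: "real ^ 'n \<Rightarrow> real"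
  proof (cases "L2_fun u")
    case True
    have "L2sq lborel u < top" using True by (simp add: L2_fun_iff)
    moreover have "ennreal D * x < top \<longleftrightarrow> x < top" for x
      using D by (auto simp: ennreal_mult_less_top)
    ultimately have "Q u < top \<longleftrightarrow> gagliardo a u < top"
      using main[OF True] by (metis ennreal_add_less_top order_le_less_trans)
    then show ?thesis
      unfolding sobolev_def using main[OF True] True by (auto simp: L2_fun_iff Q_def)
  qed (simp add: sobolev_def)
  have nrm: "ennreal ((sobolev_norm a u)\<^sup>2) = Q u" if "u \<in> sobolev a" for u
  proof -
    have m: "L2_fun (\<lambda>\<xi>. (japanese_bracket \<xi> powr a) *\<^sub>R fourier_L2 u \<xi>)" using that by (simp add: sobolev_def)
    then show ?thesis
      unfolding sobolev_norm_def Q_def by (simp add: L2_fun_iff L2_norm_eq_L2n L2sq_eq_L2n)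
  qed
  show ?thesis
  proof (rule that[OF D iff])
    fix u :: "real ^ 'n \<Rightarrow> real" assume u: "u \<in> sobolev a"
    then have L: "L2_fun u" by (simp add: sobolev_def)
    show "L2sq lborel u + gagliardo a u \<le> ennreal (D * (sobolev_norm a u)\<^sup>2)"
      using main[OF L] D by (simp add: ennreal_mult' nrm[OF u])
    show "ennreal ((sobolev_norm a u)\<^sup>2) \<le> ennreal D * (L2sq lborel u + gagliardo a u)"
      using main[OF L] by (simp add: nrm[OF u])
  qed
qed

section \<open>Operations on Sobolev functions\<close>

definition energy :: "real \<Rightarrow> (real ^ 'n \<Rightarrow> real) \<Rightarrow> ennreal" where
  "energy a u = L2sq lborel u + gagliardo a u"

lemma sobolev_iff:
  assumes "0 < a" "a < 1"
  shows "u \<in> sobolev a \<longleftrightarrow> u \<in> borel_measurable lebesgue \<and> energy a u < top"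
  using sobolev_energy[OF assms] unfolding L2_fun_iff energy_def by (metis ennreal_add_less_top)

lemma energy_cong_AE: "AE x in lebesgue. u x = v x \<Longrightarrow> energy a u = energy a v"
  unfolding energy_def using gagliardo_cong_AE L2sq_cong_AE L2sq_lebesgue by metis

lemma L2sq_diff_measurable [measurable]:
  fixes u :: "real ^ 'n \<Rightarrow> real"
  assumes [measurable]: "u \<in> borel_measurable borel"
  shows "(\<lambda>s. L2sq lborel (\<lambda>x. u (x + s) - u x)) \<in> borel_measurable borel"
proof -
  have "(\<lambda>s. L2sq lborel (\<lambda>x. u (x + s) - u x)) \<in> borel_measurable (lborel :: (real ^ 'n) measure)"
    unfolding L2sq_def by measurable
  then show ?thesis by simp
qed

lemma energy_add_borel:
  fixes u v :: "real ^ 'n \<Rightarrow> real"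
  assumes [measurable]: "u \<in> borel_measurable borel" "v \<in> borel_measurable borel"
  shows "energy a (\<lambda>x. u x + v x) \<le> 2 * energy a u + 2 * energy a v"
proof -
  have "gagliardo a (\<lambda>x. u x + v x) \<le> (\<integral>\<^sup>+s. 2 * (ennreal (frac_kernel a s) * L2sq lborel (\<lambda>x. u (x + s) - u x)) +
      2 * (ennreal (frac_kernel a s) * L2sq lborel (\<lambda>x. v (x + s) - v x)) \<partial>lborel)"
    unfolding gagliardo_def
  proof (rule nn_integral_mono)
    fix s :: "real ^ 'n"
    have "L2sq lborel (\<lambda>x. u (x + s) + v (x + s) - (u x + v x)) = L2sq lborel (\<lambda>x. (u (x + s) - u x) + (v (x + s) - v x))"
      by (simp add: algebra_simps)
    also have "\<dots> \<le> 2 * L2sq lborel (\<lambda>x. u (x + s) - u x) + 2 * L2sq lborel (\<lambda>x. v (x + s) - v x)"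
      by (rule L2sq_add_le) measurable
    finally have "ennreal (frac_kernel a s) * L2sq lborel (\<lambda>x. u (x + s) + v (x + s) - (u x + v x)) \<le> ennreal (frac_kernel a s) * \<dots>"
      by (rule mult_left_mono) simp
    then show "ennreal (frac_kernel a s) * L2sq lborel (\<lambda>x. u (x + s) + v (x + s) - (u x + v x)) \<le>
       2 * (ennreal (frac_kernel a s) * L2sq lborel (\<lambda>x. u (x + s) - u x)) + 2 * (ennreal (frac_kernel a s) * L2sq lborel (\<lambda>x. v (x + s) - v x))"
      by (simp add: distrib_left mult_ac)
  qed
  also have "\<dots> = 2 * gagliardo a u + 2 * gagliardo a v"
    unfolding gagliardo_def by (subst nn_integral_add) (auto simp: nn_integral_cmult)
  finally have "energy a (\<lambda>x. u x + v x) \<le> (2 * L2sq lborel u + 2 * L2sq lborel v) + (2 * gagliardo a u + 2 * gagliardo a v)"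
    unfolding energy_def by (intro add_mono L2sq_add_le) auto
  then show ?thesis by (simp add: energy_def distrib_left add_ac)
qed

lemma energy_scale:
  fixes u :: "real ^ 'n \<Rightarrow> real"
  assumes um: "u \<in> borel_measurable lebesgue"
  shows "energy a (\<lambda>x. c * u x) = ennreal (c\<^sup>2) * energy a u"
proof -
  obtain v where v [measurable]: "v \<in> borel_measurable borel" and uv: "AE x in lebesgue. u x = v x"
    using borel_representative[OF um] .
  have 1: "L2sq lborel (\<lambda>x. c * w x) = ennreal (c\<^sup>2) * L2sq lborel w" if "w \<in> borel_measurable borel" for w :: "real ^ 'n \<Rightarrow> real"
    using L2sq_scale[of w lborel c] that by simp
  have "gagliardo a (\<lambda>x. c * v x) = ennreal (c\<^sup>2) * gagliardo a v"
  proof -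
    have "L2sq lborel (\<lambda>x. c * v (x + s) - c * v x) = ennreal (c\<^sup>2) * L2sq lborel (\<lambda>x. v (x + s) - v x)" for s
      using 1[of "\<lambda>x. v (x + s) - v x"] by (simp add: right_diff_distrib)
    then show ?thesis unfolding gagliardo_def
      by (subst nn_integral_cmult[symmetric]) (auto simp: mult_ac)
  qed
  then have "energy a (\<lambda>x. c * v x) = ennreal (c\<^sup>2) * energy a v"
    by (simp add: energy_def 1 distrib_left)
  moreover have "energy a (\<lambda>x. c * u x) = energy a (\<lambda>x. c * v x)" by (rule energy_cong_AE) (use uv in auto)
  ultimately show ?thesis using energy_cong_AE[OF uv] by simp
qed

lemma energy_add:
  fixes u v :: "real ^ 'n \<Rightarrow> real"
  assumes um: "u \<in> borel_measurable lebesgue" and vm: "v \<in> borel_measurable lebesgue"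
  shows "energy a (\<lambda>x. u x + v x) \<le> 2 * energy a u + 2 * energy a v"
proof -
  obtain u' where u': "u' \<in> borel_measurable borel" and uu: "AE x in lebesgue. u x = u' x"
    using borel_representative[OF um] .
  obtain v' where v': "v' \<in> borel_measurable borel" and vv: "AE x in lebesgue. v x = v' x"
    using borel_representative[OF vm] .
  have "energy a (\<lambda>x. u x + v x) = energy a (\<lambda>x. u' x + v' x)" by (rule energy_cong_AE) (use uu vv in auto)
  then show ?thesis
    using energy_add_borel[OF u' v'] by (simp add: energy_cong_AE[OF uu] energy_cong_AE[OF vv])
qed

context
  fixes a :: real
  assumes a: "0 < a" "a < 1"
begin

lemma sobolev_measurable: "u \<in> sobolev a \<Longrightarrow> u \<in> borel_measurable lebesgue"
  by (simp add: sobolev_iff[OF a])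

lemma sobolev_energy_finite: "u \<in> sobolev a \<Longrightarrow> energy a u < top"
  by (simp add: sobolev_iff[OF a])

lemma sobolev_add: "u \<in> sobolev a \<Longrightarrow> v \<in> sobolev a \<Longrightarrow> (\<lambda>x. u x + v x) \<in> sobolev a"
  unfolding sobolev_iff[OF a]
  using energy_add[of u v a] by (auto simp: ennreal_mult_less_top intro: order_le_less_trans)

lemma sobolev_scale: "u \<in> sobolev a \<Longrightarrow> (\<lambda>x. c * u x) \<in> sobolev a"
  unfolding sobolev_iff[OF a] using energy_scale[of u a c] by (auto simp: ennreal_mult_less_top)

lemma sobolev_diff: "u \<in> sobolev a \<Longrightarrow> v \<in> sobolev a \<Longrightarrow> (\<lambda>x. u x - v x) \<in> sobolev a"
  using sobolev_add[of u "\<lambda>x. (-1) * v x"] sobolev_scale[of v "-1"] by simp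

lemma sobolev_0: "(\<lambda>x. 0) \<in> sobolev a"
  unfolding sobolev_iff[OF a] by (simp add: energy_def L2sq_def gagliardo_def)

lemma sobolev_cong_AE:
  assumes "u \<in> sobolev a" "v \<in> borel_measurable lebesgue" "AE x in lebesgue. u x = v x"
  shows "v \<in> sobolev a"
  using assms energy_cong_AE[OF assms(3), of a] unfolding sobolev_iff[OF a] by simp

end

text \<open>
  Split the increment of the product by the Leibniz rule. The increment of the multiplier is
  at most a constant times \<open>min 2 \<bar>s\<bar>\<close>, and the kernel integrates the square of this.
\<close>

lemma sobolev_lipschitz_mult:
  fixes u \<zeta> :: "real ^ 'n \<Rightarrow> real"
  assumes a: "0 < a" "a < 1" and u: "u \<in> sobolev a"
    and \<zeta>1: "\<And>x. \<bar>\<zeta> x\<bar> \<le> 1" and lip: "\<And>x y. \<bar>\<zeta> x - \<zeta> y\<bar> \<le> L * norm (x - y)"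
  shows "(\<lambda>x. \<zeta> x * u x) \<in> sobolev a"
proof -
  have um: "u \<in> borel_measurable lebesgue" and ufin: "energy a u < top" using u by (auto simp: sobolev_iff[OF a])
  obtain v where v [measurable]: "v \<in> borel_measurable borel" and uv: "AE x in lebesgue. u x = v x"
    using borel_representative[OF um] .
  have vfin: "energy a v < top" using energy_cong_AE[OF uv, of a] ufin by simp
  have L: "L \<ge> 0"
  proof -
    obtain b :: "real ^ 'n" where b: "b \<in> Basis" using nonempty_Basis by blast
    have "0 \<le> \<bar>\<zeta> b - \<zeta> 0\<bar>" by simp
    also have "\<dots> \<le> L * norm (b - 0)" by (rule lip)
    finally show ?thesis using b by simp
  qed
  have "continuous_on UNIV \<zeta>"
    by (rule lipschitz_on_continuous_on[of L]) (use lip L in \<open>auto simp: lipschitz_on_def dist_real_def dist_norm\<close>)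
  then have \<zeta>m [measurable]: "\<zeta> \<in> borel_measurable borel" by (rule borel_measurable_continuous_onI)
  define D where "D = max 1 (L\<^sup>2)"
  define k where "k s = D * min 4 ((norm s)\<^sup>2)" for s :: "real ^ 'n"
  have k0: "k s \<ge> 0" for s by (simp add: k_def D_def)
  have \<zeta>k: "(\<zeta> (x + s) - \<zeta> x)\<^sup>2 \<le> k s" for x s
  proof -
    have "\<bar>\<zeta> (x + s) - \<zeta> x\<bar> \<le> 2" using \<zeta>1[of "x + s"] \<zeta>1[of x] by linarith
    then have 1: "(\<zeta> (x + s) - \<zeta> x)\<^sup>2 \<le> 2\<^sup>2" by (intro abs_le_square_iff[THEN iffD1]) simp
    have "\<bar>\<zeta> (x + s) - \<zeta> x\<bar> \<le> \<bar>L * norm s\<bar>" using lip[of "x + s" x] by simp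
    then have 2: "(\<zeta> (x + s) - \<zeta> x)\<^sup>2 \<le> L\<^sup>2 * (norm s)\<^sup>2"
      by (simp only: abs_le_square_iff power_mult_distrib)
    have "1 * 4 \<le> D * 4" "L\<^sup>2 * (norm s)\<^sup>2 \<le> D * (norm s)\<^sup>2"
      by (auto simp: D_def intro!: mult_right_mono)
    with 1 2 show ?thesis unfolding k_def min_def by auto
  qed
  have L2: "L2sq lborel (\<lambda>x. \<zeta> x * v x) \<le> L2sq lborel v"
    by (rule L2sq_mono_AE) (use \<zeta>1 in \<open>auto simp: abs_mult intro!: mult_left_le_one_le\<close>)
  have step: "L2sq lborel (\<lambda>x. \<zeta> (x + s) * v (x + s) - \<zeta> x * v x) \<le>
      2 * L2sq lborel (\<lambda>x. v (x + s) - v x) + 2 * (ennreal (k s) * L2sq lborel v)" for s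
  proof -
    have "L2sq lborel (\<lambda>x. \<zeta> (x + s) * v (x + s) - \<zeta> x * v x) =
      L2sq lborel (\<lambda>x. \<zeta> (x + s) * (v (x + s) - v x) + (\<zeta> (x + s) - \<zeta> x) * v x)"
      by (simp add: algebra_simps)
    also have "\<dots> \<le> 2 * L2sq lborel (\<lambda>x. \<zeta> (x + s) * (v (x + s) - v x)) + 2 * L2sq lborel (\<lambda>x. (\<zeta> (x + s) - \<zeta> x) * v x)"
      by (rule L2sq_add_le) measurable
    also have "L2sq lborel (\<lambda>x. \<zeta> (x + s) * (v (x + s) - v x)) \<le> L2sq lborel (\<lambda>x. v (x + s) - v x)"
      by (rule L2sq_mono_AE) (use \<zeta>1 in \<open>auto simp: abs_mult intro!: mult_left_le_one_le\<close>)
    also have "L2sq lborel (\<lambda>x. (\<zeta> (x + s) - \<zeta> x) * v x) \<le> L2sq lborel (\<lambda>x. sqrt (k s) * v x)"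
    proof (rule L2sq_mono_AE, rule AE_I2)
      fix x
      have "\<bar>\<zeta> (x + s) - \<zeta> x\<bar> \<le> sqrt (k s)" using real_sqrt_le_mono[OF \<zeta>k[of x s]] by simp
      then show "norm ((\<zeta> (x + s) - \<zeta> x) * v x) \<le> norm (sqrt (k s) * v x)"
        using k0[of s] by (auto simp: abs_mult intro!: mult_right_mono)
    qed
    also have "\<dots> = ennreal (k s) * L2sq lborel v"
      using L2sq_scale[of v lborel "sqrt (k s)"] k0[of s] by simp
    finally show ?thesis by (simp add: mult_left_mono)
  qed
  have "gagliardo a (\<lambda>x. \<zeta> x * v x) \<le> (\<integral>\<^sup>+s. 2 * (ennreal (frac_kernel a s) * L2sq lborel (\<lambda>x. v (x + s) - v x)) +
      (2 * L2sq lborel v * ennreal D) * ennreal (frac_kernel a s * min 4 ((norm s)\<^sup>2)) \<partial>lborel)"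
    unfolding gagliardo_def
  proof (rule nn_integral_mono)
    fix s :: "real ^ 'n"
    have "ennreal (frac_kernel a s) * L2sq lborel (\<lambda>x. \<zeta> (x + s) * v (x + s) - \<zeta> x * v x) \<le>
        ennreal (frac_kernel a s) * (2 * L2sq lborel (\<lambda>x. v (x + s) - v x) + 2 * (ennreal (k s) * L2sq lborel v))"
      using step[of s] by (rule mult_left_mono) simp
    also have "\<dots> = 2 * (ennreal (frac_kernel a s) * L2sq lborel (\<lambda>x. v (x + s) - v x)) +
      (2 * L2sq lborel v * ennreal D) * ennreal (frac_kernel a s * min 4 ((norm s)\<^sup>2))"
      unfolding k_def by (simp add: D_def distrib_left ennreal_mult' mult_ac)
    finally show "ennreal (frac_kernel a s) * L2sq lborel (\<lambda>x. \<zeta> (x + s) * v (x + s) - \<zeta> x * v x) \<le> \<dots>" .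
  qed
  also have "\<dots> = 2 * gagliardo a v + (2 * L2sq lborel v * ennreal D) * (\<integral>\<^sup>+s. ennreal (frac_kernel a s * min 4 ((norm (s :: real ^ 'n))\<^sup>2)) \<partial>lborel)"
    unfolding gagliardo_def by (subst nn_integral_add) (auto simp: nn_integral_cmult)
  also have "\<dots> < top"
    using vfin frac_kernel_min_finite[OF a, where 'n='n] by (simp add: energy_def ennreal_mult_less_top)
  finally have "energy a (\<lambda>x. \<zeta> x * v x) < top"
    using L2 vfin unfolding energy_def by (auto intro: order_le_less_trans)
  moreover have "(\<lambda>x. \<zeta> x * v x) \<in> borel_measurable lebesgue" by (rule borel_imp_lebesgue) measurable
  ultimately have "(\<lambda>x. \<zeta> x * v x) \<in> sobolev a" by (simp add: sobolev_iff[OF a])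
  moreover have "(\<lambda>x. \<zeta> x * u x) \<in> borel_measurable lebesgue"
    by (intro borel_measurable_times um borel_imp_lebesgue \<zeta>m)
  moreover have "AE x in lebesgue. \<zeta> x * v x = \<zeta> x * u x" using uv by auto
  ultimately show ?thesis by (rule sobolev_cong_AE[OF a])
qed

text \<open>
  Dominated convergence in the increment \<open>s\<close>. It lifts convergence in the mean to convergence
  in energy for operations that commute with increments, here translations and mollifications.
\<close>

lemma gagliardo_dominated:
  fixes v :: "real ^ 'n \<Rightarrow> real"
  assumes [measurable]: "\<And>j::nat. f j \<in> borel_measurable borel" "v \<in> borel_measurable borel"
    and fin: "gagliardo a v < top"
    and lim: "\<And>s. L2sq lborel (\<lambda>x. v (x + s) - v x) < top \<Longrightarrow> (\<lambda>j. L2sq lborel (\<lambda>x. f j (x + s) - f j x)) \<longlonglongrightarrow> 0"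
    and bd: "\<And>s j. L2sq lborel (\<lambda>x. f j (x + s) - f j x) \<le> 4 * L2sq lborel (\<lambda>x. v (x + s) - v x)"
  shows "(\<lambda>j. gagliardo a (f j)) \<longlonglongrightarrow> 0"
proof -
  have "(\<lambda>j. \<integral>\<^sup>+s. ennreal (frac_kernel a s) * L2sq lborel (\<lambda>x. f j (x + s) - f j x) \<partial>lborel) \<longlonglongrightarrow> (\<integral>\<^sup>+s. 0 \<partial>(lborel :: (real ^ 'n) measure))"
  proof (rule nn_integral_dominated_convergence[where w="\<lambda>s. 4 * (ennreal (frac_kernel a s) * L2sq lborel (\<lambda>x. v (x + s) - v x))"])
    show fin': "(\<integral>\<^sup>+s. 4 * (ennreal (frac_kernel a s) * L2sq lborel (\<lambda>x. v (x + s) - v x)) \<partial>lborel) < \<infinity>"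
      using fin by (simp add: nn_integral_cmult gagliardo_def[symmetric] ennreal_mult_less_top)
    show "AE s in lborel. ennreal (frac_kernel a s) * L2sq lborel (\<lambda>x. f j (x + s) - f j x) \<le>
       4 * (ennreal (frac_kernel a s) * L2sq lborel (\<lambda>x. v (x + s) - v x))" for j
      using mult_left_mono[OF bd, of "ennreal (frac_kernel a _)"] by (intro AE_I2) (simp add: mult.left_commute)
    have "AE s in lborel. ennreal (frac_kernel a s) * L2sq lborel (\<lambda>x. v (x + s) - v x) \<noteq> \<infinity>"
      using fin by (intro nn_integral_PInf_AE) (auto simp: gagliardo_def)
    moreover have "AE s in lborel. s \<noteq> (0 :: real ^ 'n)" by (rule AE_lborel_singleton)
    ultimately show "AE s in lborel. (\<lambda>j. ennreal (frac_kernel a s) * L2sq lborel (\<lambda>x. f j (x + s) - f j x)) \<longlonglongrightarrow> 0"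
    proof eventually_elim
      case (elim s)
      have "frac_kernel a s > 0" using elim(2) by (simp add: frac_kernel_def)
      then have "L2sq lborel (\<lambda>x. v (x + s) - v x) < top"
        using elim(1) by (auto simp: ennreal_mult_eq_top_iff top.not_eq_extremum)
      from lim[OF this] have "(\<lambda>j. ennreal (frac_kernel a s) * L2sq lborel (\<lambda>x. f j (x + s) - f j x)) \<longlonglongrightarrow> ennreal (frac_kernel a s) * 0"
        by (intro ennreal_tendsto_cmult) auto
      then show ?case by simp
    qed
  qed auto
  then show ?thesis by (simp add: gagliardo_def)
qed

lemma energy_translate:
  fixes u :: "real ^ 'n \<Rightarrow> real"
  assumes [measurable]: "u \<in> borel_measurable borel"
  shows "energy a (\<lambda>x. u (x + h)) = energy a u"
proof -
  have "L2sq lborel (\<lambda>x. u (x + s + h) - u (x + h)) = L2sq lborel (\<lambda>x. u (x + s) - u x)" for s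
    using L2sq_translate[of "\<lambda>x. u (x + s) - u x" h] by (simp add: add_ac)
  then show ?thesis unfolding energy_def gagliardo_def by (simp add: L2sq_translate)
qed

lemma energy_translation_tendsto:
  fixes v :: "real ^ 'n \<Rightarrow> real"
  assumes vm [measurable]: "v \<in> borel_measurable borel" and fin: "energy a v < top"
    and h: "h \<longlonglongrightarrow> 0"
  shows "(\<lambda>j. energy a (\<lambda>x. v (x + h j) - v x)) \<longlonglongrightarrow> 0"
proof -
  have fin': "L2sq lborel v < top" "gagliardo a v < top" using fin by (auto simp: energy_def)
  have "(\<lambda>j. gagliardo a (\<lambda>x. v (x + h j) - v x)) \<longlonglongrightarrow> 0"
  proof (rule gagliardo_dominated[where v=v])
    fix s assume s: "L2sq lborel (\<lambda>x. v (x + s) - v x) < top"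
    show "(\<lambda>j. L2sq lborel (\<lambda>x. v (x + s + h j) - v (x + s) - (v (x + h j) - v x))) \<longlonglongrightarrow> 0"
      using L2_translation_seq[OF _ s h] by (simp add: algebra_simps)
  next
    fix s j
    have "L2sq lborel (\<lambda>x. v (x + s + h j) - v (x + s) - (v (x + h j) - v x)) =
        L2sq lborel (\<lambda>x. (v (x + h j + s) - v (x + h j)) - (v (x + s) - v x))" by (simp add: algebra_simps)
    also have "\<dots> \<le> 2 * L2sq lborel (\<lambda>x. v (x + h j + s) - v (x + h j)) + 2 * L2sq lborel (\<lambda>x. v (x + s) - v x)"
      by (rule L2sq_diff_le) measurable
    also have "L2sq lborel (\<lambda>x. v (x + h j + s) - v (x + h j)) = L2sq lborel (\<lambda>x. v (x + s) - v x)"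
      by (rule L2sq_translate[of "\<lambda>x. v (x + s) - v x"]) measurable
    also have "2 * L2sq lborel (\<lambda>x. v (x + s) - v x) + 2 * L2sq lborel (\<lambda>x. v (x + s) - v x) = 4 * L2sq lborel (\<lambda>x. v (x + s) - v x)"
      by (simp flip: distrib_right)
    finally show "L2sq lborel (\<lambda>x. v (x + s + h j) - v (x + s) - (v (x + h j) - v x)) \<le> 4 * L2sq lborel (\<lambda>x. v (x + s) - v x)" .
  qed (use fin' in auto)
  from tendsto_add[OF L2_translation_seq[OF vm fin'(1) h] this]
  show ?thesis by (simp add: energy_def)
qed

section \<open>Smooth bump functions and mollification\<close>

lemma Ck_SucI:
  fixes f :: "real ^ 'n \<Rightarrow> real"
  assumes "\<And>x. (f has_derivative D x) (at x)" "\<And>b. b \<in> Basis \<Longrightarrow> Ck_fun k (\<lambda>x. D x b)"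
  shows "Ck_fun (Suc k) f"
proof -
  have "frechet_derivative f (at x) = D x" for x
    using frechet_derivative_at[OF assms(1)] by simp
  then show ?thesis using assms by (auto simp: differentiable_def)
qed

lemma Ck_SucD:
  fixes f :: "real ^ 'n \<Rightarrow> real"
  assumes "Ck_fun (Suc k) f"
  shows "(f has_derivative frechet_derivative f (at x)) (at x)"
    "b \<in> Basis \<Longrightarrow> Ck_fun k (\<lambda>x. frechet_derivative f (at x) b)"
  using assms by (auto simp: frechet_derivative_works)

lemma Ck_Suc_imp: "Ck_fun (Suc k) f \<Longrightarrow> Ck_fun k (f :: real ^ 'n \<Rightarrow> real)"
proof (induction k arbitrary: f)
  case 0
  then show ?case
    by (auto intro!: differentiable_imp_continuous_on simp: differentiable_on_def intro: differentiable_at_withinI)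
next
  case (Suc k)
  show ?case
    by (rule Ck_SucI[OF Ck_SucD(1)[OF Suc.prems]]) (intro Suc.IH Ck_SucD(2)[OF Suc.prems])
qed

lemma Ck_continuous: "Ck_fun k f \<Longrightarrow> continuous_on UNIV (f :: real ^ 'n \<Rightarrow> real)"
proof (induction k)
  case (Suc k) then show ?case using Ck_Suc_imp by blast
qed simp

lemma Ck_const: "Ck_fun k (\<lambda>x :: real ^ 'n. c)"
proof (induction k arbitrary: c)
  case (Suc k)
  show ?case by (rule Ck_SucI[of _ "\<lambda>x h. 0"]) (auto intro: Suc derivative_eq_intros)
qed simp

lemma Ck_add: "Ck_fun k f \<Longrightarrow> Ck_fun k g \<Longrightarrow> Ck_fun k (\<lambda>x. f x + g x :: real)"
proof (induction k arbitrary: f g)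
  case 0 then show ?case by (auto intro: continuous_intros)
next
  case (Suc k)
  show ?case
    by (rule Ck_SucI[OF has_derivative_add[OF Ck_SucD(1)[OF Suc.prems(1)] Ck_SucD(1)[OF Suc.prems(2)]]])
      (intro Suc.IH Ck_SucD(2)[OF Suc.prems(1)] Ck_SucD(2)[OF Suc.prems(2)])
qed

lemma Ck_mult: "Ck_fun k f \<Longrightarrow> Ck_fun k g \<Longrightarrow> Ck_fun k (\<lambda>x. f x * g x :: real)"
proof (induction k arbitrary: f g)
  case 0 then show ?case by (auto intro: continuous_intros)
next
  case (Suc k)
  show ?case
    by (rule Ck_SucI[OF has_derivative_mult[OF Ck_SucD(1)[OF Suc.prems(1)] Ck_SucD(1)[OF Suc.prems(2)]]])
      (intro Ck_add Suc.IH Ck_SucD(2)[OF Suc.prems(1)] Ck_SucD(2)[OF Suc.prems(2)] Ck_Suc_imp[OF Suc.prems(1)] Ck_Suc_imp[OF Suc.prems(2)])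
qed

lemma Ck_prod: "finite I \<Longrightarrow> (\<And>i. i \<in> I \<Longrightarrow> Ck_fun k (f i)) \<Longrightarrow> Ck_fun k (\<lambda>x. \<Prod>i\<in>I. f i x :: real)"
  by (induction I rule: finite_induct) (auto intro: Ck_const Ck_mult)

text \<open>
  All derivatives of \<open>exp (- 1/t)\<close> have this form, so that its smoothness is a single
  induction.
\<close>

definition flat_exp :: "real poly \<Rightarrow> real \<Rightarrow> real" where
  "flat_exp p t = (if t > 0 then poly p (1/t) * exp (- (1/t)) else 0)"

lemma poly_times_exp_tendsto_0: "((\<lambda>y :: real. poly p y * exp (- y)) \<longlongrightarrow> 0) at_top"
proof -
  have "((\<lambda>y :: real. \<Sum>i\<le>degree p. coeff p i * (y ^ i / exp y)) \<longlongrightarrow> (\<Sum>i\<le>degree p. coeff p i * 0)) at_top"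
    by (intro tendsto_sum tendsto_mult tendsto_const tendsto_power_div_exp_0)
  then show ?thesis by (simp add: poly_altdef exp_minus field_simps sum_distrib_right sum_divide_distrib)
qed

text \<open>
  At the origin the difference quotient is, with \<open>y = 1/t\<close>, a polynomial in \<open>y\<close> times
  \<open>exp (- y)\<close>.
\<close>

lemma flat_exp_has_derivative:
  "(flat_exp p has_real_derivative flat_exp ([:0, 0, 1:] * (p - pderiv p)) t) (at t)"
proof -
  consider "t > 0" | "t < 0" | "t = 0" by linarith
  then show ?thesis
  proof cases
    case 1
    have ev: "\<forall>\<^sub>F s in nhds t. poly p (1/s) * exp (- (1/s)) = flat_exp p s"
      using eventually_nhds_in_open[of "{0<..}" t] 1 by (auto simp: flat_exp_def elim!: eventually_mono)
    have "((\<lambda>s. poly p (1/s) * exp (- (1/s))) has_real_derivative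
        (poly (pderiv p) (1/t) * (- (1 / t\<^sup>2)) * exp (- (1/t)) + poly p (1/t) * (exp (- (1/t)) * (1 / t\<^sup>2)))) (at t)"
      using 1 by (auto intro!: derivative_eq_intros DERIV_chain2[OF poly_DERIV] simp: power2_eq_square)
    also have "poly (pderiv p) (1/t) * (- (1 / t\<^sup>2)) * exp (- (1/t)) + poly p (1/t) * (exp (- (1/t)) * (1 / t\<^sup>2))
        = flat_exp ([:0, 0, 1:] * (p - pderiv p)) t"
      using 1 by (simp add: flat_exp_def field_simps power2_eq_square)
    finally show ?thesis using DERIV_cong_ev[OF refl ev refl] by blast
  next
    case 2
    have ev: "\<forall>\<^sub>F s in nhds t. 0 = flat_exp p s"
      using eventually_nhds_in_open[of "{..<0}" t] 2 by (auto simp: flat_exp_def elim!: eventually_mono)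
    have "((\<lambda>s. 0) has_real_derivative 0) (at t)" by simp
    then show ?thesis using 2 DERIV_cong_ev[OF refl ev refl] by (simp add: flat_exp_def[of _ t])
  next
    case 3
    have "((\<lambda>h. flat_exp p h / h) \<longlongrightarrow> 0) (at_right 0)"
    proof (rule Lim_transform_eventually)
      show "((\<lambda>h. poly ([:0, 1:] * p) (inverse h) * exp (- inverse h)) \<longlongrightarrow> 0) (at_right 0)"
        by (rule filterlim_compose[OF poly_times_exp_tendsto_0 filterlim_inverse_at_top_right])
      show "\<forall>\<^sub>F h in at_right 0. poly ([:0, 1:] * p) (inverse h) * exp (- inverse h) = flat_exp p h / h"
        by (auto simp: flat_exp_def field_simps eventually_at_right_less[THEN eventually_mono])
    qed
    moreover have "((\<lambda>h. flat_exp p h / h) \<longlongrightarrow> 0) (at_left 0)"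
    proof (rule Lim_transform_eventually[OF tendsto_const])
      have "\<forall>\<^sub>F h in at_left 0. h < (0 :: real)" by (simp add: eventually_at_filter)
      then show "\<forall>\<^sub>F h in at_left 0. 0 = flat_exp p h / h"
        by eventually_elim (simp add: flat_exp_def)
    qed
    ultimately have "((\<lambda>h. flat_exp p h / h) \<longlongrightarrow> 0) (at 0)" by (simp add: filterlim_split_at)
    then show ?thesis using 3 by (simp add: has_field_derivative_iff flat_exp_def[of _ 0])
  qed
qed

lemma Ck_flat_exp: "Ck_fun k (\<lambda>x :: real ^ 'n. flat_exp p (c + x \<bullet> v))"
proof (induction k arbitrary: p)
  case 0
  have "continuous_on UNIV (flat_exp p)"
    using DERIV_isCont[OF flat_exp_has_derivative] by (auto simp: continuous_on_eq_continuous_at)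
  then show ?case
    by (auto intro!: continuous_on_compose2[of UNIV "flat_exp p"] continuous_intros)
next
  case (Suc k)
  show ?case
  proof (rule Ck_SucI[of _ "\<lambda>x h. flat_exp ([:0, 0, 1:] * (p - pderiv p)) (c + x \<bullet> v) * (h \<bullet> v)"])
    fix x :: "real ^ 'n"
    have "((\<lambda>x. c + x \<bullet> v) has_derivative (\<lambda>h. h \<bullet> v)) (at x)"
      by (auto intro!: derivative_eq_intros)
    from has_derivative_compose[OF this flat_exp_has_derivative[of p, unfolded has_field_derivative_def]]
    show "((\<lambda>x. flat_exp p (c + x \<bullet> v)) has_derivative (\<lambda>h. flat_exp ([:0, 0, 1:] * (p - pderiv p)) (c + x \<bullet> v) * (h \<bullet> v))) (at x)" .
  qed (intro Ck_mult Suc Ck_const)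
qed

lemma flat_exp_1_pos: "flat_exp 1 t > 0 \<longleftrightarrow> t > 0" by (simp add: flat_exp_def)
lemma flat_exp_1_nonneg: "flat_exp 1 t \<ge> 0" by (simp add: flat_exp_def)
lemma flat_exp_1_le: "flat_exp 1 t \<le> 1" by (simp add: flat_exp_def)

text \<open>
  A product of one-dimensional bumps, positive exactly on the open cube of half-width \<open>\<epsilon>\<close>;
  smoothness is inherited from \<open>flat_exp\<close> through products and linear substitutions.
\<close>

definition bump :: "real \<Rightarrow> real ^ 'n \<Rightarrow> real" where
  "bump \<epsilon> x = (\<Prod>b\<in>Basis. flat_exp 1 (\<epsilon> + x \<bullet> b) * flat_exp 1 (\<epsilon> + x \<bullet> (- b)))"

lemma Ck_bump: "Ck_fun k (bump \<epsilon>)"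
  unfolding bump_def[abs_def] by (intro Ck_prod Ck_mult Ck_flat_exp) auto

lemma bump_nonneg: "bump \<epsilon> x \<ge> 0"
  unfolding bump_def by (intro prod_nonneg mult_nonneg_nonneg flat_exp_1_nonneg)

lemma bump_le_1: "bump \<epsilon> x \<le> 1"
  unfolding bump_def by (intro prod_le_1) (auto intro!: mult_le_one mult_nonneg_nonneg flat_exp_1_nonneg flat_exp_1_le)

lemma bump_pos:
  assumes "norm (x :: real ^ 'n) < \<epsilon>" shows "bump \<epsilon> x > 0"
  unfolding bump_def
proof (intro prod_pos mult_pos_pos)
  fix b :: "real ^ 'n" assume "b \<in> Basis"
  then have "\<bar>x \<bullet> b\<bar> < \<epsilon>" using Basis_le_norm[of b x] assms by simp
  then show "flat_exp 1 (\<epsilon> + x \<bullet> b) > 0" "flat_exp 1 (\<epsilon> + x \<bullet> (- b)) > 0" by (auto simp: flat_exp_1_pos)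
qed

lemma bump_support:
  assumes "bump \<epsilon> (x :: real ^ 'n) \<noteq> 0" shows "norm x \<le> real CARD('n) * \<epsilon>"
proof -
  have "\<bar>x \<bullet> b\<bar> \<le> \<epsilon>" if "b \<in> Basis" for b
  proof -
    have "flat_exp 1 (\<epsilon> + x \<bullet> b) \<noteq> 0 \<and> flat_exp 1 (\<epsilon> + x \<bullet> (- b)) \<noteq> 0"
      using assms that unfolding bump_def by (auto simp: prod_zero_iff)
    then show ?thesis by (auto simp: flat_exp_def split: if_splits)
  qed
  then have "(\<Sum>b\<in>Basis. \<bar>x \<bullet> b\<bar>) \<le> (\<Sum>b\<in>(Basis :: (real ^ 'n) set). \<epsilon>)" by (intro sum_mono)
  then show ?thesis using norm_le_l1[of x] by simp
qed

lemma bump_measurable [measurable]: "bump \<epsilon> \<in> borel_measurable borel"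
  by (rule borel_measurable_continuous_onI[OF Ck_continuous[OF Ck_bump]])

lemma integrable_bounded_support:
  fixes f :: "'a::euclidean_space \<Rightarrow> real"
  assumes [measurable]: "f \<in> borel_measurable borel"
    and "\<And>x. \<bar>f x\<bar> \<le> B" "\<And>x. x \<notin> cball 0 r \<Longrightarrow> f x = 0"
  shows "integrable lborel f"
proof (rule Bochner_Integration.integrable_bound)
  show "integrable lborel (\<lambda>x. B * indicator (cball 0 r) (x :: 'a))"
    using emeasure_bounded_finite[of "cball 0 r :: 'a set"] by (simp add: integrable_real_indicator)
  show "AE x in lborel. norm (f x) \<le> norm (B * indicator (cball 0 r) x)"
    using assms(2,3) by (intro AE_I2) (auto simp: indicator_def intro: order_trans[OF _ abs_ge_self])
qed measurable

lemma bump_integral: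
  assumes "\<epsilon> > 0"
  shows "integrable lborel (bump \<epsilon> :: real ^ 'n \<Rightarrow> real)" and "(\<integral>x. bump \<epsilon> (x :: real ^ 'n) \<partial>lborel) > 0"
proof -
  show i: "integrable lborel (bump \<epsilon> :: real ^ 'n \<Rightarrow> real)"
    by (rule integrable_bounded_support[of _ 1 "real CARD('n) * \<epsilon>"])
      (use bump_nonneg bump_le_1 bump_support in \<open>auto simp: abs_le_iff order_trans[OF _ bump_nonneg]\<close>)
  have "(\<integral>x. bump \<epsilon> (x :: real ^ 'n) \<partial>lborel) \<noteq> 0"
  proof
    assume "(\<integral>x. bump \<epsilon> (x :: real ^ 'n) \<partial>lborel) = 0"
    then have "AE x in lborel. bump \<epsilon> (x :: real ^ 'n) = 0"
      using integral_nonneg_eq_0_iff_AE[OF i] bump_nonneg by auto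
    then have "AE x in lborel. x \<notin> ball (0 :: real ^ 'n) \<epsilon>"
      by eventually_elim (use bump_pos in force)
    then have "ball (0 :: real ^ 'n) \<epsilon> \<in> null_sets lborel" by (simp add: AE_iff_null_sets)
    then show False using assms unit_ball_vol_pos[of "real CARD('n)"] by (simp add: null_sets_def emeasure_ball)
  qed
  moreover have "(\<integral>x. bump \<epsilon> (x :: real ^ 'n) \<partial>lborel) \<ge> 0"
    by (rule Bochner_Integration.integral_nonneg) (rule bump_nonneg)
  ultimately show "(\<integral>x. bump \<epsilon> (x :: real ^ 'n) \<partial>lborel) > 0" by simp
qed

text \<open>
  The convolution of \<open>u\<close> with the reflection of \<open>m\<close>. With this sign only translations occur as
  substitutions.
\<close>

definition correlate :: "(real ^ 'n \<Rightarrow> real) \<Rightarrow> (real ^ 'n \<Rightarrow> real) \<Rightarrow> real ^ 'n \<Rightarrow> real" where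
  "correlate u m x = (\<integral>y. u y * m (y - x) \<partial>lborel)"

lemma compact_support_uniform:
  fixes f :: "real ^ 'n \<Rightarrow> real"
  assumes c: "continuous_on UNIV f" and z: "\<And>x. x \<notin> cball 0 R \<Longrightarrow> f x = 0" and e: "e > 0"
  obtains d where "d > 0" "\<And>x y. norm (x - y) < d \<Longrightarrow> \<bar>f x - f y\<bar> \<le> e"
proof -
  have "uniformly_continuous_on (cball 0 (R + 1)) f"
    by (rule compact_uniformly_continuous) (auto intro: continuous_on_subset[OF c])
  then obtain d where d: "d > 0" "\<And>x y. x \<in> cball 0 (R+1) \<Longrightarrow> y \<in> cball 0 (R+1) \<Longrightarrow> dist y x < d \<Longrightarrow> dist (f y) (f x) < e"
    unfolding uniformly_continuous_on_def using e by metis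
  have "\<bar>f x - f y\<bar> \<le> e" if xy: "norm (x - y) < min d 1" for x y
  proof (cases "x \<in> cball 0 (R+1) \<and> y \<in> cball 0 (R+1)")
    case True
    then show ?thesis using d(2)[of y x] xy by (auto simp: dist_norm)
  next
    case False
    have "\<bar>norm x - norm y\<bar> < 1" using norm_triangle_ineq3[of x y] xy by simp
    then have "norm x > R" "norm y > R" using False by auto
    then have "f x = 0" "f y = 0" by (auto intro!: z)
    then show ?thesis using e by simp
  qed
  then show ?thesis using d(1) by (intro that[of "min d 1"]) auto
qed

lemma compact_support_bounded:
  fixes f :: "real ^ 'n \<Rightarrow> real"
  assumes c: "continuous_on UNIV f" and z: "\<And>x. x \<notin> cball 0 R \<Longrightarrow> f x = 0"
  obtains B where "\<And>x. \<bar>f x\<bar> \<le> B"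
proof -
  have "compact (f ` cball 0 R)" by (intro compact_continuous_image continuous_on_subset[OF c]) auto
  then obtain B where B: "\<And>x. x \<in> cball 0 R \<Longrightarrow> norm (f x) \<le> B"
    using compact_imp_bounded bounded_iff by (metis imageI)
  have "\<bar>f x\<bar> \<le> max B 0" for x
    using B[of x] z[of x] by (cases "x \<in> cball 0 R") auto
  then show ?thesis by (rule that)
qed

lemma integrable_correlate:
  fixes u m :: "real ^ 'n \<Rightarrow> real"
  assumes u: "integrable lborel u" and c: "continuous_on UNIV m" and z: "\<And>x. x \<notin> cball 0 R \<Longrightarrow> m x = 0"
  shows "integrable lborel (\<lambda>y. u y * m (y - x))"
proof -
  have [measurable]: "u \<in> borel_measurable borel" "m \<in> borel_measurable borel"
    using u borel_measurable_continuous_onI[OF c] by auto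
  obtain B where B: "\<And>x. \<bar>m x\<bar> \<le> B" using compact_support_bounded[OF c z] by blast
  show ?thesis
  proof (rule Bochner_Integration.integrable_bound)
    show "integrable lborel (\<lambda>y. B * u y)" using u by simp
    show "AE y in lborel. norm (u y * m (y - x)) \<le> norm (B * u y)"
    proof (rule AE_I2)
      fix y
      have "\<bar>m (y - x)\<bar> \<le> \<bar>B\<bar>" using B[of "y - x"] by simp
      then show "norm (u y * m (y - x)) \<le> norm (B * u y)"
        using mult_right_mono[OF _ abs_ge_zero[of "u y"]] by (simp add: abs_mult mult.commute[of "\<bar>u y\<bar>"])
    qed
  qed measurable
qed

lemma integral_mult_bound:
  fixes u f :: "'a \<Rightarrow> real"
  assumes u: "integrable M u" and i: "integrable M (\<lambda>y. u y * f y)" and f: "\<And>y. \<bar>f y\<bar> \<le> e"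
  shows "\<bar>\<integral>y. u y * f y \<partial>M\<bar> \<le> e * (\<integral>y. \<bar>u y\<bar> \<partial>M)"
proof -
  have "\<bar>\<integral>y. u y * f y \<partial>M\<bar> \<le> (\<integral>y. \<bar>u y * f y\<bar> \<partial>M)" by (rule integral_abs_bound)
  also have "\<dots> \<le> (\<integral>y. e * \<bar>u y\<bar> \<partial>M)"
  proof (rule integral_mono)
    show "integrable M (\<lambda>y. \<bar>u y * f y\<bar>)" by (rule integrable_abs[OF i])
    show "\<bar>u y * f y\<bar> \<le> e * \<bar>u y\<bar>" for y
      using mult_right_mono[OF f abs_ge_zero[of "u y"], of y] by (simp add: abs_mult mult.commute)
  qed (use u in simp)
  finally show ?thesis by simp
qed


lemma correlate_continuous:
  fixes u m :: "real ^ 'n \<Rightarrow> real"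
  assumes u: "integrable lborel u" and c: "continuous_on UNIV m" and z: "\<And>x. x \<notin> cball 0 R \<Longrightarrow> m x = 0"
  shows "continuous_on UNIV (correlate u m)"
  unfolding continuous_on_iff
proof (intro ballI allI impI)
  fix x and e :: real assume e: "0 < e"
  define I where "I = (\<integral>y. \<bar>u y\<bar> \<partial>lborel)"
  have I: "I \<ge> 0" by (simp add: I_def)
  have e': "0 < e / (I + 1)" using e I by simp
  obtain d where d: "d > 0" "\<And>x y. norm (x - y) < d \<Longrightarrow> \<bar>m x - m y\<bar> \<le> e / (I + 1)"
    using compact_support_uniform[OF c z e'] by blast
  have "dist (correlate u m x') (correlate u m x) < e" if "dist x' x < d" for x'
  proof -
    have i: "integrable lborel (\<lambda>y. u y * m (y - x))" for x by (rule integrable_correlate[OF u c z])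
    have eq: "correlate u m x' - correlate u m x = (\<integral>y. u y * (m (y - x') - m (y - x)) \<partial>lborel)"
      unfolding correlate_def right_diff_distrib by (rule Bochner_Integration.integral_diff[symmetric]) (rule i)+
    have "\<bar>correlate u m x' - correlate u m x\<bar> \<le> e / (I + 1) * I"
      unfolding eq I_def
    proof (rule integral_mult_bound[OF u])
      show "integrable lborel (\<lambda>y. u y * (m (y - x') - m (y - x)))"
        unfolding right_diff_distrib by (intro Bochner_Integration.integrable_diff i)
      show "\<bar>m (y - x') - m (y - x)\<bar> \<le> e / ((\<integral>y. \<bar>u y\<bar> \<partial>lborel) + 1)" for y
        using d(2)[of "y - x'" "y - x"] that unfolding I_def by (simp add: dist_norm norm_minus_commute)
    qed
    also have "\<dots> < e" using e I by (simp add: field_simps)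
    finally show ?thesis by (simp add: dist_real_def)
  qed
  then show "\<exists>d>0. \<forall>x'\<in>UNIV. dist x' x < d \<longrightarrow> dist (correlate u m x') (correlate u m x) < e" using d(1) by blast
qed

lemma derivative_zero_outside:
  fixes f :: "real ^ 'n \<Rightarrow> real"
  assumes z: "\<And>x. x \<notin> cball 0 R \<Longrightarrow> f x = 0" and D: "(f has_derivative D) (at x)" and x: "x \<notin> cball 0 R"
  shows "D = (\<lambda>h. 0)"
proof -
  have "(f has_derivative (\<lambda>h. 0)) (at x)"
  proof (rule has_derivative_transform_within_open[OF has_derivative_const])
    show "open (- cball (0 :: real ^ 'n) R)" by (simp add: open_Compl)
  qed (use x z in auto)
  then show ?thesis using has_derivative_unique[OF D] by simp
qed

text \<open>
  Differentiation under the integral: the partial derivatives of \<open>m\<close> are uniformly continuous,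
  so the remainder of its linearization is uniformly small compared with the increment.
\<close>

lemma correlate_has_derivative:
  fixes u m :: "real ^ 'n \<Rightarrow> real"
  assumes u: "integrable lborel u" and C1: "Ck_fun 1 m" and z: "\<And>x. x \<notin> cball 0 R \<Longrightarrow> m x = 0"
  shows "(correlate u m has_derivative
     (\<lambda>h. \<Sum>b\<in>Basis. (h \<bullet> b) * - correlate u (\<lambda>x. frechet_derivative m (at x) b) x)) (at x)"
proof -
  define D where "D x = frechet_derivative m (at x)" for x
  have D: "(m has_derivative D x) (at x)" for x
    unfolding D_def using Ck_SucD(1)[of 0 m x] C1 by simp
  have Dc: "continuous_on UNIV (\<lambda>x. D x b)" if "b \<in> Basis" for b
    using Ck_SucD(2)[of 0 m b] C1 that by (simp add: D_def)
  have Dz: "D x b = 0" if "x \<notin> cball 0 R" for x b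
    using derivative_zero_outside[OF z D that] by simp
  have mc: "continuous_on UNIV m" using Ck_continuous[OF C1] .
  have Dlin: "D x h = (\<Sum>b\<in>Basis. (h \<bullet> b) * D x b)" for x h
  proof -
    have "linear (D x)" using D has_derivative_linear by blast
    have "D x h = D x (\<Sum>b\<in>Basis. (h \<bullet> b) *\<^sub>R b)" by (simp only: euclidean_representation)
    also have "\<dots> = (\<Sum>b\<in>Basis. (h \<bullet> b) * D x b)"
      using \<open>linear (D x)\<close> by (simp add: linear_sum linear_scale)
    finally show ?thesis .
  qed
  have iD: "integrable lborel (\<lambda>y. u y * D (y - x) b)" if "b \<in> Basis" for b
    by (rule integrable_correlate[OF u Dc[OF that] Dz])
  have iDh: "integrable lborel (\<lambda>y. u y * D (y - x) h)" for h
  proof -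
    have "integrable lborel (\<lambda>y. \<Sum>b\<in>Basis. (h \<bullet> b) * (u y * D (y - x) b))"
      by (intro Bochner_Integration.integrable_sum integrable_mult_right iD)
    moreover have "(\<Sum>b\<in>Basis. (h \<bullet> b) * (u y * D (y - x) b)) = u y * D (y - x) h" for y
      by (subst Dlin) (simp add: sum_distrib_left mult.left_commute)
    ultimately show ?thesis by simp
  qed
  let ?T = "\<lambda>h. \<Sum>b\<in>Basis. (h \<bullet> b) * - correlate u (\<lambda>x. D x b) x"
  have T: "?T h = - (\<integral>y. u y * D (y - x) h \<partial>lborel)" for h
  proof -
    have "(\<integral>y. u y * D (y - x) h \<partial>lborel) = (\<integral>y. (\<Sum>b\<in>Basis. (h \<bullet> b) * (u y * D (y - x) b)) \<partial>lborel)"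
      by (subst Dlin) (simp add: sum_distrib_left mult.left_commute)
    also have "\<dots> = (\<Sum>b\<in>Basis. \<integral>y. (h \<bullet> b) * (u y * D (y - x) b) \<partial>lborel)"
      by (rule Bochner_Integration.integral_sum) (intro integrable_mult_right iD)
    also have "\<dots> = (\<Sum>b\<in>Basis. (h \<bullet> b) * correlate u (\<lambda>x. D x b) x)" by (simp add: correlate_def)
    finally show ?thesis by (simp add: sum_negf)
  qed
  have "(correlate u m has_derivative ?T) (at x)"
    unfolding has_derivative_at_alt
  proof (intro conjI allI impI)
    show "bounded_linear ?T" by (intro bounded_linear_intros)
    fix e :: real assume e: "0 < e"
    define I where "I = (\<integral>y. \<bar>u y\<bar> \<partial>lborel)"
    have I: "I \<ge> 0" by (simp add: I_def)
    define e1 where "e1 = e / (I + 1)"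
    have e1: "e1 > 0" using e I by (simp add: e1_def)
    define e2 where "e2 = e1 / real CARD('n)"
    have e2: "e2 > 0" using e1 by (simp add: e2_def)
    have "\<exists>d>0. \<forall>x y. norm (x - y) < d \<longrightarrow> \<bar>D x b - D y b\<bar> \<le> e2" if "b \<in> Basis" for b
      using compact_support_uniform[OF Dc[OF that] Dz e2] by metis
    then obtain d where d: "\<And>b. b \<in> Basis \<Longrightarrow> d b > 0"
      "\<And>b x y. b \<in> Basis \<Longrightarrow> norm (x - y) < d b \<Longrightarrow> \<bar>D x b - D y b\<bar> \<le> e2" by metis
    define d0 where "d0 = Min (d ` (Basis :: (real ^ 'n) set))"
    have d0: "d0 > 0" "\<And>b. b \<in> Basis \<Longrightarrow> d0 \<le> d b" unfolding d0_def using d(1) by (auto simp: Min_gr_iff)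
    have Dop: "onorm (\<lambda>h. D z h - D z' h) \<le> e1" if "norm (z - z') < d0" for z z'
    proof (rule onorm_le)
      fix h
      have "D z h - D z' h = (\<Sum>b\<in>Basis. (h \<bullet> b) * (D z b - D z' b))"
        by (subst (1 2) Dlin) (simp add: sum_subtractf right_diff_distrib)
      also have "norm \<dots> \<le> (\<Sum>b\<in>Basis. norm ((h \<bullet> b) * (D z b - D z' b)))" by (rule norm_sum)
      also have "\<dots> \<le> (\<Sum>b\<in>(Basis :: (real ^ 'n) set). norm h * e2)"
      proof (rule sum_mono)
        fix b :: "real ^ 'n" assume b: "b \<in> Basis"
        have "\<bar>D z b - D z' b\<bar> \<le> e2" using d(2)[OF b, of z z'] d0(2)[OF b] that by simp
        then show "norm ((h \<bullet> b) * (D z b - D z' b)) \<le> norm h * e2"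
          using Basis_le_norm[OF b, of h] by (simp add: abs_mult mult_mono)
      qed
      also have "\<dots> = e1 * norm h" by (simp add: e2_def)
      finally show "norm (D z h - D z' h) \<le> e1 * norm h" .
    qed
    have lin: "\<bar>m (z + h) - m z - D z h\<bar> \<le> e1 * norm h" if "norm h < d0" for z h
    proof -
      have "norm (m (z + h) - m z - D z (z + h - z)) \<le> norm (z + h - z) * e1"
      proof (rule differentiable_bound_linearization[where S="cball z (norm h)" and f'=D])
        fix t :: real assume "t \<in> {0..1}"
        then show "z + t *\<^sub>R (z + h - z) \<in> cball z (norm h)"
          by (simp add: dist_norm mult_left_le_one_le)
      next
        fix x' assume "x' \<in> cball z (norm h)"
        then have "norm (x' - z) < d0" using \<open>norm h < d0\<close> by (simp add: dist_norm norm_minus_commute)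
        then show "onorm (D x' - D z) \<le> e1" using Dop[of x' z] by (simp add: fun_diff_def)
      qed (use D in \<open>auto intro: has_derivative_at_withinI\<close>)
      then show ?thesis by (simp add: mult.commute)
    qed
    have "norm (correlate u m y - correlate u m x - ?T (y - x)) \<le> e * norm (y - x)" if "norm (y - x) < d0" for y
    proof -
      let ?R = "\<lambda>w. m (w - y) - m (w - x) + D (w - x) (y - x)"
      have i: "integrable lborel (\<lambda>y. u y * m (y - x))" for x by (rule integrable_correlate[OF u mc z])
      have iR: "integrable lborel (\<lambda>w. u w * ?R w)"
        unfolding right_diff_distrib distrib_left
        by (intro Bochner_Integration.integrable_add Bochner_Integration.integrable_diff i iDh)
      have "correlate u m y - correlate u m x - ?T (y - x) = (\<integral>w. u w * ?R w \<partial>lborel)"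
        unfolding correlate_def[of u m] T right_diff_distrib distrib_left
        by (simp add: Bochner_Integration.integral_add Bochner_Integration.integral_diff i iDh)
      also have "\<bar>\<dots>\<bar> \<le> (e1 * norm (y - x)) * I"
        unfolding I_def
      proof (rule integral_mult_bound[OF u iR])
        fix w
        have l: "linear (D (w - x))" using D has_derivative_linear by blast
        show "\<bar>?R w\<bar> \<le> e1 * norm (y - x)"
          using lin[of "- (y - x)" "w - x"] that linear_neg[OF l, of "y - x"] by (simp add: norm_minus_commute)
      qed
      also have "\<dots> = (e1 * I) * norm (y - x)" by simp
      also have "\<dots> \<le> e * norm (y - x)"
        using e I by (intro mult_right_mono) (auto simp: e1_def field_simps)
      finally show ?thesis by simp
    qed
    then show "\<exists>d>0. \<forall>y. norm (y - x) < d \<longrightarrow> norm (correlate u m y - correlate u m x - ?T (y - x)) \<le> e * norm (y - x)"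
      using d0(1) by blast
  qed
  then show ?thesis unfolding D_def .
qed

lemma Ck_correlate:
  fixes u m :: "real ^ 'n \<Rightarrow> real"
  assumes u: "integrable lborel u" and "\<And>k. Ck_fun k m" and "\<And>x. x \<notin> cball 0 R \<Longrightarrow> m x = 0"
  shows "Ck_fun k (correlate u m)"
  using assms(2,3)
proof (induction k arbitrary: m)
  case 0
  then show ?case using correlate_continuous[OF u Ck_continuous[OF 0(1)] 0(2)] by simp
next
  case (Suc k)
  have D: "(m has_derivative frechet_derivative m (at x)) (at x)" for x
    using Ck_SucD(1) Suc.prems(1) by blast
  show ?case
  proof (rule Ck_SucI[OF correlate_has_derivative[OF u Suc.prems(1,2)]])
    fix b :: "real ^ 'n" assume b: "b \<in> Basis"
    have "(\<lambda>x. \<Sum>b'\<in>Basis. (b \<bullet> b') * - correlate u (\<lambda>x. frechet_derivative m (at x) b') x) =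
       (\<lambda>x. (-1) * correlate u (\<lambda>x. frechet_derivative m (at x) b) x)"
    proof -
      have "(\<Sum>b'\<in>Basis. (b \<bullet> b') * F b') = F b" for F :: "real ^ 'n \<Rightarrow> real"
        using b by (simp add: inner_Basis if_distrib[of "\<lambda>c. c * _"] cong: if_cong)
      then show ?thesis by (simp only: mult_minus1)
    qed
    moreover have "Ck_fun k (\<lambda>x. (-1) * correlate u (\<lambda>x. frechet_derivative m (at x) b) x)"
    proof (intro Ck_mult Ck_const Suc.IH)
      show "Ck_fun k (\<lambda>x. frechet_derivative m (at x) b)" for k
        using Ck_SucD(2)[OF Suc.prems(1) b] .
      show "frechet_derivative m (at x) b = 0" if "x \<notin> cball 0 R" for x
        using derivative_zero_outside[OF Suc.prems(2) D that] by simp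
    qed
    ultimately show "Ck_fun k (\<lambda>x. \<Sum>b'\<in>Basis. (b \<bullet> b') * - correlate u (\<lambda>x. frechet_derivative m (at x) b') x)" by simp
  qed
qed

text \<open>
  Jensen's inequality for the square, obtained from the Cauchy--Schwarz inequality for
  \<open>G * sqrt m\<close> and \<open>sqrt m\<close>.
\<close>

lemma weighted_average_sq:
  fixes m G :: "'a::euclidean_space \<Rightarrow> real"
  assumes [measurable]: "m \<in> borel_measurable borel" "G \<in> borel_measurable borel"
    and m0: "\<And>h. m h \<ge> 0" and mi: "integrable lborel m" and m1: "(\<integral>h. m h \<partial>lborel) = 1"
  shows "ennreal ((\<integral>h. G h * m h \<partial>lborel)\<^sup>2) \<le> (\<integral>\<^sup>+h. ennreal (m h) * ennreal ((G h)\<^sup>2) \<partial>lborel)"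
proof -
  let ?f = "\<lambda>h. G h * sqrt (m h)" and ?g = "\<lambda>h. sqrt (m h)"
  have f: "L2sq lborel ?f = (\<integral>\<^sup>+h. ennreal (m h) * ennreal ((G h)\<^sup>2) \<partial>lborel)"
    unfolding L2sq_def using m0 by (simp add: power_mult_distrib ennreal_mult' mult.commute)
  have "L2sq lborel ?g = (\<integral>\<^sup>+h. ennreal (m h) \<partial>lborel)"
    unfolding L2sq_def using m0 by simp
  also have "\<dots> = 1" using nn_integral_eq_integral[OF mi] m0 m1 by simp
  finally have g: "L2sq lborel ?g = 1" .
  then have g': "L2n lborel ?g = 1" by (simp add: L2n_def)
  show ?thesis
  proof (cases "L2sq lborel ?f < top")
    case True
    have "\<bar>\<integral>h. ?f h * ?g h \<partial>lborel\<bar> \<le> L2n lborel ?f * L2n lborel ?g"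
      by (rule integrable_mult_L2) (use True g in auto)
    moreover have "?f h * ?g h = G h * m h" for h using m0[of h] by (simp add: mult.assoc)
    ultimately have "\<bar>\<integral>h. G h * m h \<partial>lborel\<bar> \<le> L2n lborel ?f" using g' by simp
    then have "(\<integral>h. G h * m h \<partial>lborel)\<^sup>2 \<le> (L2n lborel ?f)\<^sup>2"
      by (intro abs_le_square_iff[THEN iffD1]) simp
    then have "ennreal ((\<integral>h. G h * m h \<partial>lborel)\<^sup>2) \<le> L2sq lborel ?f"
      unfolding L2sq_eq_L2n[OF True] by (rule ennreal_leI)
    then show ?thesis unfolding f .
  next
    case False
    then show ?thesis unfolding f by (simp add: top.not_eq_extremum[symmetric])
  qed
qed

lemma correlate_shift:
  fixes u m :: "real ^ 'n \<Rightarrow> real"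
  assumes [measurable]: "u \<in> borel_measurable borel" "m \<in> borel_measurable borel"
  shows "correlate u m x = (\<integral>h. u (x + h) * m h \<partial>lborel)"
  using lborel_integral_translate[of "\<lambda>y. u y * m (y - x)" x] by (simp add: correlate_def add.commute)

lemma correlate_diff_L2:
  fixes g m :: "real ^ 'n \<Rightarrow> real"
  assumes g: "integrable lborel g" and c: "continuous_on UNIV m" and z: "\<And>x. x \<notin> cball 0 R \<Longrightarrow> m x = 0"
    and m0: "\<And>h. m h \<ge> 0" and mi: "integrable lborel m" and m1: "(\<integral>h. m h \<partial>lborel) = 1"
  shows "L2sq lborel (\<lambda>x. correlate g m x - g x) \<le> (\<integral>\<^sup>+h. ennreal (m h) * L2sq lborel (\<lambda>x. g (x + h) - g x) \<partial>lborel)"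
proof -
  have gm [measurable]: "g \<in> borel_measurable borel" "m \<in> borel_measurable borel" using g mi by simp_all
  have eq: "correlate g m x - g x = (\<integral>h. (g (x + h) - g x) * m h \<partial>lborel)" for x
  proof -
    have "integrable lborel (\<lambda>h. g (h + x) * m ((h + x) - x))"
      by (rule lborel_integrable_translate[OF integrable_correlate[OF g c z]])
    then have "integrable lborel (\<lambda>h. g (x + h) * m h)" by (simp add: add.commute)
    moreover have "integrable lborel (\<lambda>h. g x * m h)" using mi by simp
    ultimately have "(\<integral>h. g (x + h) * m h - g x * m h \<partial>lborel) = correlate g m x - g x * (\<integral>h. m h \<partial>lborel)"
      unfolding correlate_shift[OF gm] by (subst Bochner_Integration.integral_diff) auto
    then show ?thesis by (simp add: m1 left_diff_distrib)
  qed
  have "L2sq lborel (\<lambda>x. correlate g m x - g x) \<le> (\<integral>\<^sup>+x. \<integral>\<^sup>+h. ennreal (m h) * ennreal ((g (x + h) - g x)\<^sup>2) \<partial>lborel \<partial>lborel)"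
    unfolding L2sq_def eq real_norm_def power2_abs
    by (intro nn_integral_mono weighted_average_sq m0 mi m1) measurable
  also have "\<dots> = (\<integral>\<^sup>+h. \<integral>\<^sup>+x. ennreal (m h) * ennreal ((g (x + h) - g x)\<^sup>2) \<partial>lborel \<partial>lborel)"
    by (rule lborel_pair.Fubini') measurable
  also have "\<dots> = (\<integral>\<^sup>+h. ennreal (m h) * L2sq lborel (\<lambda>x. g (x + h) - g x) \<partial>lborel)"
    unfolding L2sq_def by (subst nn_integral_cmult) auto
  finally show ?thesis .
qed

lemma correlate_diff_L2_le:
  fixes g m :: "real ^ 'n \<Rightarrow> real"
  assumes g: "integrable lborel g" and c: "continuous_on UNIV m" and z: "\<And>x. x \<notin> cball 0 R \<Longrightarrow> m x = 0"
    and m0: "\<And>h. m h \<ge> 0" and mi: "integrable lborel m" and m1: "(\<integral>h. m h \<partial>lborel) = 1"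
    and bd: "\<And>h. norm h \<le> R \<Longrightarrow> L2sq lborel (\<lambda>x. g (x + h) - g x) \<le> e"
  shows "L2sq lborel (\<lambda>x. correlate g m x - g x) \<le> e"
proof -
  have [measurable]: "m \<in> borel_measurable borel" using mi by simp
  have "L2sq lborel (\<lambda>x. correlate g m x - g x) \<le> (\<integral>\<^sup>+h. ennreal (m h) * L2sq lborel (\<lambda>x. g (x + h) - g x) \<partial>lborel)"
    by (rule correlate_diff_L2[OF g c z m0 mi m1])
  also have "\<dots> \<le> (\<integral>\<^sup>+h. ennreal (m h) * e \<partial>lborel)"
  proof (rule nn_integral_mono)
    fix h
    show "ennreal (m h) * L2sq lborel (\<lambda>x. g (x + h) - g x) \<le> ennreal (m h) * e"
      using bd[of h] z[of h] by (cases "norm h \<le> R") (auto intro: mult_left_mono)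
  qed
  also have "\<dots> = (\<integral>\<^sup>+h. ennreal (m h) \<partial>lborel) * e" by (rule nn_integral_multc) measurable
  also have "(\<integral>\<^sup>+h. ennreal (m h) \<partial>lborel) = 1" using nn_integral_eq_integral[OF mi] m0 m1 by simp
  finally show ?thesis by simp
qed

text \<open>
  Dividing by the dimension puts the cube of \<open>bump\<close> inside the ball of radius \<open>\<delta>\<close>.
\<close>

definition mollifier :: "real \<Rightarrow> real ^ 'n \<Rightarrow> real" where
  "mollifier \<delta> x = inverse (\<integral>y. bump (\<delta> / real CARD('n)) (y :: real ^ 'n) \<partial>lborel) * bump (\<delta> / real CARD('n)) x"

lemma mollifier_props:
  assumes d: "\<delta> > 0"
  shows "Ck_fun k (mollifier \<delta> :: real ^ 'n \<Rightarrow> real)" "continuous_on UNIV (mollifier \<delta> :: real ^ 'n \<Rightarrow> real)"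
    "\<And>x :: real ^ 'n. x \<notin> cball 0 \<delta> \<Longrightarrow> mollifier \<delta> x = 0" "\<And>x :: real ^ 'n. mollifier \<delta> x \<ge> 0"
    "integrable lborel (mollifier \<delta> :: real ^ 'n \<Rightarrow> real)" "(\<integral>x. mollifier \<delta> (x :: real ^ 'n) \<partial>lborel) = 1"
proof -
  have d': "\<delta> / real CARD('n) > 0" using d by simp
  note i = bump_integral[OF d', where 'n='n]
  show Ck: "Ck_fun k (mollifier \<delta> :: real ^ 'n \<Rightarrow> real)" for k
    unfolding mollifier_def[abs_def] by (intro Ck_mult Ck_const Ck_bump)
  show "continuous_on UNIV (mollifier \<delta> :: real ^ 'n \<Rightarrow> real)" by (rule Ck_continuous[OF Ck])
  show "mollifier \<delta> x = 0" if "x \<notin> cball 0 \<delta>" for x :: "real ^ 'n"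
    using bump_support[of "\<delta> / real CARD('n)" x] that by (auto simp: mollifier_def)
  show "mollifier \<delta> x \<ge> 0" for x :: "real ^ 'n"
    unfolding mollifier_def using i(2) bump_nonneg by (intro mult_nonneg_nonneg) auto
  show "integrable lborel (mollifier \<delta> :: real ^ 'n \<Rightarrow> real)" unfolding mollifier_def[abs_def] using i(1) by simp
  show "(\<integral>x. mollifier \<delta> (x :: real ^ 'n) \<partial>lborel) = 1" unfolding mollifier_def using i(2) by simp
qed

lemma integrable_L2_compact:
  fixes v :: "real ^ 'n \<Rightarrow> real"
  assumes [measurable]: "v \<in> borel_measurable borel" and fin: "L2sq lborel v < top"
    and supp: "\<And>x. x \<notin> cball 0 R \<Longrightarrow> v x = 0"
  shows "integrable lborel v"
proof -
  have "trunc (R + 1) v = v" using supp by (auto simp: indicator_def fun_eq_iff)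
  then show ?thesis using trunc_props(1)[OF assms(1) fin, of "R + 1"] by simp
qed

text \<open>
  A mollification is an average of translations, hence close to the identity in the mean, and
  it commutes with increments, so that \<open>gagliardo_dominated\<close> applies.
\<close>

lemma mollify_energy:
  fixes v :: "real ^ 'n \<Rightarrow> real"
  assumes vm [measurable]: "v \<in> borel_measurable borel" and fin: "energy a v < top"
    and supp: "\<And>x. x \<notin> cball 0 R \<Longrightarrow> v x = 0"
    and d: "\<And>j. \<delta> j > 0" "\<delta> \<longlonglongrightarrow> 0"
  shows "(\<lambda>j. energy a (\<lambda>x. correlate v (mollifier (\<delta> j)) x - v x)) \<longlonglongrightarrow> 0"
proof -
  have vfin: "L2sq lborel v < top" "gagliardo a v < top" using fin by (auto simp: energy_def)
  have vi: "integrable lborel v" by (rule integrable_L2_compact[OF vm vfin(1) supp])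
  note m = mollifier_props[OF d(1), where 'n='n]
  have [measurable]: "(mollifier (\<delta> j) :: real ^ 'n \<Rightarrow> real) \<in> borel_measurable borel" for j
    by (rule borel_measurable_continuous_onI[OF m(2)])
  have cm [measurable]: "correlate v (mollifier (\<delta> j)) \<in> borel_measurable borel" for j
    by (rule borel_measurable_continuous_onI[OF correlate_continuous[OF vi m(2,3)]])
  have small: "(\<lambda>j. L2sq lborel (\<lambda>x. correlate g (mollifier (\<delta> j)) x - g x)) \<longlonglongrightarrow> 0"
    if gi: "integrable lborel g" and gfin: "L2sq lborel g < top" for g :: "real ^ 'n \<Rightarrow> real"
  proof (rule order_tendstoI)
    have gm [measurable]: "g \<in> borel_measurable borel" using gi by simp
    fix c :: ennreal assume "0 < c"
    then obtain e where e: "0 < e" "ennreal e < c" by (rule ennreal_approx_below)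
    have "\<forall>\<^sub>F h in nhds 0. L2sq lborel (\<lambda>x. g (x + h) - g x) < ennreal e"
      using order_tendstoD(2)[OF L2_translation_continuous[OF gm gfin], of "ennreal e"] e(1) by simp
    then obtain r where r: "r > 0" "\<And>h. norm h < r \<Longrightarrow> L2sq lborel (\<lambda>x. g (x + h) - g x) < ennreal e"
      unfolding eventually_nhds_metric by (auto simp: dist_norm)
    have "\<forall>\<^sub>F j in sequentially. \<delta> j < r" using order_tendstoD(2)[OF d(2) r(1)] .
    then show "\<forall>\<^sub>F j in sequentially. L2sq lborel (\<lambda>x. correlate g (mollifier (\<delta> j)) x - g x) < c"
    proof eventually_elim
      case (elim j)
      have "L2sq lborel (\<lambda>x. correlate g (mollifier (\<delta> j)) x - g x) \<le> ennreal e"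
        by (rule correlate_diff_L2_le[OF gi m(2-6)]) (use elim r(2) in \<open>auto simp: less_imp_le\<close>)
      then show ?case using e(2) by (rule order_le_less_trans)
    qed
  qed auto
  have bdd: "L2sq lborel (\<lambda>x. correlate g (mollifier (\<delta> j)) x - g x) \<le> 4 * L2sq lborel g" if gi: "integrable lborel g" for g :: "real ^ 'n \<Rightarrow> real" and j
  proof (rule correlate_diff_L2_le[OF gi m(2-6)])
    fix h
    have [measurable]: "g \<in> borel_measurable borel" using gi by simp
    have "L2sq lborel (\<lambda>x. g (x + h) - g x) \<le> 2 * L2sq lborel (\<lambda>x. g (x + h)) + 2 * L2sq lborel g"
      by (rule L2sq_diff_le) measurable
    also have "L2sq lborel (\<lambda>x. g (x + h)) = L2sq lborel g" by (rule L2sq_translate) measurable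
    finally show "L2sq lborel (\<lambda>x. g (x + h) - g x) \<le> 4 * L2sq lborel g" by (simp flip: distrib_right)
  qed
  have shift: "correlate v (mollifier (\<delta> j)) (x + s) - v (x + s) - (correlate v (mollifier (\<delta> j)) x - v x) =
      correlate (\<lambda>x. v (x + s) - v x) (mollifier (\<delta> j)) x - (v (x + s) - v x)" for x s j
  proof -
    have i: "integrable lborel (\<lambda>y. v y * mollifier (\<delta> j) (y - x))" for x by (rule integrable_correlate[OF vi m(2,3)])
    have "integrable lborel (\<lambda>y. v (y + s) * mollifier (\<delta> j) ((y + s) - (x + s)))"
      by (rule lborel_integrable_translate[OF i])
    then have i2: "integrable lborel (\<lambda>y. v (y + s) * mollifier (\<delta> j) (y - x))" by simp
    have "correlate v (mollifier (\<delta> j)) (x + s) = (\<integral>y. v (y + s) * mollifier (\<delta> j) (y - x) \<partial>lborel)"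
      using lborel_integral_translate[of "\<lambda>y. v y * mollifier (\<delta> j) (y - (x + s))" s] by (simp add: correlate_def)
    then have "correlate v (mollifier (\<delta> j)) (x + s) - correlate v (mollifier (\<delta> j)) x = correlate (\<lambda>x. v (x + s) - v x) (mollifier (\<delta> j)) x"
      unfolding correlate_def left_diff_distrib by (subst Bochner_Integration.integral_diff[OF i2 i]) simp
    then show ?thesis by simp
  qed
  have gi: "integrable lborel (\<lambda>x. v (x + s) - v x)" for s
    by (intro Bochner_Integration.integrable_diff lborel_integrable_translate vi)
  have "(\<lambda>j. gagliardo a (\<lambda>x. correlate v (mollifier (\<delta> j)) x - v x)) \<longlonglongrightarrow> 0"
    by (rule gagliardo_dominated[where v=v]) (use vfin small[OF gi] bdd[OF gi] in \<open>auto simp: shift\<close>)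
  from tendsto_add[OF small[OF vi vfin(1)] this] show ?thesis by (simp add: energy_def)
qed

lemma correlate_support:
  fixes u m :: "real ^ 'n \<Rightarrow> real"
  assumes "\<And>x. x \<notin> cball 0 R \<Longrightarrow> m x = 0" "correlate u m x \<noteq> 0"
  shows "\<exists>y. u y \<noteq> 0 \<and> dist x y \<le> R"
proof (rule ccontr)
  assume "\<not> ?thesis"
  then have "u y * m (y - x) = 0" for y
    using assms(1)[of "y - x"] by (cases "u y = 0") (auto simp: dist_norm norm_minus_commute)
  then have "correlate u m x = 0" unfolding correlate_def by (simp only: Bochner_Integration.integral_zero)
  then show False using assms(2) by simp
qed

section \<open>The closure of the test functions\<close>

lemma test_function_props:
  assumes "\<phi> \<in> test_functions U"
  shows "continuous_on UNIV \<phi>" "\<phi> \<in> borel_measurable borel" "\<And>x. x \<notin> U \<Longrightarrow> \<phi> x = 0"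
    "\<exists>R. \<forall>x. x \<notin> cball 0 R \<longrightarrow> \<phi> x = 0" "Ck_fun k \<phi>"
proof -
  show "Ck_fun k \<phi>" for k using assms by (simp add: test_functions_def)
  then show c: "continuous_on UNIV \<phi>" by (rule Ck_continuous)
  then show "\<phi> \<in> borel_measurable borel" by (rule borel_measurable_continuous_onI)
  show "\<phi> x = 0" if "x \<notin> U" for x
    using assms that closure_subset[of "{x. \<phi> x \<noteq> 0}"] by (auto simp: test_functions_def)
  have "bounded {x. \<phi> x \<noteq> 0}"
    using assms compact_imp_bounded bounded_subset closure_subset unfolding test_functions_def by blast
  then obtain R where "\<forall>x\<in>{x. \<phi> x \<noteq> 0}. norm x \<le> R" by (auto simp: bounded_iff)
  then show "\<exists>R. \<forall>x. x \<notin> cball 0 R \<longrightarrow> \<phi> x = 0" by (intro exI[of _ R]) auto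
qed

lemma Ck_compact_lipschitz:
  fixes \<phi> :: "real ^ 'n \<Rightarrow> real"
  assumes C1: "Ck_fun 1 \<phi>" and z: "\<And>x. x \<notin> cball 0 R \<Longrightarrow> \<phi> x = 0"
  obtains L where "L \<ge> 0" "\<And>x y. \<bar>\<phi> x - \<phi> y\<bar> \<le> L * norm (x - y)"
proof -
  define D where "D x = frechet_derivative \<phi> (at x)" for x
  have D: "(\<phi> has_derivative D x) (at x)" for x
    unfolding D_def using Ck_SucD(1)[of 0 \<phi> x] C1 by simp
  have Dc: "continuous_on UNIV (\<lambda>x. D x b)" if "b \<in> Basis" for b
    using Ck_SucD(2)[of 0 \<phi> b] C1 that by (simp add: D_def)
  have Dz: "D x b = 0" if "x \<notin> cball 0 R" for x b
    using derivative_zero_outside[OF z D that] by simp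
  have "\<exists>B. \<forall>x. \<bar>D x b\<bar> \<le> B" if "b \<in> Basis" for b
    using compact_support_bounded[OF Dc[OF that] Dz] by metis
  then obtain B where B: "\<And>b x. b \<in> Basis \<Longrightarrow> \<bar>D x b\<bar> \<le> B b" by metis
  define L where "L = (\<Sum>b\<in>Basis. \<bar>B b\<bar>)"
  have "norm (D x h) \<le> L * norm h" for x h
  proof -
    have "linear (D x)" using D has_derivative_linear by blast
    have "D x h = D x (\<Sum>b\<in>Basis. (h \<bullet> b) *\<^sub>R b)" by (simp only: euclidean_representation)
    also have "\<dots> = (\<Sum>b\<in>Basis. (h \<bullet> b) * D x b)"
      using \<open>linear (D x)\<close> by (simp add: linear_sum linear_scale)
    also have "norm \<dots> \<le> (\<Sum>b\<in>Basis. norm ((h \<bullet> b) * D x b))" by (rule norm_sum)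
    also have "\<dots> \<le> (\<Sum>b\<in>Basis. \<bar>B b\<bar> * norm h)"
    proof (rule sum_mono)
      fix b :: "real ^ 'n" assume b: "b \<in> Basis"
      have "\<bar>h \<bullet> b\<bar> * \<bar>D x b\<bar> \<le> norm h * \<bar>B b\<bar>"
        using B[OF b, of x] Basis_le_norm[OF b, of h] by (intro mult_mono) auto
      then show "norm ((h \<bullet> b) * D x b) \<le> \<bar>B b\<bar> * norm h" by (simp add: abs_mult mult.commute)
    qed
    finally show ?thesis by (simp add: L_def sum_distrib_right)
  qed
  then have "onorm (D x) \<le> L" for x by (rule onorm_le)
  then have "norm (\<phi> x - \<phi> y) \<le> L * norm (x - y)" for x y
    by (intro differentiable_bound[of UNIV \<phi> D]) (use D in auto)
  then show ?thesis by (intro that[of L]) (auto simp: L_def sum_nonneg)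
qed

text \<open>
  The norm of \<open>u - \<phi>\<close> in the definition of \<open>sobolev_tilde\<close> bounds the energy of \<open>u - \<phi>\<close> only
  if this difference is a Sobolev function. Small increments are bounded by the Lipschitz
  constant on a fixed ball, large ones by the norm.
\<close>

lemma test_function_sobolev:
  fixes \<phi> :: "real ^ 'n \<Rightarrow> real"
  assumes a: "0 < a" "a < 1" and \<phi>: "\<phi> \<in> test_functions U"
  shows "\<phi> \<in> sobolev a"
proof -
  note p = test_function_props[OF \<phi>]
  have [measurable]: "\<phi> \<in> borel_measurable borel" by (rule p)
  obtain R where R: "\<And>x. x \<notin> cball 0 R \<Longrightarrow> \<phi> x = 0" using p(4) by blast
  obtain B where B: "\<And>x. \<bar>\<phi> x\<bar> \<le> B" using compact_support_bounded[OF p(1) R] by blast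
  obtain L where L: "L \<ge> 0" "\<And>x y. \<bar>\<phi> x - \<phi> y\<bar> \<le> L * norm (x - y)"
    using Ck_compact_lipschitz[OF p(5) R] by metis
  have fin: "L2sq lborel \<phi> < top" by (rule L2sq_bounded_support[OF B R])
  define V where "V = L2sq lborel (indicator (cball 0 (R + 1)) :: real ^ 'n \<Rightarrow> real)"
  have V: "V < top" unfolding V_def by (rule L2sq_bounded_support[of _ 1 "R + 1"]) (auto simp: indicator_def)
  define W where "W = ennreal (L\<^sup>2) * V + 4 * L2sq lborel \<phi>"
  have W: "W < top" using V fin by (simp add: W_def ennreal_mult_less_top)
  have bd: "L2sq lborel (\<lambda>x. \<phi> (x + s) - \<phi> x) \<le> W * ennreal (min 4 ((norm s)\<^sup>2))" for s
  proof (cases "norm s \<le> 1")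
    case True
    have "L2sq lborel (\<lambda>x. \<phi> (x + s) - \<phi> x) \<le> L2sq lborel (\<lambda>x :: real ^ 'n. (L * norm s) *\<^sub>R (indicator (cball 0 (R + 1)) x :: real))"
    proof (rule L2sq_mono_AE, rule AE_I2)
      fix x
      have "\<bar>\<phi> (x + s) - \<phi> x\<bar> \<le> L * norm s" using L(2)[of "x + s" x] by simp
      moreover have "\<phi> (x + s) = 0 \<and> \<phi> x = 0" if "x \<notin> cball 0 (R + 1)"
        using that True norm_triangle_ineq2[of x "- s"] by (intro conjI R) auto
      ultimately show "norm (\<phi> (x + s) - \<phi> x) \<le> norm ((L * norm s) *\<^sub>R (indicator (cball 0 (R + 1)) x :: real))"
        using L(1) by (cases "x \<in> cball 0 (R + 1)") auto
    qed
    also have "\<dots> = ennreal ((L * norm s)\<^sup>2) * V"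
      unfolding V_def by (rule L2sq_scale) measurable
    also have "\<dots> = (ennreal (L\<^sup>2) * V) * ennreal ((norm s)\<^sup>2)"
      by (simp add: power_mult_distrib ennreal_mult' mult_ac)
    also have "\<dots> \<le> W * ennreal ((norm s)\<^sup>2)" by (intro mult_right_mono) (auto simp: W_def)
    also have "(norm s)\<^sup>2 = min 4 ((norm s)\<^sup>2)" using power_mono[OF True, of 2] by simp
    finally show ?thesis .
  next
    case False
    have "L2sq lborel (\<lambda>x. \<phi> (x + s) - \<phi> x) \<le> 2 * L2sq lborel (\<lambda>x. \<phi> (x + s)) + 2 * L2sq lborel \<phi>"
      by (rule L2sq_diff_le) measurable
    also have "L2sq lborel (\<lambda>x. \<phi> (x + s)) = L2sq lborel \<phi>" by (rule L2sq_translate) measurable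
    also have "2 * L2sq lborel \<phi> + 2 * L2sq lborel \<phi> = 4 * L2sq lborel \<phi> * ennreal 1" by (simp flip: distrib_right)
    also have "\<dots> \<le> W * ennreal (min 4 ((norm s)\<^sup>2))"
      using False one_le_power[of "norm s" 2] by (intro mult_mono ennreal_leI) (auto simp: W_def)
    finally show ?thesis .
  qed
  have "gagliardo a \<phi> \<le> (\<integral>\<^sup>+s. W * ennreal (frac_kernel a s * min 4 ((norm (s :: real ^ 'n))\<^sup>2)) \<partial>lborel)"
    unfolding gagliardo_def
  proof (rule nn_integral_mono)
    fix s
    show "ennreal (frac_kernel a s) * L2sq lborel (\<lambda>x. \<phi> (x + s) - \<phi> x) \<le> W * ennreal (frac_kernel a s * min 4 ((norm s)\<^sup>2))"
      using mult_left_mono[OF bd[of s], of "ennreal (frac_kernel a s)"] by (simp add: ennreal_mult' mult_ac)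
  qed
  also have "\<dots> = W * (\<integral>\<^sup>+s. ennreal (frac_kernel a s * min 4 ((norm (s :: real ^ 'n))\<^sup>2)) \<partial>lborel)"
    by (rule nn_integral_cmult) measurable
  also have "\<dots> < top" using W frac_kernel_min_finite[OF a, where 'n='n] by (simp add: ennreal_mult_less_top)
  finally show ?thesis
    using fin by (simp add: sobolev_iff[OF a] energy_def borel_imp_lebesgue)
qed


lemma sobolev_norm_energy_bounds:
  assumes a: "0 < a" "a < 1"
  obtains C where "C > 0" "\<And>u :: real ^ 'n \<Rightarrow> real. u \<in> sobolev a \<Longrightarrow> energy a u < top"
    "\<And>u :: real ^ 'n \<Rightarrow> real. u \<in> sobolev a \<Longrightarrow> enn2real (energy a u) \<le> C * (sobolev_norm a u)\<^sup>2"
    "\<And>u :: real ^ 'n \<Rightarrow> real. u \<in> sobolev a \<Longrightarrow> (sobolev_norm a u)\<^sup>2 \<le> C * enn2real (energy a u)"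
proof -
  obtain C where C: "C > 0"
    "\<And>u :: real ^ 'n \<Rightarrow> real. u \<in> sobolev a \<Longrightarrow> L2sq lborel u + gagliardo a u \<le> ennreal (C * (sobolev_norm a u)\<^sup>2)"
    "\<And>u :: real ^ 'n \<Rightarrow> real. u \<in> sobolev a \<Longrightarrow> ennreal ((sobolev_norm a u)\<^sup>2) \<le> ennreal C * (L2sq lborel u + gagliardo a u)"
    using sobolev_energy[OF a, where 'n='n] by metis
  show ?thesis
  proof (rule that[OF C(1)])
    fix u :: "real ^ 'n \<Rightarrow> real" assume u: "u \<in> sobolev a"
    show fin: "energy a u < top" using sobolev_energy_finite[OF a u] .
    show "enn2real (energy a u) \<le> C * (sobolev_norm a u)\<^sup>2"
      using C(2)[OF u] C(1) by (intro enn2real_leI) (auto simp: energy_def)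
    have "ennreal ((sobolev_norm a u)\<^sup>2) \<le> ennreal (C * enn2real (energy a u))"
      using C(3)[OF u] C(1) fin by (simp add: energy_def ennreal_mult' ennreal_enn2real)
    then show "(sobolev_norm a u)\<^sup>2 \<le> C * enn2real (energy a u)"
      using C(1) by (subst (asm) ennreal_le_iff) auto
  qed
qed

lemma sobolev_norm_nonneg: "sobolev_norm a u \<ge> 0"
  unfolding sobolev_norm_def L2_norm_def by simp

lemma sobolev_tilde_iff:
  fixes u :: "real ^ 'n \<Rightarrow> real"
  assumes a: "0 < a" "a < 1"
  shows "u \<in> sobolev_tilde a U \<longleftrightarrow> u \<in> sobolev a \<and> (\<forall>e>0. \<exists>\<phi>\<in>test_functions U. energy a (\<lambda>x. u x - \<phi> x) < ennreal e)"
proof -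
  obtain C where C: "C > 0" "\<And>u :: real ^ 'n \<Rightarrow> real. u \<in> sobolev a \<Longrightarrow> energy a u < top"
    "\<And>u :: real ^ 'n \<Rightarrow> real. u \<in> sobolev a \<Longrightarrow> enn2real (energy a u) \<le> C * (sobolev_norm a u)\<^sup>2"
    "\<And>u :: real ^ 'n \<Rightarrow> real. u \<in> sobolev a \<Longrightarrow> (sobolev_norm a u)\<^sup>2 \<le> C * enn2real (energy a u)"
    using sobolev_norm_energy_bounds[OF a, where 'n='n] by metis
  have "(\<forall>\<epsilon>>0. \<exists>\<phi>\<in>test_functions U. sobolev_norm a (\<lambda>x. u x - \<phi> x) < \<epsilon>) \<longleftrightarrow>
     (\<forall>e>0. \<exists>\<phi>\<in>test_functions U. energy a (\<lambda>x. u x - \<phi> x) < ennreal e)" if u: "u \<in> sobolev a"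
  proof -
    have d: "(\<lambda>x. u x - \<phi> x) \<in> sobolev a" if "\<phi> \<in> test_functions U" for \<phi>
      by (rule sobolev_diff[OF a u test_function_sobolev[OF a that]])
    show ?thesis
    proof (intro iffI allI impI)
      fix e :: real assume e: "0 < e" and *: "\<forall>\<epsilon>>0. \<exists>\<phi>\<in>test_functions U. sobolev_norm a (\<lambda>x. u x - \<phi> x) < \<epsilon>"
      have "sqrt (e / C) > 0" using e C(1) by simp
      then obtain \<phi> where \<phi>: "\<phi> \<in> test_functions U" "sobolev_norm a (\<lambda>x. u x - \<phi> x) < sqrt (e / C)"
        using * by blast
      have "(sobolev_norm a (\<lambda>x. u x - \<phi> x))\<^sup>2 < (sqrt (e / C))\<^sup>2"
        using \<phi>(2) sobolev_norm_nonneg by (intro power_strict_mono) auto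
      then have "C * (sobolev_norm a (\<lambda>x. u x - \<phi> x))\<^sup>2 < e" using C(1) e by (simp add: field_simps)
      then have "enn2real (energy a (\<lambda>x. u x - \<phi> x)) < e" using C(3)[OF d[OF \<phi>(1)]] by simp
      then have "ennreal (enn2real (energy a (\<lambda>x. u x - \<phi> x))) < ennreal e" by (simp add: ennreal_less_iff)
      then show "\<exists>\<phi>\<in>test_functions U. energy a (\<lambda>x. u x - \<phi> x) < ennreal e"
        using \<phi>(1) C(2)[OF d[OF \<phi>(1)]] by (intro bexI[of _ \<phi>]) (auto simp: ennreal_enn2real)
    next
      fix \<epsilon> :: real assume e: "0 < \<epsilon>" and *: "\<forall>e>0. \<exists>\<phi>\<in>test_functions U. energy a (\<lambda>x. u x - \<phi> x) < ennreal e"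
      have "\<epsilon>\<^sup>2 / C > 0" using e C(1) by simp
      then obtain \<phi> where \<phi>: "\<phi> \<in> test_functions U" "energy a (\<lambda>x. u x - \<phi> x) < ennreal (\<epsilon>\<^sup>2 / C)"
        using * by blast
      have "ennreal (enn2real (energy a (\<lambda>x. u x - \<phi> x))) < ennreal (\<epsilon>\<^sup>2 / C)"
        using \<phi>(2) C(2)[OF d[OF \<phi>(1)]] by (simp add: ennreal_enn2real)
      then have "enn2real (energy a (\<lambda>x. u x - \<phi> x)) < \<epsilon>\<^sup>2 / C"
        by (simp add: ennreal_less_iff)
      then have "C * enn2real (energy a (\<lambda>x. u x - \<phi> x)) < \<epsilon>\<^sup>2" using C(1) by (simp add: field_simps)
      then have "(sobolev_norm a (\<lambda>x. u x - \<phi> x))\<^sup>2 < \<epsilon>\<^sup>2" using C(4)[OF d[OF \<phi>(1)]] by simp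
      then have "sobolev_norm a (\<lambda>x. u x - \<phi> x) < \<epsilon>" using e by (simp add: power2_less_imp_less)
      then show "\<exists>\<phi>\<in>test_functions U. sobolev_norm a (\<lambda>x. u x - \<phi> x) < \<epsilon>" using \<phi>(1) by blast
    qed
  qed
  then show ?thesis by (auto simp: sobolev_tilde_def)
qed

lemma sobolev_tilde_sobolev: "u \<in> sobolev_tilde r U \<Longrightarrow> u \<in> sobolev r"
  by (simp add: sobolev_tilde_def)

context
  fixes a :: real and U :: "(real ^ 'n) set"
  assumes a: "0 < a" "a < 1"
begin

lemma sobolev_tilde_closed:
  assumes z: "z \<in> sobolev a" and approx: "\<And>e. e > 0 \<Longrightarrow> \<exists>u\<in>sobolev_tilde a U. energy a (\<lambda>x. z x - u x) < ennreal e"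
  shows "z \<in> sobolev_tilde a U"
  unfolding sobolev_tilde_iff[OF a]
proof (intro conjI z allI impI)
  fix e :: real assume e: "0 < e"
  then have e4: "e / 4 > 0" by simp
  obtain u where u: "u \<in> sobolev_tilde a U" "energy a (\<lambda>x. z x - u x) < ennreal (e / 4)" using approx[OF e4] by blast
  obtain \<phi> where \<phi>: "\<phi> \<in> test_functions U" "energy a (\<lambda>x. u x - \<phi> x) < ennreal (e / 4)"
    using u(1) e4 unfolding sobolev_tilde_iff[OF a] by blast
  have s: "u \<in> sobolev a" "\<phi> \<in> sobolev a" using u(1) \<phi>(1) by (auto intro: sobolev_tilde_sobolev test_function_sobolev[OF a])
  have "energy a (\<lambda>x. z x - \<phi> x) = energy a (\<lambda>x. (z x - u x) + (u x - \<phi> x))" by simp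
  also have "\<dots> \<le> 2 * energy a (\<lambda>x. z x - u x) + 2 * energy a (\<lambda>x. u x - \<phi> x)"
    by (rule energy_add) (intro sobolev_measurable[OF a] sobolev_diff[OF a] z s)+
  also have "\<dots> < 2 * ennreal (e / 4) + 2 * ennreal (e / 4)"
    using u(2) \<phi>(2) by (intro add_strict_mono ennreal_mult_strict_left_mono) auto
  also have "\<dots> = ennreal e" using e
    by (simp add: ennreal_plus[symmetric] ennreal_numeral[symmetric] ennreal_mult'[symmetric] del: ennreal_plus ennreal_numeral)
  finally show "\<exists>\<phi>\<in>test_functions U. energy a (\<lambda>x. z x - \<phi> x) < ennreal e" using \<phi>(1) by blast
qed

lemma test_function_tilde: "\<phi> \<in> test_functions U \<Longrightarrow> \<phi> \<in> sobolev_tilde a U"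
  unfolding sobolev_tilde_iff[OF a]
  by (auto intro!: test_function_sobolev[OF a] bexI[of _ \<phi>] simp: energy_def L2sq_def gagliardo_def)

lemma test_functions_add:
  assumes "\<phi> \<in> test_functions U" "\<psi> \<in> test_functions U"
  shows "(\<lambda>x. \<phi> x + \<psi> x) \<in> test_functions U"
proof -
  have sub: "closure {x. \<phi> x + \<psi> x \<noteq> 0} \<subseteq> closure {x. \<phi> x \<noteq> 0} \<union> closure {x. \<psi> x \<noteq> 0}"
    unfolding closure_Un[symmetric] by (rule closure_mono) auto
  moreover have "compact (closure {x. \<phi> x + \<psi> x \<noteq> 0})"
  proof -
    have "compact (closure {x. \<phi> x \<noteq> 0} \<union> closure {x. \<psi> x \<noteq> 0})" using assms by (simp add: test_functions_def compact_Un)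
    from compact_Int_closed[OF this closed_closure[of "{x. \<phi> x + \<psi> x \<noteq> 0}"]] sub
    show ?thesis by (simp add: Int_absorb1)
  qed
  ultimately show ?thesis using assms by (auto simp: test_functions_def intro!: Ck_add)
qed

lemma test_functions_scale:
  assumes "\<phi> \<in> test_functions U"
  shows "(\<lambda>x. c * \<phi> x) \<in> test_functions U"
proof -
  have sub: "closure {x. c * \<phi> x \<noteq> 0} \<subseteq> closure {x. \<phi> x \<noteq> 0}" by (rule closure_mono) auto
  moreover have "compact (closure {x. c * \<phi> x \<noteq> 0})"
  proof -
    have "compact (closure {x. \<phi> x \<noteq> 0})" using assms by (simp add: test_functions_def)
    from compact_Int_closed[OF this closed_closure[of "{x. c * \<phi> x \<noteq> 0}"]] sub
    show ?thesis by (simp add: Int_absorb1)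
  qed
  ultimately show ?thesis using assms by (auto simp: test_functions_def intro!: Ck_mult Ck_const)
qed

lemma sobolev_tilde_add:
  assumes u: "u \<in> sobolev_tilde a U" and v: "v \<in> sobolev_tilde a U"
  shows "(\<lambda>x. u x + v x) \<in> sobolev_tilde a U"
proof (rule sobolev_tilde_closed)
  note us = sobolev_tilde_sobolev[OF u] and vs = sobolev_tilde_sobolev[OF v]
  show "(\<lambda>x. u x + v x) \<in> sobolev a" by (rule sobolev_add[OF a us vs])
  fix e :: real assume "e > 0"
  then have e4: "e / 4 > 0" by simp
  obtain \<phi> \<psi> where \<phi>: "\<phi> \<in> test_functions U" "energy a (\<lambda>x. u x - \<phi> x) < ennreal (e / 4)"
    and \<psi>: "\<psi> \<in> test_functions U" "energy a (\<lambda>x. v x - \<psi> x) < ennreal (e / 4)"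
    using u v e4 unfolding sobolev_tilde_iff[OF a] by meson
  note ps = test_function_sobolev[OF a \<phi>(1)] test_function_sobolev[OF a \<psi>(1)]
  have "energy a (\<lambda>x. u x + v x - (\<phi> x + \<psi> x)) = energy a (\<lambda>x. (u x - \<phi> x) + (v x - \<psi> x))" by (simp add: algebra_simps)
  also have "\<dots> \<le> 2 * energy a (\<lambda>x. u x - \<phi> x) + 2 * energy a (\<lambda>x. v x - \<psi> x)"
    by (rule energy_add) (intro sobolev_measurable[OF a] sobolev_diff[OF a] us vs ps)+
  also have "\<dots> < 2 * ennreal (e / 4) + 2 * ennreal (e / 4)"
    using \<psi>(2) \<phi>(2) by (intro add_strict_mono ennreal_mult_strict_left_mono) auto
  also have "\<dots> = ennreal e" using \<open>e > 0\<close>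
    by (simp add: ennreal_plus[symmetric] ennreal_numeral[symmetric] ennreal_mult'[symmetric] del: ennreal_plus ennreal_numeral)
  finally show "\<exists>w\<in>sobolev_tilde a U. energy a (\<lambda>x. u x + v x - w x) < ennreal e"
    using test_function_tilde[OF test_functions_add[OF \<phi>(1) \<psi>(1)]] by (intro bexI)
qed

lemma sobolev_tilde_scale:
  assumes u: "u \<in> sobolev_tilde a U"
  shows "(\<lambda>x. c * u x) \<in> sobolev_tilde a U"
proof (rule sobolev_tilde_closed)
  note us = sobolev_tilde_sobolev[OF u]
  show "(\<lambda>x. c * u x) \<in> sobolev a" by (rule sobolev_scale[OF a us])
  fix e :: real assume e: "e > 0"
  define e' where "e' = e / (c\<^sup>2 + 1)"
  have c1: "c\<^sup>2 + 1 > 0" by (simp add: add_nonneg_pos)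
  have e': "e' > 0" using e c1 by (simp add: e'_def)
  obtain \<phi> where \<phi>: "\<phi> \<in> test_functions U" "energy a (\<lambda>x. u x - \<phi> x) < ennreal e'"
    using u e' unfolding sobolev_tilde_iff[OF a] by meson
  note ps = test_function_sobolev[OF a \<phi>(1)]
  have "energy a (\<lambda>x. c * u x - c * \<phi> x) = ennreal (c\<^sup>2) * energy a (\<lambda>x. u x - \<phi> x)"
    using energy_scale[OF sobolev_measurable[OF a sobolev_diff[OF a us ps]], of a c] by (simp add: right_diff_distrib)
  also have "\<dots> \<le> ennreal (c\<^sup>2) * ennreal e'" using \<phi>(2) by (intro mult_left_mono) auto
  also have "\<dots> = ennreal (c\<^sup>2 * e')" using e' by (simp add: ennreal_mult')
  also have "\<dots> < ennreal e" using e c1 by (simp add: ennreal_less_iff e'_def field_simps)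
  finally show "\<exists>w\<in>sobolev_tilde a U. energy a (\<lambda>x. c * u x - w x) < ennreal e"
    using test_function_tilde[OF test_functions_scale[OF \<phi>(1)]] by (intro bexI)
qed

lemma sobolev_tilde_diff: "u \<in> sobolev_tilde a U \<Longrightarrow> v \<in> sobolev_tilde a U \<Longrightarrow> (\<lambda>x. u x - v x) \<in> sobolev_tilde a U"
  using sobolev_tilde_add[of u "\<lambda>x. (-1) * v x"] sobolev_tilde_scale[of v "-1"] by simp

lemma sobolev_tilde_cong_AE:
  assumes "u \<in> sobolev_tilde a U" "v \<in> borel_measurable lebesgue" "AE x in lebesgue. u x = v x"
  shows "v \<in> sobolev_tilde a U"
proof (rule sobolev_tilde_closed)
  show "v \<in> sobolev a" using assms sobolev_tilde_sobolev by (blast intro: sobolev_cong_AE[OF a])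
  have "energy a (\<lambda>x. v x - u x) = energy a (\<lambda>x :: real ^ 'n. 0)" by (rule energy_cong_AE) (use assms(3) in auto)
  then have "energy a (\<lambda>x. v x - u x) = 0" by (simp add: energy_def L2sq_def gagliardo_def)
  then show "\<exists>u\<in>sobolev_tilde a U. energy a (\<lambda>x. v x - u x) < ennreal e" if "e > 0" for e
    using that assms(1) by (intro bexI[of _ u]) auto
qed

text \<open>
  Test functions vanish off \<open>U\<close>, so the mass of \<open>u\<close> off \<open>U\<close> is at most that of \<open>u - \<phi>\<close>.
\<close>

lemma sobolev_tilde_vanishes:
  assumes u: "u \<in> sobolev_tilde a U" and U: "open U"
  shows "AE x in lebesgue. x \<notin> U \<longrightarrow> u x = 0"
proof -
  have um [measurable]: "u \<in> borel_measurable lebesgue" by (rule sobolev_measurable[OF a sobolev_tilde_sobolev[OF u]])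
  have Um: "U \<in> sets lebesgue" using U by simp
  let ?f = "\<lambda>x. indicator (- U) x * u x"
  have "L2sq lebesgue ?f \<le> ennreal e" if "e > 0" for e
  proof -
    obtain \<phi> where \<phi>: "\<phi> \<in> test_functions U" "energy a (\<lambda>x. u x - \<phi> x) < ennreal e"
      using u \<open>e > 0\<close> unfolding sobolev_tilde_iff[OF a] by meson
    have "L2sq lebesgue ?f \<le> L2sq lebesgue (\<lambda>x. u x - \<phi> x)"
      by (rule L2sq_mono_AE) (use test_function_props(3)[OF \<phi>(1)] in \<open>auto simp: indicator_def\<close>)
    also have "\<dots> \<le> energy a (\<lambda>x. u x - \<phi> x)" by (simp add: energy_def L2sq_lebesgue)
    finally show ?thesis using \<phi>(2) by simp
  qed
  then have "L2sq lebesgue ?f \<le> 0" using ennreal_le_epsilon[of 0 "L2sq lebesgue ?f"] by simp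
  then have "(\<integral>\<^sup>+x. ennreal ((norm (?f x))\<^sup>2) \<partial>lebesgue) = 0" by (simp add: L2sq_def)
  then have "AE x in lebesgue. ennreal ((norm (?f x))\<^sup>2) = 0"
    using Um by (subst (asm) nn_integral_0_iff_AE) auto
  then show ?thesis by eventually_elim (auto simp: indicator_def)
qed

text \<open>
  Mollify with a radius below the distance of the support to the complement of \<open>U\<close>.
\<close>

lemma compact_support_tilde:
  fixes v :: "real ^ 'n \<Rightarrow> real"
  assumes vm [measurable]: "v \<in> borel_measurable borel" and fin: "energy a v < top"
    and K: "compact K" "K \<subseteq> U" "\<And>x. x \<notin> K \<Longrightarrow> v x = 0" and U: "open U"
  shows "v \<in> sobolev_tilde a U"
proof (rule sobolev_tilde_closed)
  show "v \<in> sobolev a" using fin by (simp add: sobolev_iff[OF a] borel_imp_lebesgue)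
  obtain R where "\<forall>x\<in>K. norm x \<le> R" using compact_imp_bounded[OF K(1)] by (auto simp: bounded_iff)
  then have R: "K \<subseteq> cball 0 R" by auto
  have vR: "v x = 0" if "x \<notin> cball 0 R" for x using that R K(3) by blast
  have vi: "integrable lborel v" by (rule integrable_L2_compact[OF vm _ vR]) (use fin in \<open>auto simp: energy_def\<close>)
  obtain r where r: "r > 0" "(\<Union>x\<in>K. cball x r) \<subseteq> U"
    using compact_subset_open_imp_cball_epsilon_subset[OF K(1) U K(2)] by blast
  define d where "d j = r / real (Suc j)" for j :: nat
  have d: "d j > 0" "d j \<le> r" for j using r(1) by (auto simp: d_def field_simps)
  have d0: "d \<longlonglongrightarrow> 0"
    unfolding d_def using tendsto_mult[OF tendsto_const[of r] LIMSEQ_inverse_real_of_nat] by (simp add: divide_inverse)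
  have lim: "(\<lambda>j. energy a (\<lambda>x. correlate v (mollifier (d j)) x - v x)) \<longlonglongrightarrow> 0" by (rule mollify_energy[OF vm fin vR d(1) d0])
  have test: "correlate v (mollifier (d j)) \<in> test_functions U" for j
  proof -
    note m = mollifier_props[OF d(1)[of j], where 'n='n]
    have "{x. correlate v (mollifier (d j)) x \<noteq> 0} \<subseteq> (\<Union>x\<in>K. cball x r)"
    proof
      fix x assume "x \<in> {x. correlate v (mollifier (d j)) x \<noteq> 0}"
      then have "correlate v (mollifier (d j)) x \<noteq> 0" by simp
      then obtain y where "v y \<noteq> 0" "dist x y \<le> d j" using correlate_support[where m="mollifier (d j)" and R="d j", OF m(3)] by blast
      then show "x \<in> (\<Union>x\<in>K. cball x r)" using d(2)[of j] K(3)[of y] by (intro UN_I[of y]) (auto simp: dist_commute)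
    qed
    moreover have cK: "compact (\<Union>x\<in>K. cball x r)"
      using compact_minkowski_sum_cball[OF K(1)] by simp
    ultimately have sub: "closure {x. correlate v (mollifier (d j)) x \<noteq> 0} \<subseteq> (\<Union>x\<in>K. cball x r)"
      by (meson closure_minimal compact_imp_closed)
    then have "compact (closure {x. correlate v (mollifier (d j)) x \<noteq> 0})"
      using compact_Int_closed[OF cK closed_closure[of "{x. correlate v (mollifier (d j)) x \<noteq> 0}"]] by (simp add: Int_absorb1)
    then show ?thesis
      using sub r(2) Ck_correlate[OF vi m(1,3)] by (auto simp: test_functions_def)
  qed
  fix e :: real assume "e > 0"
  then obtain j where "energy a (\<lambda>x. correlate v (mollifier (d j)) x - v x) < ennreal e"
    using order_tendstoD(2)[OF lim, of "ennreal e"] by (auto simp: eventually_sequentially)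
  moreover have "energy a (\<lambda>x. v x - correlate v (mollifier (d j)) x) = energy a (\<lambda>x. (-1) * (correlate v (mollifier (d j)) x - v x))" by simp
  moreover have "\<dots> = energy a (\<lambda>x. correlate v (mollifier (d j)) x - v x)"
  proof -
    have "correlate v (mollifier (d j)) \<in> borel_measurable borel" using test_function_props(2)[OF test] .
    then have "(\<lambda>x. correlate v (mollifier (d j)) x - v x) \<in> borel_measurable lebesgue"
      by (intro borel_imp_lebesgue borel_measurable_diff vm)
    from energy_scale[OF this, of a "-1"] show ?thesis by simp
  qed
  ultimately show "\<exists>u\<in>sobolev_tilde a U. energy a (\<lambda>x. v x - u x) < ennreal e"
    using test_function_tilde[OF test, of j] by (intro bexI[of _ "correlate v (mollifier (d j))"]) auto
qed

end

section \<open>Density of test functions in Lipschitz domains\<close>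

text \<open>
  A point of the closure near \<open>p\<close> lies on or above the graph, by continuity of \<open>\<gamma>\<close>. Moving it
  along the axis \<open>e\<close> keeps its projection and puts it strictly above.
\<close>

lemma graph_translate_inside:
  fixes U :: "(real ^ 'n) set"
  assumes e: "norm e = 1" and r: "r > 0" and lip: "L-lipschitz_on {y. y \<bullet> e = 0} \<gamma>"
    and graph: "U \<inter> ball p r = {x \<in> ball p r. \<gamma> (x - (x \<bullet> e) *\<^sub>R e) < x \<bullet> e}"
    and x: "x \<in> closure U" "x \<in> cball p (r/2)" and t: "0 < t" "t < r/2"
  shows "x + t *\<^sub>R e \<in> U"
proof -
  have ee: "e \<bullet> e = 1" using e by (simp add: dot_square_norm)
  let ?P = "\<lambda>x. x - (x \<bullet> e) *\<^sub>R e"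
  have P: "?P y \<in> {y. y \<bullet> e = 0}" for y by (simp add: inner_diff_left ee)
  have "continuous_on UNIV (\<lambda>y. \<gamma> (?P y))"
    by (rule continuous_on_compose2[OF lipschitz_on_continuous_on[OF lip]]) (use P in \<open>auto intro!: continuous_intros\<close>)
  then have cl: "closed {y. \<gamma> (?P y) \<le> y \<bullet> e}"
    by (intro closed_Collect_le continuous_intros) auto
  have xb: "x \<in> ball p r" using x(2) r by auto
  have "x \<in> closure (ball p r \<inter> U)"
    using open_Int_closure_subset[OF open_ball, of p r U] xb x(1) by blast
  moreover have "ball p r \<inter> U \<subseteq> {y. \<gamma> (?P y) \<le> y \<bullet> e}"
  proof
    fix y assume "y \<in> ball p r \<inter> U"
    then have "y \<in> {x \<in> ball p r. \<gamma> (?P x) < x \<bullet> e}" using graph by blast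
    then show "y \<in> {y. \<gamma> (?P y) \<le> y \<bullet> e}" by simp
  qed
  ultimately have le: "\<gamma> (?P x) \<le> x \<bullet> e" using closure_minimal[OF _ cl] by blast
  have Peq: "?P (x + t *\<^sub>R e) = ?P x" by (simp add: inner_add_left ee algebra_simps)
  have "dist p (x + t *\<^sub>R e) \<le> dist p x + norm (t *\<^sub>R e)"
    using dist_triangle[of p "x + t *\<^sub>R e" x] by (simp add: dist_norm)
  also have "\<dots> < r" using x(2) t e by simp
  finally have "x + t *\<^sub>R e \<in> ball p r" by simp
  moreover have "\<gamma> (?P (x + t *\<^sub>R e)) < (x + t *\<^sub>R e) \<bullet> e"
    unfolding Peq using le t by (simp add: inner_add_left ee)
  ultimately show ?thesis using graph by blast
qed

text \<open>
  The translates of \<open>v\<close> by small multiples of \<open>e\<close> have compact support in \<open>U\<close> and converge to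
  \<open>v\<close> in energy.
\<close>

lemma boundary_piece_tilde:
  fixes U :: "(real ^ 'n) set" and v :: "real ^ 'n \<Rightarrow> real"
  assumes a: "0 < a" "a < 1" and U: "open U" "compact (closure U)"
    and chart: "norm e = 1" "r > 0" "L-lipschitz_on {y. y \<bullet> e = 0} \<gamma>"
      "U \<inter> ball p r = {x \<in> ball p r. \<gamma> (x - (x \<bullet> e) *\<^sub>R e) < x \<bullet> e}"
    and vm [measurable]: "v \<in> borel_measurable borel" and fin: "energy a v < top"
    and v0: "\<And>x. x \<notin> closure U \<Longrightarrow> v x = 0" "\<And>x. x \<notin> cball p (r/2) \<Longrightarrow> v x = 0"
  shows "v \<in> sobolev_tilde a U"
proof (rule sobolev_tilde_closed[OF a])
  show "v \<in> sobolev a" using fin by (simp add: sobolev_iff[OF a] borel_imp_lebesgue)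
  \<comment> \<open>Strictly below \<open>r/2\<close>, so that the translated support stays in the chart.\<close>
  define t where "t j = (r/2) / real (Suc (Suc j))" for j :: nat
  have t: "0 < t j" "t j < r/2" for j
  proof -
    show "0 < t j" unfolding t_def using chart(2) by (intro divide_pos_pos) auto
    have "r/2 * 1 < r/2 * real (Suc (Suc j))" using chart(2) by (intro mult_strict_left_mono) auto
    then have "r/2 < r/2 * real (Suc (Suc j))" by (simp only: mult_1_right)
    then show "t j < r/2" unfolding t_def by (subst pos_divide_less_eq) auto
  qed
  have t0: "t \<longlonglongrightarrow> 0"
    unfolding t_def by (rule LIMSEQ_Suc[OF LIMSEQ_Suc[OF lim_const_over_n]])
  have "(\<lambda>j. - (t j *\<^sub>R e)) \<longlonglongrightarrow> - (0 *\<^sub>R e)" by (intro tendsto_intros t0)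
  then have h0: "(\<lambda>j. - (t j *\<^sub>R e)) \<longlonglongrightarrow> 0" by simp
  let ?w = "\<lambda>j x. v (x + - (t j *\<^sub>R e))"
  let ?K = "closure U \<inter> cball p (r/2)"
  have tilde: "?w j \<in> sobolev_tilde a U" for j
  proof (rule compact_support_tilde[OF a])
    show "energy a (?w j) < top" using energy_translate[OF vm, of a "- (t j *\<^sub>R e)"] fin by simp
    show "compact ((\<lambda>x. x + t j *\<^sub>R e) ` ?K)"
      by (intro compact_continuous_image continuous_intros compact_Int_closed U closed_cball)
    show "(\<lambda>x. x + t j *\<^sub>R e) ` ?K \<subseteq> U"
      using graph_translate_inside[OF chart _ _ t] by auto
    show "?w j x = 0" if "x \<notin> (\<lambda>x. x + t j *\<^sub>R e) ` ?K" for x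
    proof -
      have "x - t j *\<^sub>R e \<notin> ?K" using that by (metis diff_add_cancel image_eqI)
      then show ?thesis using v0 by auto
    qed
  qed (use U in auto)
  have lim: "(\<lambda>j. energy a (\<lambda>x. ?w j x - v x)) \<longlonglongrightarrow> 0" by (rule energy_translation_tendsto[OF vm fin h0])
  fix d :: real assume "d > 0"
  then obtain j where j: "energy a (\<lambda>x. ?w j x - v x) < ennreal d"
    using order_tendstoD(2)[OF lim, of "ennreal d"] by (auto simp: eventually_sequentially)
  have "(\<lambda>x. ?w j x - v x) \<in> borel_measurable lebesgue" by (intro borel_imp_lebesgue) measurable
  from energy_scale[OF this, of a "-1"] have "energy a (\<lambda>x. v x - ?w j x) < ennreal d" using j by simp
  then show "\<exists>u\<in>sobolev_tilde a U. energy a (\<lambda>x. v x - u x) < ennreal d" using tilde[of j] by (intro bexI)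
qed

definition cutoff :: "real ^ 'n \<Rightarrow> real \<Rightarrow> real ^ 'n \<Rightarrow> real" where
  "cutoff p r x = max 0 (min 1 (2 - 4 / r * dist x p))"

lemma cutoff_props:
  assumes r: "r > 0"
  shows "0 \<le> cutoff p r x" "cutoff p r x \<le> 1" "x \<notin> cball p (r/2) \<Longrightarrow> cutoff p r x = 0"
    "x \<in> ball p (r/4) \<Longrightarrow> cutoff p r x = 1" "\<bar>cutoff p r x - cutoff p r y\<bar> \<le> 4 / r * norm (x - y)"
proof -
  show "0 \<le> cutoff p r x" "cutoff p r x \<le> 1" by (auto simp: cutoff_def)
  show "cutoff p r x = 0" if "x \<notin> cball p (r/2)"
    using that r by (simp add: cutoff_def field_simps dist_commute)
  show "cutoff p r x = 1" if "x \<in> ball p (r/4)"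
    using that r by (simp add: cutoff_def field_simps dist_commute)
  have "\<bar>cutoff p r x - cutoff p r y\<bar> \<le> \<bar>4 / r * dist x p - 4 / r * dist y p\<bar>"
    unfolding cutoff_def by (auto simp: max_def min_def)
  also have "\<dots> = 4 / r * \<bar>dist x p - dist y p\<bar>"
    using r by (simp only: right_diff_distrib[symmetric] abs_mult) simp
  also have "\<dots> \<le> 4 / r * norm (x - y)"
    using r abs_dist_diff_le[of x p y] by (intro mult_left_mono) (auto simp: dist_norm norm_minus_commute[of p])
  finally show "\<bar>cutoff p r x - cutoff p r y\<bar> \<le> 4 / r * norm (x - y)" .
qed

lemma energy_finite_lipschitz_mult:
  fixes v \<zeta> :: "real ^ 'n \<Rightarrow> real"
  assumes a: "0 < a" "a < 1" and vm: "v \<in> borel_measurable borel" and fin: "energy a v < top"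
    and "\<And>x. \<bar>\<zeta> x\<bar> \<le> 1" "\<And>x y. \<bar>\<zeta> x - \<zeta> y\<bar> \<le> L * norm (x - y)"
  shows "energy a (\<lambda>x. \<zeta> x * v x) < top"
  using sobolev_lipschitz_mult[OF a _ assms(5,6)] vm fin by (auto simp: sobolev_iff[OF a] borel_imp_lebesgue)

text \<open>
  The compact boundary is covered by finitely many charts. Instead of a partition of unity,
  the chart neighbourhoods are removed one at a time: by induction on a set \<open>A\<close> of charts, the
  claim holds for functions that already vanish near the centres outside \<open>A\<close>. A cutoff splits
  such a function into a piece inside one chart and a piece vanishing near its centre. When no
  chart is left, the support is compact in \<open>U\<close>.
\<close>

theorem sobolev_tilde_lipschitz:
  fixes U :: "(real ^ 'n) set" and u :: "real ^ 'n \<Rightarrow> real"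
  assumes a: "0 < a" "a < 1" and U: "open U" "compact (closure U)" "lipschitz_boundary U"
    and u: "u \<in> sobolev a" and u0: "AE x in lebesgue. x \<notin> closure U \<longrightarrow> u x = 0"
  shows "u \<in> sobolev_tilde a U"
proof -
  define atlas where "atlas p r \<longleftrightarrow> (\<exists>e L \<gamma>. norm e = 1 \<and> L-lipschitz_on {y. y \<bullet> e = 0} \<gamma> \<and>
     U \<inter> ball p r = {x \<in> ball p r. \<gamma> (x - (x \<bullet> e) *\<^sub>R e) < x \<bullet> e})" for p r
  have "\<exists>r. r > 0 \<and> atlas p r" if pU: "p \<in> frontier U" for p
  proof -
    obtain e r L \<gamma> where "norm e = 1" "r > 0" "L-lipschitz_on {y. y \<bullet> e = 0} \<gamma>"
      "U \<inter> ball p r = {x \<in> ball p r. \<gamma> (x - (x \<bullet> e) *\<^sub>R e) < x \<bullet> e}"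
      using bspec[OF U(3)[unfolded lipschitz_boundary_def] pU] by (elim exE conjE) (rule that)
    then show ?thesis unfolding atlas_def by (intro exI[of _ r] conjI exI[of _ e] exI[of _ L] exI[of _ \<gamma>])
  qed
  then obtain r where r: "\<And>p. p \<in> frontier U \<Longrightarrow> r p > 0" and chart: "\<And>p. p \<in> frontier U \<Longrightarrow> atlas p (r p)"
    by metis
  have fc: "compact (frontier U)"
    by (rule compact_frontier_bounded[OF bounded_subset[OF compact_imp_bounded[OF U(2)] closure_subset]])
  have fcov: "frontier U \<subseteq> (\<Union>p\<in>frontier U. ball p (r p / 4))"
  proof
    fix p assume "p \<in> frontier U"
    then show "p \<in> (\<Union>p\<in>frontier U. ball p (r p / 4))" using r[of p] by (intro UN_I[of p]) auto
  qed
  obtain F where F: "F \<subseteq> frontier U" "finite F" "frontier U \<subseteq> (\<Union>p\<in>F. ball p (r p / 4))"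
    by (rule compactE_image[OF fc open_ball fcov])
  define good where "good A v \<longleftrightarrow> v \<in> borel_measurable borel \<and> energy a v < top \<and> (\<forall>x. x \<notin> closure U \<longrightarrow> v x = 0) \<and>
      (\<forall>p\<in>F - A. \<forall>x\<in>ball p (r p / 4). v x = 0)" for A and v :: "real ^ 'n \<Rightarrow> real"
  have goodD: "v \<in> borel_measurable borel" "energy a v < top" "\<And>x. x \<notin> closure U \<Longrightarrow> v x = 0"
    "\<And>p x. p \<in> F \<Longrightarrow> p \<notin> A \<Longrightarrow> x \<in> ball p (r p / 4) \<Longrightarrow> v x = 0" if "good A v" for A v
    using that unfolding good_def by blast+
  have claim: "\<forall>v. good A v \<longrightarrow> v \<in> sobolev_tilde a U" if "finite A" "A \<subseteq> F" for A
    using that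
  proof (induction A rule: finite_induct)
    case empty
    show ?case
    proof (intro allI impI)
      fix v assume v: "good {} v"
      let ?K = "closure U - (\<Union>p\<in>F. ball p (r p / 4))"
      show "v \<in> sobolev_tilde a U"
      proof (rule compact_support_tilde[OF a goodD(1,2)[OF v] _ _ _ U(1)])
        show "compact ?K" by (rule compact_diff[OF U(2)]) (rule open_UN, simp)
        have "frontier U = closure U - U" using U(1) by (simp add: frontier_def interior_open)
        then show "?K \<subseteq> U" using F(3) by blast
        fix x assume x: "x \<notin> ?K"
        show "v x = 0"
        proof (cases "x \<in> closure U")
          case True
          then obtain p where "p \<in> F" "x \<in> ball p (r p / 4)" using x by blast
          then show ?thesis using goodD(4)[OF v] by blast
        qed (rule goodD(3)[OF v])
      qed
    qed
  next
    case (insert p A)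
    show ?case
    proof (intro allI impI)
      fix v assume v: "good (insert p A) v"
      note vm [measurable] = goodD(1)[OF v] and vfin = goodD(2)[OF v]
      have p: "p \<in> frontier U" using insert.prems F(1) by blast
      note c = cutoff_props[OF r[OF p], where p=p]
      have cm [measurable]: "cutoff p (r p) \<in> borel_measurable borel" unfolding cutoff_def[abs_def] by measurable
      obtain e L \<gamma> where ch: "norm e = 1" "L-lipschitz_on {y. y \<bullet> e = 0} \<gamma>"
        "U \<inter> ball p (r p) = {x \<in> ball p (r p). \<gamma> (x - (x \<bullet> e) *\<^sub>R e) < x \<bullet> e}"
        using chart[OF p] unfolding atlas_def by (elim exE conjE) (rule that)
      have t1: "(\<lambda>x. cutoff p (r p) x * v x) \<in> sobolev_tilde a U"
      proof (rule boundary_piece_tilde[OF a U(1,2) ch(1) r[OF p] ch(2,3)])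
        show "energy a (\<lambda>x. cutoff p (r p) x * v x) < top"
        proof (rule energy_finite_lipschitz_mult[OF a vm vfin])
          show "\<bar>cutoff p (r p) x\<bar> \<le> 1" for x using c(1,2)[of x] by simp
        qed (rule c(5))
        show "cutoff p (r p) x * v x = 0" if "x \<notin> closure U" for x using goodD(3)[OF v that] by simp
        show "cutoff p (r p) x * v x = 0" if "x \<notin> cball p (r p / 2)" for x using c(3)[OF that] by simp
      qed measurable
      have t2: "(\<lambda>x. (1 - cutoff p (r p) x) * v x) \<in> sobolev_tilde a U"
      proof -
        have "energy a (\<lambda>x. (1 - cutoff p (r p) x) * v x) < top"
        proof (rule energy_finite_lipschitz_mult[OF a vm vfin, where L="4 / r p"])
          show "\<bar>1 - cutoff p (r p) x\<bar> \<le> 1" for x using c(1,2)[of x] by simp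
          show "\<bar>1 - cutoff p (r p) x - (1 - cutoff p (r p) y)\<bar> \<le> 4 / r p * norm (x - y)" for x y
            using c(5)[of x y] by (simp add: abs_minus_commute)
        qed
        moreover have "(\<lambda>x. (1 - cutoff p (r p) x) * v x) \<in> borel_measurable borel" by measurable
        moreover have "(1 - cutoff p (r p) x) * v x = 0" if "x \<notin> closure U" for x using goodD(3)[OF v that] by simp
        moreover have "(1 - cutoff p (r p) x) * v x = 0" if "q \<in> F" "q \<notin> A" "x \<in> ball q (r q / 4)" for q x
        proof (cases "q = p")
          case True then show ?thesis using c(4)[of x] that(3) by simp
        next
          case False then show ?thesis using goodD(4)[OF v that(1) _ that(3)] that(2) by simp
        qed
        ultimately have "good A (\<lambda>x. (1 - cutoff p (r p) x) * v x)"
          unfolding good_def by blast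
        then show ?thesis using insert.IH insert.prems by blast
      qed
      have "(\<lambda>x. cutoff p (r p) x * v x + (1 - cutoff p (r p) x) * v x) = v"
        by (simp add: fun_eq_iff algebra_simps)
      then show "v \<in> sobolev_tilde a U" using sobolev_tilde_add[OF a t1 t2] by simp
    qed
  qed
  have um: "u \<in> borel_measurable lebesgue" by (rule sobolev_measurable[OF a u])
  obtain v where v [measurable]: "v \<in> borel_measurable borel" and uv: "AE x in lebesgue. u x = v x"
    using borel_representative[OF um] .
  define v' where "v' x = indicator (closure U) x * v x" for x
  have v'm [measurable]: "v' \<in> borel_measurable borel" unfolding v'_def by measurable
  have uv': "AE x in lebesgue. u x = v' x"
    using uv u0 by eventually_elim (auto simp: v'_def indicator_def)
  have "energy a v' < top" using energy_cong_AE[OF uv', of a] sobolev_energy_finite[OF a u] by simp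
  then have "good F v'" unfolding good_def using v'm by (simp add: v'_def)
  then have "v' \<in> sobolev_tilde a U" using claim[OF F(2)] by blast
  then show ?thesis
    by (rule sobolev_tilde_cong_AE[OF a _ um]) (use uv' in auto)
qed

section \<open>The regional form\<close>

abbreviation lborel2 :: "((real ^ 'n) \<times> (real ^ 'n)) measure" where "lborel2 \<equiv> lborel \<Otimes>\<^sub>M lborel"

text \<open>
  With half of the kernel attached to each factor, the regional form is an inner product in
  \<open>L\<^sup>2\<close> of the product space, so that bilinearity, integrability and the Cauchy--Schwarz
  inequality come for free.
\<close>

definition diff_quot :: "real \<Rightarrow> (real ^ 'n) set \<Rightarrow> (real ^ 'n \<Rightarrow> real) \<Rightarrow> (real ^ 'n) \<times> (real ^ 'n) \<Rightarrow> real" where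
  "diff_quot a \<Omega> u = (\<lambda>(x, y). indicator \<Omega> x * indicator \<Omega> y * sqrt (frac_kernel a (x - y)) * (u x - u y))"

lemma diff_quot_measurable [measurable]:
  fixes u :: "real ^ 'n \<Rightarrow> real"
  assumes [measurable]: "u \<in> borel_measurable borel" "\<Omega> \<in> sets borel"
  shows "diff_quot a \<Omega> u \<in> borel_measurable lborel2"
  unfolding diff_quot_def by measurable

lemma double_integral_eq_gagliardo:
  fixes u :: "real ^ 'n \<Rightarrow> real"
  assumes [measurable]: "u \<in> borel_measurable borel"
  shows "(\<integral>\<^sup>+x. \<integral>\<^sup>+y. ennreal (frac_kernel a (x - y)) * ennreal ((u x - u y)\<^sup>2) \<partial>lborel \<partial>lborel) = gagliardo a u"
proof -
  have "(\<integral>\<^sup>+x. \<integral>\<^sup>+y. ennreal (frac_kernel a (x - y)) * ennreal ((u x - u y)\<^sup>2) \<partial>lborel \<partial>lborel) =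
      (\<integral>\<^sup>+x. \<integral>\<^sup>+s. ennreal (frac_kernel a s) * ennreal ((u (x + s) - u x)\<^sup>2) \<partial>lborel \<partial>lborel)"
  proof (rule nn_integral_cong)
    fix x :: "real ^ 'n"
    have "(\<integral>\<^sup>+y. ennreal (frac_kernel a (x - y)) * ennreal ((u x - u y)\<^sup>2) \<partial>lborel) =
        (\<integral>\<^sup>+s. ennreal (frac_kernel a (x - (s + x))) * ennreal ((u x - u (s + x))\<^sup>2) \<partial>lborel)"
      by (rule nn_integral_lborel_translate[symmetric]) measurable
    also have "\<dots> = (\<integral>\<^sup>+s. ennreal (frac_kernel a s) * ennreal ((u (x + s) - u x)\<^sup>2) \<partial>lborel)"
    proof (rule nn_integral_cong)
      fix s :: "real ^ 'n"
      have "frac_kernel a (x - (s + x)) = frac_kernel a s" by (simp add: frac_kernel_def)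
      then show "ennreal (frac_kernel a (x - (s + x))) * ennreal ((u x - u (s + x))\<^sup>2) = ennreal (frac_kernel a s) * ennreal ((u (x + s) - u x)\<^sup>2)"
        by (simp add: power2_commute add.commute)
    qed
    finally show "(\<integral>\<^sup>+y. ennreal (frac_kernel a (x - y)) * ennreal ((u x - u y)\<^sup>2) \<partial>lborel) =
       (\<integral>\<^sup>+s. ennreal (frac_kernel a s) * ennreal ((u (x + s) - u x)\<^sup>2) \<partial>lborel)" .
  qed
  also have "\<dots> = (\<integral>\<^sup>+s. \<integral>\<^sup>+x. ennreal (frac_kernel a s) * ennreal ((u (x + s) - u x)\<^sup>2) \<partial>lborel \<partial>lborel)"
    by (rule lborel_pair.Fubini') measurable
  also have "\<dots> = gagliardo a u"
    unfolding gagliardo_def L2sq_def by (subst nn_integral_cmult) auto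
  finally show ?thesis .
qed

lemma L2sq_diff_quot:
  fixes u :: "real ^ 'n \<Rightarrow> real"
  assumes [measurable]: "u \<in> borel_measurable borel" "\<Omega> \<in> sets borel"
  shows "L2sq lborel2 (diff_quot a \<Omega> u) = (\<integral>\<^sup>+x. \<integral>\<^sup>+y. indicator \<Omega> x * indicator \<Omega> y * (ennreal (frac_kernel a (x - y)) * ennreal ((u x - u y)\<^sup>2)) \<partial>lborel \<partial>lborel)"
proof -
  have "L2sq lborel2 (diff_quot a \<Omega> u) = (\<integral>\<^sup>+x. \<integral>\<^sup>+y. ennreal ((norm (diff_quot a \<Omega> u (x, y)))\<^sup>2) \<partial>lborel \<partial>lborel)"
    unfolding L2sq_def by (rule lborel.nn_integral_fst[symmetric]) measurable
  also have "\<dots> = (\<integral>\<^sup>+x. \<integral>\<^sup>+y. indicator \<Omega> x * indicator \<Omega> y * (ennreal (frac_kernel a (x - y)) * ennreal ((u x - u y)\<^sup>2)) \<partial>lborel \<partial>lborel)"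
    by (intro nn_integral_cong) (auto simp: diff_quot_def indicator_def power_mult_distrib ennreal_mult')
  finally show ?thesis .
qed

lemma L2sq_diff_quot_le_gagliardo:
  fixes u :: "real ^ 'n \<Rightarrow> real"
  assumes [measurable]: "u \<in> borel_measurable borel" "\<Omega> \<in> sets borel"
  shows "L2sq lborel2 (diff_quot a \<Omega> u) \<le> gagliardo a u"
  unfolding L2sq_diff_quot[OF assms] double_integral_eq_gagliardo[OF assms(1), symmetric]
  by (intro nn_integral_mono) (auto simp: indicator_def)

text \<open>
  The arguments of the form are determined only almost everywhere in \<open>\<Omega>\<close>. Hence the inner
  integral can be replaced by that of Borel representatives for almost every outer point; then
  Fubini's theorem applies.
\<close>

lemma regional_form_eq:
  fixes \<phi> \<psi> u v :: "real ^ 'n \<Rightarrow> real"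
  assumes \<Omega>: "open \<Omega>" and um [measurable]: "u \<in> borel_measurable borel" and vm [measurable]: "v \<in> borel_measurable borel"
    and \<phi>: "AE x in lebesgue. x \<in> \<Omega> \<longrightarrow> \<phi> x = u x" and \<psi>: "AE x in lebesgue. x \<in> \<Omega> \<longrightarrow> \<psi> x = v x"
    and fin: "L2sq lborel2 (diff_quot a \<Omega> u) < top" "L2sq lborel2 (diff_quot a \<Omega> v) < top"
  shows "regional_form a \<Omega> \<phi> \<psi> = (\<integral>p. diff_quot a \<Omega> u p * diff_quot a \<Omega> v p \<partial>lborel2)"
proof -
  have \<Omega>m [measurable]: "\<Omega> \<in> sets borel" using \<Omega> by simp
  have \<Omega>l: "\<Omega> \<inter> space lebesgue \<in> sets lebesgue" using \<Omega> by simp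
  let ?p = "real CARD('n) + 2 * a"
  let ?g = "\<lambda>\<phi> \<psi> x y :: real ^ 'n. (\<phi> x - \<phi> y) * (\<psi> x - \<psi> y) / norm (x - y) powr ?p"
  have inner: "(\<integral>y. ?g \<phi> \<psi> x y \<partial>lebesgue_on \<Omega>) = (\<integral>y. indicator \<Omega> y *\<^sub>R ?g u v x y \<partial>lborel)"
    if "\<phi> x = u x" "\<psi> x = v x" for x
  proof -
    have m1: "(\<lambda>y. indicator \<Omega> y *\<^sub>R ?g u v x y) \<in> borel_measurable borel" by measurable
    have ae: "AE y in lebesgue. indicator \<Omega> y *\<^sub>R ?g u v x y = indicator \<Omega> y *\<^sub>R ?g \<phi> \<psi> x y"
      using \<phi> \<psi> by eventually_elim (auto simp: that indicator_def)
    have m2: "(\<lambda>y. indicator \<Omega> y *\<^sub>R ?g \<phi> \<psi> x y) \<in> borel_measurable lebesgue"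
      using borel_measurable_AE[OF borel_imp_lebesgue[OF m1] ae] by simp
    have "(\<integral>y. ?g \<phi> \<psi> x y \<partial>lebesgue_on \<Omega>) = (\<integral>y. indicator \<Omega> y *\<^sub>R ?g \<phi> \<psi> x y \<partial>lebesgue)"
      by (rule integral_restrict_space[OF \<Omega>l])
    also have "\<dots> = (\<integral>y. indicator \<Omega> y *\<^sub>R ?g u v x y \<partial>lebesgue)"
      by (rule integral_cong_AE[OF m2 borel_imp_lebesgue[OF m1]]) (use ae in auto)
    also have "\<dots> = (\<integral>y. indicator \<Omega> y *\<^sub>R ?g u v x y \<partial>lborel)"
      by (rule integral_completion) (use m1 in simp)
    finally show ?thesis .
  qed
  have m1: "(\<lambda>x. indicator \<Omega> x *\<^sub>R (\<integral>y. indicator \<Omega> y *\<^sub>R ?g u v x y \<partial>lborel)) \<in> borel_measurable lborel"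
    by measurable
  have ae: "AE x in lebesgue. indicator \<Omega> x *\<^sub>R (\<integral>y. indicator \<Omega> y *\<^sub>R ?g u v x y \<partial>lborel) =
      indicator \<Omega> x *\<^sub>R (\<integral>y. ?g \<phi> \<psi> x y \<partial>lebesgue_on \<Omega>)"
    using \<phi> \<psi>
  proof eventually_elim
    case (elim x)
    show ?case
    proof (cases "x \<in> \<Omega>")
      case True
      then show ?thesis using inner[of x] elim by simp
    qed simp
  qed
  have m1': "(\<lambda>x. indicator \<Omega> x *\<^sub>R (\<integral>y. indicator \<Omega> y *\<^sub>R ?g u v x y \<partial>lborel)) \<in> borel_measurable lebesgue"
    using m1 by (simp add: measurable_completion)
  have m2: "(\<lambda>x. indicator \<Omega> x *\<^sub>R (\<integral>y. ?g \<phi> \<psi> x y \<partial>lebesgue_on \<Omega>)) \<in> borel_measurable lebesgue"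
    using borel_measurable_AE[OF m1' ae] by simp
  have "regional_form a \<Omega> \<phi> \<psi> = (\<integral>x. indicator \<Omega> x *\<^sub>R (\<integral>y. ?g \<phi> \<psi> x y \<partial>lebesgue_on \<Omega>) \<partial>lebesgue)"
    unfolding regional_form_def by (rule integral_restrict_space[OF \<Omega>l])
  also have "\<dots> = (\<integral>x. indicator \<Omega> x *\<^sub>R (\<integral>y. indicator \<Omega> y *\<^sub>R ?g u v x y \<partial>lborel) \<partial>lebesgue)"
    by (rule integral_cong_AE[OF m2 m1']) (use ae in auto)
  also have "\<dots> = (\<integral>x. indicator \<Omega> x *\<^sub>R (\<integral>y. indicator \<Omega> y *\<^sub>R ?g u v x y \<partial>lborel) \<partial>lborel)"
    by (rule integral_completion[OF m1])
  also have "\<dots> = (\<integral>x. (\<integral>y. diff_quot a \<Omega> u (x, y) * diff_quot a \<Omega> v (x, y) \<partial>lborel) \<partial>lborel)"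
  proof (rule Bochner_Integration.integral_cong[OF refl])
    fix x
    have "indicator \<Omega> x *\<^sub>R (\<integral>y. indicator \<Omega> y *\<^sub>R ?g u v x y \<partial>lborel) = (\<integral>y. indicator \<Omega> x *\<^sub>R (indicator \<Omega> y *\<^sub>R ?g u v x y) \<partial>lborel)"
      by (rule integral_scaleR_right[symmetric])
    also have "\<dots> = (\<integral>y. diff_quot a \<Omega> u (x, y) * diff_quot a \<Omega> v (x, y) \<partial>lborel)"
    proof (rule Bochner_Integration.integral_cong[OF refl])
      fix y
      define k where "k = sqrt (frac_kernel a (x - y))"
      have "k * k = frac_kernel a (x - y)" by (simp add: k_def)
      moreover have "frac_kernel a (x - y) = 1 / norm (x - y) powr ?p" unfolding frac_kernel_def by (rule powr_minus_divide)
      ultimately have k: "k * k = 1 / norm (x - y) powr ?p" by simp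
      have "diff_quot a \<Omega> u (x, y) * diff_quot a \<Omega> v (x, y) = indicator \<Omega> x * indicator \<Omega> y * ((u x - u y) * (v x - v y) * (k * k))"
        unfolding diff_quot_def prod.case k_def[symmetric] by (simp add: indicator_def mult_ac)
      then have "diff_quot a \<Omega> u (x, y) * diff_quot a \<Omega> v (x, y) = indicator \<Omega> x * indicator \<Omega> y * ((u x - u y) * (v x - v y) * (1 / norm (x - y) powr ?p))"
        unfolding k .
      then show "indicator \<Omega> x *\<^sub>R (indicator \<Omega> y *\<^sub>R ?g u v x y) = diff_quot a \<Omega> u (x, y) * diff_quot a \<Omega> v (x, y)"
        by (simp add: mult.assoc)
    qed
    finally show "indicator \<Omega> x *\<^sub>R (\<integral>y. indicator \<Omega> y *\<^sub>R ?g u v x y \<partial>lborel) = (\<integral>y. diff_quot a \<Omega> u (x, y) * diff_quot a \<Omega> v (x, y) \<partial>lborel)" .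
  qed
  also have "\<dots> = (\<integral>p. diff_quot a \<Omega> u p * diff_quot a \<Omega> v p \<partial>lborel2)"
    by (rule lborel_pair.integral_fst', rule integrable_mult_L2) (use fin in measurable)
  finally show ?thesis .
qed

context
  fixes a :: real and \<Omega> :: "(real ^ 'n) set"
  assumes a: "0 < a" "a < 1" and \<Omega>: "open \<Omega>"
begin

lemma sobolev_representative:
  assumes u: "u \<in> sobolev a"
  obtains v where "v \<in> borel_measurable borel" "AE x in lebesgue. u x = v x" "energy a v = energy a u"
    "energy a v < top" "L2sq lborel2 (diff_quot a \<Omega> v) < top"
proof -
  have \<Omega>m: "\<Omega> \<in> sets borel" using \<Omega> by simp
  obtain v where v: "v \<in> borel_measurable borel" "AE x in lebesgue. u x = v x"
    using borel_representative[OF sobolev_measurable[OF a u]] .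
  have e: "energy a v = energy a u" using energy_cong_AE[OF v(2), of a] by simp
  then have fin: "energy a v < top" using sobolev_energy_finite[OF a u] by simp
  then have "gagliardo a v < top" by (simp add: energy_def)
  then have "L2sq lborel2 (diff_quot a \<Omega> v) < top" using L2sq_diff_quot_le_gagliardo[OF v(1) \<Omega>m] by (rule order_le_less_trans[rotated])
  with v e fin show ?thesis by (intro that)
qed

lemma regional_form_cong:
  assumes "u \<in> sobolev a" "v \<in> sobolev a"
    and "AE x in lebesgue. x \<in> \<Omega> \<longrightarrow> \<phi> x = u x" "AE x in lebesgue. x \<in> \<Omega> \<longrightarrow> \<psi> x = v x"
  shows "regional_form a \<Omega> \<phi> \<psi> = regional_form a \<Omega> u v"
proof -
  obtain u' where u': "u' \<in> borel_measurable borel" "AE x in lebesgue. u x = u' x" "energy a u' = energy a u"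
    "energy a u' < top" "L2sq lborel2 (diff_quot a \<Omega> u') < top" by (rule sobolev_representative[OF assms(1)])
  obtain v' where v': "v' \<in> borel_measurable borel" "AE x in lebesgue. v x = v' x" "energy a v' = energy a v"
    "energy a v' < top" "L2sq lborel2 (diff_quot a \<Omega> v') < top" by (rule sobolev_representative[OF assms(2)])
  have 1: "AE x in lebesgue. x \<in> \<Omega> \<longrightarrow> \<phi> x = u' x" using assms(3) u'(2) by eventually_elim auto
  have 2: "AE x in lebesgue. x \<in> \<Omega> \<longrightarrow> \<psi> x = v' x" using assms(4) v'(2) by eventually_elim auto
  have 3: "AE x in lebesgue. x \<in> \<Omega> \<longrightarrow> u x = u' x" using u'(2) by eventually_elim auto
  have 4: "AE x in lebesgue. x \<in> \<Omega> \<longrightarrow> v x = v' x" using v'(2) by eventually_elim auto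
  show ?thesis
    unfolding regional_form_eq[OF \<Omega> u'(1) v'(1) 1 2 u'(5) v'(5)] regional_form_eq[OF \<Omega> u'(1) v'(1) 3 4 u'(5) v'(5)] ..
qed

lemma regional_form_sym: "regional_form a \<Omega> u v = regional_form a \<Omega> v u"
  unfolding regional_form_def by (simp add: mult.commute)

lemma regional_form_scale: "regional_form a \<Omega> (\<lambda>x. c * u x) v = c * regional_form a \<Omega> u v"
proof -
  have eq: "(c * u x - c * u y) * (v x - v y) / norm (x - y) powr (real CARD('n) + 2 * a) =
      c * ((u x - u y) * (v x - v y) / norm (x - y) powr (real CARD('n) + 2 * a))" for x y
    by (simp add: right_diff_distrib[symmetric] mult.assoc)
  show ?thesis unfolding regional_form_def eq by (simp only: integral_mult_right_zero)
qed

lemma regional_form_add: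
  assumes "u \<in> sobolev a" "v \<in> sobolev a" "w \<in> sobolev a"
  shows "regional_form a \<Omega> (\<lambda>x. u x + v x) w = regional_form a \<Omega> u w + regional_form a \<Omega> v w"
proof -
  have [measurable]: "\<Omega> \<in> sets borel" using \<Omega> by simp
  obtain u' where u': "u' \<in> borel_measurable borel" "AE x in lebesgue. u x = u' x" "energy a u' = energy a u"
    "energy a u' < top" "L2sq lborel2 (diff_quot a \<Omega> u') < top" by (rule sobolev_representative[OF assms(1)])
  obtain v' where v': "v' \<in> borel_measurable borel" "AE x in lebesgue. v x = v' x" "energy a v' = energy a v"
    "energy a v' < top" "L2sq lborel2 (diff_quot a \<Omega> v') < top" by (rule sobolev_representative[OF assms(2)])
  obtain w' where w': "w' \<in> borel_measurable borel" "AE x in lebesgue. w x = w' x" "energy a w' = energy a w"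
    "energy a w' < top" "L2sq lborel2 (diff_quot a \<Omega> w') < top" by (rule sobolev_representative[OF assms(3)])
  note [measurable] = u'(1) v'(1) w'(1)
  have eq: "diff_quot a \<Omega> (\<lambda>x. u' x + v' x) = (\<lambda>p. diff_quot a \<Omega> u' p + diff_quot a \<Omega> v' p)"
    by (auto simp: diff_quot_def algebra_simps)
  have fin: "L2sq lborel2 (diff_quot a \<Omega> (\<lambda>x. u' x + v' x)) < top"
    unfolding eq using u'(5) v'(5) by (intro L2sq_add_finite) measurable
  have 0: "AE x in lebesgue. x \<in> \<Omega> \<longrightarrow> u x + v x = u' x + v' x" using u'(2) v'(2) by eventually_elim auto
  have 1: "AE x in lebesgue. x \<in> \<Omega> \<longrightarrow> u x = u' x" using u'(2) by eventually_elim auto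
  have 2: "AE x in lebesgue. x \<in> \<Omega> \<longrightarrow> v x = v' x" using v'(2) by eventually_elim auto
  have 3: "AE x in lebesgue. x \<in> \<Omega> \<longrightarrow> w x = w' x" using w'(2) by eventually_elim auto
  have uv: "(\<lambda>x. u' x + v' x) \<in> borel_measurable borel" by measurable
  have i: "integrable lborel2 (\<lambda>p. diff_quot a \<Omega> u' p * diff_quot a \<Omega> w' p)" "integrable lborel2 (\<lambda>p. diff_quot a \<Omega> v' p * diff_quot a \<Omega> w' p)"
    by (rule integrable_mult_L2; use u'(5) v'(5) w'(5) in measurable)+
  have "regional_form a \<Omega> (\<lambda>x. u x + v x) w = (\<integral>p. diff_quot a \<Omega> (\<lambda>x. u' x + v' x) p * diff_quot a \<Omega> w' p \<partial>lborel2)"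
    by (rule regional_form_eq[OF \<Omega> uv w'(1) 0 3 fin w'(5)])
  also have "\<dots> = (\<integral>p. diff_quot a \<Omega> u' p * diff_quot a \<Omega> w' p + diff_quot a \<Omega> v' p * diff_quot a \<Omega> w' p \<partial>lborel2)"
    unfolding eq distrib_right ..
  also have "\<dots> = (\<integral>p. diff_quot a \<Omega> u' p * diff_quot a \<Omega> w' p \<partial>lborel2) + (\<integral>p. diff_quot a \<Omega> v' p * diff_quot a \<Omega> w' p \<partial>lborel2)"
    by (rule Bochner_Integration.integral_add[OF i])
  also have "\<dots> = regional_form a \<Omega> u w + regional_form a \<Omega> v w"
    by (simp only: regional_form_eq[OF \<Omega> u'(1) w'(1) 1 3 u'(5) w'(5)] regional_form_eq[OF \<Omega> v'(1) w'(1) 2 3 v'(5) w'(5)])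
  finally show ?thesis .
qed

lemma regional_form_self:
  assumes v: "v \<in> borel_measurable borel" "AE x in lebesgue. u x = v x" "L2sq lborel2 (diff_quot a \<Omega> v) < top"
  shows "L2sq lborel2 (diff_quot a \<Omega> v) = ennreal (regional_form a \<Omega> u u)" "regional_form a \<Omega> u u \<ge> 0"
proof -
  have [measurable]: "\<Omega> \<in> sets borel" using \<Omega> by simp
  note [measurable] = v(1)
  have 1: "AE x in lebesgue. x \<in> \<Omega> \<longrightarrow> u x = v x" using v(2) by eventually_elim auto
  have eq: "regional_form a \<Omega> u u = (\<integral>p. diff_quot a \<Omega> v p * diff_quot a \<Omega> v p \<partial>lborel2)"
    by (rule regional_form_eq[OF \<Omega> v(1,1) 1 1 v(3,3)])
  then show "regional_form a \<Omega> u u \<ge> 0" by simp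
  have "L2sq lborel2 (diff_quot a \<Omega> v) = (\<integral>\<^sup>+p. ennreal (diff_quot a \<Omega> v p * diff_quot a \<Omega> v p) \<partial>lborel2)"
    unfolding L2sq_def by (simp add: power2_eq_square)
  also have "\<dots> = ennreal (\<integral>p. diff_quot a \<Omega> v p * diff_quot a \<Omega> v p \<partial>lborel2)"
    by (rule nn_integral_eq_integral) (use v(3) in \<open>auto intro!: integrable_mult_L2\<close>)
  finally show "L2sq lborel2 (diff_quot a \<Omega> v) = ennreal (regional_form a \<Omega> u u)" unfolding eq .
qed

lemma regional_form_nonneg: "u \<in> sobolev a \<Longrightarrow> regional_form a \<Omega> u u \<ge> 0"
  by (rule sobolev_representative) (auto intro: regional_form_self(2))

lemma regional_form_le_energy: "u \<in> sobolev a \<Longrightarrow> ennreal (regional_form a \<Omega> u u) \<le> energy a u"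
proof -
  assume u: "u \<in> sobolev a"
  have \<Omega>m: "\<Omega> \<in> sets borel" using \<Omega> by simp
  obtain v where v: "v \<in> borel_measurable borel" "AE x in lebesgue. u x = v x" "energy a v = energy a u"
    "energy a v < top" "L2sq lborel2 (diff_quot a \<Omega> v) < top" by (rule sobolev_representative[OF u])
  have "ennreal (regional_form a \<Omega> u u) \<le> gagliardo a v"
    using L2sq_diff_quot_le_gagliardo[OF v(1) \<Omega>m, of a] regional_form_self(1)[OF v(1,2,5)] by simp
  also have "\<dots> \<le> energy a u" unfolding v(3)[symmetric] by (simp add: energy_def)
  finally show ?thesis .
qed

lemma regional_form_Cauchy_Schwarz:
  assumes u: "u \<in> sobolev a" and w: "w \<in> sobolev a"
  shows "\<bar>regional_form a \<Omega> u w\<bar> \<le> sqrt (regional_form a \<Omega> u u) * sqrt (regional_form a \<Omega> w w)"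
proof -
  have [measurable]: "\<Omega> \<in> sets borel" using \<Omega> by simp
  obtain u' where u': "u' \<in> borel_measurable borel" "AE x in lebesgue. u x = u' x" "energy a u' = energy a u"
    "energy a u' < top" "L2sq lborel2 (diff_quot a \<Omega> u') < top" by (rule sobolev_representative[OF u])
  obtain w' where w': "w' \<in> borel_measurable borel" "AE x in lebesgue. w x = w' x" "energy a w' = energy a w"
    "energy a w' < top" "L2sq lborel2 (diff_quot a \<Omega> w') < top" by (rule sobolev_representative[OF w])
  note [measurable] = u'(1) w'(1)
  have 1: "AE x in lebesgue. x \<in> \<Omega> \<longrightarrow> u x = u' x" using u'(2) by eventually_elim auto
  have 3: "AE x in lebesgue. x \<in> \<Omega> \<longrightarrow> w x = w' x" using w'(2) by eventually_elim auto
  have "\<bar>\<integral>p. diff_quot a \<Omega> u' p * diff_quot a \<Omega> w' p \<partial>lborel2\<bar> \<le> L2n lborel2 (diff_quot a \<Omega> u') * L2n lborel2 (diff_quot a \<Omega> w')"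
    by (rule integrable_mult_L2) (use u'(5) w'(5) in measurable)
  then show ?thesis
    unfolding regional_form_eq[OF \<Omega> u'(1) w'(1) 1 3 u'(5) w'(5)] L2n_def
      regional_form_self(1)[OF u'(1,2,5)] regional_form_self(1)[OF w'(1,2,5)]
    using regional_form_self(2)[OF u'(1,2,5)] regional_form_self(2)[OF w'(1,2,5)] by simp
qed

end

section \<open>Riesz representation for positive forms\<close>

lemma quadratic_vanishing_linear_term:
  fixes A B :: real
  assumes "\<And>t. t\<^sup>2 * A + 2 * t * B \<ge> 0"
  shows "B = 0"
proof (rule ccontr)
  assume "B \<noteq> 0"
  define q where "q = \<bar>A\<bar> + 1"
  define t where "t = - B / q"
  have q: "q > 0" "A \<le> q" by (simp_all add: q_def)
  have "t\<^sup>2 * A \<le> t\<^sup>2 * q" using q by (intro mult_left_mono) auto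
  also have "t\<^sup>2 * q = B\<^sup>2 / q" using q by (simp add: t_def power2_eq_square)
  finally have "t\<^sup>2 * A \<le> B\<^sup>2 / q" .
  moreover have "2 * t * B = - 2 * (B\<^sup>2 / q)" by (simp add: t_def power2_eq_square)
  moreover have "B\<^sup>2 / q > 0" using \<open>B \<noteq> 0\<close> q by simp
  ultimately show False using assms[of t] by linarith
qed

lemma le_of_perturbed_le:
  fixes p q r M N Ju Jz :: real
  assumes "\<bar>p\<bar> + \<bar>q\<bar> \<le> M" "Ju = Jz + 2 * (p - q) + r" "Ju < N" "0 \<le> r"
  shows "Jz - 2 * M \<le> N"
  using assms unfolding right_diff_distrib by linarith

text \<open>
  Minimise \<open>b u u - 2 * l u\<close>. The functional is bounded below because \<open>l\<close> is bounded, a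
  minimising sequence is Cauchy by the parallelogram identity, and the first variation at the
  minimiser is the claim. The space is a set of functions on which \<open>b\<close> may be degenerate up to
  null sets, hence the formulation without a norm.
\<close>

theorem riesz_representation_form:
  fixes S :: "('x \<Rightarrow> real) set" and b :: "('x \<Rightarrow> real) \<Rightarrow> ('x \<Rightarrow> real) \<Rightarrow> real"
  assumes S0: "S \<noteq> {}"
    and S_add: "\<And>u v. u \<in> S \<Longrightarrow> v \<in> S \<Longrightarrow> (\<lambda>x. u x + v x) \<in> S"
    and S_scale: "\<And>c u. u \<in> S \<Longrightarrow> (\<lambda>x. c * u x) \<in> S"
    and b_add: "\<And>u v w. u \<in> S \<Longrightarrow> v \<in> S \<Longrightarrow> w \<in> S \<Longrightarrow> b (\<lambda>x. u x + v x) w = b u w + b v w"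
    and b_scale: "\<And>c u w. u \<in> S \<Longrightarrow> w \<in> S \<Longrightarrow> b (\<lambda>x. c * u x) w = c * b u w"
    and b_sym: "\<And>u w. u \<in> S \<Longrightarrow> w \<in> S \<Longrightarrow> b u w = b w u"
    and b_pos: "\<And>u. u \<in> S \<Longrightarrow> b u u \<ge> 0"
    and b_cs: "\<And>u w. u \<in> S \<Longrightarrow> w \<in> S \<Longrightarrow> \<bar>b u w\<bar> \<le> sqrt (b u u) * sqrt (b w w)"
    and complete: "\<And>u. (\<And>n. u n \<in> S) \<Longrightarrow> (\<And>e. e > 0 \<Longrightarrow> \<exists>K. \<forall>m\<ge>K. \<forall>n\<ge>K. b (\<lambda>x. u m x - u n x) (\<lambda>x. u m x - u n x) \<le> e) \<Longrightarrow>
       \<exists>z\<in>S. (\<lambda>n::nat. b (\<lambda>x. u n x - z x) (\<lambda>x. u n x - z x)) \<longlonglongrightarrow> 0"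
    and l_add: "\<And>u v. u \<in> S \<Longrightarrow> v \<in> S \<Longrightarrow> l (\<lambda>x. u x + v x) = l u + l v"
    and l_scale: "\<And>c u. u \<in> S \<Longrightarrow> l (\<lambda>x. c * u x) = c * l u"
    and l_bound: "\<And>u. u \<in> S \<Longrightarrow> \<bar>l u\<bar> \<le> K * sqrt (b u u)"
  shows "\<exists>z\<in>S. \<forall>u\<in>S. b z u = l u"
proof -
  have b_add2: "b w (\<lambda>x. u x + v x) = b w u + b w v" if "u \<in> S" "v \<in> S" "w \<in> S" for u v w
    using b_add[OF that] b_sym[OF that(3) S_add[OF that(1,2)]] b_sym[OF that(1,3)] b_sym[OF that(2,3)] by simp
  have b_scale2: "b w (\<lambda>x. c * u x) = c * b w u" if "u \<in> S" "w \<in> S" for c u w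
    using b_scale[OF that] b_sym[OF that(2) S_scale[OF that(1)]] b_sym[OF that] by simp
  define J where "J u = b u u - 2 * l u" for u
  \<comment> \<open>Completing the square along a line.\<close>
  have J_line: "J (\<lambda>x. u x + c * w x) = J u + 2 * c * (b u w - l w) + c\<^sup>2 * b w w" if "u \<in> S" "w \<in> S" for u w c
  proof -
    note cw = S_scale[OF that(2), of c]
    have "b (\<lambda>x. u x + c * w x) (\<lambda>x. u x + c * w x) = b u u + c * b u w + (c * b w u + c * (c * b w w))"
      using that cw by (simp add: b_add b_add2 b_scale b_scale2 S_add)
    then show ?thesis
      unfolding J_def using that cw b_sym[OF that] by (simp add: l_add l_scale power2_eq_square algebra_simps)
  qed
  have J_bdd: "J u \<ge> - K\<^sup>2" if "u \<in> S" for u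
  proof -
    have "0 \<le> (sqrt (b u u) - K)\<^sup>2" by simp
    also have "\<dots> = b u u - 2 * (K * sqrt (b u u)) + K\<^sup>2" using b_pos[OF that] by (simp add: power2_diff)
    finally show ?thesis using l_bound[OF that] unfolding J_def by (simp add: abs_le_iff)
  qed
  define m where "m = Inf (J ` S)"
  have bdd: "bdd_below (J ` S)" using J_bdd by (intro bdd_belowI[of _ "- K\<^sup>2"]) auto
  have m_le: "m \<le> J u" if "u \<in> S" for u unfolding m_def using bdd that by (intro cInf_lower) auto
  have "\<exists>u\<in>S. J u < m + 1 / real (Suc n)" for n
  proof -
    have "\<exists>y\<in>J ` S. y < m + 1 / real (Suc n)"
      using cInf_lessD[of "J ` S" "m + 1 / real (Suc n)"] S0 unfolding m_def by auto
    then show ?thesis by blast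
  qed
  then obtain u where u: "\<And>n. u n \<in> S" "\<And>n. J (u n) < m + 1 / real (Suc n)" by metis
  have diff_S: "(\<lambda>x. v x - w x) \<in> S" if "v \<in> S" "w \<in> S" for v w
    using S_add[OF that(1) S_scale[OF that(2), of "-1"]] by simp
  \<comment> \<open>The parallelogram identity makes every minimising sequence a Cauchy sequence.\<close>
  have parallelogram: "b (\<lambda>x. v x - w x) (\<lambda>x. v x - w x) \<le> 2 * (J v - m) + 2 * (J w - m)" if v: "v \<in> S" and w: "w \<in> S" for v w
  proof -
    define d where "d x = v x - w x" for x
    have d: "d \<in> S" unfolding d_def by (rule diff_S[OF v w])
    have J1: "J v = J w + 2 * (b w d - l d) + b d d" using J_line[OF w d, of 1] by (simp add: d_def)
    have "m \<le> J (\<lambda>x. w x + (1/2) * d x)" by (rule m_le) (rule S_add[OF w S_scale[OF d]])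
    also have "\<dots> = J w + (b w d - l d) + b d d / 4" using J_line[OF w d, of "1/2"] by (simp add: power2_eq_square)
    finally have "b d d \<le> 2 * (J v - m) + 2 * (J w - m)" using J1 by (simp add: algebra_simps)
    then show ?thesis by (simp add: d_def[abs_def])
  qed
  have "\<exists>z\<in>S. (\<lambda>n. b (\<lambda>x. u n x - z x) (\<lambda>x. u n x - z x)) \<longlonglongrightarrow> 0"
  proof (rule complete[OF u(1)])
    fix e :: real assume e: "e > 0"
    obtain N :: nat where N: "4 / e < real N" using reals_Archimedean2 by blast
    have "b (\<lambda>x. u i x - u j x) (\<lambda>x. u i x - u j x) \<le> e" if "i \<ge> N" "j \<ge> N" for i j
    proof -
      have J: "2 * (J (u k) - m) \<le> 2 * (e / 4)" if "k \<ge> N" for k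
      proof -
        have "4 / e \<le> real (Suc k)" using N that by linarith
        then have "1 / real (Suc k) \<le> e / 4" using e by (simp add: field_simps)
        then have "m + 1 / real (Suc k) \<le> m + e / 4" by (rule add_left_mono)
        with u(2)[of k] have "J (u k) \<le> m + e / 4" by (rule less_imp_le[OF order_less_le_trans])
        then have "J (u k) - m \<le> e / 4" by (simp only: diff_le_eq add.commute)
        then show ?thesis by (rule mult_left_mono) simp
      qed
      have "2 * (J (u i) - m) + 2 * (J (u j) - m) \<le> 2 * (e / 4) + 2 * (e / 4)"
        using J[OF that(1)] J[OF that(2)] by (rule add_mono)
      also have "\<dots> = e" by simp
      finally have "2 * (J (u i) - m) + 2 * (J (u j) - m) \<le> e" .
      with parallelogram[OF u(1) u(1), of i j] show ?thesis by (rule order_trans)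
    qed
    then show "\<exists>K. \<forall>i\<ge>K. \<forall>j\<ge>K. b (\<lambda>x. u i x - u j x) (\<lambda>x. u i x - u j x) \<le> e" by blast
  qed
  then obtain z where z: "z \<in> S" and lim: "(\<lambda>n. b (\<lambda>x. u n x - z x) (\<lambda>x. u n x - z x)) \<longlonglongrightarrow> 0" by blast
  define d where "d n = (\<lambda>x. u n x - z x)" for n
  have d: "d n \<in> S" for n unfolding d_def by (rule diff_S[OF u(1) z])
  have dl: "(\<lambda>n. b (d n) (d n)) \<longlonglongrightarrow> 0" using lim by (simp add: d_def)
  have sd: "(\<lambda>n. sqrt (b (d n) (d n))) \<longlonglongrightarrow> 0" using tendsto_real_sqrt[OF dl] by simp
  have Ju: "J (u n) = J z + 2 * (b z (d n) - l (d n)) + b (d n) (d n)" for n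
    using J_line[OF z d, of 1 n] by (simp add: d_def)
  have "(\<lambda>n. J z - 2 * ((sqrt (b z z) + K) * sqrt (b (d n) (d n)))) \<longlonglongrightarrow> J z - 2 * ((sqrt (b z z) + K) * 0)"
    by (intro tendsto_intros sd)
  moreover have "(\<lambda>n. m + 1 / real (Suc n)) \<longlonglongrightarrow> m + 0"
    by (intro tendsto_add tendsto_const LIMSEQ_Suc[OF lim_1_over_n])
  moreover have "J z - 2 * ((sqrt (b z z) + K) * sqrt (b (d n) (d n))) \<le> m + 1 / real (Suc n)" for n
  proof -
    have "\<bar>b z (d n)\<bar> + \<bar>l (d n)\<bar> \<le> (sqrt (b z z) + K) * sqrt (b (d n) (d n))"
      using b_cs[OF z d, of n] l_bound[OF d, of n] by (simp add: distrib_right)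
    from le_of_perturbed_le[OF this Ju u(2) b_pos[OF d]] show ?thesis .
  qed
  ultimately have "J z - 2 * ((sqrt (b z z) + K) * 0) \<le> m + 0"
    by (intro LIMSEQ_le) auto
  then have Jz: "J z \<le> m" by simp
  have "b z w = l w" if w: "w \<in> S" for w
  proof -
    have "t\<^sup>2 * b w w + 2 * t * (b z w - l w) \<ge> 0" for t
      using J_line[OF z w, of t] m_le[OF S_add[OF z S_scale[OF w, of t]]] Jz by simp
    then have "b z w - l w = 0" by (rule quadratic_vanishing_linear_term)
    then show ?thesis by simp
  qed
  with z show ?thesis by blast
qed

section \<open>Completeness of the energy space\<close>

text \<open>
  Fatou's lemma, for the \<open>L\<^sup>2\<close> part and twice for the Gagliardo part; the factor \<open>2\<close> comes from
  bounding the two parts separately by \<open>e\<close>.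
\<close>

lemma energy_le_of_AE_limit:
  fixes f :: "nat \<Rightarrow> real ^ 'n \<Rightarrow> real"
  assumes fm [measurable]: "\<And>k. f k \<in> borel_measurable borel"
    and gm [measurable]: "g \<in> borel_measurable borel"
    and lim: "AE x in lborel. (\<lambda>k. f k x) \<longlonglongrightarrow> g x"
    and bd: "\<forall>\<^sub>F k in sequentially. energy a (f k) \<le> e"
  shows "energy a g \<le> 2 * e"
proof -
  have "L2sq lborel g \<le> liminf (\<lambda>k. L2sq lborel (f k))"
    by (rule L2sq_le_of_AE_limit[OF _ lim]) measurable
  also have "\<dots> \<le> e"
    by (rule Liminf_le) (use bd in \<open>auto elim!: eventually_mono simp: energy_def intro: order_trans[rotated]\<close>)
  finally have 1: "L2sq lborel g \<le> e" .
  have "gagliardo a g \<le> (\<integral>\<^sup>+s. liminf (\<lambda>k. ennreal (frac_kernel a s) * L2sq lborel (\<lambda>x. f k (x + s) - f k x)) \<partial>lborel)"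
    unfolding gagliardo_def
  proof (rule nn_integral_mono)
    fix s :: "real ^ 'n"
    have l: "AE x in lborel. (\<lambda>k. f k (x + s) - f k x) \<longlonglongrightarrow> g (x + s) - g x"
      using lim AE_lborel_translate[OF lim, of s] by eventually_elim (rule tendsto_diff)
    have sc: "ennreal (frac_kernel a s) * L2sq lborel h = L2sq lborel (\<lambda>x. sqrt (frac_kernel a s) *\<^sub>R h x)"
      if "h \<in> borel_measurable borel" for h :: "real ^ 'n \<Rightarrow> real"
      using L2sq_scale[of h lborel "sqrt (frac_kernel a s)"] that by simp
    have "L2sq lborel (\<lambda>x. sqrt (frac_kernel a s) *\<^sub>R (g (x + s) - g x)) \<le>
        liminf (\<lambda>k. L2sq lborel (\<lambda>x. sqrt (frac_kernel a s) *\<^sub>R (f k (x + s) - f k x)))"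
    proof (rule L2sq_le_of_AE_limit)
      show "AE x in lborel. (\<lambda>k. sqrt (frac_kernel a s) *\<^sub>R (f k (x + s) - f k x)) \<longlonglongrightarrow> sqrt (frac_kernel a s) *\<^sub>R (g (x + s) - g x)"
        using l by eventually_elim (intro tendsto_scaleR tendsto_const)
    qed measurable
    then show "ennreal (frac_kernel a s) * L2sq lborel (\<lambda>x. g (x + s) - g x) \<le> liminf (\<lambda>k. ennreal (frac_kernel a s) * L2sq lborel (\<lambda>x. f k (x + s) - f k x))"
      by (subst (1 2) sc) measurable
  qed
  also have "\<dots> \<le> liminf (\<lambda>k. gagliardo a (f k))" unfolding gagliardo_def by (rule nn_integral_liminf) measurable
  also have "\<dots> \<le> e"
    by (rule Liminf_le) (use bd in \<open>auto elim!: eventually_mono simp: energy_def intro: order_trans[rotated]\<close>)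
  finally have "gagliardo a g \<le> e" .
  with 1 show ?thesis unfolding energy_def mult_2 by (rule add_mono)
qed


lemma sobolev_complete:
  fixes u :: "nat \<Rightarrow> real ^ 'n \<Rightarrow> real"
  assumes a: "0 < a" "a < 1" and u: "\<And>n. u n \<in> sobolev a"
    and cauchy: "\<And>e. e > 0 \<Longrightarrow> \<exists>K. \<forall>m\<ge>K. \<forall>n\<ge>K. energy a (\<lambda>x. u m x - u n x) \<le> ennreal e"
  obtains z where "z \<in> sobolev a" "(\<lambda>n. energy a (\<lambda>x. u n x - z x)) \<longlonglongrightarrow> 0"
proof -
  have "\<exists>v. v \<in> borel_measurable borel \<and> (AE x in lebesgue. u n x = v x)" for n
    using borel_representative[OF sobolev_measurable[OF a u]] by metis
  then obtain v where vm [measurable]: "\<And>n. v n \<in> borel_measurable borel"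
    and uv: "\<And>n. AE x in lebesgue. u n x = v n x" by metis
  have Euv: "energy a (\<lambda>x. u m x - u n x) = energy a (\<lambda>x. v m x - v n x)" for m n
    by (rule energy_cong_AE) (use uv[of m] uv[of n] in eventually_elim, simp)
  have cauchy2: "\<exists>K. \<forall>m\<ge>K. \<forall>n\<ge>K. L2sq lborel (\<lambda>x. v m x - v n x) \<le> ennreal e" if "e > 0" for e
  proof -
    have "L2sq lborel (\<lambda>x. v m x - v n x) \<le> energy a (\<lambda>x. v m x - v n x)" for m n by (simp add: energy_def)
    then show ?thesis using cauchy[OF that] unfolding Euv by (blast intro: order_trans)
  qed
  have vml: "\<And>n. v n \<in> borel_measurable lborel" by simp
  obtain z r where z: "z \<in> borel_measurable lborel" and r: "strict_mono r"
    and zl: "AE x in lborel. (\<lambda>k. v (r k) x) \<longlonglongrightarrow> z x"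
    and "(\<lambda>n. L2sq lborel (\<lambda>x. v n x - z x)) \<longlonglongrightarrow> 0"
    by (rule L2_complete[OF vml cauchy2])
  have zm [measurable]: "z \<in> borel_measurable borel" using z by simp
  have bound: "energy a (\<lambda>x. v n x - z x) \<le> 2 * e" if "\<And>m. m \<ge> K \<Longrightarrow> energy a (\<lambda>x. v n x - v m x) \<le> e" for n e K
  proof (rule energy_le_of_AE_limit[where f="\<lambda>k x. v n x - v (r k) x"])
    show "AE x in lborel. (\<lambda>k. v n x - v (r k) x) \<longlonglongrightarrow> v n x - z x"
      using zl by eventually_elim (intro tendsto_diff tendsto_const)
    show "\<forall>\<^sub>F k in sequentially. energy a (\<lambda>x. v n x - v (r k) x) \<le> e"
      using eventually_ge_at_top[of K] by eventually_elim (use that seq_suble[OF r] order_trans in blast)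
  qed measurable
  have lim: "(\<lambda>n. energy a (\<lambda>x. v n x - z x)) \<longlonglongrightarrow> 0"
  proof (rule order_tendstoI)
    fix c :: ennreal assume "0 < c"
    then obtain e where e: "0 < e" "ennreal e < c" by (rule ennreal_approx_below)
    then have "e / 2 > 0" by simp
    then obtain K where K: "\<forall>m\<ge>K. \<forall>n\<ge>K. energy a (\<lambda>x. v m x - v n x) \<le> ennreal (e / 2)"
      using cauchy[of "e / 2"] unfolding Euv by blast
    have "energy a (\<lambda>x. v n x - z x) < c" if n: "n \<ge> K" for n
    proof -
      have "energy a (\<lambda>x. v n x - z x) \<le> 2 * ennreal (e / 2)" by (rule bound[of K]) (use K n in blast)
      also have "\<dots> = ennreal e" using e(1) by (simp add: ennreal_numeral[symmetric] ennreal_mult'[symmetric] del: ennreal_numeral)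
      finally show ?thesis using e(2) by (rule order_le_less_trans)
    qed
    then show "\<forall>\<^sub>F n in sequentially. energy a (\<lambda>x. v n x - z x) < c" by (rule eventually_sequentiallyI)
  qed auto
  have "\<forall>\<^sub>F n in sequentially. energy a (\<lambda>x. v n x - z x) < top" using order_tendstoD(2)[OF lim, of top] by simp
  then obtain n where n: "energy a (\<lambda>x. v n x - z x) < top" by (auto simp: eventually_sequentially)
  have vs: "v n \<in> sobolev a" by (rule sobolev_cong_AE[OF a u borel_imp_lebesgue[OF vm] uv])
  have "(\<lambda>x. v n x - z x) \<in> sobolev a"
    unfolding sobolev_iff[OF a] using n by (auto intro!: borel_imp_lebesgue)
  from sobolev_diff[OF a vs this] have zs: "z \<in> sobolev a" by simp
  have "energy a (\<lambda>x. u n x - z x) = energy a (\<lambda>x. v n x - z x)" for n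
    by (rule energy_cong_AE) (use uv[of n] in eventually_elim, simp)
  then show ?thesis using zs lim by (intro that[of z]) auto
qed

section \<open>Coercivity of the regional form\<close>

lemma frac_kernel_far_bound:
  assumes d: "0 < d" and s: "d \<le> norm s"
  shows "frac_kernel a s \<le> (1 / min 4 (d\<^sup>2)) * (frac_kernel a s * min 4 ((norm s)\<^sup>2))"
proof -
  have m: "min 4 (d\<^sup>2) > 0" using d by simp
  have "d\<^sup>2 \<le> (norm s)\<^sup>2" using d s by (intro power_mono) auto
  then have "min 4 (d\<^sup>2) \<le> min 4 ((norm s)\<^sup>2)" by (auto simp: min_def)
  then have "frac_kernel a s * min 4 (d\<^sup>2) \<le> frac_kernel a s * min 4 ((norm s)\<^sup>2)" by (intro mult_left_mono) auto
  then show ?thesis using m by (simp add: field_simps)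
qed


lemma nn_integral_frac_kernel_far:
  assumes a: "0 < a" "a < 1" and d: "0 < d"
  shows "(\<integral>\<^sup>+s. ennreal (frac_kernel a s) * indicator {s. d \<le> norm s} (s :: real ^ 'n) \<partial>lborel) < top"
proof -
  have "(\<integral>\<^sup>+s. ennreal (frac_kernel a s) * indicator {s. d \<le> norm s} (s :: real ^ 'n) \<partial>lborel) \<le>
     (\<integral>\<^sup>+s. ennreal (1 / min 4 (d\<^sup>2)) * ennreal (frac_kernel a s * min 4 ((norm (s :: real ^ 'n))\<^sup>2)) \<partial>lborel)"
  proof (rule nn_integral_mono)
    fix s :: "real ^ 'n"
    have "min 4 (d\<^sup>2) > 0" using d by simp
    then show "ennreal (frac_kernel a s) * indicator {s. d \<le> norm s} s \<le> ennreal (1 / min 4 (d\<^sup>2)) * ennreal (frac_kernel a s * min 4 ((norm s)\<^sup>2))"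
      using frac_kernel_far_bound[OF d, of s a] by (auto simp: indicator_def ennreal_mult'[symmetric] intro!: ennreal_leI)
  qed
  also have "\<dots> = ennreal (1 / min 4 (d\<^sup>2)) * (\<integral>\<^sup>+s. ennreal (frac_kernel a s * min 4 ((norm (s :: real ^ 'n))\<^sup>2)) \<partial>lborel)"
    by (rule nn_integral_cmult) measurable
  also have "\<dots> < top" using frac_kernel_min_finite[OF a, where 'n='n] by (simp add: ennreal_mult_less_top)
  finally show ?thesis .
qed

text \<open>
  If \<open>\<Omega>\<close> were contained in the closure of \<open>U\<close>, it would be open, closed, bounded and nonempty,
  which is impossible. So the difference has positive measure, \<open>u\<close> vanishes there, and the
  kernel is bounded below on the bounded set \<open>\<Omega>\<close>.
\<close>

lemma Poincare_regional:
  fixes \<Omega> U :: "(real ^ 'n) set"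
  assumes a: "0 < a" and \<Omega>: "bounded \<Omega>" "open \<Omega>" and U: "open U" "closure U \<subseteq> \<Omega>" "compact (closure U)" "U \<noteq> {}"
  shows "\<exists>c>0. \<forall>u :: real ^ 'n \<Rightarrow> real. u \<in> borel_measurable borel \<longrightarrow> (\<forall>x. x \<notin> U \<longrightarrow> u x = 0) \<longrightarrow>
      ennreal c * L2sq lborel u \<le> L2sq lborel2 (diff_quot a \<Omega> u)"
proof -
  have [measurable]: "\<Omega> \<in> sets borel" "U \<in> sets borel" using \<Omega> U by auto
  define A where "A = \<Omega> - closure U"
  have A_open: "open A" unfolding A_def using \<Omega>(2) by (intro open_Diff closed_closure)
  have [measurable]: "A \<in> sets borel" using A_open by simp
  have "A \<noteq> {}"
  proof
    assume "A = {}"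
    then have eq: "\<Omega> = closure U" using U(2) unfolding A_def by blast
    then have "closed \<Omega>" by simp
    moreover have "\<Omega> \<noteq> {}" using eq U(4) closure_subset by blast
    ultimately have "\<Omega> = UNIV" using \<Omega>(2) clopen by blast
    then show False using \<Omega>(1) not_bounded_UNIV by blast
  qed
  then obtain p r where pr: "r > 0" "ball p r \<subseteq> A" using A_open by (metis ex_in_conv openE)
  have vol: "emeasure lborel A > 0"
  proof -
    have "0 < emeasure lborel (ball p r)" using pr(1) by (simp add: emeasure_ball)
    also have "\<dots> \<le> emeasure lborel A" using pr(2) by (intro emeasure_mono) auto
    finally show ?thesis .
  qed
  have "bounded A" unfolding A_def using \<Omega>(1) by (rule bounded_subset) auto
  then have volfin: "emeasure lborel A < top" using emeasure_bounded_finite[of A] by simp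
  define m where "m = enn2real (emeasure lborel A)"
  have m: "emeasure lborel A = ennreal m" "m > 0"
    using vol volfin unfolding m_def by (auto simp: enn2real_positive_iff)
  obtain R where R: "\<And>x. x \<in> \<Omega> \<Longrightarrow> norm x \<le> R" using \<Omega>(1) by (auto simp: bounded_iff)
  \<comment> \<open>Larger than the diameter of \<open>\<Omega>\<close>.\<close>
  define D where "D = 2 * \<bar>R\<bar> + 1"
  define k where "k = D powr (- (real CARD('n) + 2 * a))"
  have k: "k > 0" unfolding k_def D_def by simp
  have kle: "k \<le> frac_kernel a (x - y)" if "x \<in> \<Omega>" "y \<in> \<Omega>" "x \<noteq> y" for x y
    unfolding k_def frac_kernel_def
  proof (rule powr_mono2')
    show "norm (x - y) \<le> D" using norm_triangle_ineq4[of x y] R[OF that(1)] R[OF that(2)] unfolding D_def by linarith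
  qed (use a that in auto)
  have "ennreal (k * m) * L2sq lborel u \<le> L2sq lborel2 (diff_quot a \<Omega> u)"
    if um [measurable]: "u \<in> borel_measurable borel" and u0: "\<And>x. x \<notin> U \<Longrightarrow> u x = 0" for u :: "real ^ 'n \<Rightarrow> real"
  proof -
    have "ennreal (k * m) * L2sq lborel u = (\<integral>\<^sup>+x. \<integral>\<^sup>+y. ennreal k * ennreal ((u x)\<^sup>2) * indicator A y \<partial>lborel \<partial>lborel)"
      using k m(2) unfolding L2sq_def
      by (simp add: nn_integral_cmult_indicator m(1) nn_integral_multc nn_integral_cmult ennreal_mult' mult_ac)
    also have "\<dots> \<le> L2sq lborel2 (diff_quot a \<Omega> u)"
      unfolding L2sq_diff_quot[OF um \<open>\<Omega> \<in> sets borel\<close>]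
    proof (intro nn_integral_mono)
      fix x y
      show "ennreal k * ennreal ((u x)\<^sup>2) * indicator A y \<le> indicator \<Omega> x * indicator \<Omega> y * (ennreal (frac_kernel a (x - y)) * ennreal ((u x - u y)\<^sup>2))"
      proof (cases "x \<in> U \<and> y \<in> A")
        case True
        then have "y \<notin> U" "y \<in> \<Omega>" "x \<in> \<Omega>" "x \<noteq> y" using U(2) closure_subset[of U] by (auto simp: A_def)
        then show ?thesis using True u0[of y] kle[of x y]
          by (auto simp: indicator_def intro!: mult_right_mono ennreal_leI)
      next
        case False
        then show ?thesis using u0[of x] by (auto simp: indicator_def)
      qed
    qed
    finally show ?thesis .
  qed
  then show ?thesis using k m(2) by (intro exI[of _ "k * m"]) auto
qed

text \<open>
  A pair of points outside \<open>\<Omega> \<times> \<Omega>\<close> contributes only if one of them is in \<open>U\<close> and the other one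
  off \<open>\<Omega>\<close>. Their distance is bounded below, and away from the origin the kernel is integrable.
\<close>

lemma exterior_energy:
  fixes \<Omega> U :: "(real ^ 'n) set"
  assumes a: "0 < a" "a < 1" and \<Omega>: "open \<Omega>" and U: "open U" "closure U \<subseteq> \<Omega>" "compact (closure U)"
  shows "\<exists>C\<ge>0. \<forall>u :: real ^ 'n \<Rightarrow> real. u \<in> borel_measurable borel \<longrightarrow> (\<forall>x. x \<notin> U \<longrightarrow> u x = 0) \<longrightarrow>
      gagliardo a u \<le> L2sq lborel2 (diff_quot a \<Omega> u) + ennreal C * L2sq lborel u"
proof -
  have [measurable]: "\<Omega> \<in> sets borel" "U \<in> sets borel" using \<Omega> U by auto
  have U\<Omega>: "U \<subseteq> \<Omega>" by (rule order_trans[OF closure_subset U(2)])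
  obtain d where d: "d > 0" "(\<Union>x\<in>closure U. cball x d) \<subseteq> \<Omega>"
    using compact_subset_open_imp_cball_epsilon_subset[OF U(3) \<Omega> U(2)] by blast
  have far: "d \<le> norm (x - y)" if "x \<in> U" "y \<notin> \<Omega>" for x y
  proof (rule ccontr)
    assume "\<not> d \<le> norm (x - y)"
    then have "y \<in> cball x d" by (simp add: dist_norm)
    then show False using that d(2) closure_subset[of U] by blast
  qed
  define kf where "kf s = ennreal (frac_kernel a s) * indicator {s. d \<le> norm s} s" for s :: "real ^ 'n"
  have kfm [measurable]: "kf \<in> borel_measurable borel" unfolding kf_def by measurable
  define C where "C = enn2real (\<integral>\<^sup>+s. kf s \<partial>lborel)"
  have C: "(\<integral>\<^sup>+s. kf s \<partial>lborel) = ennreal C"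
    unfolding C_def kf_def using nn_integral_frac_kernel_far[OF a d(1), where 'n='n] by simp
  have kf_sym: "kf (x - y) = kf (y - x)" for x y
    using frac_kernel_minus[of a "x - y"] by (simp add: kf_def indicator_def norm_minus_commute)
  have Cx: "(\<integral>\<^sup>+y. kf (x - y) \<partial>lborel) = ennreal C" for x
  proof -
    have "(\<integral>\<^sup>+y. kf (x - y) \<partial>lborel) = (\<integral>\<^sup>+y. kf (y + (- x)) \<partial>lborel)"
      by (simp add: kf_sym[of x])
    also have "\<dots> = ennreal C" unfolding C[symmetric] by (rule nn_integral_lborel_translate) measurable
    finally show ?thesis .
  qed
  have "gagliardo a u \<le> L2sq lborel2 (diff_quot a \<Omega> u) + ennreal (2 * C) * L2sq lborel u"
    if um [measurable]: "u \<in> borel_measurable borel" and u0: "\<And>x. x \<notin> U \<Longrightarrow> u x = 0" for u :: "real ^ 'n \<Rightarrow> real"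
  proof -
    let ?D = "\<lambda>x y. indicator \<Omega> x * indicator \<Omega> y * (ennreal (frac_kernel a (x - y)) * ennreal ((u x - u y)\<^sup>2))"
    have "gagliardo a u = (\<integral>\<^sup>+x. \<integral>\<^sup>+y. ennreal (frac_kernel a (x - y)) * ennreal ((u x - u y)\<^sup>2) \<partial>lborel \<partial>lborel)"
      by (rule double_integral_eq_gagliardo[OF um, symmetric])
    also have "\<dots> \<le> (\<integral>\<^sup>+x. \<integral>\<^sup>+y. ?D x y + (ennreal ((u x)\<^sup>2) * kf (x - y) + ennreal ((u y)\<^sup>2) * kf (x - y)) \<partial>lborel \<partial>lborel)"
    proof (intro nn_integral_mono)
      fix x y
      consider "x \<in> \<Omega> \<and> y \<in> \<Omega>" | "x \<in> U \<and> y \<notin> \<Omega>" | "y \<in> U \<and> x \<notin> \<Omega>" | "x \<notin> U \<and> y \<notin> U"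
        using U\<Omega> by blast
      then show "ennreal (frac_kernel a (x - y)) * ennreal ((u x - u y)\<^sup>2) \<le> ?D x y + (ennreal ((u x)\<^sup>2) * kf (x - y) + ennreal ((u y)\<^sup>2) * kf (x - y))"
      proof cases
        case 1 then show ?thesis by (simp add: add_increasing2)
      next
        case 2
        then have "y \<notin> U" using U(2) closure_subset[of U] by blast
        then show ?thesis using 2 far[of x y] u0[of y] by (simp add: kf_def mult.commute)
      next
        case 3
        then have "x \<notin> U" using U(2) closure_subset[of U] by blast
        then show ?thesis using 3 far[of y x] u0[of x] by (simp add: kf_def mult.commute norm_minus_commute)
      next
        case 4 then show ?thesis using u0 by simp
      qed
    qed
    also have "\<dots> = (\<integral>\<^sup>+x. \<integral>\<^sup>+y. ?D x y \<partial>lborel \<partial>lborel) +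
       ((\<integral>\<^sup>+x. \<integral>\<^sup>+y. ennreal ((u x)\<^sup>2) * kf (x - y) \<partial>lborel \<partial>lborel) + (\<integral>\<^sup>+x. \<integral>\<^sup>+y. ennreal ((u y)\<^sup>2) * kf (x - y) \<partial>lborel \<partial>lborel))"
      by (simp add: nn_integral_add)
    also have "(\<integral>\<^sup>+x. \<integral>\<^sup>+y. ennreal ((u y)\<^sup>2) * kf (x - y) \<partial>lborel \<partial>lborel) = (\<integral>\<^sup>+y. \<integral>\<^sup>+x. ennreal ((u y)\<^sup>2) * kf (x - y) \<partial>lborel \<partial>lborel)"
      by (rule lborel_pair.Fubini') measurable
    also have "\<dots> = (\<integral>\<^sup>+x. \<integral>\<^sup>+y. ennreal ((u x)\<^sup>2) * kf (x - y) \<partial>lborel \<partial>lborel)"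
      by (simp add: kf_sym)
    also have "(\<integral>\<^sup>+x. \<integral>\<^sup>+y. ennreal ((u x)\<^sup>2) * kf (x - y) \<partial>lborel \<partial>lborel) = ennreal C * L2sq lborel u"
      unfolding L2sq_def by (simp add: nn_integral_cmult Cx nn_integral_multc mult.commute)
    also have "(\<integral>\<^sup>+x. \<integral>\<^sup>+y. ?D x y \<partial>lborel \<partial>lborel) = L2sq lborel2 (diff_quot a \<Omega> u)"
      by (rule L2sq_diff_quot[symmetric]) measurable
    also have "ennreal C * L2sq lborel u + ennreal C * L2sq lborel u = ennreal (2 * C) * L2sq lborel u"
    proof -
      have eq: "ennreal (2 * C) = 2 * ennreal C" by (simp add: ennreal_mult')
      show ?thesis unfolding eq by (simp only: mult_2 distrib_right)
    qed
    finally show ?thesis .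
  qed
  then show ?thesis by (intro exI[of _ "2 * C"]) (auto simp: C_def)
qed

lemma regional_coercive:
  fixes \<Omega> U :: "(real ^ 'n) set"
  assumes a: "0 < a" "a < 1"
    and \<Omega>: "bounded \<Omega>" "open \<Omega>" and U: "open U" "closure U \<subseteq> \<Omega>" "compact (closure U)" "U \<noteq> {}"
  obtains K where "K > 0" "\<And>u. u \<in> sobolev_tilde a U \<Longrightarrow> energy a u \<le> ennreal (K * regional_form a \<Omega> u u)"
proof -
  obtain c where c: "c > 0" "\<And>u :: real ^ 'n \<Rightarrow> real. u \<in> borel_measurable borel \<Longrightarrow> (\<And>x. x \<notin> U \<Longrightarrow> u x = 0) \<Longrightarrow>
      ennreal c * L2sq lborel u \<le> L2sq lborel2 (diff_quot a \<Omega> u)" using Poincare_regional[OF a(1) \<Omega> U] by blast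
  obtain C where C: "C \<ge> 0" "\<And>u :: real ^ 'n \<Rightarrow> real. u \<in> borel_measurable borel \<Longrightarrow> (\<And>x. x \<notin> U \<Longrightarrow> u x = 0) \<Longrightarrow>
      gagliardo a u \<le> L2sq lborel2 (diff_quot a \<Omega> u) + ennreal C * L2sq lborel u" using exterior_energy[OF a \<Omega>(2) U(1-3)] by blast
  define K where "K = 1 + (1 + C) / c"
  have K: "K > 0" unfolding K_def using c(1) C(1) by (simp add: add_pos_nonneg)
  have "energy a u \<le> ennreal (K * regional_form a \<Omega> u u)" if u: "u \<in> sobolev_tilde a U" for u
  proof -
    note us = sobolev_tilde_sobolev[OF u]
    obtain v where v: "v \<in> borel_measurable borel" "AE x in lebesgue. u x = v x"
      using borel_representative[OF sobolev_measurable[OF a us]] .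
    note [measurable] = v(1)
    have Um [measurable]: "U \<in> sets borel" "\<Omega> \<in> sets borel" using U(1) \<Omega>(2) by auto
    define w where "w x = indicator U x * v x" for x
    have wm: "w \<in> borel_measurable borel" unfolding w_def by measurable
    have uw: "AE x in lebesgue. u x = w x"
      using v(2) sobolev_tilde_vanishes[OF a u U(1)] by eventually_elim (auto simp: w_def indicator_def)
    have w0: "w x = 0" if "x \<notin> U" for x using that by (simp add: w_def)
    have wfin: "L2sq lborel2 (diff_quot a \<Omega> w) < top"
    proof -
      have "L2sq lborel2 (diff_quot a \<Omega> w) \<le> gagliardo a w" by (rule L2sq_diff_quot_le_gagliardo[OF wm Um(2)])
      also have "\<dots> \<le> energy a u" using energy_cong_AE[OF uw, of a] by (simp add: energy_def)
      also have "\<dots> < top" by (rule sobolev_energy_finite[OF a us])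
      finally show ?thesis .
    qed
    define b where "b = regional_form a \<Omega> u u"
    have b: "L2sq lborel2 (diff_quot a \<Omega> w) = ennreal b" "b \<ge> 0"
      unfolding b_def by (rule regional_form_self[OF a \<Omega>(2) wm uw wfin])+
    have Lw: "L2sq lborel w \<le> ennreal (b / c)"
    proof -
      have "L2sq lborel w = ennreal (1 / c) * (ennreal c * L2sq lborel w)"
        using c(1) by (simp add: mult.assoc[symmetric] ennreal_mult'[symmetric])
      also have "\<dots> \<le> ennreal (1 / c) * ennreal b" using c(2)[OF wm w0] b(1) by (intro mult_left_mono) auto
      also have "\<dots> = ennreal (b / c)" using c(1) b(2) by (simp add: ennreal_mult'[symmetric])
      finally show ?thesis .
    qed
    have "energy a u = L2sq lborel w + gagliardo a w" using energy_cong_AE[OF uw, of a] by (simp add: energy_def)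
    also have "\<dots> \<le> L2sq lborel w + (ennreal b + ennreal C * L2sq lborel w)"
      using C(2)[OF wm w0] b(1) by (intro add_left_mono) simp
    also have "\<dots> \<le> ennreal (b / c) + (ennreal b + ennreal C * ennreal (b / c))"
      using Lw by (intro add_mono mult_left_mono order_refl) auto
    also have "\<dots> = ennreal (b / c + (b + C * (b / c)))"
    proof -
      have "b / c \<ge> 0" "C * (b / c) \<ge> 0" using b(2) c(1) C(1) by simp_all
      then show ?thesis using b(2) ennreal_mult'[OF C(1), of "b / c"] by (simp only: ennreal_plus add_nonneg_nonneg)
    qed
    also have "b / c + (b + C * (b / c)) = K * b" using c(1) by (simp add: K_def field_simps)
    finally show ?thesis unfolding b_def .
  qed
  then show ?thesis using K by (intro that)
qed

section \<open>The Dirichlet problem\<close>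

lemma AE_lebesgue_on_iff:
  assumes "S \<in> sets borel"
  shows "(AE x in lebesgue_on S. P x) \<longleftrightarrow> (AE x in lebesgue. x \<in> S \<longrightarrow> P x)"
  by (rule AE_restrict_space_iff) (use assms in simp)

lemma sobolev_onE:
  fixes u :: "real ^ 'n \<Rightarrow> real"
  assumes "open \<Omega>" "u \<in> sobolev_on a \<Omega>"
  obtains w where "w \<in> sobolev_extensions a \<Omega> u" "w \<in> sobolev a" "AE x in lebesgue. x \<in> \<Omega> \<longrightarrow> u x = w x"
proof -
  obtain w where w: "w \<in> sobolev_extensions a \<Omega> u" using assms(2) by (auto simp: sobolev_on_def)
  have "AE x in lebesgue. x \<in> \<Omega> \<longrightarrow> w x = u x"
    using w assms(1) by (simp add: sobolev_extensions_def AE_lebesgue_on_iff)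
  then have "AE x in lebesgue. x \<in> \<Omega> \<longrightarrow> u x = w x" by eventually_elim auto
  with w show ?thesis by (intro that[of w]) (auto simp: sobolev_extensions_def)
qed

lemma lipschitz_cutoff_between:
  fixes K \<Omega> :: "(real ^ 'n) set"
  assumes K: "compact K" "K \<subseteq> \<Omega>" "K \<noteq> {}" and \<Omega>: "open \<Omega>"
  obtains \<zeta> L where "\<And>x. \<bar>\<zeta> x\<bar> \<le> (1::real)" "\<And>x y. \<bar>\<zeta> x - \<zeta> y\<bar> \<le> L * norm (x - y)"
    "\<And>x. x \<in> K \<Longrightarrow> \<zeta> x = 1" "\<And>x. x \<notin> \<Omega> \<Longrightarrow> \<zeta> x = 0"
proof -
  obtain d where d: "d > 0" "(\<Union>x\<in>K. cball x d) \<subseteq> \<Omega>"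
    using compact_subset_open_imp_cball_epsilon_subset[OF K(1) \<Omega> K(2)] by blast
  define \<zeta> where "\<zeta> x = max 0 (1 - infdist x K / d)" for x
  have d0: "0 \<le> infdist x K / d" for x using d(1) by (simp add: infdist_nonneg)
  show ?thesis
  proof (rule that[of \<zeta> "1 / d"])
    show "\<bar>\<zeta> x\<bar> \<le> 1" for x using d0[of x] by (auto simp: \<zeta>_def)
    show "\<zeta> x = 1" if "x \<in> K" for x using that by (simp add: \<zeta>_def)
    show "\<bar>\<zeta> x - \<zeta> y\<bar> \<le> 1 / d * norm (x - y)" for x y
    proof -
      have "\<bar>\<zeta> x - \<zeta> y\<bar> \<le> \<bar>infdist x K / d - infdist y K / d\<bar>" by (auto simp: \<zeta>_def max_def)
      also have "\<dots> = \<bar>infdist x K - infdist y K\<bar> / d" using d(1) by (simp add: diff_divide_distrib[symmetric])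
      also have "\<dots> \<le> dist x y / d" using d(1) infdist_triangle_abs[of x K y] by (intro divide_right_mono) auto
      finally show ?thesis by (simp add: dist_norm)
    qed
    show "\<zeta> x = 0" if "x \<notin> \<Omega>" for x
    proof -
      have "d \<le> infdist x K"
      proof (rule ccontr)
        assume "\<not> d \<le> infdist x K"
        moreover obtain y where "y \<in> K" "infdist x K = dist x y"
          using infdist_attains_inf[OF compact_imp_closed[OF K(1)] K(3)] by metis
        ultimately have "x \<in> cball y d" "y \<in> K" by (auto simp: dist_commute)
        then show False using d(2) that by blast
      qed
      then show ?thesis using d(1) by (simp add: \<zeta>_def)
    qed
  qed
qed

text \<open>
  The supremum in the dual norm is exploited by rescaling \<open>\<psi>\<close>. The energy is visibly
  homogeneous, so the scaling factor is taken from it; this is why the bound is stated with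
  the energy and not with the Sobolev norm.
\<close>

lemma sobolev_dual_norm_bound:
  fixes U :: "(real ^ 'n) set"
  assumes a: "0 < a" "a < 1" and f: "f \<in> sobolev_dual a U"
    and C: "C > 0" "\<And>u :: real ^ 'n \<Rightarrow> real. u \<in> sobolev a \<Longrightarrow> (sobolev_norm a u)\<^sup>2 \<le> C * enn2real (energy a u)"
  shows "sobolev_dual_norm a U f \<ge> 0"
    and "\<psi> \<in> sobolev_tilde a U \<Longrightarrow> \<bar>f \<psi>\<bar> \<le> sobolev_dual_norm a U f * sqrt (C * enn2real (energy a \<psi>))"
proof -
  obtain K where K: "\<And>\<psi>. \<psi> \<in> sobolev_tilde a U \<Longrightarrow> \<bar>f \<psi>\<bar> \<le> K * sobolev_norm a \<psi>"
    using f unfolding sobolev_dual_def by blast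
  have f_scale: "f (\<lambda>x. c * \<psi> x) = c * f \<psi>" if "\<psi> \<in> sobolev_tilde a U" for c \<psi>
    using f that by (auto simp: sobolev_dual_def)
  let ?B = "{\<psi> \<in> sobolev_tilde a U. sobolev_norm a \<psi> \<le> 1}"
  have bdd: "bdd_above ((\<lambda>\<psi>. \<bar>f \<psi>\<bar>) ` ?B)"
  proof (rule bdd_aboveI2)
    fix \<psi> assume \<psi>: "\<psi> \<in> ?B"
    have "K * sobolev_norm a \<psi> \<le> \<bar>K\<bar> * 1"
      using \<psi> sobolev_norm_nonneg[of a \<psi>] by (intro mult_mono) auto
    then show "\<bar>f \<psi>\<bar> \<le> \<bar>K\<bar>" using K[of \<psi>] \<psi> by simp
  qed
  have up: "\<bar>f \<psi>\<bar> \<le> sobolev_dual_norm a U f" if "\<psi> \<in> sobolev_tilde a U" "sobolev_norm a \<psi> \<le> 1" for \<psi>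
    unfolding sobolev_dual_norm_def by (rule cSUP_upper[OF _ bdd]) (use that in simp)
  have norm_le: "sobolev_norm a \<psi> \<le> sqrt (C * enn2real (energy a \<psi>))" if "\<psi> \<in> sobolev a" for \<psi> :: "real ^ 'n \<Rightarrow> real"
    using C(2)[OF that] by (rule real_le_rsqrt)
  have zero: "(\<lambda>x. 0) \<in> sobolev_tilde a U"
    by (rule test_function_tilde[OF a]) (simp add: test_functions_def Ck_const)
  have "sobolev_norm a (\<lambda>x :: real ^ 'n. 0) \<le> 0"
    using norm_le[OF sobolev_0[OF a]] by (simp add: energy_def L2sq_def gagliardo_def)
  then show nonneg: "sobolev_dual_norm a U f \<ge> 0" using up[OF zero] by simp
  assume \<psi>: "\<psi> \<in> sobolev_tilde a U"
  note \<psi>s = sobolev_tilde_sobolev[OF \<psi>]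
  define N where "N = sqrt (C * enn2real (energy a \<psi>))"
  have N0: "N \<ge> 0" using C(1) by (simp add: N_def)
  show "\<bar>f \<psi>\<bar> \<le> sobolev_dual_norm a U f * sqrt (C * enn2real (energy a \<psi>))"
  proof (cases "N = 0")
    case True
    then have "sobolev_norm a \<psi> = 0" using norm_le[OF \<psi>s, folded N_def] sobolev_norm_nonneg[of a \<psi>] by simp
    then show ?thesis unfolding N_def[symmetric] True using K[OF \<psi>] by simp
  next
    case False
    then have N: "N > 0" using N0 by simp
    let ?\<psi> = "\<lambda>x. (1 / N) * \<psi> x"
    have t: "?\<psi> \<in> sobolev_tilde a U" by (rule sobolev_tilde_scale[OF a \<psi>])
    have "energy a ?\<psi> = ennreal ((1 / N)\<^sup>2) * energy a \<psi>" by (rule energy_scale[OF sobolev_measurable[OF a \<psi>s]])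
    then have "C * enn2real (energy a ?\<psi>) = (1 / N)\<^sup>2 * (C * enn2real (energy a \<psi>))"
      by (simp add: enn2real_mult)
    also have "C * enn2real (energy a \<psi>) = N\<^sup>2" using C(1) by (simp add: N_def)
    also have "(1 / N)\<^sup>2 * N\<^sup>2 = 1" using N by (simp add: power_divide)
    finally have "sobolev_norm a ?\<psi> \<le> 1" using norm_le[OF sobolev_tilde_sobolev[OF t]] by simp
    then have "\<bar>f ?\<psi>\<bar> \<le> sobolev_dual_norm a U f" by (rule up[OF t])
    then have "\<bar>(1 / N) * f \<psi>\<bar> \<le> sobolev_dual_norm a U f" unfolding f_scale[OF \<psi>] .
    then have "\<bar>f \<psi>\<bar> / N \<le> sobolev_dual_norm a U f" using N by (simp add: abs_mult)
    then have "\<bar>f \<psi>\<bar> \<le> sobolev_dual_norm a U f * N" using N by (simp add: pos_divide_le_eq)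
    then show ?thesis by (simp add: N_def)
  qed
qed

lemma sobolev_tilde_form_complete:
  fixes \<Omega> U :: "(real ^ 'n) set"
  assumes a: "0 < a" "a < 1" and \<Omega>: "open \<Omega>"
    and K: "K > 0" "\<And>u. u \<in> sobolev_tilde a U \<Longrightarrow> energy a u \<le> ennreal (K * regional_form a \<Omega> u u)"
    and u: "\<And>n. u n \<in> sobolev_tilde a U"
    and cauchy: "\<And>e. e > 0 \<Longrightarrow> \<exists>M. \<forall>m\<ge>M. \<forall>n\<ge>M. regional_form a \<Omega> (\<lambda>x. u m x - u n x) (\<lambda>x. u m x - u n x) \<le> e"
  shows "\<exists>z\<in>sobolev_tilde a U. (\<lambda>n::nat. regional_form a \<Omega> (\<lambda>x. u n x - z x) (\<lambda>x. u n x - z x)) \<longlonglongrightarrow> 0"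
proof -
  note us = sobolev_tilde_sobolev[OF u]
  have energy_cauchy: "\<exists>M. \<forall>m\<ge>M. \<forall>n\<ge>M. energy a (\<lambda>x. u m x - u n x) \<le> ennreal e" if "e > 0" for e
  proof -
    have "e / K > 0" using that K(1) by simp
    then obtain M where M: "\<forall>m\<ge>M. \<forall>n\<ge>M. regional_form a \<Omega> (\<lambda>x. u m x - u n x) (\<lambda>x. u m x - u n x) \<le> e / K"
      using cauchy by blast
    have "energy a (\<lambda>x. u m x - u n x) \<le> ennreal e" if "m \<ge> M" "n \<ge> M" for m n
    proof -
      have "energy a (\<lambda>x. u m x - u n x) \<le> ennreal (K * regional_form a \<Omega> (\<lambda>x. u m x - u n x) (\<lambda>x. u m x - u n x))"
        by (rule K(2)[OF sobolev_tilde_diff[OF a u u]])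
      also have "\<dots> \<le> ennreal (K * (e / K))"
        using M that K(1) by (intro ennreal_leI mult_left_mono) auto
      finally show ?thesis using K(1) by simp
    qed
    then show ?thesis by blast
  qed
  obtain z where z: "z \<in> sobolev a" and lim: "(\<lambda>n. energy a (\<lambda>x. u n x - z x)) \<longlonglongrightarrow> 0"
    by (rule sobolev_complete[OF a us energy_cauchy])
  have zt: "z \<in> sobolev_tilde a U"
  proof (rule sobolev_tilde_closed[OF a z])
    fix e :: real assume "e > 0"
    then obtain n where n: "energy a (\<lambda>x. u n x - z x) < ennreal e"
      using order_tendstoD(2)[OF lim, of "ennreal e"] by (auto simp: eventually_sequentially)
    have "energy a (\<lambda>x. (-1) * (u n x - z x)) = ennreal ((-1)\<^sup>2) * energy a (\<lambda>x. u n x - z x)"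
      by (rule energy_scale[OF sobolev_measurable[OF a sobolev_diff[OF a us z]]])
    then have "energy a (\<lambda>x. z x - u n x) < ennreal e" using n by simp
    then show "\<exists>u\<in>sobolev_tilde a U. energy a (\<lambda>x. z x - u x) < ennreal e" using u by blast
  qed
  have "(\<lambda>n. regional_form a \<Omega> (\<lambda>x. u n x - z x) (\<lambda>x. u n x - z x)) \<longlonglongrightarrow> 0"
  proof (rule tendsto_sandwich[OF _ _ tendsto_const])
    show "(\<lambda>n. enn2real (energy a (\<lambda>x. u n x - z x))) \<longlonglongrightarrow> 0"
      using lim by (intro tendsto_enn2real) (auto simp: zero_ennreal.rep_eq[symmetric])
    have "0 \<le> regional_form a \<Omega> (\<lambda>x. u n x - z x) (\<lambda>x. u n x - z x) \<and>
       regional_form a \<Omega> (\<lambda>x. u n x - z x) (\<lambda>x. u n x - z x) \<le> enn2real (energy a (\<lambda>x. u n x - z x))" for n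
    proof -
      note s = sobolev_diff[OF a us z, of n]
      have "enn2real (ennreal (regional_form a \<Omega> (\<lambda>x. u n x - z x) (\<lambda>x. u n x - z x))) \<le> enn2real (energy a (\<lambda>x. u n x - z x))"
        using regional_form_le_energy[OF a \<Omega> s] sobolev_energy_finite[OF a s] by (intro enn2real_mono) auto
      then show ?thesis using regional_form_nonneg[OF a \<Omega> s] by simp
    qed
    then show "\<forall>\<^sub>F n in sequentially. 0 \<le> regional_form a \<Omega> (\<lambda>x. u n x - z x) (\<lambda>x. u n x - z x)"
      "\<forall>\<^sub>F n in sequentially. regional_form a \<Omega> (\<lambda>x. u n x - z x) (\<lambda>x. u n x - z x) \<le> enn2real (energy a (\<lambda>x. u n x - z x))"
      by auto
  qed
  with zt show ?thesis by blast
qed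


text \<open>
  The function \<open>d\<close> may be nonzero off \<open>\<Omega>\<close>. Multiplication by a cutoff that is \<open>1\<close> on the
  closure of \<open>U\<close> and \<open>0\<close> off \<open>\<Omega>\<close> removes this part without changing \<open>d\<close> in \<open>\<Omega>\<close>, and then the
  density theorem applies.
\<close>

lemma sobolev_difference_tilde:
  fixes \<Omega> U :: "(real ^ 'n) set"
  assumes a: "0 < a" "a < 1" and \<Omega>: "open \<Omega>"
    and U: "open U" "compact (closure U)" "closure U \<subseteq> \<Omega>" "U \<noteq> {}" "lipschitz_boundary U"
    and d: "d \<in> sobolev a" "AE x in lebesgue. x \<in> \<Omega> - closure U \<longrightarrow> d x = 0"
  obtains e where "e \<in> sobolev_tilde a U" "AE x in lebesgue. x \<in> \<Omega> \<longrightarrow> d x = e x"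
proof -
  obtain \<zeta> L where \<zeta>: "\<And>x. \<bar>\<zeta> x\<bar> \<le> (1::real)" "\<And>x y. \<bar>\<zeta> x - \<zeta> y\<bar> \<le> L * norm (x - y)"
    "\<And>x. x \<in> closure U \<Longrightarrow> \<zeta> x = 1" "\<And>x. x \<notin> \<Omega> \<Longrightarrow> \<zeta> x = 0"
    using lipschitz_cutoff_between[OF U(2,3) _ \<Omega>] U(4) by auto
  have es: "(\<lambda>x. \<zeta> x * d x) \<in> sobolev a" by (rule sobolev_lipschitz_mult[OF a d(1) \<zeta>(1,2)])
  have "AE x in lebesgue. x \<notin> closure U \<longrightarrow> \<zeta> x * d x = 0"
    using d(2)
  proof eventually_elim
    case (elim x)
    then show ?case using \<zeta>(4)[of x] by (cases "x \<in> \<Omega>") auto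
  qed
  then have "(\<lambda>x. \<zeta> x * d x) \<in> sobolev_tilde a U" by (rule sobolev_tilde_lipschitz[OF a U(1,2,5) es])
  moreover have "AE x in lebesgue. x \<in> \<Omega> \<longrightarrow> d x = \<zeta> x * d x"
    using d(2)
  proof eventually_elim
    case (elim x)
    then show ?case using \<zeta>(3)[of x] by (cases "x \<in> closure U") auto
  qed
  ultimately show ?thesis by (rule that)
qed

theorem theorem2p13:
  fixes \<Omega> \<O> :: "(real ^ 'n) set" and a :: real
  assumes "bounded \<Omega>" and "lipschitz_domain \<Omega>"
    and "\<O> \<subseteq> \<Omega>" and "\<O> \<noteq> {}" and "open \<O>" and "lipschitz_domain \<O>"
    and "compactly_contained \<O> \<Omega>"
    and "0 < a" and "a < 1"
  shows "\<exists>C. \<forall>f\<in>sobolev_dual a \<O>. \<forall>G\<in>sobolev_on a \<Omega>. \<forall>g :: real ^ 'n \<Rightarrow> real.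
           (AE x in lebesgue_on (\<Omega> - closure \<O>). G x = g x) \<longrightarrow>
           (\<exists>v. weak_solution a \<Omega> \<O> f g v \<and>
                (\<forall>w. weak_solution a \<Omega> \<O> f g w \<longrightarrow> (AE x in lebesgue_on \<Omega>. w x = v x)) \<and>
                sobolev_on_norm a \<Omega> v
                  \<le> C * (sobolev_dual_norm a \<O> f + sobolev_on_norm a \<Omega> G))"
proof -
  note a = \<open>0 < a\<close> \<open>a < 1\<close>
  have \<Omega>: "bounded \<Omega>" "open \<Omega>" using assms by (auto simp: lipschitz_domain_def)
  have U: "open \<O>" "closure \<O> \<subseteq> \<Omega>" "compact (closure \<O>)" "\<O> \<noteq> {}" "lipschitz_boundary \<O>"
    using assms by (auto simp: lipschitz_domain_def compactly_contained_def)
  have \<Omega>m: "\<Omega> \<in> sets borel" "\<Omega> - closure \<O> \<in> sets borel" using \<Omega>(2) by auto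
  let ?b = "regional_form a \<Omega>" and ?H = "sobolev_tilde a \<O>"
  obtain C1 where C1: "C1 > 0"
    "\<And>u :: real ^ 'n \<Rightarrow> real. u \<in> sobolev a \<Longrightarrow> enn2real (energy a u) \<le> C1 * (sobolev_norm a u)\<^sup>2"
    "\<And>u :: real ^ 'n \<Rightarrow> real. u \<in> sobolev a \<Longrightarrow> (sobolev_norm a u)\<^sup>2 \<le> C1 * enn2real (energy a u)"
    using sobolev_norm_energy_bounds[OF a, where 'n='n] by metis
  obtain K where K: "K > 0" "\<And>u. u \<in> ?H \<Longrightarrow> energy a u \<le> ennreal (K * ?b u u)"
    using regional_coercive[OF a \<Omega> U(1-4)] by metis
  note Hs = sobolev_tilde_sobolev[of _ a \<O>]
  have b_pos: "?b u u \<ge> 0" if "u \<in> sobolev a" for u by (rule regional_form_nonneg[OF a \<Omega>(2) that])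
  have b_le: "?b u u \<le> enn2real (energy a u)" if "u \<in> sobolev a" for u
  proof -
    have "enn2real (ennreal (?b u u)) \<le> enn2real (energy a u)"
      using regional_form_le_energy[OF a \<Omega>(2) that] sobolev_energy_finite[OF a that] by (intro enn2real_mono) auto
    then show ?thesis using b_pos[OF that] by simp
  qed
  have energy_le: "enn2real (energy a u) \<le> K * ?b u u" if "u \<in> ?H" for u
    using K(2)[OF that] K(1) b_pos[OF Hs[OF that]] by (intro enn2real_leI) auto
  define c where "c = sqrt (C1 * K)"
  have c: "c \<ge> 0" using C1(1) K(1) by (simp add: c_def)
  have f_le: "\<bar>f \<psi>\<bar> \<le> sobolev_dual_norm a \<O> f * c * sqrt (?b \<psi> \<psi>)" if f: "f \<in> sobolev_dual a \<O>" and \<psi>: "\<psi> \<in> ?H" for f \<psi>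
  proof -
    have dn1: "sobolev_dual_norm a \<O> f \<ge> 0"
      by (rule sobolev_dual_norm_bound(1)[OF a f C1(1)]) (rule C1(3))
    have dn2: "\<bar>f \<psi>\<bar> \<le> sobolev_dual_norm a \<O> f * sqrt (C1 * enn2real (energy a \<psi>))"
      by (rule sobolev_dual_norm_bound(2)[OF a f C1(1) _ \<psi>]) (rule C1(3))
    have "C1 * enn2real (energy a \<psi>) \<le> C1 * (K * ?b \<psi> \<psi>)" using energy_le[OF \<psi>] C1(1) by (intro mult_left_mono) auto
    then have "sqrt (C1 * enn2real (energy a \<psi>)) \<le> sqrt (C1 * K * ?b \<psi> \<psi>)" by (simp add: mult.assoc)
    also have "\<dots> = c * sqrt (?b \<psi> \<psi>)" by (simp only: c_def real_sqrt_mult)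
    finally have "sobolev_dual_norm a \<O> f * sqrt (C1 * enn2real (energy a \<psi>)) \<le> sobolev_dual_norm a \<O> f * (c * sqrt (?b \<psi> \<psi>))"
      using dn1 by (rule mult_left_mono)
    with dn2 show ?thesis unfolding mult.assoc by (rule order_trans)
  qed
  have solve: "\<exists>z\<in>?H. \<forall>\<psi>\<in>?H. ?b z \<psi> = l \<psi>"
    if l: "\<And>u v. u \<in> ?H \<Longrightarrow> v \<in> ?H \<Longrightarrow> l (\<lambda>x. u x + v x) = l u + l v" "\<And>c u. u \<in> ?H \<Longrightarrow> l (\<lambda>x. c * u x) = c * l u"
      "\<And>u. u \<in> ?H \<Longrightarrow> \<bar>l u\<bar> \<le> M * sqrt (?b u u)" for l M
  proof (rule riesz_representation_form[where S="?H" and b="?b" and K=M])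
    have "(\<lambda>x. 0) \<in> ?H" by (rule test_function_tilde[OF a]) (simp add: test_functions_def Ck_const)
    then show "?H \<noteq> {}" by blast
  qed (auto intro: sobolev_tilde_add[OF a] sobolev_tilde_scale[OF a] regional_form_add[OF a \<Omega>(2)] Hs
      regional_form_scale[OF a \<Omega>(2)] regional_form_sym[OF a \<Omega>(2)] b_pos regional_form_Cauchy_Schwarz[OF a \<Omega>(2)]
      sobolev_tilde_form_complete[OF a \<Omega>(2) K] l)
  \<comment> \<open>The norm of \<open>W' + z\<close> will be at most \<open>\<alpha>\<close> times the norm of \<open>W'\<close> plus \<open>\<beta>\<close> times \<open>sqrt (B z z)\<close>.\<close>
  define \<alpha> where "\<alpha> = sqrt 2 * C1"
  define \<beta> where "\<beta> = sqrt (2 * C1 * K)"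
  define D where "D = \<beta> * c + \<alpha> + \<beta> * sqrt C1"
  have pos: "\<alpha> > 0" "\<beta> \<ge> 0" "sqrt C1 \<ge> 0" using C1(1) K(1) by (auto simp: \<alpha>_def \<beta>_def)
  have D: "D > 0" "\<beta> * c \<le> D" "\<alpha> + \<beta> * sqrt C1 \<le> D" using pos c by (auto simp: D_def add_nonneg_pos add_pos_nonneg)
  show ?thesis
  proof (intro exI[of _ D] ballI allI impI)
    fix f G and g :: "real ^ 'n \<Rightarrow> real"
    assume f: "f \<in> sobolev_dual a \<O>" and G: "G \<in> sobolev_on a \<Omega>"
      and "AE x in lebesgue_on (\<Omega> - closure \<O>). G x = g x"
    then have Gg: "AE x in lebesgue. x \<in> \<Omega> - closure \<O> \<longrightarrow> G x = g x" by (simp only: AE_lebesgue_on_iff[OF \<Omega>m(2)])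
    define F where "F = sobolev_dual_norm a \<O> f"
    have F: "F \<ge> 0" unfolding F_def by (rule sobolev_dual_norm_bound(1)[OF a f C1(1)]) (rule C1(3))
    obtain W where W: "W \<in> sobolev_extensions a \<Omega> G" "W \<in> sobolev a" "AE x in lebesgue. x \<in> \<Omega> \<longrightarrow> G x = W x"
      by (rule sobolev_onE[OF \<Omega>(2) G])
    define l where "l \<psi> = f \<psi> - ?b W \<psi>" for \<psi>
    define M where "M = F * c + sqrt (?b W W)"
    have M: "M \<ge> 0" using F c b_pos[OF W(2)] by (simp add: M_def)
    have "\<exists>z\<in>?H. \<forall>\<psi>\<in>?H. ?b z \<psi> = l \<psi>"
    proof (rule solve)
      fix u v assume uv: "u \<in> ?H" "v \<in> ?H"
      have "f (\<lambda>x. u x + v x) = f u + f v" using f uv by (simp add: sobolev_dual_def)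
      moreover have "?b W (\<lambda>x. u x + v x) = ?b W u + ?b W v"
        using regional_form_add[OF a \<Omega>(2) Hs[OF uv(1)] Hs[OF uv(2)] W(2)] by (simp only: regional_form_sym[OF a \<Omega>(2), of W])
      ultimately show "l (\<lambda>x. u x + v x) = l u + l v" by (simp add: l_def)
    next
      fix k u assume u: "u \<in> ?H"
      have "f (\<lambda>x. k * u x) = k * f u" using f u by (simp add: sobolev_dual_def)
      moreover have "?b W (\<lambda>x. k * u x) = k * ?b W u"
        by (simp only: regional_form_sym[OF a \<Omega>(2), of W] regional_form_scale[OF a \<Omega>(2)])
      ultimately show "l (\<lambda>x. k * u x) = k * l u" by (simp add: l_def right_diff_distrib)
    next
      fix u assume u: "u \<in> ?H"
      have "\<bar>l u\<bar> \<le> \<bar>f u\<bar> + \<bar>?b W u\<bar>" unfolding l_def by (rule abs_triangle_ineq4)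
      also have "\<dots> \<le> F * c * sqrt (?b u u) + sqrt (?b W W) * sqrt (?b u u)"
        unfolding F_def by (intro add_mono f_le[OF f u] regional_form_Cauchy_Schwarz[OF a \<Omega>(2) W(2) Hs[OF u]])
      finally show "\<bar>l u\<bar> \<le> M * sqrt (?b u u)" by (simp add: M_def distrib_right)
    qed
    then obtain z where z: "z \<in> ?H" and bz: "\<And>\<psi>. \<psi> \<in> ?H \<Longrightarrow> ?b z \<psi> = f \<psi> - ?b W \<psi>" unfolding l_def by blast
    note zs = Hs[OF z]
    define v where "v x = W x + z x" for x
    have vs: "v \<in> sobolev a" unfolding v_def by (rule sobolev_add[OF a W(2) zs])
    have bv: "?b v \<psi> = f \<psi>" if "\<psi> \<in> ?H" for \<psi>
      using regional_form_add[OF a \<Omega>(2) W(2) zs Hs[OF that]] bz[OF that] by (simp add: v_def[abs_def])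
    have z0: "AE x in lebesgue. x \<notin> \<O> \<longrightarrow> z x = 0" by (rule sobolev_tilde_vanishes[OF a z U(1)])
    have v_sol: "weak_solution a \<Omega> \<O> f g v"
      unfolding weak_solution_def
    proof (intro conjI ballI bv)
      have "v \<in> sobolev_extensions a \<Omega> v" using vs by (simp add: sobolev_extensions_def)
      then show "v \<in> sobolev_on a \<Omega>" by (auto simp: sobolev_on_def)
      have "AE x in lebesgue. x \<in> \<Omega> - closure \<O> \<longrightarrow> v x = g x"
        using Gg W(3) z0
      proof eventually_elim
        case (elim x)
        then show ?case using closure_subset[of \<O>] by (auto simp: v_def)
      qed
      then show "AE x in lebesgue_on (\<Omega> - closure \<O>). v x = g x" by (simp only: AE_lebesgue_on_iff[OF \<Omega>m(2)])
    qed
    have unique: "AE x in lebesgue_on \<Omega>. w x = v x" if w: "weak_solution a \<Omega> \<O> f g w" for w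
    proof -
      obtain W2 where W2: "W2 \<in> sobolev_extensions a \<Omega> w" "W2 \<in> sobolev a" "AE x in lebesgue. x \<in> \<Omega> \<longrightarrow> w x = W2 x"
        using w by (auto simp: weak_solution_def elim: sobolev_onE[OF \<Omega>(2)])
      have bw: "?b w \<psi> = f \<psi>" if "\<psi> \<in> ?H" for \<psi> using w that by (simp add: weak_solution_def)
      define d where "d x = W2 x + (-1) * v x" for x
      have nv: "(\<lambda>x. (-1) * v x) \<in> sobolev a" by (rule sobolev_scale[OF a vs])
      have ds: "d \<in> sobolev a" unfolding d_def by (rule sobolev_add[OF a W2(2) nv])
      have wg: "AE x in lebesgue. x \<in> \<Omega> - closure \<O> \<longrightarrow> w x = g x"
        using w by (simp add: weak_solution_def AE_lebesgue_on_iff[OF \<Omega>m(2)])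
      have vg: "AE x in lebesgue. x \<in> \<Omega> - closure \<O> \<longrightarrow> v x = g x"
        using v_sol by (simp add: weak_solution_def AE_lebesgue_on_iff[OF \<Omega>m(2)])
      have d0: "AE x in lebesgue. x \<in> \<Omega> - closure \<O> \<longrightarrow> d x = 0"
        using wg vg W2(3) by eventually_elim (auto simp: d_def)
      obtain e where e: "e \<in> ?H" "AE x in lebesgue. x \<in> \<Omega> \<longrightarrow> d x = e x"
        by (rule sobolev_difference_tilde[OF a \<Omega>(2) U(1,3,2,4,5) ds d0])
      have "?b e e = ?b d e"
        by (rule regional_form_cong[OF a \<Omega>(2) Hs[OF e(1)] Hs[OF e(1)] e(2), symmetric]) simp
      also have "\<dots> = ?b W2 e + (-1) * ?b v e"
        using regional_form_add[OF a \<Omega>(2) W2(2) nv Hs[OF e(1)]] regional_form_scale[OF a \<Omega>(2), of "-1" v e]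
        by (simp add: d_def[abs_def])
      also have "?b W2 e = ?b w e"
        by (rule regional_form_cong[OF a \<Omega>(2) W2(2) Hs[OF e(1)] W2(3), symmetric]) simp
      finally have "?b e e = 0" using bw[OF e(1)] bv[OF e(1)] by simp
      then have "energy a e = 0" using K(2)[OF e(1)] by simp
      then have "L2sq lborel e = 0" by (simp add: energy_def)
      then have "(\<integral>\<^sup>+x. ennreal ((norm (e x))\<^sup>2) \<partial>lebesgue) = 0" by (simp add: L2sq_def nn_integral_completion)
      then have "AE x in lebesgue. ennreal ((norm (e x))\<^sup>2) = 0"
        using sobolev_measurable[OF a Hs[OF e(1)]] by (subst (asm) nn_integral_0_iff_AE) auto
      then have "AE x in lebesgue. x \<in> \<Omega> \<longrightarrow> w x = v x"
        using e(2) W2(3) by eventually_elim (auto simp: d_def)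
      then show ?thesis by (simp only: AE_lebesgue_on_iff[OF \<Omega>m(1)])
    qed
    have sz: "sqrt (?b z z) \<le> M"
    proof -
      let ?s = "sqrt (?b z z)"
      have "?s * ?s = f z - ?b W z" using bz[OF z] b_pos[OF zs] by simp
      also have "\<dots> \<le> \<bar>f z\<bar> + \<bar>?b W z\<bar>" by linarith
      also have "\<dots> \<le> F * c * ?s + sqrt (?b W W) * ?s"
        unfolding F_def by (intro add_mono f_le[OF f z] regional_form_Cauchy_Schwarz[OF a \<Omega>(2) W(2) zs])
      also have "\<dots> = M * ?s" by (simp add: M_def distrib_right)
      finally have le: "?s * ?s \<le> M * ?s" .
      show ?thesis
      proof (cases "?s > 0")
        case True then show ?thesis by (rule mult_right_le_imp_le[OF le])
      qed (use M in linarith)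
    qed
    \<comment> \<open>The function \<open>v\<close> was built from one extension \<open>W\<close> of \<open>G\<close>, but the estimate is needed for all of them, since the norm of \<open>G\<close> is an infimum.\<close>
    have est: "sobolev_on_norm a \<Omega> v \<le> D * (F + sobolev_norm a W')" if W': "W' \<in> sobolev_extensions a \<Omega> G" for W'
    proof -
      have W's: "W' \<in> sobolev a" using W' by (simp add: sobolev_extensions_def)
      have W'G: "AE x in lebesgue. x \<in> \<Omega> \<longrightarrow> W' x = G x"
        using W' by (simp add: sobolev_extensions_def AE_lebesgue_on_iff[OF \<Omega>m(1)])
      define N where "N = sobolev_norm a W'"
      have N: "N \<ge> 0" unfolding N_def by (rule sobolev_norm_nonneg)
      let ?V = "\<lambda>x. W' x + z x" and ?s = "sqrt (?b z z)"
      have Vs: "?V \<in> sobolev a" by (rule sobolev_add[OF a W's zs])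
      have "AE x in lebesgue. x \<in> \<Omega> \<longrightarrow> ?V x = v x" using W'G W(3) by eventually_elim (auto simp: v_def)
      then have "?V \<in> sobolev_extensions a \<Omega> v" using Vs by (simp add: sobolev_extensions_def AE_lebesgue_on_iff[OF \<Omega>m(1)])
      then have "sobolev_on_norm a \<Omega> v \<le> sobolev_norm a ?V"
        unfolding sobolev_on_norm_def by (intro cINF_lower bdd_belowI2[of _ 0] sobolev_norm_nonneg)
      also have "sobolev_norm a ?V \<le> \<alpha> * N + \<beta> * ?s"
      proof (rule power2_le_imp_le)
        have "enn2real (energy a ?V) \<le> enn2real (2 * energy a W' + 2 * energy a z)"
          using sobolev_energy_finite[OF a W's] sobolev_energy_finite[OF a zs]
          by (intro enn2real_mono energy_add sobolev_measurable[OF a] W's zs) (simp add: ennreal_mult_less_top)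
        also have "\<dots> = 2 * enn2real (energy a W') + 2 * enn2real (energy a z)"
          using sobolev_energy_finite[OF a W's] sobolev_energy_finite[OF a zs] by (simp add: enn2real_plus enn2real_mult ennreal_mult_less_top)
        also have "\<dots> \<le> 2 * (C1 * N\<^sup>2) + 2 * (K * ?b z z)"
          unfolding N_def by (intro add_mono mult_left_mono C1(2) energy_le W's z) auto
        finally have "C1 * enn2real (energy a ?V) \<le> C1 * (2 * (C1 * N\<^sup>2) + 2 * (K * ?b z z))"
          using C1(1) by (intro mult_left_mono) auto
        with C1(3)[OF Vs] have "(sobolev_norm a ?V)\<^sup>2 \<le> C1 * (2 * (C1 * N\<^sup>2) + 2 * (K * ?b z z))" by (rule order_trans)
        also have "\<dots> = (\<alpha> * N)\<^sup>2 + (\<beta> * ?s)\<^sup>2"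
          using C1(1) K(1) b_pos[OF zs] by (simp add: \<alpha>_def \<beta>_def power_mult_distrib power2_eq_square algebra_simps)
        also have "\<dots> \<le> (\<alpha> * N + \<beta> * ?s)\<^sup>2"
          using pos N b_pos[OF zs] by (simp add: power2_sum)
        finally show "(sobolev_norm a ?V)\<^sup>2 \<le> (\<alpha> * N + \<beta> * ?s)\<^sup>2" .
        show "\<alpha> * N + \<beta> * ?s \<ge> 0" using pos N b_pos[OF zs] by simp
      qed
      also have "\<dots> \<le> \<alpha> * N + \<beta> * (F * c + sqrt C1 * N)"
      proof -
        have "?b W W = ?b W' W'"
        proof (rule regional_form_cong[OF a \<Omega>(2) W's W's])
          show "AE x in lebesgue. x \<in> \<Omega> \<longrightarrow> W x = W' x" using W'G W(3) by eventually_elim auto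
          then show "AE x in lebesgue. x \<in> \<Omega> \<longrightarrow> W x = W' x" .
        qed
        also have "\<dots> \<le> C1 * N\<^sup>2" using b_le[OF W's] C1(2)[OF W's] unfolding N_def by (rule order_trans)
        finally have "sqrt (?b W W) \<le> sqrt (C1 * N\<^sup>2)" by (rule real_sqrt_le_mono)
        also have "\<dots> = sqrt C1 * N" using N by (simp add: real_sqrt_mult)
        finally have "?s \<le> F * c + sqrt C1 * N" using sz unfolding M_def by simp
        then show ?thesis using pos(2) by (intro add_left_mono mult_left_mono)
      qed
      also have "\<dots> = (\<beta> * c) * F + (\<alpha> + \<beta> * sqrt C1) * N" by (simp add: algebra_simps)
      also have "\<dots> \<le> D * F + D * N" by (intro add_mono mult_right_mono D(2,3) F N)
      finally show ?thesis by (simp add: N_def distrib_left)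
    qed
    have "sobolev_on_norm a \<Omega> v / D - F \<le> sobolev_on_norm a \<Omega> G"
      unfolding sobolev_on_norm_def[of a \<Omega> G]
    proof (rule cINF_greatest)
      show "sobolev_extensions a \<Omega> G \<noteq> {}" using W(1) by blast
      show "sobolev_on_norm a \<Omega> v / D - F \<le> sobolev_norm a W'" if "W' \<in> sobolev_extensions a \<Omega> G" for W'
        using est[OF that] D(1) by (simp add: diff_le_eq pos_divide_le_eq mult.commute add.commute)
    qed
    then have "sobolev_on_norm a \<Omega> v \<le> D * (F + sobolev_on_norm a \<Omega> G)"
      using D(1) by (simp add: diff_le_eq pos_divide_le_eq mult.commute add.commute)
    with v_sol unique show "\<exists>v. weak_solution a \<Omega> \<O> f g v \<and>
                (\<forall>w. weak_solution a \<Omega> \<O> f g w \<longrightarrow> (AE x in lebesgue_on \<Omega>. w x = v x)) \<and>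
                sobolev_on_norm a \<Omega> v \<le> D * (sobolev_dual_norm a \<O> f + sobolev_on_norm a \<Omega> G)"
      unfolding F_def by blast
  qed
qed

end
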